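(* Let $q$ be a primitive $N$-th root of unity. For any compatible datum $(H,g,\chi,\lambda(N))$ for $q$ there exist a Hopf algebra $\mathcal O=\mathcal O(H,g,\chi,\lambda(N))$, an injective Hopf algebra map $\sigma_{\mathcal O}:H\to\mathcal O$ and an element $y\in\mathcal O$ such that $$\{y^i\sigma_{\mathcal O}(h)\mid 0\le i\le N-1,\ h\in\mathcal B(H)\}$$ is a basis for $\mathcal O$, where $\mathcal B(H)$ is a basis of $H$; moreover the algebra structure of $\mathcal O$ is given by $$y^N=\lambda(N)(1_{\mathcal O}-\Gamma^N),\ \text{ where } \Gamma=\sigma_{\mathcal O}(g),\qquad \sigma_{\mathcal O}(h)y^a=y^a\sigma_{\mathcal O}[\varphi_H^a(h)]\ \text{ for any } a\in\mathbb N,\ h\in H,$$ and the coalgebra structure is given by $\Delta_{\mathcal O}(y)=y\otimes 1_{\mathcal O}+\Gamma\otimes y$. Here $\varphi_H:H\to H$ is the algebra automorphism $\varphi_H(h)=\sum\chi(h_{(1)})h_{(2)}$. Furthermore: i) Let $p:\mathcal O\to H$ be the linear map with $p[y^n\sigma_{\mathcal O}(h)]=\delta_{n,0}h$ for every $0\le n\le N-1$, $h\in\mathcal B(H)$. Then $p$ is an $H$-bilinear coalgebra (not necessarily algebra) retraction of $\sigma_{\mathcal O}$ (i.e. $p\sigma_{\mathcal O}=\mathrm{Id}_H$). Moreover the pre-bialgebra in ${}_H^H\mathcal{YD}$ associated to $(\mathcal O,p,\sigma_{\mathcal O})$ is $(R,m,u,\delta,\varepsilon)$ with corresponding cocycle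 $\xi$, where 1) $R=R_q(H,g,\chi)$ is a braided bialgebra in ${}_H^H\mathcal{YD}$, in fact a quantum line spanned by (the powers of) $y$, of dimension $N$, and the $N$-th power of $y$ in $R$ is zero; 2) for any $0\le n\le N-1$ the $n$-th power of $y$ in $R$ coincides with the $n$-th power of $y$ in $\mathcal O$, namely $y^n$; 3) for any $0\le a,b\le N-1$, $$\xi(y^a\otimes y^b)=\begin{cases}1_H&\text{if }a+b=0,\\ \lambda(N)(1_H-g^N)&\text{if } a+b=N,\\ 0&\text{otherwise.}\end{cases}$$ Furthermore the map $\omega:R_q(H,g,\chi)\#_\xi H\to\mathcal O(H,g,\chi,\lambda(N))$, $\omega(r\otimes h)=r\sigma_{\mathcal O}(h)$, is a Hopf algebra isomorphism. ii) Let $B$ be a bialgebra, let $f:H\to B$ be a bialgebra homomorphism and let $b\in B$ be such that $$f(h)b=bf[\varphi_H(h)]\ \text{ for every }h\in H,\qquad b^N=\lambda(N)(1-f(g)^N),\qquad \Delta_B(b)=b\otimes 1_B+f(g)\otimes b.$$ Then there exists a unique bialgebra homomorphism $\widehat f:\mathcal O\to B$ such that $\widehat f\circ\sigma_{\mathcal O}=f$ and $\widehat f(y)=b$.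
   Context: $K$ is a field of characteristic $0$; everything is over $K$; $\mathbb N$ contains $0$; $S$ is the antipode of $H$. Yetter-Drinfeld datum. For $q$ a primitive $N$-th root of unity, a Yetter-Drinfeld datum $(H,g,\chi)$ for $q$ consists of a Hopf algebra $H$, a group-like $g\in G(H)$ and an algebra map $\chi:H\to K$ with $\chi(g)=q$ and $g\sum\chi(h_{(1)})h_{(2)}=\sum h_{(1)}\chi(h_{(2)})g$ for all $h\in H$. Compatible datum. A compatible datum for $q$ is $(H,g,\chi,\lambda(N))$ with $(H,g,\chi)$ a Yetter-Drinfeld datum for $q$ and $\lambda(N)\in K$, where $\lambda(N)=0$ is required if $g^N=1_H$ or if $\chi^N(h)(1_H-g^N)\ne\sum h_{(1)}(1_H-g^N)S(h_{(2)})$ for some $h\in H$ ($\chi^N$ the convolution power), and $\lambda(N)$ is arbitrary otherwise. Yetter-Drinfeld modules. An object $V$ of ${}_H^H\mathcal{YD}$ is a left $H$-module and left $H$-comodule (coaction $\rho(v)=\sum v_{\langle -1\rangle}\otimes v_{\langle 0\rangle}$) with $\rho(hv)=\sum h_{(1)}v_{\langle -1\rangle}S(h_{(3)})\otimes h_{(2)}v_{\langle 0\rangle}$; tensor products carry the diagonal action and codiagonal coaction; $c_{V,W}(v\otimes w)=\sum v_{\langle -1\rangle}w\otimes v_{\langle 0\rangle}$. Quantum line. $R_q(H,g,\chi)$ is the algebra $K[X]/(X^N)$, $y$ the class of $X$, with its unique structure of braided bialgebra in ${}_H^H\mathcal{YD}$ such that $hy=\chi(h)y$, $\rho(y)=g\otimes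 y$, $\delta(y)=y\otimes 1+1\otimes y$. Associated pre-bialgebra. Let $A$ be a bialgebra, $\sigma:H\to A$ an injective bialgebra map and $\pi:A\to H$ a coalgebra map which is $H$-bilinear ($A$ being an $H$-bimodule via $\sigma$) with $\pi\sigma=\mathrm{Id}_H$. Put $\tau(a)=\sum a_{(1)}\sigma S\pi(a_{(2)})$ and $R=\{a\in A\mid \sum a_{(1)}\otimes\pi(a_{(2)})=a\otimes 1_H\}$. The pre-bialgebra associated to $(A,\pi,\sigma)$ is $R$ endowed with: comultiplication $\delta(r)=\sum\tau(r_{(1)})\otimes r_{(2)}=\sum r^{(1)}\otimes r^{(2)}$, counit $\varepsilon=\varepsilon_A|_R$; action ${}^hr=\sum\sigma(h_{(1)})r\sigma S(h_{(2)})$; coaction $\rho(r)=\sum\pi(r_{(1)})\otimes r_{(2)}$; unit $u$ with $u(1)=1_A$; multiplication $m(r\otimes s)=\tau(r\cdot_A s)$ (in general neither associative nor $H$-colinear). The corresponding cocycle is $\xi:R\otimes R\to H$, $\xi(r\otimes s)=\pi(r\cdot_A s)$. $R\#_\xi H$ is $R\otimes H$ with unit $1_R\otimes 1_H$, counit $\varepsilon\otimes\varepsilon_H$, $\Delta(r\# h)=\sum r^{(1)}\# r^{(2)}_{\langle -1\rangle}h_{(1)}\otimes r^{(2)}_{\langle 0\rangle}\# h_{(2)}$ and product $(r\# h)(s\# k)=\sum \widetilde m^0(r\otimes {}^{h_{(1)}}s)\#\widetilde m^1(r\otimes {}^{h_{(1)}}s)h_{(2)}k$, where $\sum\widetilde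 m^0(r\otimes s)\otimes\widetilde m^1(r\otimes s)=(m\otimes\xi)\delta_{R\otimes R}(r\otimes s)$ and $\delta_{R\otimes R}(r\otimes s)=\sum r^{(1)}\otimes {}^{r^{(2)}_{\langle -1\rangle}}s^{(1)}\otimes r^{(2)}_{\langle 0\rangle}\otimes s^{(2)}$. *)

theory Defs
  imports
    "HOL-Algebra.Algebra"
    "HOL-Algebra.Free_Abelian_Groups"
    "Jordan_Normal_Form.Missing_VectorSpace"
begin

text \<open>
  Vector spaces are the carrier-based \<open>module\<close> records of HOL-Algebra together with the
  locale \<open>vectorspace\<close>. Structure maps of coalgebras, comodules etc. take values in an
  explicitly constructed tensor product. A Sweedler sum \<open>\<Sum> F(c\<^sub>1, c\<^sub>2)\<close> is the value at
  \<open>\<Delta>(c)\<close> of the linear map induced by the bilinear map \<open>F\<close>. As usual in HOL-Algebra,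
  values of functions outside the carriers are irrelevant.
\<close>

section \<open>Linear maps and tensor products\<close>

abbreviation lin_maps ::
  "('k, 'c) ring_scheme \<Rightarrow> ('k, 'a, 'm) module_scheme \<Rightarrow> ('k, 'b, 'n) module_scheme \<Rightarrow> ('a \<Rightarrow> 'b) set"
  where "lin_maps K V W \<equiv> LinearCombinations.module_hom K V W"

definition base_module :: "('k, 'c) ring_scheme \<Rightarrow> ('k, 'k) module" where
  "base_module K =
     \<lparr>carrier = carrier K, monoid.mult = monoid.mult K, one = one K,
      ring.zero = ring.zero K, ring.add = ring.add K, smult = monoid.mult K\<rparr>"

text \<open>
  \<open>V \<otimes> W\<close> is the free abelian group on \<open>V \<times> W\<close> modulo the subgroup generated by
  the usual relators; its elements are cosets of that subgroup.
\<close>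

type_synonym ('a, 'b) tensor = "('a \<times> 'b \<Rightarrow>\<^sub>0 int) set"

definition tensor_relators ::
  "('k, 'c) ring_scheme \<Rightarrow> ('k, 'a, 'm) module_scheme \<Rightarrow> ('k, 'b, 'n) module_scheme \<Rightarrow>
     ('a \<times> 'b \<Rightarrow>\<^sub>0 int) set" where
  "tensor_relators K V W =
     {frag_of (v \<oplus>\<^bsub>V\<^esub> v', w) - frag_of (v, w) - frag_of (v', w) | v v' w.
        v \<in> carrier V \<and> v' \<in> carrier V \<and> w \<in> carrier W} \<union>
     {frag_of (v, w \<oplus>\<^bsub>W\<^esub> w') - frag_of (v, w) - frag_of (v, w') | v w w'.
        v \<in> carrier V \<and> w \<in> carrier W \<and> w' \<in> carrier W} \<union>
     {frag_of (k \<odot>\<^bsub>V\<^esub> v, w) - frag_of (v, k \<odot>\<^bsub>W\<^esub> w) | k v w.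
        k \<in> carrier K \<and> v \<in> carrier V \<and> w \<in> carrier W}"

definition tensor_kernel ::
  "('k, 'c) ring_scheme \<Rightarrow> ('k, 'a, 'm) module_scheme \<Rightarrow> ('k, 'b, 'n) module_scheme \<Rightarrow>
     ('a \<times> 'b \<Rightarrow>\<^sub>0 int) set" where
  "tensor_kernel K V W =
     generate (free_Abelian_group (carrier V \<times> carrier W)) (tensor_relators K V W)"

definition pure_tensor ::
  "('k, 'c) ring_scheme \<Rightarrow> ('k, 'a, 'm) module_scheme \<Rightarrow> ('k, 'b, 'n) module_scheme \<Rightarrow>
     'a \<Rightarrow> 'b \<Rightarrow> ('a, 'b) tensor" where
  "pure_tensor K V W v w =
     tensor_kernel K V W #>\<^bsub>free_Abelian_group (carrier V \<times> carrier W)\<^esub> frag_of (v, w)"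

text \<open>
  Only the vector space structure; the fields \<open>mult\<close> and \<open>one\<close> are filled in by
  \<open>tensor_algebra\<close> below.
\<close>

definition tensor ::
  "('k, 'c) ring_scheme \<Rightarrow> ('k, 'a, 'm) module_scheme \<Rightarrow> ('k, 'b, 'n) module_scheme \<Rightarrow>
     ('k, ('a, 'b) tensor) module" where
  "tensor K V W =
     (let F = free_Abelian_group (carrier V \<times> carrier W); N = tensor_kernel K V W in
      \<lparr>carrier = carrier (F Mod N), monoid.mult = undefined, one = undefined,
       ring.zero = one (F Mod N), ring.add = monoid.mult (F Mod N),
       smult = (\<lambda>k T. \<Union>x\<in>T. N #>\<^bsub>F\<^esub> frag_extend (\<lambda>(v, w). frag_of (k \<odot>\<^bsub>V\<^esub> v, w)) x)\<rparr>)"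

text \<open>
  The linear map \<open>V \<otimes> W \<rightarrow> M\<close> induced by a bilinear map \<open>f\<close>; it is unique on the
  carrier because the pure tensors generate.
\<close>

definition tensor_lift ::
  "('k, 'c) ring_scheme \<Rightarrow> ('k, 'a, 'm) module_scheme \<Rightarrow> ('k, 'b, 'n) module_scheme \<Rightarrow>
     ('k, 'd, 'l) module_scheme \<Rightarrow> ('a \<Rightarrow> 'b \<Rightarrow> 'd) \<Rightarrow> ('a, 'b) tensor \<Rightarrow> 'd" where
  "tensor_lift K V W M f =
     (SOME F. F \<in> lin_maps K (tensor K V W) M \<and>
        (\<forall>v\<in>carrier V. \<forall>w\<in>carrier W. F (pure_tensor K V W v w) = f v w))"

definition tensor_map ::
  "('k, 'c) ring_scheme \<Rightarrow> ('k, 'a, 'm) module_scheme \<Rightarrow> ('k, 'b, 'n) module_scheme \<Rightarrow>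
     ('k, 'a2, 'm2) module_scheme \<Rightarrow> ('k, 'b2, 'n2) module_scheme \<Rightarrow>
     ('a \<Rightarrow> 'a2) \<Rightarrow> ('b \<Rightarrow> 'b2) \<Rightarrow> ('a, 'b) tensor \<Rightarrow> ('a2, 'b2) tensor" where
  "tensor_map K V W V' W' f g =
     tensor_lift K V W (tensor K V' W') (\<lambda>v w. pure_tensor K V' W' (f v) (g w))"

section \<open>Algebras, coalgebras, bialgebras, Hopf algebras\<close>

text \<open>HOL-Algebra's locale \<open>algebra\<close> covers commutative algebras only.\<close>

definition k_algebra :: "('k, 'c) ring_scheme \<Rightarrow> ('k, 'a, 'm) module_scheme \<Rightarrow> bool" where
  "k_algebra K A \<longleftrightarrow> vectorspace K A \<and> ring A \<and>
     (\<forall>k\<in>carrier K. \<forall>x\<in>carrier A. \<forall>y\<in>carrier A.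
        (k \<odot>\<^bsub>A\<^esub> x) \<otimes>\<^bsub>A\<^esub> y = k \<odot>\<^bsub>A\<^esub> (x \<otimes>\<^bsub>A\<^esub> y) \<and>
        x \<otimes>\<^bsub>A\<^esub> (k \<odot>\<^bsub>A\<^esub> y) = k \<odot>\<^bsub>A\<^esub> (x \<otimes>\<^bsub>A\<^esub> y))"

definition algebra_maps ::
  "('k, 'c) ring_scheme \<Rightarrow> ('k, 'a, 'm) module_scheme \<Rightarrow> ('k, 'b, 'n) module_scheme \<Rightarrow> ('a \<Rightarrow> 'b) set"
  where "algebra_maps K A B = ring_hom A B \<inter> lin_maps K A B"

definition tensor_algebra ::
  "('k, 'c) ring_scheme \<Rightarrow> ('k, 'a, 'm) module_scheme \<Rightarrow> ('k, 'b, 'n) module_scheme \<Rightarrow>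
     ('k, ('a, 'b) tensor) module" where
  "tensor_algebra K A B =
     (tensor K A B)
       \<lparr>monoid.mult := (\<lambda>s t.
          tensor_lift K A B (tensor K A B) (\<lambda>a b.
            tensor_lift K A B (tensor K A B) (\<lambda>a' b'.
              pure_tensor K A B (a \<otimes>\<^bsub>A\<^esub> a') (b \<otimes>\<^bsub>B\<^esub> b')) t) s),
        one := pure_tensor K A B \<one>\<^bsub>A\<^esub> \<one>\<^bsub>B\<^esub>\<rparr>"

record ('k, 'a) bialg = "('k, 'a) module" +
  comult :: "'a \<Rightarrow> ('a, 'a) tensor"
  counit :: "'a \<Rightarrow> 'k"

text \<open>\<open>sweedler K C M F c\<close> is \<open>\<Sum> F(c\<^sub>1, c\<^sub>2) \<in> M\<close>.\<close>

definition sweedler ::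
  "('k, 'c) ring_scheme \<Rightarrow> ('k, 'a, 'm) bialg_scheme \<Rightarrow> ('k, 'd, 'l) module_scheme \<Rightarrow>
     ('a \<Rightarrow> 'a \<Rightarrow> 'd) \<Rightarrow> 'a \<Rightarrow> 'd" where
  "sweedler K C M F c = tensor_lift K C C M F (comult C c)"

definition sweedler3 ::
  "('k, 'c) ring_scheme \<Rightarrow> ('k, 'a, 'm) bialg_scheme \<Rightarrow> ('k, 'd, 'l) module_scheme \<Rightarrow>
     ('a \<Rightarrow> 'a \<Rightarrow> 'a \<Rightarrow> 'd) \<Rightarrow> 'a \<Rightarrow> 'd" where
  "sweedler3 K C M F c = sweedler K C M (\<lambda>a b. sweedler K C M (\<lambda>x y. F x y b) a) c"

text \<open>
  Coassociativity is stated in \<open>C \<otimes> (C \<otimes> C)\<close>: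
  \<open>\<Sum> c\<^sub>1\<^sub>1 \<otimes> (c\<^sub>1\<^sub>2 \<otimes> c\<^sub>2) = \<Sum> c\<^sub>1 \<otimes> \<Delta>(c\<^sub>2)\<close>.
\<close>

definition coalgebra :: "('k, 'c) ring_scheme \<Rightarrow> ('k, 'a, 'm) bialg_scheme \<Rightarrow> bool" where
  "coalgebra K C \<longleftrightarrow> vectorspace K C \<and>
     comult C \<in> lin_maps K C (tensor K C C) \<and>
     counit C \<in> lin_maps K C (base_module K) \<and>
     (\<forall>c\<in>carrier C.
        sweedler3 K C (tensor K C (tensor K C C))
          (\<lambda>x y z. pure_tensor K C (tensor K C C) x (pure_tensor K C C y z)) c =
        sweedler K C (tensor K C (tensor K C C))
          (\<lambda>x y. pure_tensor K C (tensor K C C) x (comult C y)) c \<and>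
        sweedler K C C (\<lambda>x y. counit C x \<odot>\<^bsub>C\<^esub> y) c = c \<and>
        sweedler K C C (\<lambda>x y. counit C y \<odot>\<^bsub>C\<^esub> x) c = c)"

definition coalgebra_maps ::
  "('k, 'c) ring_scheme \<Rightarrow> ('k, 'a, 'm) bialg_scheme \<Rightarrow> ('k, 'b, 'n) bialg_scheme \<Rightarrow> ('a \<Rightarrow> 'b) set"
  where "coalgebra_maps K C D =
     {f \<in> lin_maps K C D. \<forall>c\<in>carrier C.
        comult D (f c) = tensor_map K C C D D f f (comult C c) \<and> counit D (f c) = counit C c}"

definition bialgebra :: "('k, 'c) ring_scheme \<Rightarrow> ('k, 'a, 'm) bialg_scheme \<Rightarrow> bool" where
  "bialgebra K A \<longleftrightarrow> k_algebra K A \<and> coalgebra K A \<and>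
     comult A \<in> algebra_maps K A (tensor_algebra K A A) \<and>
     counit A \<in> algebra_maps K A (base_module K)"

definition bialgebra_maps ::
  "('k, 'c) ring_scheme \<Rightarrow> ('k, 'a, 'm) bialg_scheme \<Rightarrow> ('k, 'b, 'n) bialg_scheme \<Rightarrow> ('a \<Rightarrow> 'b) set"
  where "bialgebra_maps K A B = algebra_maps K A B \<inter> coalgebra_maps K A B"

definition is_antipode ::
  "('k, 'c) ring_scheme \<Rightarrow> ('k, 'a, 'm) bialg_scheme \<Rightarrow> ('a \<Rightarrow> 'a) \<Rightarrow> bool" where
  "is_antipode K H S \<longleftrightarrow> S \<in> lin_maps K H H \<and>
     (\<forall>h\<in>carrier H.
        sweedler K H H (\<lambda>x y. S x \<otimes>\<^bsub>H\<^esub> y) h = counit H h \<odot>\<^bsub>H\<^esub> \<one>\<^bsub>H\<^esub> \<and>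
        sweedler K H H (\<lambda>x y. x \<otimes>\<^bsub>H\<^esub> S y) h = counit H h \<odot>\<^bsub>H\<^esub> \<one>\<^bsub>H\<^esub>)"

definition hopf_algebra :: "('k, 'c) ring_scheme \<Rightarrow> ('k, 'a, 'm) bialg_scheme \<Rightarrow> bool" where
  "hopf_algebra K H \<longleftrightarrow> bialgebra K H \<and> (\<exists>S. is_antipode K H S)"

definition antipode :: "('k, 'c) ring_scheme \<Rightarrow> ('k, 'a, 'm) bialg_scheme \<Rightarrow> 'a \<Rightarrow> 'a" where
  "antipode K H = (SOME S. is_antipode K H S)"

definition hopf_maps ::
  "('k, 'c) ring_scheme \<Rightarrow> ('k, 'a, 'm) bialg_scheme \<Rightarrow> ('k, 'b, 'n) bialg_scheme \<Rightarrow> ('a \<Rightarrow> 'b) set"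
  where "hopf_maps K H L =
     {f \<in> bialgebra_maps K H L. \<forall>h\<in>carrier H. f (antipode K H h) = antipode K L (f h)}"

section \<open>Yetter-Drinfeld data and compatible data\<close>

text \<open>The scalar \<open>lam\<close> below is \<open>\<lambda>(N)\<close>.\<close>

definition primitive_root :: "('k, 'c) ring_scheme \<Rightarrow> nat \<Rightarrow> 'k \<Rightarrow> bool" where
  "primitive_root K N q \<longleftrightarrow> 0 < N \<and> q \<in> carrier K \<and> q [^]\<^bsub>K\<^esub> N = \<one>\<^bsub>K\<^esub> \<and>
     (\<forall>k. 0 < k \<and> k < N \<longrightarrow> q [^]\<^bsub>K\<^esub> k \<noteq> \<one>\<^bsub>K\<^esub>)"

definition grouplikes :: "('k, 'c) ring_scheme \<Rightarrow> ('k, 'a, 'm) bialg_scheme \<Rightarrow> 'a set" where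
  "grouplikes K H =
     {g \<in> carrier H. comult H g = pure_tensor K H H g g \<and> counit H g = \<one>\<^bsub>K\<^esub>}"

definition phi ::
  "('k, 'c) ring_scheme \<Rightarrow> ('k, 'a, 'm) bialg_scheme \<Rightarrow> ('a \<Rightarrow> 'k) \<Rightarrow> 'a \<Rightarrow> 'a" where
  "phi K H \<chi> h = sweedler K H H (\<lambda>x y. \<chi> x \<odot>\<^bsub>H\<^esub> y) h"

primrec conv_pow ::
  "('k, 'c) ring_scheme \<Rightarrow> ('k, 'a, 'm) bialg_scheme \<Rightarrow> ('a \<Rightarrow> 'k) \<Rightarrow> nat \<Rightarrow> 'a \<Rightarrow> 'k" where
  "conv_pow K H \<chi> 0 = counit H"
| "conv_pow K H \<chi> (Suc n) =
     (\<lambda>h. sweedler K H (base_module K) (\<lambda>x y. conv_pow K H \<chi> n x \<otimes>\<^bsub>K\<^esub> \<chi> y) h)"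

definition yd_datum ::
  "('k, 'c) ring_scheme \<Rightarrow> ('k, 'a, 'm) bialg_scheme \<Rightarrow> 'a \<Rightarrow> ('a \<Rightarrow> 'k) \<Rightarrow> 'k \<Rightarrow> bool" where
  "yd_datum K H g \<chi> q \<longleftrightarrow> hopf_algebra K H \<and> g \<in> grouplikes K H \<and>
     \<chi> \<in> algebra_maps K H (base_module K) \<and> \<chi> g = q \<and>
     (\<forall>h\<in>carrier H.
        g \<otimes>\<^bsub>H\<^esub> sweedler K H H (\<lambda>x y. \<chi> x \<odot>\<^bsub>H\<^esub> y) h =
        sweedler K H H (\<lambda>x y. \<chi> y \<odot>\<^bsub>H\<^esub> x) h \<otimes>\<^bsub>H\<^esub> g)"

definition compatible_datum ::
  "('k, 'c) ring_scheme \<Rightarrow> ('k, 'a, 'm) bialg_scheme \<Rightarrow> 'a \<Rightarrow> ('a \<Rightarrow> 'k) \<Rightarrow> 'k \<Rightarrow> nat \<Rightarrow> 'k \<Rightarrow> bool"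
  where
  "compatible_datum K H g \<chi> q N lam \<longleftrightarrow> yd_datum K H g \<chi> q \<and> lam \<in> carrier K \<and>
     (g [^]\<^bsub>H\<^esub> N = \<one>\<^bsub>H\<^esub> \<or>
      (\<exists>h\<in>carrier H.
         conv_pow K H \<chi> N h \<odot>\<^bsub>H\<^esub> (\<one>\<^bsub>H\<^esub> \<ominus>\<^bsub>H\<^esub> g [^]\<^bsub>H\<^esub> N) \<noteq>
         sweedler K H H
           (\<lambda>x y. x \<otimes>\<^bsub>H\<^esub> (\<one>\<^bsub>H\<^esub> \<ominus>\<^bsub>H\<^esub> g [^]\<^bsub>H\<^esub> N) \<otimes>\<^bsub>H\<^esub> antipode K H y) h)
      \<longrightarrow> lam = \<zero>\<^bsub>K\<^esub>)"

section \<open>Yetter-Drinfeld modules and braided bialgebras\<close>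

text \<open>
  One record serves for objects of the Yetter-Drinfeld category and for (pre-)bialgebras in it;
  for a mere object the algebra and coalgebra fields are not used.
\<close>

record ('k, 'h, 'a) yd_bialg = "('k, 'a) bialg" +
  act :: "'h \<Rightarrow> 'a \<Rightarrow> 'a"
  coact :: "'a \<Rightarrow> ('h, 'a) tensor"

definition yd_module ::
  "('k, 'c) ring_scheme \<Rightarrow> ('k, 'h, 'm) bialg_scheme \<Rightarrow> ('k, 'h, 'v, 'n) yd_bialg_scheme \<Rightarrow> bool" where
  "yd_module K H V \<longleftrightarrow> vectorspace K V \<and>
     (\<forall>h\<in>carrier H. act V h \<in> lin_maps K V V) \<and>
     (\<forall>v\<in>carrier V. (\<lambda>h. act V h v) \<in> lin_maps K H V) \<and>
     (\<forall>v\<in>carrier V. act V \<one>\<^bsub>H\<^esub> v = v) \<and>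
     (\<forall>h\<in>carrier H. \<forall>k\<in>carrier H. \<forall>v\<in>carrier V. act V (h \<otimes>\<^bsub>H\<^esub> k) v = act V h (act V k v)) \<and>
     coact V \<in> lin_maps K V (tensor K H V) \<and>
     (\<forall>v\<in>carrier V.
        tensor_lift K H V (tensor K H (tensor K H V))
          (\<lambda>x w. sweedler K H (tensor K H (tensor K H V))
             (\<lambda>x1 x2. pure_tensor K H (tensor K H V) x1 (pure_tensor K H V x2 w)) x) (coact V v) =
        tensor_lift K H V (tensor K H (tensor K H V))
          (\<lambda>x w. pure_tensor K H (tensor K H V) x (coact V w)) (coact V v) \<and>
        tensor_lift K H V V (\<lambda>x w. counit H x \<odot>\<^bsub>V\<^esub> w) (coact V v) = v) \<and>
     (\<forall>h\<in>carrier H. \<forall>v\<in>carrier V.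
        coact V (act V h v) =
        sweedler3 K H (tensor K H V)
          (\<lambda>h1 h2 h3. tensor_lift K H V (tensor K H V)
             (\<lambda>x w. pure_tensor K H V (h1 \<otimes>\<^bsub>H\<^esub> x \<otimes>\<^bsub>H\<^esub> antipode K H h3) (act V h2 w))
             (coact V v)) h)"

definition yd_maps ::
  "('k, 'c) ring_scheme \<Rightarrow> ('k, 'h, 'm) bialg_scheme \<Rightarrow> ('k, 'h, 'v, 'n) yd_bialg_scheme \<Rightarrow>
     ('k, 'h, 'w, 'l) yd_bialg_scheme \<Rightarrow> ('v \<Rightarrow> 'w) set" where
  "yd_maps K H V W =
     {f \<in> lin_maps K V W. \<forall>v\<in>carrier V.
        (\<forall>h\<in>carrier H. f (act V h v) = act W h (f v)) \<and>
        coact W (f v) = tensor_map K H V H W (\<lambda>x. x) f (coact V v)}"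

definition yd_unit ::
  "('k, 'c) ring_scheme \<Rightarrow> ('k, 'h, 'm) bialg_scheme \<Rightarrow> ('k, 'h, 'k) yd_bialg" where
  "yd_unit K H =
     \<lparr>carrier = carrier K, monoid.mult = monoid.mult K, one = one K,
      ring.zero = ring.zero K, ring.add = ring.add K, smult = monoid.mult K,
      comult = undefined, counit = undefined,
      act = (\<lambda>h k. counit H h \<otimes>\<^bsub>K\<^esub> k),
      coact = (\<lambda>k. pure_tensor K H (base_module K) \<one>\<^bsub>H\<^esub> k)\<rparr>"

definition yd_tensor ::
  "('k, 'c) ring_scheme \<Rightarrow> ('k, 'h, 'm) bialg_scheme \<Rightarrow> ('k, 'h, 'v, 'n) yd_bialg_scheme \<Rightarrow>
     ('k, 'h, 'w, 'l) yd_bialg_scheme \<Rightarrow> ('k, 'h, ('v, 'w) tensor) yd_bialg" where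
  "yd_tensor K H V W =
     \<lparr>carrier = carrier (tensor K V W), monoid.mult = undefined, one = undefined,
      ring.zero = ring.zero (tensor K V W), ring.add = ring.add (tensor K V W),
      smult = smult (tensor K V W),
      comult = undefined, counit = undefined,
      act = (\<lambda>h t. sweedler K H (tensor K V W)
        (\<lambda>h1 h2. tensor_map K V W V W (act V h1) (act W h2) t) h),
      coact = (\<lambda>t. tensor_lift K V W (tensor K H (tensor K V W))
        (\<lambda>v w. tensor_lift K H V (tensor K H (tensor K V W))
          (\<lambda>x v0. tensor_lift K H W (tensor K H (tensor K V W))
            (\<lambda>z w0. pure_tensor K H (tensor K V W) (x \<otimes>\<^bsub>H\<^esub> z) (pure_tensor K V W v0 w0))
            (coact W w)) (coact V v)) t)\<rparr>"

definition mult_map ::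
  "('k, 'c) ring_scheme \<Rightarrow> ('k, 'a, 'm) module_scheme \<Rightarrow> ('a, 'a) tensor \<Rightarrow> 'a" where
  "mult_map K R = tensor_lift K R R R (\<lambda>r s. r \<otimes>\<^bsub>R\<^esub> s)"

text \<open>
  \<open>\<delta>\<^bsub>R \<otimes> R\<^esub>(r \<otimes> s) = \<Sum> (r\<^sup>(\<^sup>1\<^sup>) \<otimes> r\<^sup>(\<^sup>2\<^sup>)\<^sub>-\<^sub>1 s\<^sup>(\<^sup>1\<^sup>)) \<otimes> (r\<^sup>(\<^sup>2\<^sup>)\<^sub>0 \<otimes> s\<^sup>(\<^sup>2\<^sup>))\<close>, that is
  \<open>(R \<otimes> c \<otimes> R)(\<delta> \<otimes> \<delta>)\<close> for the braiding \<open>c(v \<otimes> w) = \<Sum> v\<^sub>-\<^sub>1 w \<otimes> v\<^sub>0\<close>.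
\<close>

definition braided_comult ::
  "('k, 'c) ring_scheme \<Rightarrow> ('k, 'h, 'm) bialg_scheme \<Rightarrow> ('k, 'h, 'r, 'n) yd_bialg_scheme \<Rightarrow>
     'r \<Rightarrow> 'r \<Rightarrow> (('r, 'r) tensor, ('r, 'r) tensor) tensor" where
  "braided_comult K H R r s =
     (let RR = tensor K R R; T = tensor K RR RR in
      sweedler K R T (\<lambda>r1 r2.
        sweedler K R T (\<lambda>s1 s2.
          tensor_lift K H R T (\<lambda>x r0.
            pure_tensor K RR RR (pure_tensor K R R r1 (act R x s1)) (pure_tensor K R R r0 s2))
          (coact R r2)) s) r)"

definition braided_bialgebra ::
  "('k, 'c) ring_scheme \<Rightarrow> ('k, 'h, 'm) bialg_scheme \<Rightarrow> ('k, 'h, 'r, 'n) yd_bialg_scheme \<Rightarrow> bool"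
  where
  "braided_bialgebra K H R \<longleftrightarrow>
     yd_module K H R \<and> k_algebra K R \<and> coalgebra K R \<and>
     mult_map K R \<in> yd_maps K H (yd_tensor K H R R) R \<and>
     (\<lambda>k. k \<odot>\<^bsub>R\<^esub> \<one>\<^bsub>R\<^esub>) \<in> yd_maps K H (yd_unit K H) R \<and>
     comult R \<in> yd_maps K H R (yd_tensor K H R R) \<and>
     counit R \<in> yd_maps K H R (yd_unit K H) \<and>
     comult R \<one>\<^bsub>R\<^esub> = pure_tensor K R R \<one>\<^bsub>R\<^esub> \<one>\<^bsub>R\<^esub> \<and>
     (\<forall>r\<in>carrier R. \<forall>s\<in>carrier R.
        comult R (r \<otimes>\<^bsub>R\<^esub> s) =
        tensor_map K (tensor K R R) (tensor K R R) R R (mult_map K R) (mult_map K R)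
          (braided_comult K H R r s)) \<and>
     counit R \<in> algebra_maps K R (base_module K)"

definition braided_bialgebra_isos ::
  "('k, 'c) ring_scheme \<Rightarrow> ('k, 'h, 'm) bialg_scheme \<Rightarrow> ('k, 'h, 'r, 'n) yd_bialg_scheme \<Rightarrow>
     ('k, 'h, 's, 'l) yd_bialg_scheme \<Rightarrow> ('r \<Rightarrow> 's) set" where
  "braided_bialgebra_isos K H R R' =
     {f. f \<in> yd_maps K H R R' \<and> f \<in> algebra_maps K R R' \<and> f \<in> coalgebra_maps K R R' \<and>
         bij_betw f (carrier R) (carrier R')}"

section \<open>Quantum lines\<close>

definition trunc_ideal :: "('k, 'c) ring_scheme \<Rightarrow> nat \<Rightarrow> (nat \<Rightarrow> 'k) set" where
  "trunc_ideal K N = PIdl\<^bsub>UP K\<^esub> (monom (UP K) \<one>\<^bsub>K\<^esub> N)"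

definition trunc_poly :: "('k, 'c) ring_scheme \<Rightarrow> nat \<Rightarrow> ('k, (nat \<Rightarrow> 'k) set) module" where
  "trunc_poly K N =
     ring.extend (UP K Quot trunc_ideal K N)
       (module.fields (\<lambda>k T. \<Union>p\<in>T. trunc_ideal K N +>\<^bsub>UP K\<^esub> (k \<odot>\<^bsub>UP K\<^esub> p)))"

definition trunc_var :: "('k, 'c) ring_scheme \<Rightarrow> nat \<Rightarrow> (nat \<Rightarrow> 'k) set" where
  "trunc_var K N = trunc_ideal K N +>\<^bsub>UP K\<^esub> monom (UP K) \<one>\<^bsub>K\<^esub> 1"

definition is_quantum_line ::
  "('k, 'c) ring_scheme \<Rightarrow> ('k, 'h, 'm) bialg_scheme \<Rightarrow> 'h \<Rightarrow> ('h \<Rightarrow> 'k) \<Rightarrow> nat \<Rightarrow>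
     ('k, 'h, (nat \<Rightarrow> 'k) set) yd_bialg \<Rightarrow> bool" where
  "is_quantum_line K H g \<chi> N Q \<longleftrightarrow>
     module.truncate Q = trunc_poly K N \<and> braided_bialgebra K H Q \<and>
     (\<forall>h\<in>carrier H. act Q h (trunc_var K N) = \<chi> h \<odot>\<^bsub>Q\<^esub> trunc_var K N) \<and>
     coact Q (trunc_var K N) = pure_tensor K H Q g (trunc_var K N) \<and>
     comult Q (trunc_var K N) =
       pure_tensor K Q Q (trunc_var K N) \<one>\<^bsub>Q\<^esub> \<oplus>\<^bsub>tensor K Q Q\<^esub>
       pure_tensor K Q Q \<one>\<^bsub>Q\<^esub> (trunc_var K N)"

text \<open>The choice is immaterial: the structure maps are determined on the carrier.\<close>

definition quantum_line ::
  "('k, 'c) ring_scheme \<Rightarrow> ('k, 'h, 'm) bialg_scheme \<Rightarrow> 'h \<Rightarrow> ('h \<Rightarrow> 'k) \<Rightarrow> nat \<Rightarrow>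
     ('k, 'h, (nat \<Rightarrow> 'k) set) yd_bialg" where
  "quantum_line K H g \<chi> N = (SOME Q. is_quantum_line K H g \<chi> N Q)"

section \<open>The pre-bialgebra and the cocycle associated to a splitting datum\<close>

definition tau ::
  "('k, 'c) ring_scheme \<Rightarrow> ('k, 'h, 'm) bialg_scheme \<Rightarrow> ('k, 'a, 'n) bialg_scheme \<Rightarrow>
     ('a \<Rightarrow> 'h) \<Rightarrow> ('h \<Rightarrow> 'a) \<Rightarrow> 'a \<Rightarrow> 'a" where
  "tau K H A \<pi> \<sigma> a = sweedler K A A (\<lambda>x y. x \<otimes>\<^bsub>A\<^esub> \<sigma> (antipode K H (\<pi> y))) a"

definition coinvariants ::
  "('k, 'c) ring_scheme \<Rightarrow> ('k, 'h, 'm) bialg_scheme \<Rightarrow> ('k, 'a, 'n) bialg_scheme \<Rightarrow>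
     ('a \<Rightarrow> 'h) \<Rightarrow> ('k, 'a) module" where
  "coinvariants K H A \<pi> =
     (module.truncate A)
       \<lparr>carrier := {a \<in> carrier A.
          sweedler K A (tensor K A H) (\<lambda>x y. pure_tensor K A H x (\<pi> y)) a =
          pure_tensor K A H a \<one>\<^bsub>H\<^esub>}\<rparr>"

text \<open>
  The formulas for \<open>\<delta>\<close> and \<open>\<rho>\<close> give elements of \<open>A \<otimes> A\<close> and \<open>H \<otimes> A\<close>; the
  values are their unique preimages in \<open>R \<otimes> R\<close> and \<open>H \<otimes> R\<close> under the injective
  maps induced by the inclusion \<open>R \<subseteq> A\<close>.
\<close>

definition assoc_prebialgebra ::
  "('k, 'c) ring_scheme \<Rightarrow> ('k, 'h, 'm) bialg_scheme \<Rightarrow> ('k, 'a, 'n) bialg_scheme \<Rightarrow>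
     ('a \<Rightarrow> 'h) \<Rightarrow> ('h \<Rightarrow> 'a) \<Rightarrow> ('k, 'h, 'a) yd_bialg" where
  "assoc_prebialgebra K H A \<pi> \<sigma> =
     (let R = coinvariants K H A \<pi> in
      \<lparr>carrier = carrier R,
       monoid.mult = (\<lambda>r s. tau K H A \<pi> \<sigma> (r \<otimes>\<^bsub>A\<^esub> s)),
       one = one A, ring.zero = ring.zero A, ring.add = ring.add A, smult = smult A,
       comult = (\<lambda>r. THE t. t \<in> carrier (tensor K R R) \<and>
         tensor_map K R R A A (\<lambda>x. x) (\<lambda>x. x) t =
         sweedler K A (tensor K A A) (\<lambda>x y. pure_tensor K A A (tau K H A \<pi> \<sigma> x) y) r),
       counit = counit A,
       act = (\<lambda>h r. sweedler K H A (\<lambda>h1 h2. \<sigma> h1 \<otimes>\<^bsub>A\<^esub> r \<otimes>\<^bsub>A\<^esub> \<sigma> (antipode K H h2)) h),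
       coact = (\<lambda>r. THE t. t \<in> carrier (tensor K H R) \<and>
         tensor_map K H R H A (\<lambda>x. x) (\<lambda>x. x) t =
         sweedler K A (tensor K H A) (\<lambda>x y. pure_tensor K H A (\<pi> x) y) r)\<rparr>)"

definition cocycle ::
  "('k, 'c) ring_scheme \<Rightarrow> ('k, 'h, 'm) bialg_scheme \<Rightarrow> ('k, 'a, 'n) bialg_scheme \<Rightarrow>
     ('a \<Rightarrow> 'h) \<Rightarrow> ('a, 'a) tensor \<Rightarrow> 'h" where
  "cocycle K H A \<pi> =
     tensor_lift K (coinvariants K H A \<pi>) (coinvariants K H A \<pi>) H (\<lambda>r s. \<pi> (r \<otimes>\<^bsub>A\<^esub> s))"

definition retraction_bilinear ::
  "('k, 'h, 'm) bialg_scheme \<Rightarrow> ('k, 'a, 'n) bialg_scheme \<Rightarrow> ('a \<Rightarrow> 'h) \<Rightarrow> ('h \<Rightarrow> 'a) \<Rightarrow> bool"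
  where
  "retraction_bilinear H A \<pi> \<sigma> \<longleftrightarrow>
     (\<forall>h\<in>carrier H. \<pi> (\<sigma> h) = h) \<and>
     (\<forall>h\<in>carrier H. \<forall>a\<in>carrier A.
        \<pi> (\<sigma> h \<otimes>\<^bsub>A\<^esub> a) = h \<otimes>\<^bsub>H\<^esub> \<pi> a \<and> \<pi> (a \<otimes>\<^bsub>A\<^esub> \<sigma> h) = \<pi> a \<otimes>\<^bsub>H\<^esub> h)"

section \<open>The bosonization \<open>R #\<^sub>\<xi> H\<close>\<close>

text \<open>\<open>(m \<otimes> \<xi>) \<delta>\<^bsub>R \<otimes> R\<^esub>(r \<otimes> s) \<in> R \<otimes> H\<close>.\<close>

definition twisted_mult ::
  "('k, 'c) ring_scheme \<Rightarrow> ('k, 'h, 'm) bialg_scheme \<Rightarrow> ('k, 'h, 'r, 'n) yd_bialg_scheme \<Rightarrow>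
     (('r, 'r) tensor \<Rightarrow> 'h) \<Rightarrow> 'r \<Rightarrow> 'r \<Rightarrow> ('r, 'h) tensor" where
  "twisted_mult K H R \<xi> r s =
     tensor_map K (tensor K R R) (tensor K R R) R H (mult_map K R) \<xi> (braided_comult K H R r s)"

definition smash ::
  "('k, 'c) ring_scheme \<Rightarrow> ('k, 'h, 'm) bialg_scheme \<Rightarrow> ('k, 'h, 'r, 'n) yd_bialg_scheme \<Rightarrow>
     (('r, 'r) tensor \<Rightarrow> 'h) \<Rightarrow> ('k, ('r, 'h) tensor) bialg" where
  "smash K H R \<xi> =
     (let RH = tensor K R H; T = tensor K RH RH in
      \<lparr>carrier = carrier RH,
       monoid.mult = (\<lambda>t u.
         tensor_lift K R H RH (\<lambda>r h.
           tensor_lift K R H RH (\<lambda>s k.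
             sweedler K H RH (\<lambda>h1 h2.
               tensor_lift K R H RH (\<lambda>m0 m1. pure_tensor K R H m0 (m1 \<otimes>\<^bsub>H\<^esub> h2 \<otimes>\<^bsub>H\<^esub> k))
                 (twisted_mult K H R \<xi> r (act R h1 s))) h) u) t),
       one = pure_tensor K R H \<one>\<^bsub>R\<^esub> \<one>\<^bsub>H\<^esub>,
       ring.zero = ring.zero RH, ring.add = ring.add RH, smult = smult RH,
       comult = tensor_lift K R H T (\<lambda>r h.
         sweedler K R T (\<lambda>r1 r2.
           sweedler K H T (\<lambda>h1 h2.
             tensor_lift K H R T (\<lambda>x r0.
               pure_tensor K RH RH (pure_tensor K R H r1 (x \<otimes>\<^bsub>H\<^esub> h1)) (pure_tensor K R H r0 h2))
             (coact R r2)) h) r),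
       counit = tensor_lift K R H (base_module K) (\<lambda>r h. counit R r \<otimes>\<^bsub>K\<^esub> counit H h)\<rparr>)"

section \<open>The Hopf algebra \<open>\<O>(H, g, \<chi>, \<lambda>(N))\<close>\<close>

text \<open>
  This describes \<open>\<O>\<close> up to a unique isomorphism compatible with \<open>\<sigma>\<close> and \<open>y\<close>. Injectivity of
  \<open>(i, h) \<mapsto> y\<^sup>i \<sigma>(h)\<close> says that the displayed basis is one as an indexed family.
\<close>

definition is_O ::
  "('k, 'c) ring_scheme \<Rightarrow> ('k, 'h, 'm) bialg_scheme \<Rightarrow> 'h \<Rightarrow> ('h \<Rightarrow> 'k) \<Rightarrow> nat \<Rightarrow> 'k \<Rightarrow>
     ('k, 'a, 'n) bialg_scheme \<Rightarrow> ('h \<Rightarrow> 'a) \<Rightarrow> 'a \<Rightarrow> bool" where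
  "is_O K H g \<chi> N lam A \<sigma> y \<longleftrightarrow>
     hopf_algebra K A \<and> \<sigma> \<in> hopf_maps K H A \<and> inj_on \<sigma> (carrier H) \<and> y \<in> carrier A \<and>
     (\<forall>BH. vectorspace.basis K H BH \<longrightarrow>
        inj_on (\<lambda>(i, h). y [^]\<^bsub>A\<^esub> (i::nat) \<otimes>\<^bsub>A\<^esub> \<sigma> h) ({..<N} \<times> BH) \<and>
        vectorspace.basis K A {y [^]\<^bsub>A\<^esub> i \<otimes>\<^bsub>A\<^esub> \<sigma> h | i h. i < N \<and> h \<in> BH}) \<and>
     y [^]\<^bsub>A\<^esub> N = lam \<odot>\<^bsub>A\<^esub> (\<one>\<^bsub>A\<^esub> \<ominus>\<^bsub>A\<^esub> \<sigma> g [^]\<^bsub>A\<^esub> N) \<and>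
     (\<forall>a::nat. \<forall>h\<in>carrier H.
        \<sigma> h \<otimes>\<^bsub>A\<^esub> y [^]\<^bsub>A\<^esub> a = y [^]\<^bsub>A\<^esub> a \<otimes>\<^bsub>A\<^esub> \<sigma> ((phi K H \<chi> ^^ a) h)) \<and>
     comult A y =
       pure_tensor K A A y \<one>\<^bsub>A\<^esub> \<oplus>\<^bsub>tensor K A A\<^esub> pure_tensor K A A (\<sigma> g) y"

end

theory Submission imports Defs begin

text \<open>
  The Hopf algebra \<open>\<O>\<close> is the cyclic extension \<open>H[y; \<phi>] / (y\<^sup>N = z)\<close> with \<open>z = \<lambda>(1 - g\<^sup>N)\<close>:
  a function \<open>f\<close> with values in \<open>H\<close> that vanishes outside \<open>{0, \<dots>, N - 1}\<close> stands for
  \<open>\<Sum> y\<^sup>i f(i)\<close>. Such an extension is associative as soon as \<open>\<phi>(z) = z\<close> and \<open>h z = z \<phi>\<^sup>N(h)\<close>; the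
  first identity holds because \<open>\<chi>(g)\<^sup>N = 1\<close>, and the second is what the compatibility condition on
  \<open>\<lambda>\<close> says (lemma \<open>h_zz\<close>). By construction the extension is free over \<open>H\<close> on the powers of \<open>y\<close>,
  and it has a universal property for algebra maps. This property yields \<open>\<Delta>\<close> and \<open>\<epsilon>\<close>: one only has
  to know that \<open>(y \<otimes> 1 + g \<otimes> y)\<^sup>N\<close> is \<open>\<Delta>(z)\<close>, and this is so because the two summands \<open>q\<close>-commute
  and the inner Gaussian binomial coefficients vanish at a primitive \<open>N\<close>-th root of unity (lemma
  \<open>bO_pow_N\<close>). For the antipode, a left and a right convolution inverse of the
  identity are constructed by recursion on the power of \<open>y\<close>; being one-sided inverses they coincide (lemmas \<open>left_inverse_values\<close>, \<open>right_inverse_values\<close>, \<open>hopf_A\<close>).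

  The retraction \<open>p\<close> picks the coefficient of \<open>y\<^sup>0\<close>, and then \<open>\<tau>(y\<^sup>n h) = \<epsilon>(h) y\<^sup>n\<close>. So the
  coinvariants are spanned by \<open>y\<^sup>n\<close> for \<open>n < N\<close>; they multiply like powers of a nilpotent \<open>y\<close>, since
  \<open>\<epsilon>(z) = 0\<close>, and \<open>H\<close> acts and coacts on \<open>y\<^sup>n\<close> through \<open>\<chi>\<^sup>n\<close> and \<open>g\<^sup>n\<close>. The locale \<open>line_structure\<close>
  records exactly these data. That they form a braided bialgebra is not checked by hand: the
  quotient \<open>\<O> / \<O> H\<^sup>+\<close> has the same basis, its comultiplication is induced from that of \<open>\<O>\<close>, and the
  braided multiplicativity on the line is the image of the multiplicativity of \<open>\<Delta>\<close> on \<open>\<O>\<close> (lemma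
  \<open>comult_mult_e\<close>, theorem \<open>braided_bialgebra_Q\<close>). The locale applies both to the coinvariants and to
  \<open>K[X] / (X\<^sup>N)\<close>, so that the quantum line exists, and two line structures are isomorphic (lemma
  \<open>line_structure_iso\<close>). Since a braided bialgebra structure with a primitive generator of weight
  \<open>(g, \<chi>)\<close> is a line structure, the quantum line is unique as well.

  For the bosonization, \<open>(m \<otimes> \<xi>) \<delta>\<^bsub>R \<otimes> R\<^esub>(r \<otimes> s)\<close> equals \<open>(\<tau> \<otimes> p) \<Delta>(r s)\<close>, and
  \<open>\<Sum> \<tau>(c\<^sub>1) \<sigma>(p(c\<^sub>2)) = c\<close>. Hence \<open>\<omega>\<close> sends the twisted product to the product of \<open>\<O>\<close> (lemma \<open>om_tw\<close>);
  as \<open>\<omega>\<close> is bijective and respects the other operations too, the Hopf algebra axioms are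
  transported from \<open>\<O>\<close> to \<open>R #\<^sub>\<xi> H\<close> (lemma \<open>hopf_transport\<close>).

  The universal property of the model among bialgebras is the one for algebra maps together with a
  comparison of coalgebra structures on generators (lemma \<open>univ_bialg\<close>). It gives a map from the
  model to any other Hopf algebra with the stated presentation, and this map carries a basis to a
  basis (lemma \<open>is_O_iso\<close>); so the universal property holds for each of them.
\<close>

text \<open>An abbreviated input syntax for structure indices: \<open>x \<otimes>\<^sub>A y\<close> is the product in \<open>A\<close>.\<close>

syntax "_sub_index" :: "id_position \<Rightarrow> index" (\<open>\<^sub>_\<close>)
  "_sub_index_var" :: "var_position \<Rightarrow> index" (\<open>\<^sub>_\<close>)
translations "_sub_index x" => "_index x"
  "_sub_index_var x" => "_index x"

section \<open>Linear and bilinear maps\<close>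

named_theorems lin

lemma lin_mapsI:
 assumes "!!x. x : carrier V ==> f x : carrier W"
 "!!x y. x : carrier V ==> y : carrier V ==> f (x \<oplus>\<^sub>V y) = f x \<oplus>\<^sub>W f y"
 "!!k x. k : carrier K ==> x : carrier V ==> f (k \<odot>\<^sub>V x) = k \<odot>\<^sub>W f x"
 shows "f : lin_maps K V W"
 using assms unfolding LinearCombinations.module_hom_def by auto

lemma lin_mem: "f : lin_maps K V W ==> x : carrier V ==> f x : carrier W"
 unfolding LinearCombinations.module_hom_def by auto

lemma lin_addD: "f : lin_maps K V W ==> x : carrier V ==> y : carrier V ==>
 f (x \<oplus>\<^sub>V y) = f x \<oplus>\<^sub>W f y"
 unfolding LinearCombinations.module_hom_def by auto

lemma lin_smultD: "f : lin_maps K V W ==> k : carrier K ==> x : carrier V ==>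
 f (k \<odot>\<^sub>V x) = k \<odot>\<^sub>W f x"
 unfolding LinearCombinations.module_hom_def by auto

lemma lin_cong:
 assumes "f : lin_maps K V W" "vectorspace K V" "!!x. x : carrier V ==> g x = f x"
 shows "g : lin_maps K V W"
proof -
 interpret V: vectorspace K V by fact
 show ?thesis using assms(1,3) by (intro lin_mapsI) (auto simp: lin_mem lin_addD lin_smultD)
qed

lemma vs_add_closed: "vectorspace K V ==> x : carrier V ==> y : carrier V ==> x \<oplus>\<^sub>V y : carrier V"
 by (simp add: vectorspace_def module_def abelian_group_def abelian_monoid.a_closed)

lemma vs_zero_closed: "vectorspace K V ==> \<zero>\<^sub>V : carrier V"
 by (simp add: vectorspace_def module_def abelian_group_def abelian_monoid.zero_closed)

lemma vs_smult_closed: "vectorspace K V ==> k : carrier K ==> x : carrier V ==> k \<odot>\<^sub>V x : carrier V"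
 by (rule module.smult_closed[of K V]) (simp_all add: vectorspace_def)

lemma vs_minus_closed: "vectorspace K V ==> x : carrier V ==> y : carrier V ==> x \<ominus>\<^sub>V y : carrier V"
 by (simp add: vectorspace_def module_def abelian_group.minus_closed)

lemma vs_abelian_group: "vectorspace K V ==> abelian_group V"
 by (simp add: vectorspace_def module_def)

lemma vs_module: "vectorspace K V ==> module K V"
 by (simp add: vectorspace_def)

lemma vs_field: "vectorspace K V ==> field K"
 by (simp add: vectorspace_def)

lemma lin_zeroD: "f : lin_maps K V W ==> vectorspace K V ==> vectorspace K W ==> f \<zero>\<^sub>V = \<zero>\<^sub>W"
 by (rule mod_hom.f0_is_0[of K V W f]) (simp_all add: mod_hom_def mod_hom_axioms_def vs_module)

lemma lin_negD: "f : lin_maps K V W ==> vectorspace K V ==> vectorspace K W ==> x : carrier V ==>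
 f (\<ominus>\<^sub>V x) = \<ominus>\<^sub>W f x"
 by (rule mod_hom.f_neg[of K V W f]) (simp_all add: mod_hom_def mod_hom_axioms_def vs_module)

lemma lin_minusD: "f : lin_maps K V W ==> vectorspace K V ==> vectorspace K W ==> x : carrier V ==>
 y : carrier V ==> f (x \<ominus>\<^sub>V y) = f x \<ominus>\<^sub>W f y"
 by (rule mod_hom.f_minus[of K V W f]) (simp_all add: mod_hom_def mod_hom_axioms_def vs_module)

lemma lin_finsumD:
 assumes "f : lin_maps K V W" "vectorspace K V" "vectorspace K W" "finite I"
 "!!i. i : I ==> x i : carrier V"
 shows "f (finsum V x I) = finsum W (%i. f (x i)) I"
 using assms(4,5)
proof (induction I rule: finite_induct)
 case empty
 interpret V: vectorspace K V by fact
 interpret W: vectorspace K W by fact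
 show ?case using assms(1-3) by (simp add: lin_zeroD)
next
 case (insert i I)
 interpret V: vectorspace K V by fact
 interpret W: vectorspace K W by fact
 have "f (finsum V x (insert i I)) = f (x i \<oplus>\<^sub>V finsum V x I)"
 using insert by (subst V.finsum_insert) auto
 also have "... = f (x i) \<oplus>\<^sub>W finsum W (%i. f (x i)) I"
 using insert assms(1) by (simp add: lin_addD)
 also have "... = finsum W (%i. f (x i)) (insert i I)"
 using insert assms(1) by (subst W.finsum_insert) (auto simp: lin_mem)
 finally show ?case .
qed

lemma lin_id [lin]: "(%x. x) : lin_maps K V V"
 by (intro lin_mapsI) auto

lemma lin_comp: "f : lin_maps K V W ==> g : lin_maps K U V ==> (%x. f (g x)) : lin_maps K U W"
 by (intro lin_mapsI) (auto simp: lin_mem lin_addD lin_smultD)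

lemma lin_zero [lin]: "vectorspace K M ==> (%x. \<zero>\<^sub>M) : lin_maps K V M"
proof -
 assume "vectorspace K M" then interpret M: vectorspace K M .
 show ?thesis by (intro lin_mapsI) auto
qed

lemma lin_add [lin]:
 assumes "vectorspace K M" "f : lin_maps K V M" "g : lin_maps K V M"
 shows "(%x. f x \<oplus>\<^sub>M g x) : lin_maps K V M"
proof -
 interpret M: vectorspace K M by fact
 show ?thesis using assms
 by (intro lin_mapsI) (auto simp: lin_mem lin_addD lin_smultD M.add.m_ac M.smult_r_distr)
qed

lemma lin_finsum [lin]:
 assumes "vectorspace K M" "finite I" "!!i. i : I ==> f i : lin_maps K V M"
 shows "(%x. finsum M (%i. f i x) I) : lin_maps K V M"
 using assms(2,3)
proof (induction I rule: finite_induct)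
 case empty
 interpret M: vectorspace K M by fact
 show ?case using assms(1) by (simp add: lin_zero)
next
 case (insert i I)
 interpret M: vectorspace K M by fact
 have *: "finsum M (%i. f i x) (insert i I) = f i x \<oplus>\<^sub>M finsum M (%i. f i x) I"
 if "x : carrier V" for x
 using insert that by (subst M.finsum_insert) (auto intro: lin_mem)
 have L: "(%x. f i x \<oplus>\<^sub>M finsum M (%i. f i x) I) : lin_maps K V M"
 using insert assms(1) by (intro lin_add) auto
 have cl: "!!x j. x : carrier V ==> j : insert i I ==> f j x : carrier M"
 using insert by (auto intro: lin_mem)
 show ?case
 proof (intro lin_mapsI)
 fix x assume "x : carrier V"
 then show "finsum M (%i. f i x) (insert i I) : carrier M" using lin_mem[OF L] * by simp
 next
 fix x y assume x: "x : carrier V" "y : carrier V"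
 have "finsum M (%i. f i (x \<oplus>\<^sub>V y)) (insert i I) = finsum M (%i. f i x \<oplus>\<^sub>M f i y) (insert i I)"
  using x cl by (intro M.finsum_cong') (auto intro: lin_addD insert.prems)
 also have "... = finsum M (%i. f i x) (insert i I) \<oplus>\<^sub>M finsum M (%i. f i y) (insert i I)"
  using cl x by (intro M.finsum_addf) auto
 finally show "finsum M (%i. f i (x \<oplus>\<^sub>V y)) (insert i I) =
  finsum M (%i. f i x) (insert i I) \<oplus>\<^sub>M finsum M (%i. f i y) (insert i I)" .
 next
 fix k x assume x: "k : carrier K" "x : carrier V"
 have "finsum M (%i. f i (k \<odot>\<^sub>V x)) (insert i I) = finsum M (%i. k \<odot>\<^sub>M f i x) (insert i I)"
  using x cl by (intro M.finsum_cong') (auto intro: lin_smultD insert.prems)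
 also have "... = k \<odot>\<^sub>M finsum M (%i. f i x) (insert i I)"
  using cl x by (subst M.finsum_smult) auto
 finally show "finsum M (%i. f i (k \<odot>\<^sub>V x)) (insert i I) = k \<odot>\<^sub>M finsum M (%i. f i x) (insert i I)" .
 qed
qed

lemma lin_smult_const [lin]:
 assumes "vectorspace K M" "f : lin_maps K V M" "c : carrier K"
 shows "(%x. c \<odot>\<^sub>M f x) : lin_maps K V M"
proof -
 interpret M: vectorspace K M by fact
 show ?thesis using assms
 by (intro lin_mapsI) (auto simp: lin_mem lin_addD lin_smultD M.smult_r_distr
  M.smult_assoc1[symmetric] M.m_comm)
qed

lemma base_module_simps [simp]:
 "carrier (base_module K) = carrier K" "monoid.mult (base_module K) = monoid.mult K"
 "one (base_module K) = one K" "ring.zero (base_module K) = ring.zero K"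
 "ring.add (base_module K) = ring.add K" "smult (base_module K) = monoid.mult K"
 by (simp_all add: base_module_def)

lemma lin_smult_fun [lin]:
 assumes "vectorspace K M" "f : lin_maps K V (base_module K)" "m : carrier M"
 shows "(%x. f x \<odot>\<^sub>M m) : lin_maps K V M"
proof -
 interpret M: vectorspace K M by fact
 have "!!x. x : carrier V ==> f x : carrier K" using lin_mem[OF assms(2)] by simp
 then show ?thesis using assms(3) lin_addD[OF assms(2)] lin_smultD[OF assms(2)]
 by (intro lin_mapsI) (auto simp: M.smult_l_distr M.smult_assoc1)
qed

definition bilinear_map where
 "bilinear_map K V W M f \<longleftrightarrow> (ALL v:carrier V. f v : lin_maps K W M) &
  (ALL w:carrier W. (%v. f v w) : lin_maps K V M)"

lemma bilinI [lin]:
 "(!!v. v : carrier V ==> (%w. f v w) : lin_maps K W M) ==>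
 (!!w. w : carrier W ==> (%v. f v w) : lin_maps K V M) ==> bilinear_map K V W M f"
 unfolding bilinear_map_def by auto

lemma bilin_lin1: "bilinear_map K V W M f ==> v : carrier V ==> f v : lin_maps K W M"
 and bilin_lin2: "bilinear_map K V W M f ==> w : carrier W ==> (%v. f v w) : lin_maps K V M"
 unfolding bilinear_map_def by auto

lemma bilin_closed: "bilinear_map K V W M f ==> v : carrier V ==> w : carrier W ==> f v w : carrier M"
 by (meson bilin_lin1 lin_mem)

section \<open>The tensor product\<close>

lemmas frag_induct = free_Abelian_group_induct[consumes 1, case_names zero diff frag]

lemma keys_frag_diff:
 "a : S ==> b : S ==> Poly_Mapping.keys (frag_of a - frag_of b) \<subseteq> S"
 "a : S ==> b : S ==> c : S ==> Poly_Mapping.keys (frag_of a - frag_of b - frag_of c) \<subseteq> S"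
 using keys_diff[of "frag_of a - frag_of b" "frag_of c"] keys_diff[of "frag_of a" "frag_of b"]
 by auto

lemma tensor_kernel_subgroup:
 assumes "vectorspace K V" "vectorspace K W"
 shows "subgroup (tensor_kernel K V W) (free_Abelian_group (carrier V \<times> carrier W))"
 and "tensor_relators K V W \<subseteq> carrier (free_Abelian_group (carrier V \<times> carrier W))"
proof -
 interpret V: vectorspace K V by fact
 interpret W: vectorspace K W by fact
 show *: "tensor_relators K V W \<subseteq> carrier (free_Abelian_group (carrier V \<times> carrier W))"
 unfolding tensor_relators_def
 by (rule subsetI; elim UnE CollectE exE conjE; simp only: carrier_free_Abelian_group_iff)
  (rule keys_frag_diff; simp; fail)+
 show "subgroup (tensor_kernel K V W) (free_Abelian_group (carrier V \<times> carrier W))"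
 unfolding tensor_kernel_def
 by (rule group.generate_is_subgroup[OF group_free_Abelian_group *])
qed

locale tensor_construction =
 fixes K :: "('k, 'c) ring_scheme" and V :: "('k, 'a, 'm) module_scheme"
 and W :: "('k, 'b, 'n) module_scheme"
 assumes V: "vectorspace K V" and W: "vectorspace K W"
begin

interpretation V: vectorspace K V by (rule V)
interpretation W: vectorspace K W by (rule W)

abbreviation "F == free_Abelian_group (carrier V \<times> carrier W)"
abbreviation "N == tensor_kernel K V W"
abbreviation "cls x == N #>\<^sub>F x"

text \<open>A scalar acts on the tensor product through the first component of each generator.\<close>

definition scale :: "'k => ('a \<times> 'b \<Rightarrow>\<^sub>0 int) => ('a \<times> 'b \<Rightarrow>\<^sub>0 int)" where
 "scale k = frag_extend (%(v, w). frag_of (k \<odot>\<^sub>V v, w))"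

lemma scale_simps: "scale k 0 = 0" "scale k (x - y) = scale k x - scale k y"
 "scale k (x + y) = scale k x + scale k y"
 "scale k (- x) = - scale k x" "scale k (frag_of (v, w)) = frag_of (k \<odot>\<^sub>V v, w)"
 unfolding scale_def by (simp_all add: frag_extend_diff frag_extend_add frag_extend_minus)

lemma N_subgroup: "subgroup N F" and N_relators: "tensor_relators K V W \<subseteq> N"
 and relators_F: "tensor_relators K V W \<subseteq> carrier F"
 using tensor_kernel_subgroup[OF V W] by (auto simp: tensor_kernel_def intro: generate.incl)

lemma N_rel:
 "v : carrier V ==> v' : carrier V ==> w : carrier W ==>
  frag_of (v \<oplus>\<^sub>V v', w) - frag_of (v, w) - frag_of (v', w) : N"
 "v : carrier V ==> w : carrier W ==> w' : carrier W ==>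
  frag_of (v, w \<oplus>\<^sub>W w') - frag_of (v, w) - frag_of (v, w') : N"
 "k : carrier K ==> v : carrier V ==> w : carrier W ==>
  frag_of (k \<odot>\<^sub>V v, w) - frag_of (v, k \<odot>\<^sub>W w) : N"
 subgoal by (rule subsetD[OF N_relators], unfold tensor_relators_def, rule UnI1, rule UnI1,
  rule CollectI, intro exI conjI, rule refl, assumption+)
 subgoal by (rule subsetD[OF N_relators], unfold tensor_relators_def, rule UnI1, rule UnI2,
  rule CollectI, intro exI conjI, rule refl, assumption+)
 subgoal by (rule subsetD[OF N_relators], unfold tensor_relators_def, rule UnI2,
  rule CollectI, intro exI conjI, rule refl, assumption+)
 done

lemma N_normal: "N \<lhd> F"
 by (simp add: comm_group.normal_iff_subgroup[OF abelian_free_Abelian_group] N_subgroup)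

lemma N_closed: "0 : N" "x : N ==> y : N ==> x + y : N" "x : N ==> - x : N"
 "x : N ==> y : N ==> x - y : N"
 "x : N ==> x : carrier F"
proof -
 note s = N_subgroup
 show c: "x : N ==> x : carrier F" for x using subgroup.mem_carrier[OF s] by blast
 show "0 : N" using subgroup.one_closed[OF s] by simp
 show p: "x : N ==> y : N ==> x + y : N" for x y using subgroup.m_closed[OF s] by fastforce
 show m: "x : N ==> - x : N" for x
 using subgroup.m_inv_closed[OF s, of x] c[of x] by simp
 show "x : N ==> y : N ==> x - y : N" using p[of x "-y"] m[of y] by simp
qed

lemma cls_eq: "x : carrier F ==> y : carrier F ==> cls x = cls y \<longleftrightarrow> x - y : N"
proof -
 assume xy: "x : carrier F" "y : carrier F"
 have r: "cls x = (%n. n + x) ` N" for x unfolding r_coset_def by auto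
 show ?thesis
 proof
 assume "cls x = cls y"
 moreover have "x : cls x" unfolding r using N_closed(1) by force
 ultimately have "x : cls y" by simp
 then show "x - y : N" unfolding r by auto
 next
 assume *: "x - y : N"
 have "EX m:N. n + x = m + y" if "n : N" for n
  using N_closed(2)[OF that *] by (intro bexI[of _ "n + (x - y)"]) auto
 moreover have "EX m:N. n + y = m + x" if "n : N" for n
  using N_closed(4)[OF that *] by (intro bexI[of _ "n - (x - y)"]) auto
 ultimately show "cls x = cls y" unfolding r by auto
 qed
qed

lemma tensor_carrier: "carrier (tensor K V W) = cls ` carrier F"
 by (auto simp: tensor_def Let_def FactGroup_def RCOSETS_def)

lemma tensor_carrierE:
 assumes "t : carrier (tensor K V W)" obtains x where "x : carrier F" "t = cls x"
 using assms by (auto simp: tensor_carrier)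

lemma tensor_add: "x : carrier F ==> y : carrier F ==> cls x \<oplus>\<^bsub>tensor K V W\<^esub> cls y = cls (x + y)"
 using normal.rcos_sum[OF N_normal, of x y] by (simp add: tensor_def Let_def FactGroup_def)

lemma tensor_zero: "\<zero>\<^bsub>tensor K V W\<^esub> = cls 0"
 using group.coset_mult_one[OF group_free_Abelian_group, of N "carrier V \<times> carrier W"] N_closed(5)
 by (auto simp: tensor_def Let_def FactGroup_def subset_iff)

lemma scale_F: "k : carrier K ==> x : carrier F ==> scale k x : carrier F"
 unfolding scale_def using keys_frag_extend[of "%(v, w). frag_of (k \<odot>\<^sub>V v, w)" x] by force

lemma scale_N: "k : carrier K ==> x : N ==> scale k x : N"
proof -
 assume k: "k : carrier K" and x: "x : N"
 have rel: "scale k r : N" if "r : tensor_relators K V W" for r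
 proof -
 have "scale k r : tensor_relators K V W"
  using that k unfolding tensor_relators_def
 proof (elim UnE, goal_cases)
  case 1
  then obtain v v' w where *: "r = frag_of (v \<oplus>\<^sub>V v', w) - frag_of (v, w) - frag_of (v', w)"
   "v : carrier V" "v' : carrier V" "w : carrier W" by auto
  then have "scale k r = frag_of ((k \<odot>\<^sub>V v) \<oplus>\<^sub>V (k \<odot>\<^sub>V v'), w) - frag_of (k \<odot>\<^sub>V v, w) -
   frag_of (k \<odot>\<^sub>V v', w)"
  using k by (simp add: scale_simps V.smult_r_distr)
  then show ?case using *(2-) k
   by - (rule UnI1, rule UnI1, rule CollectI, rule exI[of _ "k \<odot>\<^sub>V v"],
   rule exI[of _ "k \<odot>\<^sub>V v'"], rule exI[of _ w], simp)
 next
  case 2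
  then obtain v w w' where *: "r = frag_of (v, w \<oplus>\<^sub>W w') - frag_of (v, w) - frag_of (v, w')"
   "v : carrier V" "w : carrier W" "w' : carrier W" by auto
  then have "scale k r = frag_of (k \<odot>\<^sub>V v, w \<oplus>\<^sub>W w') - frag_of (k \<odot>\<^sub>V v, w) -
   frag_of (k \<odot>\<^sub>V v, w')"
  using k by (simp add: scale_simps)
  then show ?case using *(2-) k
   by - (rule UnI1, rule UnI2, rule CollectI, rule exI[of _ "k \<odot>\<^sub>V v"],
   rule exI[of _ w], rule exI[of _ w'], simp)
 next
  case 3
  then obtain c v w where *: "r = frag_of (c \<odot>\<^sub>V v, w) - frag_of (v, c \<odot>\<^sub>W w)"
   "c : carrier K" "v : carrier V" "w : carrier W" by auto
  then have "scale k r = frag_of (c \<odot>\<^sub>V (k \<odot>\<^sub>V v), w) - frag_of (k \<odot>\<^sub>V v, c \<odot>\<^sub>W w)"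
  using k by (simp add: scale_simps V.smult_assoc1[symmetric] V.m_comm)
  then show ?case using *(2-) k
   by - (rule UnI2, rule CollectI, rule exI[of _ c], rule exI[of _ "k \<odot>\<^sub>V v"],
   rule exI[of _ w], simp)
 qed
 then show ?thesis using N_relators by auto
 qed
 have "x : generate F (tensor_relators K V W)" using x by (simp add: tensor_kernel_def)
 then show ?thesis
 proof (induction rule: generate.induct)
 case one then show ?case by (simp add: scale_simps N_closed)
 next
 case (incl h) then show ?case by (rule rel)
 next
 case (inv h)
 then have "h : carrier F" using relators_F by blast
 then have "inv\<^bsub>F\<^esub> h = - h" by (intro inv_free_Abelian_group) simp
 then show ?case using rel[OF inv] by (simp add: scale_simps N_closed)
 next
 case (eng h1 h2) then show ?case by (simp add: scale_simps N_closed)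
 qed
qed

lemma tensor_smult: "k : carrier K ==> x : carrier F ==> k \<odot>\<^bsub>tensor K V W\<^esub> cls x = cls (scale k x)"
proof -
 assume k: "k : carrier K" and x: "x : carrier F"
 have "cls (scale k x') = cls (scale k x)" if "x' : cls x" for x'
 proof -
 from that obtain n where n: "n : N" "x' = n + x" by (auto simp: r_coset_def)
 then have "x' : carrier F" using x N_closed(5)[of n] keys_add[of n x] by auto
 moreover have "scale k x' - scale k x = scale k n" unfolding n by (simp add: scale_simps)
 ultimately show ?thesis using scale_N[OF k n(1)] scale_F[OF k] x
  by (simp add: cls_eq del: carrier_free_Abelian_group_iff)
 qed
 moreover have "x : cls x" using N_closed(1) unfolding r_coset_def by force
 ultimately have "(\<Union>x'\<in>cls x. cls (scale k x')) = cls (scale k x)" by blast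
 then show ?thesis by (simp add: tensor_def Let_def scale_def)
qed

lemma scale_add: "a : carrier K ==> b : carrier K ==> x : carrier F ==>
 scale (a \<oplus>\<^sub>K b) x - (scale a x + scale b x) : N"
proof -
 assume ab: "a : carrier K" "b : carrier K" and "x : carrier F"
 then have "Poly_Mapping.keys x \<subseteq> carrier V \<times> carrier W" by simp
 then show ?thesis
 proof (induction rule: frag_induct)
 case zero show ?case by (simp add: scale_simps N_closed)
 next
 case (diff x y)
 have "scale (a \<oplus>\<^sub>K b) (x - y) - (scale a (x - y) + scale b (x - y)) =
  (scale (a \<oplus>\<^sub>K b) x - (scale a x + scale b x)) - (scale (a \<oplus>\<^sub>K b) y - (scale a y + scale b y))"
  by (simp add: scale_simps)
 then show ?case using N_closed(4)[OF diff(3) diff(4)] by simp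
 next
 case (frag p)
 obtain v w where p: "p = (v, w)" by (cases p)
 have "frag_of ((a \<odot>\<^sub>V v) \<oplus>\<^sub>V (b \<odot>\<^sub>V v), w) - frag_of (a \<odot>\<^sub>V v, w) - frag_of (b \<odot>\<^sub>V v, w) : N"
  using frag p ab by (intro N_rel) auto
 then show ?case using frag p ab by (simp add: scale_simps V.smult_l_distr diff_diff_eq)
 qed
qed

lemma scale_assoc: "a : carrier K ==> b : carrier K ==> x : carrier F ==>
 scale (a \<otimes>\<^sub>K b) x = scale a (scale b x)"
proof -
 assume ab: "a : carrier K" "b : carrier K" and "x : carrier F"
 then have "Poly_Mapping.keys x \<subseteq> carrier V \<times> carrier W" by simp
 then show ?thesis
 by (induction rule: frag_induct) (auto simp: scale_simps ab V.smult_assoc1)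
qed

lemma scale_one: "x : carrier F ==> scale \<one>\<^sub>K x = x"
proof -
 assume "x : carrier F"
 then have "Poly_Mapping.keys x \<subseteq> carrier V \<times> carrier W" by simp
 then show ?thesis
 by (induction rule: frag_induct) (auto simp: scale_simps)
qed

lemma tensor_vs: "vectorspace K (tensor K V W)"
proof -
 let ?T = "tensor K V W"
 interpret Q: comm_group "F Mod N"
 by (rule comm_group.abelian_FactGroup[OF abelian_free_Abelian_group N_subgroup])
 have eq: "carrier ?T = carrier (F Mod N)" "\<zero>\<^sub>?T = \<one>\<^bsub>F Mod N\<^esub>"
 "!!s t. s \<oplus>\<^sub>?T t = s \<otimes>\<^bsub>F Mod N\<^esub> t"
 by (simp_all add: tensor_def Let_def)
 have ag: "abelian_group ?T"
 by (rule abelian_groupI, unfold eq)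
  (rule Q.m_closed Q.one_closed Q.m_assoc Q.m_comm Q.l_one Q.l_inv_ex; assumption)+
 have addF: "x + y : carrier F" if "x : carrier F" "y : carrier F" for x y
 using that keys_add[of x y] by auto
 have sa: "cls (scale (a \<oplus>\<^sub>K b) x) = cls (scale a x + scale b x)"
 if "a : carrier K" "b : carrier K" "x : carrier F" for a b x
 proof (subst cls_eq)
 show "scale (a \<oplus>\<^sub>K b) x : carrier F" using that by (intro scale_F) auto
 show "scale a x + scale b x : carrier F" using that by (intro addF scale_F)
 qed (intro scale_add that)
 have "module K ?T"
 proof (rule moduleI)
 show "cring K" by (rule V.R.is_cring)
 show "abelian_group ?T" by (rule ag)
 next
 fix a x assume "a : carrier K" "x : carrier ?T"
 then show "a \<odot>\<^sub>?T x : carrier ?T"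
  by (elim tensor_carrierE) (simp add: tensor_smult scale_F tensor_carrier del: carrier_free_Abelian_group_iff)
 next
 fix a b x assume *: "a : carrier K" "b : carrier K" "x : carrier ?T"
 then show "(a \<oplus>\<^sub>K b) \<odot>\<^sub>?T x = (a \<odot>\<^sub>?T x) \<oplus>\<^sub>?T (b \<odot>\<^sub>?T x)"
  by (elim tensor_carrierE) (simp add: tensor_smult tensor_add scale_F sa del: carrier_free_Abelian_group_iff)
 from * show "(a \<otimes>\<^sub>K b) \<odot>\<^sub>?T x = a \<odot>\<^sub>?T (b \<odot>\<^sub>?T x)"
  by (elim tensor_carrierE) (simp add: tensor_smult scale_F scale_assoc del: carrier_free_Abelian_group_iff)
 next
 fix a x y assume "a : carrier K" "x : carrier ?T" "y : carrier ?T"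
 then show "a \<odot>\<^sub>?T (x \<oplus>\<^sub>?T y) = (a \<odot>\<^sub>?T x) \<oplus>\<^sub>?T (a \<odot>\<^sub>?T y)"
  by (elim tensor_carrierE) (simp add: tensor_smult tensor_add scale_F addF scale_simps(3)
   del: carrier_free_Abelian_group_iff)
 next
 fix x assume "x : carrier ?T"
 then show "\<one>\<^sub>K \<odot>\<^sub>?T x = x"
  by (elim tensor_carrierE) (simp add: tensor_smult scale_one del: carrier_free_Abelian_group_iff)
 qed
 then show ?thesis using V by (simp add: vectorspace_def)
qed

lemma pure_F: "v : carrier V ==> w : carrier W ==> frag_of (v, w) : carrier F"
 by simp

lemma pure_bilinear: "bilinear_map K V W (tensor K V W) (pure_tensor K V W)"
proof -
 have sub: "x : carrier F ==> y : carrier F ==> x - y : carrier F"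
  and addF: "x : carrier F ==> y : carrier F ==> x + y : carrier F" for x y
 using keys_diff[of x y] keys_add[of x y] by auto
 have dd: "x - (y + z) = x - y - z" for x y z :: "'a \<times> 'b \<Rightarrow>\<^sub>0 int" by simp
 have 1: "frag_of (v \<oplus>\<^sub>V v', w) - (frag_of (v, w) + frag_of (v', w)) : N"
 if "v : carrier V" "v' : carrier V" "w : carrier W" for v v' w
 unfolding dd using that by (intro N_rel)
 have 2: "frag_of (v, w \<oplus>\<^sub>W w') - (frag_of (v, w) + frag_of (v, w')) : N"
 if "v : carrier V" "w' : carrier W" "w : carrier W" for v w w'
 unfolding dd using that by (intro N_rel)
 have 3: "frag_of (v, k \<odot>\<^sub>W w) - frag_of (k \<odot>\<^sub>V v, w) : N"
 if "v : carrier V" "k : carrier K" "w : carrier W" for v w k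
 proof -
 have "frag_of (k \<odot>\<^sub>V v, w) - frag_of (v, k \<odot>\<^sub>W w) : N"
  using that by (intro N_rel)
 from N_closed(3)[OF this] show ?thesis by simp
 qed
 show ?thesis
 by (intro bilinI lin_mapsI)
  (simp_all add: pure_tensor_def tensor_add tensor_smult cls_eq pure_F addF scale_simps(5) 1 2 3
  N_closed(1) tensor_carrier
  del: carrier_free_Abelian_group_iff)
qed

lemma tensor_induct_cls:
 assumes t: "t : carrier (tensor K V W)"
 and pure: "!!v w. v : carrier V ==> w : carrier W ==> P (pure_tensor K V W v w)"
 and P0: "P \<zero>\<^bsub>tensor K V W\<^esub>"
 and minus: "!!s t. s : carrier (tensor K V W) ==> t : carrier (tensor K V W) ==> P s ==> P t ==>
  P (s \<ominus>\<^bsub>tensor K V W\<^esub> t)"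
 shows "P t"
proof -
 interpret T: vectorspace K "tensor K V W" by (rule tensor_vs)
 obtain x where x: "x : carrier F" "t = cls x" using t by (rule tensor_carrierE)
 have "Poly_Mapping.keys x \<subseteq> carrier V \<times> carrier W" using x by simp
 then have "P (cls x)"
 proof (induction rule: frag_induct)
 case zero then show ?case using P0 by (simp only: tensor_zero)
 next
 case (diff x y)
 then have xy: "x : carrier F" "y : carrier F" "x - y : carrier F"
  using keys_diff[of x y] by auto
 have "cls x = cls (x - y) \<oplus>\<^bsub>tensor K V W\<^esub> cls y" using xy by (simp add: tensor_add)
 moreover have "cls x : carrier (tensor K V W)" "cls y : carrier (tensor K V W)"
  "cls (x - y) : carrier (tensor K V W)" using xy by (auto simp: tensor_carrier)
 ultimately have "cls (x - y) = cls x \<ominus>\<^bsub>tensor K V W\<^esub> cls y"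
  by (simp add: T.M.minus_eq T.M.add.inv_solve_right)
 then show ?case using diff minus \<open>cls x \<in> _\<close> \<open>cls y \<in> _\<close> by simp
 next
 case (frag p) then show ?case using pure unfolding pure_tensor_def by (cases p) auto
 qed
 then show ?thesis using x by simp
qed

text \<open>A bilinear map extends additively to the free abelian group and kills the relators there, so it factors through the quotient.\<close>

lemma lift_exists:
 assumes M: "vectorspace K M" and f: "bilinear_map K V W M f"
 shows "EX L. L : lin_maps K (tensor K V W) M &
  (ALL v:carrier V. ALL w:carrier W. L (pure_tensor K V W v w) = f v w)"
proof -
 interpret M: vectorspace K M by (rule M)
 have cg: "comm_group (add_monoid M)" using M.M.a_comm_group by simp
 note f1 = bilin_lin1[OF f] and f2 = bilin_lin2[OF f] and fc = bilin_closed[OF f]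
 have fadd1: "f (v \<oplus>\<^sub>V v') w = f v w \<oplus>\<^sub>M f v' w" if "v : carrier V" "v' : carrier V" "w : carrier W" for v v' w
 using lin_addD[OF f2] that by blast
 have fadd2: "f v (w \<oplus>\<^sub>W w') = f v w \<oplus>\<^sub>M f v w'" if "v : carrier V" "w' : carrier W" "w : carrier W" for v w w'
 using lin_addD[OF f1] that by blast
 have fs1: "f (k \<odot>\<^sub>V v) w = k \<odot>\<^sub>M f v w" if "k : carrier K" "v : carrier V" "w : carrier W" for k v w
 using lin_smultD[OF f2] that by blast
 have fs2: "f v (k \<odot>\<^sub>W w) = k \<odot>\<^sub>M f v w" if "k : carrier K" "v : carrier V" "w : carrier W" for k v w
 using lin_smultD[OF f1] that by blast
 obtain h where h: "h : hom F (add_monoid M)" and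
 hf: "!!p. p : carrier V \<times> carrier W ==> h (frag_of p) = (%(v, w). f v w) p"
 by (rule comm_group.free_Abelian_group_universal[OF cg, of "%(v, w). f v w" "carrier V \<times> carrier W"])
  (auto simp: fc)
 interpret h: group_hom F "add_monoid M" h
 using h cg by (simp add: group_hom_def group_hom_axioms_def comm_group_def)
 have hc: "h x : carrier M" if "x : carrier F" for x using h.hom_closed that by simp
 have hadd: "h (x + y) = h x \<oplus>\<^sub>M h y" if "x : carrier F" "y : carrier F" for x y
 using h.hom_mult that by simp
 have h0: "h 0 = \<zero>\<^sub>M" using h.hom_one by simp
 have hm: "h (x - y) = h x \<ominus>\<^sub>M h y" if "x : carrier F" "y : carrier F" for x y
 proof -
 have d: "x - y : carrier F" using that keys_diff[of x y] by auto
 have "h x = h (x - y) \<oplus>\<^sub>M h y" using hadd[OF d that(2)] by simp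
 then show ?thesis using hc[OF d] hc[OF that(1)] hc[OF that(2)]
  by (simp add: M.M.minus_eq M.M.add.inv_solve_right)
 qed
 have hrel: "h r = \<zero>\<^sub>M" if "r : tensor_relators K V W" for r
 proof -
 have sub: "x : carrier F ==> y : carrier F ==> x - y : carrier F" for x y
  using keys_diff[of x y] by auto
 have can: "a \<oplus>\<^sub>M b \<ominus>\<^sub>M a \<ominus>\<^sub>M b = \<zero>\<^sub>M" if "a : carrier M" "b : carrier M" for a b
 proof -
  have "a \<oplus>\<^sub>M b \<ominus>\<^sub>M a = b"
  using that by (simp add: M.M.minus_eq M.M.a_comm[of a b] M.M.a_assoc M.M.r_neg)
  then show ?thesis using that by (simp add: M.M.minus_eq M.M.r_neg)
 qed
 show ?thesis using that unfolding tensor_relators_def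
  by (elim UnE CollectE exE conjE)
  (simp_all add: hm hf sub pure_F fadd1 fadd2 fs1 fs2 fc can M.M.r_neg M.M.minus_eq[of "f _ _" "f _ _"]
  del: carrier_free_Abelian_group_iff)
 qed
 have hN: "h n = \<zero>\<^sub>M" if "n : N" for n
 proof -
 have "n : generate F (tensor_relators K V W)" using that by (simp add: tensor_kernel_def)
 then show ?thesis
 proof (induction rule: generate.induct)
  case one then show ?case by (simp add: h0)
 next
  case (incl h) then show ?case by (rule hrel)
 next
  case (inv r)
  then have rF: "r : carrier F" using relators_F by blast
  have "h (inv\<^bsub>F\<^esub> r) = inv\<^bsub>add_monoid M\<^esub> (h r)" using h.hom_inv[OF rF] .
  also have "... = \<zero>\<^sub>M" using hrel[OF inv] M.M.add.inv_one by simp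
  finally show ?case .
 next
  case (eng h1 h2)
  have "h1 : carrier F" "h2 : carrier F"
  using eng.hyps by (auto simp only: tensor_kernel_def[symmetric] intro: N_closed(5))
  then have "h (h1 + h2) = h h1 \<oplus>\<^sub>M h h2" by (rule hadd)
  then show ?case using eng.IH by simp
 qed
 qed
 define L where "L T = h (SOME x. x : T)" for T
 have L: "L (cls x) = h x" if "x : carrier F" for x
 proof -
 have "x : cls x" using N_closed(1) unfolding r_coset_def by force
 then have "(SOME y. y : cls x) : cls x" by (rule someI)
 then obtain n where n: "n : N" "(SOME y. y : cls x) = n + x" unfolding r_coset_def by force
 have "h (n + x) = h x"
  unfolding hadd[OF N_closed(5)[OF n(1)] that] hN[OF n(1)] using hc[OF that] by simp
 then show ?thesis unfolding L_def n(2) .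
 qed
 have hs: "h (scale k x) = k \<odot>\<^sub>M h x" if k: "k : carrier K" and x: "x : carrier F" for k x
 proof -
 have "Poly_Mapping.keys x \<subseteq> carrier V \<times> carrier W" using x by simp
 then show ?thesis
 proof (induction rule: frag_induct)
  case zero then show ?case using k by (simp add: scale_simps h0)
 next
  case (diff x y)
  then have xy: "x : carrier F" "y : carrier F" by auto
  show ?case unfolding scale_simps hm[OF xy] hm[OF scale_F[OF k xy(1)] scale_F[OF k xy(2)]] diff.IH
  using k hc[OF xy(1)] hc[OF xy(2)] by (simp add: M.M.minus_eq M.smult_r_distr M.smult_r_minus)
 next
  case (frag p) then show ?case using k by (cases p) (auto simp: scale_simps hf fs1)
 qed
 qed
 have addF: "x : carrier F ==> y : carrier F ==> x + y : carrier F" for x y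
 using keys_add[of x y] by auto
 have "L : lin_maps K (tensor K V W) M"
 by (rule lin_mapsI; elim tensor_carrierE; simp add: L hc hadd tensor_add tensor_smult hs scale_F addF
  del: carrier_free_Abelian_group_iff)
 moreover have "L (pure_tensor K V W v w) = f v w" if "v : carrier V" "w : carrier W" for v w
 using that hf[of "(v, w)"] unfolding pure_tensor_def by (subst L) auto
 ultimately show ?thesis by blast
qed

end

lemma vs_tensor [lin]: "vectorspace K V ==> vectorspace K W ==> vectorspace K (tensor K V W)"
 by (rule tensor_construction.tensor_vs) (simp add: tensor_construction_def)

lemma bilin_pure: "vectorspace K V ==> vectorspace K W ==>
 bilinear_map K V W (tensor K V W) (pure_tensor K V W)"
 by (rule tensor_construction.pure_bilinear) (simp add: tensor_construction_def)

lemma pure_mem [lin]: "vectorspace K V ==> vectorspace K W ==> v : carrier V ==> w : carrier W ==>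
 pure_tensor K V W v w : carrier (tensor K V W)"
 by (meson bilin_pure bilin_closed)

lemma tensor_induct [consumes 3, case_names pure add]:
 assumes V: "vectorspace K V" and W: "vectorspace K W" and t: "t : carrier (tensor K V W)"
 and pure: "!!v w. v : carrier V ==> w : carrier W ==> P (pure_tensor K V W v w)"
 and add: "!!s t. s : carrier (tensor K V W) ==> t : carrier (tensor K V W) ==> P s ==> P t ==>
  P (s \<oplus>\<^bsub>tensor K V W\<^esub> t)"
 shows "P t"
proof -
 interpret V: vectorspace K V by fact
 interpret W: vectorspace K W by fact
 let ?T = "tensor K V W"
 interpret T: vectorspace K ?T using V W by (rule vs_tensor)
 interpret tc: tensor_construction K V W using V W by (simp add: tensor_construction_def)
 have neg: "\<ominus>\<^sub>?T pure_tensor K V W v w = pure_tensor K V W (\<ominus>\<^sub>V v) w"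
 if "v : carrier V" "w : carrier W" for v w
 using lin_negD[OF bilin_lin2[OF bilin_pure[OF V W]] V vs_tensor[OF V W]] that by auto
 have z: "\<zero>\<^sub>?T = pure_tensor K V W \<zero>\<^sub>V \<zero>\<^sub>W"
 using lin_zeroD[OF bilin_lin2[OF bilin_pure[OF V W]] V vs_tensor[OF V W]] by auto
 have "P t & P (\<ominus>\<^sub>?T t)"
 proof (rule tc.tensor_induct_cls[OF t])
 fix v w assume "v : carrier V" "w : carrier W"
 then show "P (pure_tensor K V W v w) & P (\<ominus>\<^sub>?T pure_tensor K V W v w)"
  using pure neg by simp
 next
 show "P \<zero>\<^sub>?T & P (\<ominus>\<^sub>?T \<zero>\<^sub>?T)"
  using z[symmetric] pure[of "\<zero>\<^sub>V" "\<zero>\<^sub>W"] T.M.add.inv_one by (simp add: a_inv_def)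
 next
 fix s t assume s: "s : carrier ?T" "t : carrier ?T"
  and "P s & P (\<ominus>\<^sub>?T s)" "P t & P (\<ominus>\<^sub>?T t)"
 then have "P (s \<oplus>\<^sub>?T (\<ominus>\<^sub>?T t))" "P (t \<oplus>\<^sub>?T (\<ominus>\<^sub>?T s))"
  by (auto intro!: add)
 moreover have "\<ominus>\<^sub>?T (s \<ominus>\<^sub>?T t) = t \<oplus>\<^sub>?T (\<ominus>\<^sub>?T s)"
  using s by (simp add: T.M.minus_eq T.M.minus_add T.M.a_comm)
 ultimately show "P (s \<ominus>\<^sub>?T t) & P (\<ominus>\<^sub>?T (s \<ominus>\<^sub>?T t))"
  by (simp add: T.M.minus_eq)
 qed
 then show ?thesis ..
qed

lemma tensor_lin_eq:
 assumes "vectorspace K V" "vectorspace K W" "F : lin_maps K (tensor K V W) M" "G : lin_maps K (tensor K V W) M"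
 "!!v w. v : carrier V ==> w : carrier W ==> F (pure_tensor K V W v w) = G (pure_tensor K V W v w)"
 "t : carrier (tensor K V W)"
 shows "F t = G t"
 using assms(1,2,6)
 by (induction t rule: tensor_induct) (auto simp: assms(5) lin_addD[OF assms(3)] lin_addD[OF assms(4)])

lemma lift_spec:
 assumes "vectorspace K V" "vectorspace K W" "vectorspace K M" "bilinear_map K V W M f"
 shows "tensor_lift K V W M f : lin_maps K (tensor K V W) M"
 and "v : carrier V ==> w : carrier W ==> tensor_lift K V W M f (pure_tensor K V W v w) = f v w"
proof -
 interpret tc: tensor_construction K V W using assms by (simp add: tensor_construction_def)
 have "tensor_lift K V W M f : lin_maps K (tensor K V W) M &
  (ALL v:carrier V. ALL w:carrier W. tensor_lift K V W M f (pure_tensor K V W v w) = f v w)"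
 unfolding tensor_lift_def using tc.lift_exists[OF assms(3,4)] by (rule someI_ex)
 then show "tensor_lift K V W M f : lin_maps K (tensor K V W) M"
 "v : carrier V ==> w : carrier W ==> tensor_lift K V W M f (pure_tensor K V W v w) = f v w" by auto
qed

section \<open>Calculus of induced maps\<close>

declare vs_add_closed [lin] vs_zero_closed [lin] vs_smult_closed [lin] vs_minus_closed [lin]

lemma vs_cong:
 assumes "vectorspace K V" "carrier W = carrier V" "ring.zero W = ring.zero V" "ring.add W = ring.add V"
 "smult W = smult V"
 shows "vectorspace K W"
proof -
 interpret V: vectorspace K V by fact
 have "abelian_group W"
 by (rule abelian_groupI) (auto simp: assms V.M.a_ac intro: V.M.l_neg)
 then have "module K W"
 by (intro moduleI V.R.is_cring)
  (auto simp: assms V.smult_l_distr V.smult_r_distr V.smult_assoc1)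
 then show ?thesis using V.field_axioms by (simp add: vectorspace_def)
qed

lemma base_vs [lin]: "field K ==> vectorspace K (base_module K)"
proof -
 assume "field K"
 then interpret field K .
 have "abelian_group (base_module K)"
 by (rule abelian_groupI) (auto simp: a_ac intro: l_neg)
 then have "module K (base_module K)"
 by (intro moduleI is_cring) (auto simp: l_distr r_distr m_assoc)
 then show ?thesis using \<open>field K\<close> by (simp add: vectorspace_def)
qed

lemma lift_lin [lin]:
 assumes "vectorspace K V" "vectorspace K W" "vectorspace K M" "bilinear_map K V W M f"
 "g : lin_maps K U (tensor K V W)"
 shows "(%x. tensor_lift K V W M f (g x)) : lin_maps K U M"
 by (rule lin_comp[OF lift_spec(1)[OF assms(1-4)] assms(5)])

lemma lift_closed [lin]:
 assumes "vectorspace K V" "vectorspace K W" "vectorspace K M" "bilinear_map K V W M f"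
 "t : carrier (tensor K V W)"
 shows "tensor_lift K V W M f t : carrier M"
 by (rule lin_mem[OF lift_spec(1)[OF assms(1-4)] assms(5)])

lemmas lift_pure = lift_spec(2)

lemma lift_cong:
 assumes "!!v w. v : carrier V ==> w : carrier W ==> f v w = g v w" "t = t'"
 shows "tensor_lift K V W M f t = tensor_lift K V W M g t'"
proof -
 have "tensor_lift K V W M f = tensor_lift K V W M g"
 unfolding tensor_lift_def using assms(1) by (intro arg_cong[where f=Eps] ext) auto
 then show ?thesis using assms(2) by simp
qed

lemma lift_unique:
 assumes "vectorspace K V" "vectorspace K W" "vectorspace K M" "bilinear_map K V W M f"
 "L : lin_maps K (tensor K V W) M"
 "!!v w. v : carrier V ==> w : carrier W ==> L (pure_tensor K V W v w) = f v w"
 "t : carrier (tensor K V W)"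
 shows "tensor_lift K V W M f t = L t"
 by (rule tensor_lin_eq[OF assms(1,2) lift_spec(1)[OF assms(1-4)] assms(5)])
 (simp_all add: lift_spec(2)[OF assms(1-4)] assms(6,7))

lemma lift_pure_id:
 assumes "vectorspace K V" "vectorspace K W" "t : carrier (tensor K V W)"
 shows "tensor_lift K V W (tensor K V W) (pure_tensor K V W) t = t"
 by (rule lift_unique) (rule assms bilin_pure vs_tensor lin_id refl)+

text \<open>A linear map can be pulled inside an induced map; this is the rule by which Sweedler sums
  are manipulated below.\<close>

lemma lin_lift_comp:
 assumes "vectorspace K V" "vectorspace K W" "vectorspace K M" "bilinear_map K V W M f"
 "vectorspace K M'" "L : lin_maps K M M'" "t : carrier (tensor K V W)"
 shows "L (tensor_lift K V W M f t) = tensor_lift K V W M' (%v w. L (f v w)) t"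
proof -
 have b: "bilinear_map K V W M' (%v w. L (f v w))"
 using assms(4) by (intro bilinI lin_comp[OF assms(6)]) (auto simp: bilinear_map_def)
 show ?thesis
 by (rule lift_unique[symmetric, OF assms(1,2,5) b lin_comp[OF assms(6) lift_spec(1)[OF assms(1-4)]]])
  (simp_all add: lift_spec(2)[OF assms(1-4)] assms(7))
qed

lemma lift_lin_fun [lin]:
 assumes V: "vectorspace K V" and W: "vectorspace K W" and M: "vectorspace K M"
 and bil: "!!x. x : carrier U ==> bilinear_map K V W M (F x)"
 and F: "!!v w. v : carrier V ==> w : carrier W ==> (%x. F x v w) : lin_maps K U M"
 and U: "vectorspace K U"
 and t: "t : carrier (tensor K V W)"
 shows "(%x. tensor_lift K V W M (F x) t) : lin_maps K U M"
 using V W t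
proof (induction t rule: tensor_induct)
 case (pure v w)
 show ?case by (rule lin_cong[OF F[OF pure] U]) (rule lift_pure[OF V W M bil pure])
next
 case (add s t)
 show ?case
 by (rule lin_cong[OF lin_add[OF M add(3,4)] U])
  (rule lin_addD[OF lift_spec(1)[OF V W M bil] add(1,2)])
qed

lemma lift_addD:
 assumes "vectorspace K V" "vectorspace K W" "vectorspace K M" "bilinear_map K V W M f"
 "s : carrier (tensor K V W)" "t : carrier (tensor K V W)"
 shows "tensor_lift K V W M f (s \<oplus>\<^bsub>tensor K V W\<^esub> t) = tensor_lift K V W M f s \<oplus>\<^sub>M tensor_lift K V W M f t"
 by (rule lin_addD[OF lift_spec(1)[OF assms(1-4)] assms(5,6)])

lemma lin_pure_l [lin]: "vectorspace K V ==> vectorspace K W ==> f : lin_maps K U V ==> w : carrier W ==>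
 (%x. pure_tensor K V W (f x) w) : lin_maps K U (tensor K V W)"
 by (rule lin_comp[OF bilin_lin2[OF bilin_pure]])

lemma lin_pure_r [lin]: "vectorspace K V ==> vectorspace K W ==> f : lin_maps K U W ==> v : carrier V ==>
 (%x. pure_tensor K V W v (f x)) : lin_maps K U (tensor K V W)"
 by (rule lin_comp[OF bilin_lin1[OF bilin_pure]])

lemma bilin_comp1: "bilinear_map K V W M f ==> g : lin_maps K U W ==> v : carrier V ==>
 (%x. f v (g x)) : lin_maps K U M"
 by (rule lin_comp[OF bilin_lin1])

lemma bilin_comp2: "bilinear_map K V W M f ==> g : lin_maps K U V ==> w : carrier W ==>
 (%x. f (g x) w) : lin_maps K U M"
 by (rule lin_comp[OF bilin_lin2])

lemma tensor_map_lin [lin]: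
 assumes "vectorspace K V" "vectorspace K W" "vectorspace K V'" "vectorspace K W'"
 "f : lin_maps K V V'" "h : lin_maps K W W'" "g : lin_maps K U (tensor K V W)"
 shows "(%x. tensor_map K V W V' W' f h (g x)) : lin_maps K U (tensor K V' W')"
 unfolding tensor_map_def
 by (assumption | rule lin assms lin_comp[OF assms(5)] lin_comp[OF assms(6)] lin_mem[OF assms(5)]
 lin_mem[OF assms(6)])+

lemma bilin_pure_map:
 assumes "vectorspace K V" "vectorspace K W" "vectorspace K V'" "vectorspace K W'"
 "f : lin_maps K V V'" "h : lin_maps K W W'"
 shows "bilinear_map K V W (tensor K V' W') (%v w. pure_tensor K V' W' (f v) (h w))"
 by (assumption | rule lin assms lin_comp[OF assms(5)] lin_comp[OF assms(6)] lin_mem[OF assms(5)]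
 lin_mem[OF assms(6)])+

lemma tensor_map_closed [lin]:
 assumes "vectorspace K V" "vectorspace K W" "vectorspace K V'" "vectorspace K W'"
 "f : lin_maps K V V'" "h : lin_maps K W W'" "t : carrier (tensor K V W)"
 shows "tensor_map K V W V' W' f h t : carrier (tensor K V' W')"
 by (rule lin_mem[OF tensor_map_lin[OF assms(1-6) lin_id] assms(7)])

lemma tensor_map_pure:
 assumes "vectorspace K V" "vectorspace K W" "vectorspace K V'" "vectorspace K W'"
 "f : lin_maps K V V'" "h : lin_maps K W W'" "v : carrier V" "w : carrier W"
 shows "tensor_map K V W V' W' f h (pure_tensor K V W v w) = pure_tensor K V' W' (f v) (h w)"
 unfolding tensor_map_def
 by (rule lift_pure[OF assms(1,2) vs_tensor[OF assms(3,4)] bilin_pure_map[OF assms(1-6)] assms(7,8)])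

text \<open>An induced map after a map \<open>f \<otimes> h\<close>.\<close>

lemma lift_tensor_map:
 assumes V: "vectorspace K V" "vectorspace K W" "vectorspace K V'" "vectorspace K W'"
 "f : lin_maps K V V'" "h : lin_maps K W W'" and M: "vectorspace K M" "bilinear_map K V' W' M F"
 and t: "t : carrier (tensor K V W)"
 shows "tensor_lift K V' W' M F (tensor_map K V W V' W' f h t) = tensor_lift K V W M (%v w. F (f v) (h w)) t"
proof -
 have "tensor_lift K V' W' M F (tensor_map K V W V' W' f h t) =
  tensor_lift K V W M (%v w. tensor_lift K V' W' M F (pure_tensor K V' W' (f v) (h w))) t"
 unfolding tensor_map_def
 by (rule lin_lift_comp[OF V(1,2) vs_tensor[OF V(3,4)] bilin_pure_map[OF V] M(1) lift_spec(1)[OF V(3,4) M] t])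
 also have "... = tensor_lift K V W M (%v w. F (f v) (h w)) t"
 by (rule lift_cong) (simp_all add: lift_pure[OF V(3,4) M] lin_mem[OF V(5)] lin_mem[OF V(6)])
 finally show ?thesis .
qed

text \<open>Tensor products see only the vector space structure of their factors.\<close>

lemma tensor_kernel_cong:
 assumes "carrier V' = carrier V" "ring.add V' = ring.add V" "smult V' = smult V"
 "carrier W' = carrier W" "ring.add W' = ring.add W" "smult W' = smult W"
 shows "tensor_kernel K V' W' = tensor_kernel K V W"
 by (simp add: tensor_kernel_def tensor_relators_def assms)

lemma tensor_cong:
 assumes "carrier V' = carrier V" "ring.add V' = ring.add V" "smult V' = smult V"
 "carrier W' = carrier W" "ring.add W' = ring.add W" "smult W' = smult W"
 shows "tensor K V' W' = tensor K V W" "pure_tensor K V' W' = pure_tensor K V W"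
 using tensor_kernel_cong[OF assms, of K]
 by (auto simp: tensor_def pure_tensor_def assms fun_eq_iff)

lemma lin_maps_cong:
 assumes "carrier V' = carrier V" "ring.add V' = ring.add V" "smult V' = smult V"
 "carrier W' = carrier W" "ring.add W' = ring.add W" "smult W' = smult W"
 shows "lin_maps K V' W' = lin_maps K V W"
 by (simp add: LinearCombinations.module_hom_def assms)

lemma tensor_lift_cong_space:
 assumes "carrier V' = carrier V" "ring.add V' = ring.add V" "smult V' = smult V"
 "carrier W' = carrier W" "ring.add W' = ring.add W" "smult W' = smult W"
 "carrier M' = carrier M" "ring.add M' = ring.add M" "smult M' = smult M"
 shows "tensor_lift K V' W' M' = tensor_lift K V W M"
 using tensor_cong[OF assms(1-6), of K]
 by (auto simp: tensor_lift_def assms fun_eq_iff LinearCombinations.module_hom_def)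

section \<open>Algebras and their tensor products\<close>

lemma alg_vs: "k_algebra K A ==> vectorspace K A"
 and alg_ring: "k_algebra K A ==> ring A"
 by (simp_all add: k_algebra_def)

lemma alg_monoid: "k_algebra K A ==> monoid A"
 using alg_ring ring.is_monoid by blast

lemma alg_mult_mem [lin]: "k_algebra K A ==> x : carrier A ==> y : carrier A ==> x \<otimes>\<^sub>A y : carrier A"
 using alg_monoid monoid.m_closed by metis

lemma alg_one_mem [lin]: "k_algebra K A ==> \<one>\<^sub>A : carrier A"
 using alg_monoid monoid.one_closed by metis

lemma alg_pow_closed [lin]: "k_algebra K A ==> x : carrier A ==> x [^]\<^sub>A (n::nat) : carrier A"
 using alg_monoid monoid.nat_pow_closed by metis

lemma alg_assoc: "k_algebra K A ==> x : carrier A ==> y : carrier A ==> z : carrier A ==>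
 x \<otimes>\<^sub>A y \<otimes>\<^sub>A z = x \<otimes>\<^sub>A (y \<otimes>\<^sub>A z)"
 using alg_monoid monoid.m_assoc by metis

lemma alg_one_l: "k_algebra K A ==> x : carrier A ==> \<one>\<^sub>A \<otimes>\<^sub>A x = x"
 and alg_one_r: "k_algebra K A ==> x : carrier A ==> x \<otimes>\<^sub>A \<one>\<^sub>A = x"
 using alg_monoid monoid.l_one monoid.r_one by metis+

lemma alg_smult_l: "k_algebra K A ==> k : carrier K ==> x : carrier A ==> y : carrier A ==>
 (k \<odot>\<^sub>A x) \<otimes>\<^sub>A y = k \<odot>\<^sub>A (x \<otimes>\<^sub>A y)"
 and alg_smult_r: "k_algebra K A ==> k : carrier K ==> x : carrier A ==> y : carrier A ==>
 x \<otimes>\<^sub>A (k \<odot>\<^sub>A y) = k \<odot>\<^sub>A (x \<otimes>\<^sub>A y)"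
 by (simp_all add: k_algebra_def)

lemma bilin_mult: assumes "k_algebra K A" shows "bilinear_map K A A A (monoid.mult A)"
proof -
 interpret A: ring A using assms by (rule alg_ring)
 show ?thesis by (intro bilinI lin_mapsI)
  (auto simp: A.l_distr A.r_distr alg_smult_l[OF assms] alg_smult_r[OF assms])
qed

lemma lin_mult_l [lin]: "k_algebra K A ==> f : lin_maps K U A ==> w : carrier A ==>
 (%x. f x \<otimes>\<^sub>A w) : lin_maps K U A"
 by (rule lin_comp[OF bilin_lin2[OF bilin_mult]])

lemma lin_mult_r [lin]: "k_algebra K A ==> f : lin_maps K U A ==> v : carrier A ==>
 (%x. v \<otimes>\<^sub>A f x) : lin_maps K U A"
 by (rule lin_comp[OF bilin_lin1[OF bilin_mult]])

lemma k_algebraI: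
 assumes V: "vectorspace K A" and cl: "!!x y. x : carrier A ==> y : carrier A ==> x \<otimes>\<^sub>A y : carrier A"
 and bil: "bilinear_map K A A A (monoid.mult A)"
 and one: "\<one>\<^sub>A : carrier A"
 and assoc: "!!x y z. x : carrier A ==> y : carrier A ==> z : carrier A ==>
  x \<otimes>\<^sub>A y \<otimes>\<^sub>A z = x \<otimes>\<^sub>A (y \<otimes>\<^sub>A z)"
 and l: "!!x. x : carrier A ==> \<one>\<^sub>A \<otimes>\<^sub>A x = x" and r: "!!x. x : carrier A ==> x \<otimes>\<^sub>A \<one>\<^sub>A = x"
 shows "k_algebra K A"
proof -
 note b1 = bilin_lin1[OF bil] and b2 = bilin_lin2[OF bil]
 have "monoid A" by (rule monoidI) (auto intro: cl one assoc l r)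
 then have "ring A"
 by (intro ringI vs_abelian_group[OF V]) (auto intro: lin_addD[OF b1] lin_addD[OF b2])
 then show ?thesis unfolding k_algebra_def
 using V lin_smultD[OF b1] lin_smultD[OF b2] by auto
qed

lemma base_algebra: "field K ==> k_algebra K (base_module K)"
proof -
 assume K: "field K" then interpret field K .
 show ?thesis
 by (rule k_algebraI[OF base_vs[OF K]]) (auto intro!: bilinI lin_mapsI simp: l_distr r_distr m_ac)
qed

lemma tensor_algebra_simps [simp]:
 "carrier (tensor_algebra K A B) = carrier (tensor K A B)"
 "ring.zero (tensor_algebra K A B) = ring.zero (tensor K A B)"
 "ring.add (tensor_algebra K A B) = ring.add (tensor K A B)"
 "smult (tensor_algebra K A B) = smult (tensor K A B)"
 "one (tensor_algebra K A B) = pure_tensor K A B \<one>\<^sub>A \<one>\<^sub>B"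
 by (simp_all add: tensor_algebra_def)

lemma lin_tensor_algebra [simp]:
 "lin_maps K (tensor_algebra K A B) M = lin_maps K (tensor K A B) M"
 "lin_maps K M (tensor_algebra K A B) = lin_maps K M (tensor K A B)"
 by (rule lin_maps_cong; simp)+

lemma alg_map_lin: "f : algebra_maps K A B ==> f : lin_maps K A B"
 and alg_map_one: "f : algebra_maps K A B ==> f \<one>\<^sub>A = \<one>\<^sub>B"
 and alg_map_mult: "f : algebra_maps K A B ==> x : carrier A ==> y : carrier A ==> f (x \<otimes>\<^sub>A y) = f x \<otimes>\<^sub>B f y"
 by (auto simp: algebra_maps_def ring_hom_def)

lemma algebra_mapsI:
 assumes "f : lin_maps K A B" "f \<one>\<^sub>A = \<one>\<^sub>B"
 "!!x y. x : carrier A ==> y : carrier A ==> f (x \<otimes>\<^sub>A y) = f x \<otimes>\<^sub>B f y"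
 shows "f : algebra_maps K A B"
 using assms by (auto simp: algebra_maps_def ring_hom_def lin_mem lin_addD)

lemma alg_map_pow: "f : algebra_maps K A B ==> k_algebra K A ==> k_algebra K B ==> x : carrier A ==>
 f (x [^]\<^sub>A (n::nat)) = f x [^]\<^sub>B n"
proof (induction n)
 case 0 then show ?case by (simp add: alg_map_one)
next
 case (Suc n) then show ?case by (simp add: alg_map_mult alg_pow_closed)
qed

lemma alg_map_comp:
 assumes "f : algebra_maps K B C" "g : algebra_maps K A B"
 shows "(%x. f (g x)) : algebra_maps K A C"
 by (rule algebra_mapsI) (auto simp: lin_comp[OF alg_map_lin[OF assms(1)] alg_map_lin[OF assms(2)]]
  alg_map_one[OF assms(1)] alg_map_one[OF assms(2)] alg_map_mult[OF assms(1)] alg_map_mult[OF assms(2)]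
  lin_mem[OF alg_map_lin[OF assms(2)]])

locale two_algebras =
 fixes K :: "('k, 'c) ring_scheme" and A :: "('k, 'a, 'm) module_scheme" and B :: "('k, 'b, 'n) module_scheme"
 assumes A: "k_algebra K A" and B: "k_algebra K B"
begin

abbreviation "T == tensor K A B"
abbreviation "TA == tensor_algebra K A B"
abbreviation "p == pure_tensor K A B"

lemmas vA = alg_vs[OF A] and vB = alg_vs[OF B]
lemmas vT = vs_tensor[OF vA vB]
lemmas facts = A B vA vB vT bilin_closed[OF bilin_mult[OF A]] bilin_closed[OF bilin_mult[OF B]]

lemma bil_in: "a : carrier A ==> b : carrier B ==>
 bilinear_map K A B T (%a' b'. p (a \<otimes>\<^sub>A a') (b \<otimes>\<^sub>B b'))"
 by (assumption | rule lin facts)+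

lemma bil_out: "t : carrier T ==> bilinear_map K A B T
  (%a b. tensor_lift K A B T (%a' b'. p (a \<otimes>\<^sub>A a') (b \<otimes>\<^sub>B b')) t)"
 by (assumption | rule lin facts)+

lemma ta_mult: "s \<otimes>\<^sub>TA t = tensor_lift K A B T (%a b. tensor_lift K A B T (%a' b'. p (a \<otimes>\<^sub>A a') (b \<otimes>\<^sub>B b')) t) s"
 by (simp add: tensor_algebra_def)

lemma ta_mult_pure:
 assumes "a : carrier A" "b : carrier B" "a' : carrier A" "b' : carrier B"
 shows "p a b \<otimes>\<^sub>TA p a' b' = p (a \<otimes>\<^sub>A a') (b \<otimes>\<^sub>B b')"
proof -
 have c: "p a' b' : carrier T" using assms by (intro pure_mem vA vB)
 show ?thesis unfolding ta_mult lift_pure[OF vA vB vT bil_out[OF c] assms(1,2)]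
 lift_pure[OF vA vB vT bil_in[OF assms(1,2)] assms(3,4)] ..
qed

lemma ta_bilin: "bilinear_map K T T T (monoid.mult TA)"
proof (rule bilinI)
 fix s assume s: "s : carrier T"
 show "(%w. s \<otimes>\<^sub>TA w) : lin_maps K T T" unfolding ta_mult
 proof (rule lift_lin_fun[OF vA vB vT bil_out _ vT s], assumption)
 fix a b assume "a : carrier A" "b : carrier B"
 then show "(%x. tensor_lift K A B T (%a' b'. p (a \<otimes>\<^sub>A a') (b \<otimes>\<^sub>B b')) x) : lin_maps K T T"
  by (intro lift_spec(1) vA vB vT bil_in)
 qed
next
 fix t assume t: "t : carrier T"
 show "(%v. v \<otimes>\<^sub>TA t) : lin_maps K T T" unfolding ta_mult
 by (rule lift_spec(1)[OF vA vB vT bil_out[OF t]])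
qed

lemmas ta_addl = lin_addD[OF bilin_lin2[OF ta_bilin]] and ta_addr = lin_addD[OF bilin_lin1[OF ta_bilin]]
 and ta_cl = bilin_closed[OF ta_bilin]

lemma tensor_k_algebra: "k_algebra K TA"
proof (rule k_algebraI)
 show "vectorspace K TA" by (rule vs_cong[OF vT]) simp_all
 show "bilinear_map K TA TA TA (monoid.mult TA)" using ta_bilin by (simp add: bilinear_map_def)
 show "!!x y. x : carrier TA ==> y : carrier TA ==> x \<otimes>\<^sub>TA y : carrier TA" by (simp add: ta_cl)
 show one: "\<one>\<^sub>TA : carrier TA"
 using pure_mem[OF vA vB alg_one_mem[OF A] alg_one_mem[OF B]] by simp
 interpret VT: vectorspace K T by (rule vT)
 fix s assume s0: "s : carrier TA" then have s: "s : carrier T" by simp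
 from vA vB s show "\<one>\<^sub>TA \<otimes>\<^sub>TA s = s"
 proof (induction s rule: tensor_induct)
 case (pure v w) then show ?case
  by (simp add: ta_mult_pure alg_one_mem[OF A] alg_one_mem[OF B] alg_one_l[OF A] alg_one_l[OF B])
 next
 case (add s t) then show ?case using one by (simp add: ta_addr)
 qed
 from vA vB s show "s \<otimes>\<^sub>TA \<one>\<^sub>TA = s"
 proof (induction s rule: tensor_induct)
 case (pure v w) then show ?case
  by (simp add: ta_mult_pure alg_one_mem[OF A] alg_one_mem[OF B] alg_one_r[OF A] alg_one_r[OF B])
 next
 case (add s t) then show ?case using one by (simp add: ta_addl)
 qed
 fix t u assume "t : carrier TA" "u : carrier TA"
 then have t: "t : carrier T" and u: "u : carrier T" by auto
 from vA vB s show "s \<otimes>\<^sub>TA t \<otimes>\<^sub>TA u = s \<otimes>\<^sub>TA (t \<otimes>\<^sub>TA u)"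
 proof (induction s rule: tensor_induct)
 case (add s s') then show ?case using t u by (simp add: ta_addl ta_cl)
 next
 case 1: (pure a b)
 then have pab: "p a b : carrier T" by (intro pure_mem vA vB)
 from vA vB t show ?case
 proof (induction t rule: tensor_induct)
  case (add s s') then show ?case using u pab by (simp add: ta_addl ta_addr ta_cl)
 next
  case 2: (pure a' b')
  then have pab': "p a' b' : carrier T" by (intro pure_mem vA vB)
  from vA vB u show ?case
  proof (induction u rule: tensor_induct)
  case (add s s') then show ?case using pab pab' by (simp add: ta_addr ta_cl)
  next
  case (pure a'' b'') then show ?case using 1 2
   by (simp add: ta_mult_pure alg_mult_mem[OF A] alg_mult_mem[OF B] alg_assoc[OF A] alg_assoc[OF B])
  qed
 qed
 qed
qed

text \<open>A bilinear map that is multiplicative in both arguments at once induces an algebra map.\<close>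

lemma lift_algebra_map:
 assumes C: "k_algebra K C" and F: "bilinear_map K A B C F" and one: "F \<one>\<^sub>A \<one>\<^sub>B = \<one>\<^sub>C"
 and mult: "!!a b a' b'. a : carrier A ==> b : carrier B ==> a' : carrier A ==> b' : carrier B ==>
  F (a \<otimes>\<^sub>A a') (b \<otimes>\<^sub>B b') = F a b \<otimes>\<^sub>C F a' b'"
 shows "tensor_lift K A B C F : algebra_maps K TA C"
proof (rule algebra_mapsI)
 note vC = alg_vs[OF C]
 let ?L = "tensor_lift K A B C F"
 note L = lift_spec(1)[OF vA vB vC F] and Lp = lift_pure[OF vA vB vC F]
 interpret C: ring C by (rule alg_ring[OF C])
 show "?L : lin_maps K TA C" using L by simp
 show "?L \<one>\<^sub>TA = \<one>\<^sub>C" by (simp add: Lp alg_one_mem[OF A] alg_one_mem[OF B] one)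
 fix s t assume "s : carrier TA" "t : carrier TA"
 then have s: "s : carrier T" and t: "t : carrier T" by auto
 from vA vB s show "?L (s \<otimes>\<^sub>TA t) = ?L s \<otimes>\<^sub>C ?L t"
 proof (induction s rule: tensor_induct)
 case (add s s') then show ?case using t by (simp add: ta_addl ta_cl lin_addD[OF L] C.l_distr lin_mem[OF L])
 next
 case 1: (pure a b)
 then have pab: "p a b : carrier T" by (intro pure_mem vA vB)
 from vA vB t show ?case
 proof (induction t rule: tensor_induct)
  case (add s s') then show ?case using pab by (simp add: ta_addr ta_cl lin_addD[OF L] C.r_distr lin_mem[OF L])
 next
  case (pure a' b') then show ?case using 1
  by (simp add: ta_mult_pure Lp alg_mult_mem[OF A] alg_mult_mem[OF B] mult)
 qed
 qed
qed

end

lemma tensor_map_algebra_map: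
 assumes "k_algebra K A" "k_algebra K B" "k_algebra K A'" "k_algebra K B'"
 "f : algebra_maps K A A'" "h : algebra_maps K B B'"
 shows "tensor_map K A B A' B' f h : algebra_maps K (tensor_algebra K A B) (tensor_algebra K A' B')"
proof -
 interpret AB: two_algebras K A B using assms by (simp add: two_algebras_def)
 interpret AB': two_algebras K A' B' using assms by (simp add: two_algebras_def)
 have "bilinear_map K A B (tensor K A' B') (%v w. pure_tensor K A' B' (f v) (h w))"
 by (rule bilin_pure_map) (rule AB.vA AB.vB AB'.vA AB'.vB alg_map_lin assms)+
 then have b: "bilinear_map K A B AB'.TA (%v w. pure_tensor K A' B' (f v) (h w))"
 by (simp add: bilinear_map_def)
 have "tensor_lift K A B AB'.TA (%v w. pure_tensor K A' B' (f v) (h w)) : algebra_maps K AB.TA AB'.TA"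
 by (rule AB.lift_algebra_map[OF AB'.tensor_k_algebra b])
  (simp_all add: alg_map_one[OF assms(5)] alg_map_one[OF assms(6)] alg_map_mult[OF assms(5)]
  alg_map_mult[OF assms(6)] AB'.ta_mult_pure lin_mem[OF alg_map_lin[OF assms(5)]]
  lin_mem[OF alg_map_lin[OF assms(6)]])
 moreover have "tensor_lift K A B AB'.TA = tensor_lift K A B AB'.T"
 by (rule tensor_lift_cong_space) simp_all
 ultimately show ?thesis unfolding tensor_map_def by simp
qed

section \<open>Coalgebras, bialgebras and antipodes\<close>

definition trilinear_map where
 "trilinear_map K A B C M F \<longleftrightarrow>
  (ALL a:carrier A. ALL b:carrier B. F a b : lin_maps K C M) &
  (ALL a:carrier A. ALL c:carrier C. (%b. F a b c) : lin_maps K B M) &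
  (ALL b:carrier B. ALL c:carrier C. (%a. F a b c) : lin_maps K A M)"

lemma trilinI [lin]:
 assumes "!!a b. a : carrier A ==> b : carrier B ==> (%c. F a b c) : lin_maps K C M"
 "!!a c. a : carrier A ==> c : carrier C ==> (%b. F a b c) : lin_maps K B M"
 "!!b c. b : carrier B ==> c : carrier C ==> (%a. F a b c) : lin_maps K A M"
 shows "trilinear_map K A B C M F"
 using assms unfolding trilinear_map_def by auto

lemma coalg_vs: "coalgebra K C ==> vectorspace K C"
 and comult_lin: "coalgebra K C ==> comult C : lin_maps K C (tensor K C C)"
 and counit_lin: "coalgebra K C ==> counit C : lin_maps K C (base_module K)"
 by (simp_all add: coalgebra_def)

lemma comult_comp: "coalgebra K C ==> f : lin_maps K U C ==> (%x. comult C (f x)) : lin_maps K U (tensor K C C)"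
 and counit_comp: "coalgebra K C ==> f : lin_maps K U C ==> (%x. counit C (f x)) : lin_maps K U (base_module K)"
 by (rule lin_comp[OF comult_lin] lin_comp[OF counit_lin]; assumption)+

lemma comult_mem: "coalgebra K C ==> c : carrier C ==> comult C c : carrier (tensor K C C)"
 using lin_mem[OF comult_lin] .

lemma counit_mem: "coalgebra K C ==> c : carrier C ==> counit C c : carrier K"
 using lin_mem[OF counit_lin] by fastforce

lemma coassoc:
 assumes C: "coalgebra K C" and M: "vectorspace K M" and F: "trilinear_map K C C C M F"
 and c: "c : carrier C"
 shows "tensor_lift K C C M (%a b. tensor_lift K C C M (%x y. F x y b) (comult C a)) (comult C c) =
 tensor_lift K C C M (%a b. tensor_lift K C C M (%x y. F a x y) (comult C b)) (comult C c)"
proof -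
 note V = coalg_vs[OF C]
 let ?T = "tensor K C C" let ?T3 = "tensor K C ?T"
 have F1: "a : carrier C ==> b : carrier C ==> F a b : lin_maps K C M"
 and F2: "a : carrier C ==> c : carrier C ==> (%b. F a b c) : lin_maps K C M"
 and F3: "b : carrier C ==> c : carrier C ==> (%a. F a b c) : lin_maps K C M" for a b c
 using F by (auto simp: trilinear_map_def)
 note r = V M comult_mem[OF C] comult_comp[OF C] lin_comp[OF F1] F1 F2 F3
 have B0: "bilinear_map K C C M (F a)" if "a : carrier C" for a
 by (assumption | rule that r lin)+
 have B: "bilinear_map K C ?T M (%a. tensor_lift K C C M (F a))"
 by (assumption | rule r lin B0 lift_spec(1))+
 define L where "L = tensor_lift K C ?T M (%a. tensor_lift K C C M (F a))"
 have L: "L : lin_maps K ?T3 M" unfolding L_def by (assumption | rule lift_spec(1) r lin B)+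
 have Lp: "L (pure_tensor K C ?T a t) = tensor_lift K C C M (F a) t" if "a : carrier C" "t : carrier ?T" for a t
 unfolding L_def by (rule lift_pure[OF V vs_tensor[OF V V] M B that])
 note VT3 = vs_tensor[OF V vs_tensor[OF V V]]
 have ax: "tensor_lift K C C ?T3 (%a b. tensor_lift K C C ?T3 (%x y. pure_tensor K C ?T x (pure_tensor K C C y b)) (comult C a)) (comult C c)
  = tensor_lift K C C ?T3 (%x y. pure_tensor K C ?T x (comult C y)) (comult C c)"
 using C c by (simp add: coalgebra_def sweedler_def sweedler3_def)
 have b1: "bilinear_map K C C ?T3 (%a b. tensor_lift K C C ?T3 (%x y. pure_tensor K C ?T x (pure_tensor K C C y b)) (comult C a))"
 by (assumption | rule r lin)+
 have b1': "bilinear_map K C C ?T3 (%x y. pure_tensor K C ?T x (pure_tensor K C C y b))" if "b : carrier C" for b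
 by (assumption | rule that r lin)+
 have b2: "bilinear_map K C C ?T3 (%x y. pure_tensor K C ?T x (comult C y))"
 by (assumption | rule r lin)+
 have "L (tensor_lift K C C ?T3 (%a b. tensor_lift K C C ?T3 (%x y. pure_tensor K C ?T x (pure_tensor K C C y b)) (comult C a)) (comult C c))
 = tensor_lift K C C M (%a b. tensor_lift K C C M (%x y. F x y b) (comult C a)) (comult C c)"
 unfolding lin_lift_comp[OF V V VT3 b1 M L comult_mem[OF C c]]
 by (intro lift_cong refl)
  (simp add: lin_lift_comp[OF V V VT3 b1' M L] comult_mem[OF C] Lp pure_mem V lift_pure[OF V V M B0] cong: lift_cong)
 moreover have "L (tensor_lift K C C ?T3 (%x y. pure_tensor K C ?T x (comult C y)) (comult C c)) =
  tensor_lift K C C M (%a b. tensor_lift K C C M (%x y. F a x y) (comult C b)) (comult C c)"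
 unfolding lin_lift_comp[OF V V VT3 b2 M L comult_mem[OF C c]]
 by (intro lift_cong refl) (simp add: Lp comult_mem[OF C])
 ultimately show ?thesis using ax by simp
qed

lemma counit_l:
 assumes C: "coalgebra K C" and M: "vectorspace K M" and F: "F : lin_maps K C M" and c: "c : carrier C"
 shows "tensor_lift K C C M (%x y. counit C x \<odot>\<^sub>M F y) (comult C c) = F c"
proof -
 note V = coalg_vs[OF C]
 note r = V M comult_mem[OF C] comult_comp[OF C] counit_comp[OF C] counit_mem[OF C]
 have b: "bilinear_map K C C C (%x y. counit C x \<odot>\<^sub>C y)"
 by (assumption | rule r lin)+
 have "F c = F (tensor_lift K C C C (%x y. counit C x \<odot>\<^sub>C y) (comult C c))"
 using C c by (simp add: coalgebra_def sweedler_def)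
 also have "... = tensor_lift K C C M (%x y. F (counit C x \<odot>\<^sub>C y)) (comult C c)"
 by (rule lin_lift_comp[OF V V V b M F comult_mem[OF C c]])
 also have "... = tensor_lift K C C M (%x y. counit C x \<odot>\<^sub>M F y) (comult C c)"
 by (rule lift_cong) (simp_all add: lin_smultD[OF F] counit_mem[OF C])
 finally show ?thesis ..
qed

lemma counit_r:
 assumes C: "coalgebra K C" and M: "vectorspace K M" and F: "F : lin_maps K C M" and c: "c : carrier C"
 shows "tensor_lift K C C M (%x y. counit C y \<odot>\<^sub>M F x) (comult C c) = F c"
proof -
 note V = coalg_vs[OF C]
 note r = V M comult_mem[OF C] comult_comp[OF C] counit_comp[OF C] counit_mem[OF C]
 have b: "bilinear_map K C C C (%x y. counit C y \<odot>\<^sub>C x)"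
 by (assumption | rule r lin)+
 have "F c = F (tensor_lift K C C C (%x y. counit C y \<odot>\<^sub>C x) (comult C c))"
 using C c by (simp add: coalgebra_def sweedler_def)
 also have "... = tensor_lift K C C M (%x y. F (counit C y \<odot>\<^sub>C x)) (comult C c)"
 by (rule lin_lift_comp[OF V V V b M F comult_mem[OF C c]])
 also have "... = tensor_lift K C C M (%x y. counit C y \<odot>\<^sub>M F x) (comult C c)"
 by (rule lift_cong) (simp_all add: lin_smultD[OF F] counit_mem[OF C])
 finally show ?thesis ..
qed

text \<open>In a convolution algebra a left inverse and a right inverse coincide.\<close>

lemma convolution_inverse_unique:
 assumes C: "coalgebra K C" and A: "k_algebra K A"
 and f: "f : lin_maps K C A" and g: "g : lin_maps K C A" and h: "h : lin_maps K C A"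
 and fg: "!!c. c : carrier C ==> tensor_lift K C C A (%x y. f x \<otimes>\<^sub>A g y) (comult C c) = counit C c \<odot>\<^sub>A \<one>\<^sub>A"
 and gh: "!!c. c : carrier C ==> tensor_lift K C C A (%x y. g x \<otimes>\<^sub>A h y) (comult C c) = counit C c \<odot>\<^sub>A \<one>\<^sub>A"
 and c: "c : carrier C"
 shows "f c = h c"
proof -
 note V = coalg_vs[OF C] and W = alg_vs[OF A]
 note r = V W A comult_mem[OF C] comult_comp[OF C] counit_comp[OF C] counit_mem[OF C]
 lin_comp[OF f] lin_comp[OF g] lin_comp[OF h] lin_mem[OF f] lin_mem[OF g] lin_mem[OF h]
 have tri: "trilinear_map K C C C A (%x y b. f x \<otimes>\<^sub>A (g y \<otimes>\<^sub>A h b))"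
 by (assumption | rule r lin)+
 have bgh: "bilinear_map K C C A (%x y. g x \<otimes>\<^sub>A h y)" and bfg: "bilinear_map K C C A (%x y. f x \<otimes>\<^sub>A g y)"
 by (assumption | rule r lin)+
 have ml: "(%z. a \<otimes>\<^sub>A z) : lin_maps K A A" and mr: "(%z. z \<otimes>\<^sub>A a) : lin_maps K A A" if "a : carrier A" for a
 by (assumption | rule that r lin)+
 have "f c = tensor_lift K C C A (%a b. counit C b \<odot>\<^sub>A f a) (comult C c)"
 by (rule counit_r[OF C W f c, symmetric])
 also have "... = tensor_lift K C C A (%a b. tensor_lift K C C A (%x y. f a \<otimes>\<^sub>A (g x \<otimes>\<^sub>A h y)) (comult C b)) (comult C c)"
 proof (intro lift_cong refl)
 fix a b assume ab: "a : carrier C" "b : carrier C"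
 have "counit C b \<odot>\<^sub>A f a = f a \<otimes>\<^sub>A (counit C b \<odot>\<^sub>A \<one>\<^sub>A)"
  using ab by (simp add: alg_smult_r[OF A] counit_mem[OF C] lin_mem[OF f] alg_one_mem[OF A] alg_one_r[OF A])
 also have "... = f a \<otimes>\<^sub>A tensor_lift K C C A (%x y. g x \<otimes>\<^sub>A h y) (comult C b)" by (simp add: gh ab)
 also have "... = tensor_lift K C C A (%x y. f a \<otimes>\<^sub>A (g x \<otimes>\<^sub>A h y)) (comult C b)"
  by (rule lin_lift_comp[OF V V W bgh W ml comult_mem[OF C]]) (simp_all add: ab lin_mem[OF f])
 finally show "counit C b \<odot>\<^sub>A f a = tensor_lift K C C A (%x y. f a \<otimes>\<^sub>A (g x \<otimes>\<^sub>A h y)) (comult C b)" .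
 qed
 also have "... = tensor_lift K C C A (%a b. tensor_lift K C C A (%x y. f x \<otimes>\<^sub>A (g y \<otimes>\<^sub>A h b)) (comult C a)) (comult C c)"
 by (rule coassoc[OF C W tri c, symmetric])
 also have "... = tensor_lift K C C A (%a b. counit C a \<odot>\<^sub>A h b) (comult C c)"
 proof (intro lift_cong refl)
 fix a b assume ab: "a : carrier C" "b : carrier C"
 have "tensor_lift K C C A (%x y. f x \<otimes>\<^sub>A (g y \<otimes>\<^sub>A h b)) (comult C a) =
  tensor_lift K C C A (%x y. (f x \<otimes>\<^sub>A g y) \<otimes>\<^sub>A h b) (comult C a)"
  by (rule lift_cong) (simp_all add: alg_assoc[OF A] lin_mem[OF f] lin_mem[OF g] lin_mem[OF h] ab)
 also have "... = tensor_lift K C C A (%x y. f x \<otimes>\<^sub>A g y) (comult C a) \<otimes>\<^sub>A h b"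
  by (rule lin_lift_comp[OF V V W bfg W mr comult_mem[OF C], symmetric]) (simp_all add: ab lin_mem[OF h])
 also have "... = counit C a \<odot>\<^sub>A h b" using ab
  by (simp add: fg alg_smult_l[OF A] counit_mem[OF C] lin_mem[OF h] alg_one_mem[OF A] alg_one_l[OF A])
 finally show "tensor_lift K C C A (%x y. f x \<otimes>\<^sub>A (g y \<otimes>\<^sub>A h b)) (comult C a) = counit C a \<odot>\<^sub>A h b" .
 qed
 also have "... = h c" by (rule counit_l[OF C W h c])
 finally show ?thesis .
qed

lemma bialg_alg: "bialgebra K A ==> k_algebra K A"
 and bialg_coalg: "bialgebra K A ==> coalgebra K A"
 and bialg_comult: "bialgebra K A ==> comult A : algebra_maps K A (tensor_algebra K A A)"
 and bialg_counit: "bialgebra K A ==> counit A : algebra_maps K A (base_module K)"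
 by (simp_all add: bialgebra_def)

lemma coalg_map_lin: "f : coalgebra_maps K C D ==> f : lin_maps K C D"
 and coalg_map_comult: "f : coalgebra_maps K C D ==> c : carrier C ==> comult D (f c) = tensor_map K C C D D f f (comult C c)"
 and coalg_map_counit: "f : coalgebra_maps K C D ==> c : carrier C ==> counit D (f c) = counit C c"
 by (simp_all add: coalgebra_maps_def)

lemma lift_coalg_map:
 assumes "f : coalgebra_maps K C D" "vectorspace K C" "vectorspace K D" "vectorspace K M"
 "bilinear_map K D D M F" "c : carrier C" "comult C c : carrier (tensor K C C)"
 shows "tensor_lift K D D M F (comult D (f c)) = tensor_lift K C C M (%x y. F (f x) (f y)) (comult C c)"
 unfolding coalg_map_comult[OF assms(1,6)]
 by (rule lift_tensor_map) (rule assms coalg_map_lin)+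

lemma antipode_lin: "is_antipode K H S ==> S : lin_maps K H H"
 and antipode_l: "is_antipode K H S ==> h : carrier H ==>
  tensor_lift K H H H (%x y. S x \<otimes>\<^sub>H y) (comult H h) = counit H h \<odot>\<^sub>H \<one>\<^sub>H"
 and antipode_r: "is_antipode K H S ==> h : carrier H ==>
  tensor_lift K H H H (%x y. x \<otimes>\<^sub>H S y) (comult H h) = counit H h \<odot>\<^sub>H \<one>\<^sub>H"
 by (simp_all add: is_antipode_def sweedler_def)

lemma hopf_bialg: "hopf_algebra K H ==> bialgebra K H"
 by (simp add: hopf_algebra_def)

lemma antipode_is_antipode: "hopf_algebra K H ==> is_antipode K H (antipode K H)"
 using someI_ex[of "is_antipode K H"] by (simp add: hopf_algebra_def antipode_def)

text \<open>In a situation where only one-sided candidates for the antipode can be written down, two of them, one on each side, are enough.\<close>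

lemma hopf_algebra_one_sided:
 assumes H: "bialgebra K H" and S: "S : lin_maps K H H" and T: "T : lin_maps K H H"
 and l: "!!h. h : carrier H ==> tensor_lift K H H H (%x y. S x \<otimes>\<^sub>H y) (comult H h) = counit H h \<odot>\<^sub>H \<one>\<^sub>H"
 and r: "!!h. h : carrier H ==> tensor_lift K H H H (%x y. x \<otimes>\<^sub>H T y) (comult H h) = counit H h \<odot>\<^sub>H \<one>\<^sub>H"
 shows "hopf_algebra K H"
proof -
 have eq: "S h = T h" if "h : carrier H" for h
 by (rule convolution_inverse_unique[OF bialg_coalg[OF H] bialg_alg[OF H] S lin_id T l r that])
 have "tensor_lift K H H H (%x y. x \<otimes>\<^sub>H S y) (comult H h) = counit H h \<odot>\<^sub>H \<one>\<^sub>H" if "h : carrier H" for h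
 unfolding r[OF that, symmetric] by (rule lift_cong) (simp_all add: eq)
 then show ?thesis using H S l unfolding hopf_algebra_def is_antipode_def sweedler_def by blast
qed

text \<open>Both \<open>f \<circ> S\<close> and \<open>S \<circ> f\<close> are convolution inverses of \<open>f\<close>.\<close>

lemma bialg_map_hopf:
 assumes H: "hopf_algebra K H" and L: "hopf_algebra K L" and f: "f : bialgebra_maps K H L"
 shows "f : hopf_maps K H L"
proof -
 note Hb = hopf_bialg[OF H] and Lb = hopf_bialg[OF L]
 note Hc = bialg_coalg[OF Hb] and La = bialg_alg[OF Lb] and Ha = bialg_alg[OF Hb]
 note SH = antipode_is_antipode[OF H] and SL = antipode_is_antipode[OF L]
 have fa: "f : algebra_maps K H L" and fc: "f : coalgebra_maps K H L" using f by (auto simp: bialgebra_maps_def)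
 note fl = alg_map_lin[OF fa]
 note r = coalg_vs[OF Hc] alg_vs[OF La] La Ha lin_comp[OF antipode_lin[OF SH]] lin_comp[OF antipode_lin[OF SL]] lin_comp[OF fl]
  lin_mem[OF antipode_lin[OF SH]] lin_mem[OF antipode_lin[OF SL]] lin_mem[OF fl] comult_mem[OF Hc] counit_mem[OF Hc]
  counit_mem[OF bialg_coalg[OF Lb]]
 have bs: "bilinear_map K H H H (%x y. antipode K H x \<otimes>\<^sub>H y)" by (assumption | rule r lin)+
 have bl: "bilinear_map K L L L (%x y. x \<otimes>\<^sub>L antipode K L y)" by (assumption | rule r lin)+
 have "f (antipode K H h) = antipode K L (f h)" if h: "h : carrier H" for h
 proof (rule convolution_inverse_unique[OF Hc La _ fl _ _ _ h, where f="%h. f (antipode K H h)" and h="%h. antipode K L (f h)"])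
 show "(%h. f (antipode K H h)) : lin_maps K H L" "(%h. antipode K L (f h)) : lin_maps K H L"
  by (assumption | rule r lin)+
 fix c assume c: "c : carrier H"
 have "tensor_lift K H H L (%x y. f (antipode K H x) \<otimes>\<^sub>L f y) (comult H c) =
  tensor_lift K H H L (%x y. f (antipode K H x \<otimes>\<^sub>H y)) (comult H c)"
  by (rule lift_cong) (simp_all add: alg_map_mult[OF fa] lin_mem[OF antipode_lin[OF SH]])
 also have "... = f (tensor_lift K H H H (%x y. antipode K H x \<otimes>\<^sub>H y) (comult H c))"
  by (rule lin_lift_comp[symmetric]) (assumption | rule r bs fl c)+
 also have "... = counit H c \<odot>\<^sub>L \<one>\<^sub>L" using c
  by (simp add: antipode_l[OF SH] lin_smultD[OF fl] counit_mem[OF Hc] alg_one_mem[OF Ha] alg_map_one[OF fa])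
 finally show "tensor_lift K H H L (%x y. f (antipode K H x) \<otimes>\<^sub>L f y) (comult H c) = counit H c \<odot>\<^sub>L \<one>\<^sub>L" .
 have "tensor_lift K H H L (%x y. f x \<otimes>\<^sub>L antipode K L (f y)) (comult H c) =
  tensor_lift K L L L (%x y. x \<otimes>\<^sub>L antipode K L y) (comult L (f c))"
  by (rule lift_coalg_map[symmetric, OF fc _ _ _ bl c]) (rule r c)+
 also have "... = counit H c \<odot>\<^sub>L \<one>\<^sub>L" using c
  by (simp add: antipode_r[OF SL] lin_mem[OF fl] coalg_map_counit[OF fc])
 finally show "tensor_lift K H H L (%x y. f x \<otimes>\<^sub>L antipode K L (f y)) (comult H c) = counit H c \<odot>\<^sub>L \<one>\<^sub>L" .
 qed
 then show ?thesis using f by (simp add: hopf_maps_def)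
qed

lemma lift_ta_mult:
 assumes A: "k_algebra K A" and B: "k_algebra K B" and M: "vectorspace K M" and F: "bilinear_map K A B M F"
 and s: "s : carrier (tensor K A B)" and t: "t : carrier (tensor K A B)"
 shows "tensor_lift K A B M F (s \<otimes>\<^bsub>tensor_algebra K A B\<^esub> t) =
 tensor_lift K A B M (%a b. tensor_lift K A B M (%a' b'. F (a \<otimes>\<^sub>A a') (b \<otimes>\<^sub>B b')) t) s"
proof -
 interpret AB: two_algebras K A B using A B by (simp add: two_algebras_def)
 have i: "tensor_lift K A B M F (AB.p a b \<otimes>\<^bsub>AB.TA\<^esub> t) = tensor_lift K A B M (%a' b'. F (a \<otimes>\<^sub>A a') (b \<otimes>\<^sub>B b')) t"
 if ab: "a : carrier A" "b : carrier B" for a b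
 proof (rule lift_unique[symmetric, where L="%t. tensor_lift K A B M F (AB.p a b \<otimes>\<^bsub>AB.TA\<^esub> t)", OF AB.vA AB.vB M _ _ _ t])
 show "bilinear_map K A B M (%a' b'. F (a \<otimes>\<^sub>A a') (b \<otimes>\<^sub>B b'))"
  by (assumption | rule AB.facts bilin_comp1[OF F] bilin_comp2[OF F] ab lin)+
 show "(%t. tensor_lift K A B M F (AB.p a b \<otimes>\<^bsub>AB.TA\<^esub> t)) : lin_maps K AB.T M"
  by (assumption | rule AB.facts bilin_lin1[OF AB.ta_bilin] F ab M lin)+
 qed (use ab in \<open>simp_all add: AB.ta_mult_pure lift_pure[OF AB.vA AB.vB M F] alg_mult_mem[OF A] alg_mult_mem[OF B]\<close>)
 have b1: "bilinear_map K A B AB.T (%a b. AB.p a b \<otimes>\<^bsub>AB.TA\<^esub> t)"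
 by (assumption | rule t AB.facts lin_comp[OF bilin_lin2[OF AB.ta_bilin]] lin)+
 have e: "s \<otimes>\<^bsub>AB.TA\<^esub> t = tensor_lift K A B AB.T (%a b. AB.p a b \<otimes>\<^bsub>AB.TA\<^esub> t) s"
 by (rule lift_unique[symmetric, OF AB.vA AB.vB AB.vT b1 bilin_lin2[OF AB.ta_bilin t] refl s])
 show ?thesis unfolding e lin_lift_comp[OF AB.vA AB.vB AB.vT b1 M lift_spec(1)[OF AB.vA AB.vB M F] s]
 by (rule lift_cong) (simp_all add: i)
qed

lemma lift_comult_mult:
 assumes A: "bialgebra K A" and M: "vectorspace K M" and F: "bilinear_map K A A M F"
 and a: "a : carrier A" and b: "b : carrier A"
 shows "tensor_lift K A A M F (comult A (a \<otimes>\<^sub>A b)) =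
 tensor_lift K A A M (%x y. tensor_lift K A A M (%x' y'. F (x \<otimes>\<^sub>A x') (y \<otimes>\<^sub>A y')) (comult A b)) (comult A a)"
 unfolding alg_map_mult[OF bialg_comult[OF A] a b]
 by (rule lift_ta_mult[OF bialg_alg[OF A] bialg_alg[OF A] M F]) (rule comult_mem[OF bialg_coalg[OF A]] a b)+

lemma lift_fcong:
 assumes "!!v w. v : carrier V ==> w : carrier W ==> f v w = g v w"
 shows "tensor_lift K V W M f t = tensor_lift K V W M g t"
 by (rule lift_cong) (simp_all add: assms)

section \<open>Gaussian binomial coefficients\<close>

context field
begin

primrec gauss :: "'a => nat => nat => 'a" where
 "gauss q 0 k = (if k = 0 then \<one> else \<zero>)"
| "gauss q (Suc n) k = (if k = 0 then \<one> else gauss q n k \<oplus> q [^] (n - (k - 1)) \<otimes> gauss q n (k - 1))"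

lemma gauss_closed [simp]: "q : carrier R ==> gauss q n k : carrier R"
 by (induction n arbitrary: k) auto

lemma gauss_0 [simp]: "gauss q n 0 = \<one>"
 by (cases n) auto

lemma gauss_big: "q : carrier R ==> n < k ==> gauss q n k = \<zero>"
 by (induction n arbitrary: k) auto

lemma gauss_self [simp]: "q : carrier R ==> gauss q n n = \<one>"
 by (induction n) (auto simp: gauss_big)

text \<open>The recursion in \<open>k\<close> with denominators cleared, which therefore also holds at roots of unity.\<close>

lemma gauss_ratio:
 assumes q: "q : carrier R"
 shows "k <= n ==> (\<one> \<ominus> q [^] Suc k) \<otimes> gauss q n (Suc k) = (\<one> \<ominus> q [^] (n - k)) \<otimes> gauss q n k"
proof -
 \<comment> \<open>Powers are hidden behind \<open>w\<close>, so that the simplifier does not unfold \<open>q [^] Suc k\<close>.\<close>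
 define w where "w = (%i::nat. q [^] i)"
 have [simp]: "w i : carrier R" for i using q by (simp add: w_def)
 have w0: "w 0 = \<one>" by (simp add: w_def)
 have ww: "w i \<otimes> w j = w (i + j)" for i j using q by (simp add: w_def nat_pow_mult)
 have pas: "gauss q (Suc n) (Suc k) = gauss q n (Suc k) \<oplus> w (n - k) \<otimes> gauss q n k" for n k
 by (simp add: w_def)
 have tele: "(\<one> \<ominus> a) \<oplus> a \<otimes> (\<one> \<ominus> b) = \<one> \<ominus> a \<otimes> b" if "a : carrier R" "b : carrier R" for a b
 using that by (simp add: minus_eq r_distr r_minus a_assoc r_neg1 r_neg2)
 have "k <= n ==> (\<one> \<ominus> w (Suc k)) \<otimes> gauss q n (Suc k) = (\<one> \<ominus> w (n - k)) \<otimes> gauss q n k"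
 proof (induction n arbitrary: k)
 case 0 then show ?case using q by (simp add: gauss_big minus_eq r_neg w0)
 next
 case (Suc n)
 note [simp] = q and [simp del] = gauss.simps
 have ab: "(\<one> \<ominus> w (Suc k)) \<otimes> gauss q (Suc n) (Suc k) = (\<one> \<ominus> w (Suc n)) \<otimes> gauss q n k" if k: "k <= n" for k
 proof -
  have e: "w (n - k) \<otimes> w (Suc k) = w (Suc n)" using k by (simp add: ww)
  have "(\<one> \<ominus> w (Suc k)) \<otimes> gauss q (Suc n) (Suc k) =
   (\<one> \<ominus> w (Suc k)) \<otimes> gauss q n (Suc k) \<oplus> (\<one> \<ominus> w (Suc k)) \<otimes> (w (n - k) \<otimes> gauss q n k)"
  by (simp add: pas r_distr)
  also have "... = (\<one> \<ominus> w (n - k)) \<otimes> gauss q n k \<oplus> (w (n - k) \<otimes> (\<one> \<ominus> w (Suc k))) \<otimes> gauss q n k"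
  using Suc.IH[OF k] by (simp add: m_ac)
  also have "... = ((\<one> \<ominus> w (n - k)) \<oplus> w (n - k) \<otimes> (\<one> \<ominus> w (Suc k))) \<otimes> gauss q n k"
  by (simp add: l_distr)
  also have "... = (\<one> \<ominus> w (Suc n)) \<otimes> gauss q n k" by (simp add: tele e)
  finally show ?thesis .
 qed
 show ?case
 proof (cases "k = Suc n")
  case True then show ?thesis by (simp add: gauss_big minus_eq r_neg w0)
 next
  case False
  then have k: "k <= n" using Suc.prems by simp
  show ?thesis
  proof (cases k)
  case 0 then show ?thesis using ab[OF k] by simp
  next
  case (Suc k')
  then have k': "k' <= n" "Suc n - k = n - k'" using k by auto
  have e: "w (n - k') \<otimes> w (Suc k') = w (Suc n)" using k' by (simp add: ww)
  have "(\<one> \<ominus> w (n - k')) \<otimes> gauss q (Suc n) (Suc k') =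
   (\<one> \<ominus> w (n - k')) \<otimes> gauss q n (Suc k') \<oplus> w (n - k') \<otimes> ((\<one> \<ominus> w (n - k')) \<otimes> gauss q n k')"
   by (simp add: pas r_distr m_ac)
  also have "... = (\<one> \<ominus> w (n - k')) \<otimes> gauss q n (Suc k') \<oplus> (w (n - k') \<otimes> (\<one> \<ominus> w (Suc k'))) \<otimes> gauss q n (Suc k')"
   unfolding Suc.IH[OF k'(1), symmetric] by (simp add: m_ac)
  also have "... = ((\<one> \<ominus> w (n - k')) \<oplus> w (n - k') \<otimes> (\<one> \<ominus> w (Suc k'))) \<otimes> gauss q n (Suc k')"
   by (simp add: l_distr)
  also have "... = (\<one> \<ominus> w (Suc n)) \<otimes> gauss q n (Suc k')" by (simp add: tele e)
  finally show ?thesis using ab[OF k] k' Suc by simp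
  qed
 qed
 qed
 then show "k <= n ==> ?thesis" unfolding w_def .
qed

text \<open>By the ratio formula the coefficients vanish one after another, starting from the factor \<open>1 - q\<^sup>N = 0\<close>.\<close>

lemma gauss_root_of_unity:
 assumes q: "q : carrier R" and N: "q [^] N = \<one>" and prim: "!!k. 0 < k ==> k < N ==> q [^] k ~= \<one>"
 shows "0 < k ==> k < N ==> gauss q N k = \<zero>"
proof (induction k)
 case (Suc k)
 have "(\<one> \<ominus> q [^] Suc k) \<otimes> gauss q N (Suc k) = (\<one> \<ominus> q [^] (N - k)) \<otimes> gauss q N k"
 using Suc.prems by (intro gauss_ratio q) simp
 also have "... = \<zero>"
 proof (cases "k = 0")
 case True then show ?thesis using N q by (simp add: minus_eq r_neg)
 next
 case False then show ?thesis using Suc q by simp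
 qed
 finally have "\<one> \<ominus> q [^] Suc k = \<zero> \<or> gauss q N (Suc k) = \<zero>"
 using q by (simp add: integral_iff del: nat_pow_Suc)
 moreover have "\<one> \<ominus> q [^] Suc k ~= \<zero>" using prim[of "Suc k"] Suc.prems q
 by (metis nat_pow_closed one_closed r_right_minus_eq zero_less_Suc)
 ultimately show ?case by simp
qed simp

end

text \<open>The operator \<open>P\<close> plays the role of multiplication by \<open>X + Y\<close> and \<open>e i j\<close> the role of
  \<open>X\<^sup>i Y\<^sup>j\<close>, where \<open>Y X = q X Y\<close>.\<close>

lemma q_binomial_operator:
 assumes V: "vectorspace K V" and q: "q : carrier K"
 and P: "P : lin_maps K V V" and e: "!!i j. e i j : carrier V"
 and step: "!!i j. P (e i j) = q [^]\<^sub>K j \<odot>\<^sub>V e (Suc i) j \<oplus>\<^sub>V e i (Suc j)"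
 shows "(P ^^ n) (e 0 0) = finsum V (%k. field.gauss K q n k \<odot>\<^sub>V e k (n - k)) {..n}"
proof (induction n)
 interpret V: vectorspace K V by fact
 case 0 show ?case by (simp add: e)
next
 interpret V: vectorspace K V by fact
 case (Suc n)
 let ?g = "V.gauss q"
 have gc: "?g n k \<odot>\<^sub>V e i j : carrier V" for n k i j by (simp add: q e)
 have "(P ^^ Suc n) (e 0 0) = P (finsum V (%k. ?g n k \<odot>\<^sub>V e k (n - k)) {..n})"
 using Suc.IH by simp
 also have "... = finsum V (%k. P (?g n k \<odot>\<^sub>V e k (n - k))) {..n}"
 by (rule lin_finsumD[OF P V V]) (simp_all add: gc)
 also have "... = finsum V (%k. (q [^]\<^sub>K (n - k) \<otimes>\<^sub>K ?g n k) \<odot>\<^sub>V e (Suc k) (n - k) \<oplus>\<^sub>V ?g n k \<odot>\<^sub>V e k (Suc n - k)) {..n}"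
 by (rule V.finsum_cong')
  (auto simp: lin_smultD[OF P] q e step V.smult_r_distr V.smult_assoc1[symmetric] V.m_comm Suc_diff_le)
 also have "... = finsum V (%k. (q [^]\<^sub>K (n - k) \<otimes>\<^sub>K ?g n k) \<odot>\<^sub>V e (Suc k) (n - k)) {..n} \<oplus>\<^sub>V
  finsum V (%k. ?g n k \<odot>\<^sub>V e k (Suc n - k)) {..n}"
 by (rule V.finsum_addf) (auto simp: q e)
 also have "finsum V (%k. ?g n k \<odot>\<^sub>V e k (Suc n - k)) {..n} =
  finsum V (%k. ?g n k \<odot>\<^sub>V e k (Suc n - k)) {..Suc n}"
 proof -
 have "finsum V (%k. ?g n k \<odot>\<^sub>V e k (Suc n - k)) {..Suc n} = ?g n (Suc n) \<odot>\<^sub>V e (Suc n) 0 \<oplus>\<^sub>V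
  finsum V (%k. ?g n k \<odot>\<^sub>V e k (Suc n - k)) {..n}"
  by (simp add: atMost_Suc q e)
 then show ?thesis by (simp add: V.gauss_big q e)
 qed
 also have "... = finsum V (%k. ?g n (Suc k) \<odot>\<^sub>V e (Suc k) (n - k)) {..n} \<oplus>\<^sub>V e 0 (Suc n)"
 by (subst V.finsum_Suc2) (auto simp: q e)
 also have "finsum V (%k. (q [^]\<^sub>K (n - k) \<otimes>\<^sub>K ?g n k) \<odot>\<^sub>V e (Suc k) (n - k)) {..n} \<oplus>\<^sub>V
  (finsum V (%k. ?g n (Suc k) \<odot>\<^sub>V e (Suc k) (n - k)) {..n} \<oplus>\<^sub>V e 0 (Suc n)) =
  (finsum V (%k. (q [^]\<^sub>K (n - k) \<otimes>\<^sub>K ?g n k) \<odot>\<^sub>V e (Suc k) (n - k)) {..n} \<oplus>\<^sub>V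
  finsum V (%k. ?g n (Suc k) \<odot>\<^sub>V e (Suc k) (n - k)) {..n}) \<oplus>\<^sub>V e 0 (Suc n)"
 by (rule V.M.a_assoc[symmetric]) (auto simp: q e)
 also have "finsum V (%k. (q [^]\<^sub>K (n - k) \<otimes>\<^sub>K ?g n k) \<odot>\<^sub>V e (Suc k) (n - k)) {..n} \<oplus>\<^sub>V
  finsum V (%k. ?g n (Suc k) \<odot>\<^sub>V e (Suc k) (n - k)) {..n} =
  finsum V (%k. ?g (Suc n) (Suc k) \<odot>\<^sub>V e (Suc k) (Suc n - Suc k)) {..n}"
 proof (subst V.finsum_addf[symmetric])
 show "finsum V (%k. (q [^]\<^sub>K (n - k) \<otimes>\<^sub>K ?g n k) \<odot>\<^sub>V e (Suc k) (n - k) \<oplus>\<^sub>V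
  ?g n (Suc k) \<odot>\<^sub>V e (Suc k) (n - k)) {..n} =
  finsum V (%k. ?g (Suc n) (Suc k) \<odot>\<^sub>V e (Suc k) (Suc n - Suc k)) {..n}"
  by (rule V.finsum_cong') (auto simp: q e V.smult_l_distr[symmetric] V.R.a_comm)
 qed (auto simp: q e)
 also have "... \<oplus>\<^sub>V e 0 (Suc n) = finsum V (%k. ?g (Suc n) k \<odot>\<^sub>V e k (Suc n - k)) {..Suc n}"
 by (subst V.finsum_Suc2) (auto simp: q e)
 finally show ?case .
qed

text \<open>At a primitive root of unity only the two outer terms of the expansion survive.\<close>

lemma q_binomial_root_of_unity:
 assumes V: "vectorspace K V" and root: "primitive_root K N q"
 and P: "P : lin_maps K V V" and e: "!!i j. e i j : carrier V"
 and step: "!!i j. P (e i j) = q [^]\<^sub>K j \<odot>\<^sub>V e (Suc i) j \<oplus>\<^sub>V e i (Suc j)"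
 shows "(P ^^ N) (e 0 0) = e N 0 \<oplus>\<^sub>V e 0 N"
proof -
 interpret V: vectorspace K V by fact
 have q: "q : carrier K" and N: "0 < N" and v: "!!k. 0 < k ==> k < N ==> V.gauss q N k = \<zero>\<^sub>K"
 using root V.gauss_root_of_unity[of q N] unfolding primitive_root_def by auto
 have "(P ^^ N) (e 0 0) = finsum V (%k. V.gauss q N k \<odot>\<^sub>V e k (N - k)) {..N}"
 by (rule q_binomial_operator[where P=P and e=e and q=q, OF V q P]) (rule e step)+
 also have "... = finsum V (%k. V.gauss q N k \<odot>\<^sub>V e k (N - k)) {0, N}"
 by (rule V.M.add.finprod_mono_neutral_cong_right) (auto simp: v e q)
 also have "... = e 0 N \<oplus>\<^sub>V e N 0" using N by (simp add: e q)
 finally show ?thesis by (simp add: V.M.a_comm e)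
qed

section \<open>Yetter-Drinfeld data\<close>

locale yd_setting =
 fixes K :: "('k, 'c) ring_scheme" and H :: "('k, 'h, 'm) bialg_scheme"
 and g :: 'h and \<chi> :: "'h => 'k" and q lam :: 'k and N :: nat
 assumes field: "field K" and root: "primitive_root K N q" and datum: "compatible_datum K H g \<chi> q N lam"
begin

abbreviation S where "S == antipode K H"
abbreviation KB where "KB == base_module K"
abbreviation HH where "HH == tensor K H H"
abbreviation phiH (\<open>\<phi>\<close>) where "\<phi> == phi K H \<chi>"
abbreviation liftH where "liftH M == tensor_lift K H H M"
abbreviation cp where "cp == conv_pow K H \<chi>"

lemma N_pos: "0 < N" and q_closed: "q : carrier K" and q_N: "q [^]\<^sub>K N = \<one>\<^sub>K"
 using root by (auto simp: primitive_root_def)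

lemma yd: "yd_datum K H g \<chi> q" and lam_closed: "lam : carrier K"
 using datum by (auto simp: compatible_datum_def)

lemma hopf: "hopf_algebra K H" and chi_alg: "\<chi> : algebra_maps K H KB" and chi_g: "\<chi> g = q"
 and g_grouplike: "g : grouplikes K H"
 using yd by (auto simp: yd_datum_def)

lemmas bialg = hopf_bialg[OF hopf]
lemmas hA = bialg_alg[OF bialg] and hC = bialg_coalg[OF bialg] and hS = antipode_is_antipode[OF hopf]
lemmas hV = alg_vs[OF hA] and hHH = vs_tensor[OF alg_vs[OF hA] alg_vs[OF hA]]
lemmas S_lin = antipode_lin[OF hS] and chi_lin = alg_map_lin[OF chi_alg]
lemmas comultH = comult_mem[OF hC] and counitH = counit_mem[OF hC]
lemmas baseV = base_vs[OF field]

sublocale K: field K by (rule field)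
sublocale HV: vectorspace K H by (rule hV)
sublocale HR: ring H by (rule alg_ring[OF hA])

lemma chi_mem: "h : carrier H ==> \<chi> h : carrier K"
 using lin_mem[OF chi_lin] by simp

lemma g_mem: "g : carrier H" and g_comult: "comult H g = pure_tensor K H H g g" and g_counit: "counit H g = \<one>\<^sub>K"
 using g_grouplike by (auto simp: grouplikes_def)

lemma kmult_l: "f : lin_maps K U KB ==> c : carrier K ==> (%x. f x \<otimes>\<^sub>K c) : lin_maps K U KB"
 and kmult_r: "f : lin_maps K U KB ==> c : carrier K ==> (%x. c \<otimes>\<^sub>K f x) : lin_maps K U KB"
 using lin_mult_l[OF base_algebra[OF field]] lin_mult_r[OF base_algebra[OF field]] by auto

lemmas [lin] = hA hV baseV hHH comultH counitH comult_comp[OF hC] counit_comp[OF hC] lin_comp[OF S_lin] lin_mem[OF S_lin]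
 lin_comp[OF chi_lin] chi_mem kmult_l kmult_r K.m_closed g_mem lam_closed q_closed

lemma phi_eq: "\<phi> h = liftH H (%x y. \<chi> x \<odot>\<^sub>H y) (comult H h)"
 by (simp add: phi_def sweedler_def)

lemma counit_mult: "h : carrier H ==> k : carrier H ==> counit H (h \<otimes>\<^sub>H k) = counit H h \<otimes>\<^sub>K counit H k"
 and counit_one: "counit H \<one>\<^sub>H = \<one>\<^sub>K"
 and chi_mult: "h : carrier H ==> k : carrier H ==> \<chi> (h \<otimes>\<^sub>H k) = \<chi> h \<otimes>\<^sub>K \<chi> k"
 and chi_one: "\<chi> \<one>\<^sub>H = \<one>\<^sub>K"
 using alg_map_mult[OF bialg_counit[OF bialg]] alg_map_one[OF bialg_counit[OF bialg]]
 alg_map_mult[OF chi_alg] alg_map_one[OF chi_alg] by auto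

lemma comult_one: "comult H \<one>\<^sub>H = pure_tensor K H H \<one>\<^sub>H \<one>\<^sub>H"
 using alg_map_one[OF bialg_comult[OF bialg]] by simp

lemma phi_bilin: "bilinear_map K H H H (%x y. \<chi> x \<odot>\<^sub>H y)"
 by (assumption | rule lin)+

lemma phi_alg: "\<phi> : algebra_maps K H H"
proof -
 interpret HHa: two_algebras K H H using hA by (simp add: two_algebras_def)
 have "tensor_lift K H H H (%x y. \<chi> x \<odot>\<^sub>H y) : algebra_maps K HHa.TA H"
 by (rule HHa.lift_algebra_map[OF hA phi_bilin])
  (simp_all add: chi_one chi_mult alg_smult_l[OF hA] alg_smult_r[OF hA] chi_mem HV.smult_assoc1[symmetric] K.m_comm)
 from alg_map_comp[OF this bialg_comult[OF bialg]] show ?thesis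
 by (simp add: phi_eq[abs_def])
qed

lemmas phi_lin = alg_map_lin[OF phi_alg]
lemmas phi_mem = lin_mem[OF phi_lin]
lemmas [lin] = phi_mem lin_comp[OF phi_lin]

lemma phi_funpow_alg: "(\<phi> ^^ n) : algebra_maps K H H"
proof (induction n)
 case 0 show ?case by (rule algebra_mapsI) (auto intro: lin_mapsI)
next
 case (Suc n)
 have "(%x. \<phi> ((\<phi> ^^ n) x)) : algebra_maps K H H" by (rule alg_map_comp[OF phi_alg Suc.IH])
 then show ?case by (simp add: comp_def)
qed

lemmas phin_lin = alg_map_lin[OF phi_funpow_alg]
lemmas phin_mem = lin_mem[OF phin_lin]
lemmas [lin] = phin_mem lin_comp[OF phin_lin]

lemma comultH_lift_lin: "vectorspace K M ==> bilinear_map K H H M F ==> (%h. liftH M F (comult H h)) : lin_maps K H M"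
 by (assumption | rule lin)+

text \<open>\<open>\<Delta>(\<phi>(h)) = \<Sum> \<phi>(h\<^sub>1) \<otimes> h\<^sub>2\<close>.\<close>

lemma lift_comult_phi:
 assumes M: "vectorspace K M" and F: "bilinear_map K H H M F" and h: "h : carrier H"
 shows "liftH M F (comult H (\<phi> h)) = liftH M (%x y. F (\<phi> x) y) (comult H h)"
proof -
 note r = M F h bilin_comp1[OF F] bilin_comp2[OF F] bilin_closed[OF F]
 have "liftH M F (comult H (\<phi> h)) = liftH M (%a b. liftH M F (comult H (\<chi> a \<odot>\<^sub>H b))) (comult H h)"
 unfolding phi_eq
 by (rule lin_lift_comp[OF hV hV hV phi_bilin M comultH_lift_lin[OF M F] comultH[OF h]])
 also have "... = liftH M (%a b. liftH M (%x y. \<chi> a \<odot>\<^sub>M F x y) (comult H b)) (comult H h)"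
 proof (rule lift_fcong)
 fix a b assume a: "a : carrier H" and b: "b : carrier H"
 have "liftH M F (comult H (\<chi> a \<odot>\<^sub>H b)) = \<chi> a \<odot>\<^sub>M liftH M F (comult H b)"
  by (rule lin_smultD[OF comultH_lift_lin[OF M F] chi_mem[OF a] b])
 also have "... = liftH M (%x y. \<chi> a \<odot>\<^sub>M F x y) (comult H b)"
  by (rule lin_lift_comp[OF hV hV M F M _ comultH[OF b]]) (assumption | rule a r lin)+
 finally show "liftH M F (comult H (\<chi> a \<odot>\<^sub>H b)) = liftH M (%x y. \<chi> a \<odot>\<^sub>M F x y) (comult H b)" .
 qed
 also have "... = liftH M (%a b. liftH M (%x y. \<chi> x \<odot>\<^sub>M F y b) (comult H a)) (comult H h)"
 by (rule coassoc[OF hC M _ h, symmetric]) (assumption | rule r lin)+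
 also have "... = liftH M (%x y. F (\<phi> x) y) (comult H h)"
 proof (rule lift_fcong)
 fix a b assume a: "a : carrier H" and b: "b : carrier H"
 have "F (\<phi> a) b = liftH M (%x y. F (\<chi> x \<odot>\<^sub>H y) b) (comult H a)"
  unfolding phi_eq by (rule lin_lift_comp[OF hV hV hV phi_bilin M _ comultH[OF a]]) (assumption | rule b bilin_lin2[OF F])+
 also have "... = liftH M (%x y. \<chi> x \<odot>\<^sub>M F y b) (comult H a)"
  by (rule lift_cong) (simp_all add: lin_smultD[OF bilin_lin2[OF F]] b chi_mem)
 finally show "liftH M (%x y. \<chi> x \<odot>\<^sub>M F y b) (comult H a) = F (\<phi> a) b" ..
 qed
 finally show ?thesis .
qed

lemma cp_lin: "cp n : lin_maps K H KB"
proof (induction n)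
 case 0 show ?case using counit_lin[OF hC] by simp
next
 case (Suc n)
 have c: "x : carrier H ==> cp n x : carrier K" for x using lin_mem[OF Suc] by simp
 show ?case unfolding conv_pow.simps sweedler_def
 by (assumption | rule lin lin_comp[OF Suc] c)+
qed

lemma cp_mem: "h : carrier H ==> cp n h : carrier K"
 using lin_mem[OF cp_lin] by simp

lemmas [lin] = cp_mem lin_comp[OF cp_lin]

text \<open>Left winding maps \<open>h \<mapsto> \<Sum> f(h\<^sub>1) h\<^sub>2\<close> compose by convolving their functionals; in particular \<open>\<phi>\<^sup>n\<close> is the winding map of \<open>\<chi>\<^sup>n\<close>.\<close>

lemma wind_comp:
 assumes f1: "f1 : lin_maps K H KB" and f2: "f2 : lin_maps K H KB" and h: "h : carrier H"
 shows "liftH H (%x y. f2 x \<odot>\<^sub>H y) (comult H (liftH H (%x y. f1 x \<odot>\<^sub>H y) (comult H h))) =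
 liftH H (%a b. liftH KB (%x y. f1 x \<otimes>\<^sub>K f2 y) (comult H a) \<odot>\<^sub>H b) (comult H h)"
proof -
 have c: "x : carrier H ==> f1 x : carrier K" "x : carrier H ==> f2 x : carrier K" for x
 using lin_mem[OF f1] lin_mem[OF f2] by auto
 note r = lin_comp[OF f1] lin_comp[OF f2] c
 have b1: "bilinear_map K H H H (%x y. f1 x \<odot>\<^sub>H y)" and b2: "bilinear_map K H H H (%x y. f2 x \<odot>\<^sub>H y)"
 and bk: "bilinear_map K H H KB (%x y. f1 x \<otimes>\<^sub>K f2 y)" by (assumption | rule r lin)+
 note L = comultH_lift_lin[OF hV b2]
 have "liftH H (%x y. f2 x \<odot>\<^sub>H y) (comult H (liftH H (%x y. f1 x \<odot>\<^sub>H y) (comult H h))) =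
  liftH H (%a b. liftH H (%x y. f2 x \<odot>\<^sub>H y) (comult H (f1 a \<odot>\<^sub>H b))) (comult H h)"
 by (rule lin_lift_comp[OF hV hV hV b1 hV L comultH[OF h]])
 also have "... = liftH H (%a b. liftH H (%x y. (f1 a \<otimes>\<^sub>K f2 x) \<odot>\<^sub>H y) (comult H b)) (comult H h)"
 proof (rule lift_fcong)
 fix a b assume a: "a : carrier H" and b: "b : carrier H"
 have "liftH H (%x y. f2 x \<odot>\<^sub>H y) (comult H (f1 a \<odot>\<^sub>H b)) = f1 a \<odot>\<^sub>H liftH H (%x y. f2 x \<odot>\<^sub>H y) (comult H b)"
  by (rule lin_smultD[OF L c(1)[OF a] b])
 also have "... = liftH H (%x y. f1 a \<odot>\<^sub>H (f2 x \<odot>\<^sub>H y)) (comult H b)"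
  by (rule lin_lift_comp[OF hV hV hV b2 hV _ comultH[OF b]]) (assumption | rule a r lin)+
 also have "... = liftH H (%x y. (f1 a \<otimes>\<^sub>K f2 x) \<odot>\<^sub>H y) (comult H b)"
  by (rule lift_fcong) (simp add: HV.smult_assoc1 c a)
 finally show "liftH H (%x y. f2 x \<odot>\<^sub>H y) (comult H (f1 a \<odot>\<^sub>H b)) = ..." .
 qed
 also have "... = liftH H (%a b. liftH H (%x y. (f1 x \<otimes>\<^sub>K f2 y) \<odot>\<^sub>H b) (comult H a)) (comult H h)"
 by (rule coassoc[OF hC hV _ h, symmetric]) (assumption | rule r lin)+
 also have "... = liftH H (%a b. liftH KB (%x y. f1 x \<otimes>\<^sub>K f2 y) (comult H a) \<odot>\<^sub>H b) (comult H h)"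
 proof (rule lift_fcong)
 fix a b assume a: "a : carrier H" and b: "b : carrier H"
 have "(%k. k \<odot>\<^sub>H b) : lin_maps K KB H" by (assumption | rule b lin)+
 from lin_lift_comp[OF hV hV baseV bk hV this comultH[OF a]]
 show "liftH H (%x y. (f1 x \<otimes>\<^sub>K f2 y) \<odot>\<^sub>H b) (comult H a) =
  liftH KB (%x y. f1 x \<otimes>\<^sub>K f2 y) (comult H a) \<odot>\<^sub>H b" ..
 qed
 finally show ?thesis .
qed

lemma phin_eq: "h : carrier H ==> (\<phi> ^^ n) h = liftH H (%x y. cp n x \<odot>\<^sub>H y) (comult H h)"
proof (induction n)
 case 0 then show ?case using counit_l[OF hC hV lin_id 0] by simp
next
 case (Suc n)
 have "(\<phi> ^^ Suc n) h = liftH H (%x y. \<chi> x \<odot>\<^sub>H y) (comult H (liftH H (%x y. cp n x \<odot>\<^sub>H y) (comult H h)))"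
 unfolding Suc.IH[OF Suc.prems, symmetric] phi_eq[symmetric] by simp
 also have "... = liftH H (%x y. cp (Suc n) x \<odot>\<^sub>H y) (comult H h)"
 by (simp add: wind_comp[OF cp_lin chi_lin Suc.prems] sweedler_def)
 finally show ?case .
qed

lemma counit_phin: "h : carrier H ==> counit H ((\<phi> ^^ n) h) = cp n h"
proof -
 assume h: "h : carrier H"
 have b: "bilinear_map K H H H (%x y. cp n x \<odot>\<^sub>H y)" by (assumption | rule lin)+
 have "counit H ((\<phi> ^^ n) h) = liftH KB (%x y. counit H (cp n x \<odot>\<^sub>H y)) (comult H h)"
 unfolding phin_eq[OF h] by (rule lin_lift_comp[OF hV hV hV b baseV counit_lin[OF hC] comultH[OF h]])
 also have "... = liftH KB (%x y. counit H y \<odot>\<^sub>KB cp n x) (comult H h)"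
 by (rule lift_cong) (simp_all add: lin_smultD[OF counit_lin[OF hC]] cp_mem counitH K.m_comm)
 also have "... = cp n h" by (rule counit_r[OF hC baseV cp_lin h])
 finally show ?thesis .
qed

lemma cp_mult: "h : carrier H ==> k : carrier H ==> cp n (h \<otimes>\<^sub>H k) = cp n h \<otimes>\<^sub>K cp n k"
 and cp_one: "cp n \<one>\<^sub>H = \<one>\<^sub>K"
 by (simp_all add: counit_phin[symmetric] alg_map_mult[OF phi_funpow_alg] alg_map_one[OF phi_funpow_alg]
  counit_mult counit_one phin_mem)

lemma cp_1: "h : carrier H ==> cp (Suc 0) h = \<chi> h"
 using counit_l[OF hC baseV chi_lin] by (simp add: sweedler_def)

lemma cp_add: "h : carrier H ==> liftH KB (%x y. cp m x \<otimes>\<^sub>K cp n y) (comult H h) = cp (m + n) h"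
proof -
 assume h: "h : carrier H"
 have b: "bilinear_map K H H H (%x y. cp m x \<odot>\<^sub>H y)" by (assumption | rule lin)+
 have L: "(%h. counit H ((\<phi> ^^ n) h)) : lin_maps K H KB" by (assumption | rule lin)+
 have "cp (m + n) h = counit H ((\<phi> ^^ n) ((\<phi> ^^ m) h))"
 using h by (simp add: counit_phin[symmetric] add.commute[of m] funpow_add)
 also have "... = liftH KB (%x y. counit H ((\<phi> ^^ n) (cp m x \<odot>\<^sub>H y))) (comult H h)"
 unfolding phin_eq[OF h, of m] by (rule lin_lift_comp[OF hV hV hV b baseV L comultH[OF h]])
 also have "... = liftH KB (%x y. cp m x \<otimes>\<^sub>K cp n y) (comult H h)"
 by (rule lift_cong) (simp_all add: counit_phin cp_mem lin_smultD[OF cp_lin])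
 finally show ?thesis ..
qed

end

lemma smult_pow:
 assumes A: "k_algebra K A" and k: "k : carrier K" and x: "x : carrier A"
 shows "(k \<odot>\<^sub>A x) [^]\<^sub>A (n::nat) = k [^]\<^sub>K n \<odot>\<^sub>A x [^]\<^sub>A n"
proof -
 interpret V: vectorspace K A by (rule alg_vs[OF A])
 show ?thesis
 proof (induction n)
 case 0 then show ?case by (simp add: alg_one_mem[OF A])
 next
 case (Suc n)
 have c: "x [^]\<^sub>A n : carrier A" "k [^]\<^sub>K n : carrier K" "k \<odot>\<^sub>A x : carrier A"
  using k x by (simp_all add: alg_pow_closed[OF A])
 have "(k \<odot>\<^sub>A x) [^]\<^sub>A Suc n = (k [^]\<^sub>K n \<odot>\<^sub>A x [^]\<^sub>A n) \<otimes>\<^sub>A (k \<odot>\<^sub>A x)"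
  using Suc.IH by simp
 also have "... = k [^]\<^sub>K n \<odot>\<^sub>A (k \<odot>\<^sub>A (x [^]\<^sub>A n \<otimes>\<^sub>A x))"
  unfolding alg_smult_l[OF A c(2,1,3)] alg_smult_r[OF A k c(1) x] ..
 also have "... = (k [^]\<^sub>K n \<otimes>\<^sub>K k) \<odot>\<^sub>A (x [^]\<^sub>A n \<otimes>\<^sub>A x)"
  by (rule V.smult_assoc1[symmetric, OF c(2) k alg_mult_mem[OF A c(1) x]])
 finally show ?case by simp
 qed
qed

context yd_setting
begin

lemma liftH_out:
 assumes "vectorspace K M" "bilinear_map K H H M F" "vectorspace K M'" "L : lin_maps K M M'" "h : carrier H"
 shows "L (liftH M F (comult H h)) = liftH M' (%x y. L (F x y)) (comult H h)"
 by (rule lin_lift_comp[OF hV hV assms(1-4) comultH[OF assms(5)]])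

text \<open>The inverse is \<open>h \<mapsto> \<Sum> \<chi>(S(h\<^sub>1)) h\<^sub>2\<close>, because \<open>\<chi> \<circ> S\<close> is the convolution inverse of \<open>\<chi>\<close>.\<close>

lemma phi_bij: "bij_betw \<phi> (carrier H) (carrier H)"
proof -
 let ?cS = "%x. \<chi> (S x)"
 define psi where "psi h = liftH H (%x y. \<chi> (S x) \<odot>\<^sub>H y) (comult H h)" for h
 have cl: "?cS : lin_maps K H KB" by (assumption | rule lin)+
 have bl: "bilinear_map K H H H (%x y. S x \<otimes>\<^sub>H y)" and br: "bilinear_map K H H H (%x y. x \<otimes>\<^sub>H S y)"
 by (assumption | rule lin)+
 have l: "liftH KB (%x y. \<chi> (S x) \<otimes>\<^sub>K \<chi> y) (comult H a) = counit H a" if a: "a : carrier H" for a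
 proof -
 have "liftH KB (%x y. \<chi> (S x) \<otimes>\<^sub>K \<chi> y) (comult H a) = liftH KB (%x y. \<chi> (S x \<otimes>\<^sub>H y)) (comult H a)"
  by (rule lift_fcong) (simp add: chi_mult lin_mem[OF S_lin])
 also have "... = \<chi> (counit H a \<odot>\<^sub>H \<one>\<^sub>H)"
  unfolding antipode_l[OF hS a, symmetric] by (rule liftH_out[symmetric, OF hV bl baseV chi_lin a])
 also have "... = counit H a" by (simp add: lin_smultD[OF chi_lin] counitH a chi_one)
 finally show ?thesis .
 qed
 have r: "liftH KB (%x y. \<chi> x \<otimes>\<^sub>K \<chi> (S y)) (comult H a) = counit H a" if a: "a : carrier H" for a
 proof -
 have "liftH KB (%x y. \<chi> x \<otimes>\<^sub>K \<chi> (S y)) (comult H a) = liftH KB (%x y. \<chi> (x \<otimes>\<^sub>H S y)) (comult H a)"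
  by (rule lift_fcong) (simp add: chi_mult lin_mem[OF S_lin])
 also have "... = \<chi> (counit H a \<odot>\<^sub>H \<one>\<^sub>H)"
  unfolding antipode_r[OF hS a, symmetric] by (rule liftH_out[symmetric, OF hV br baseV chi_lin a])
 also have "... = counit H a" by (simp add: lin_smultD[OF chi_lin] counitH a chi_one)
 finally show ?thesis .
 qed
 have 1: "\<phi> (psi h) = h" if h: "h : carrier H" for h
 proof -
 have "\<phi> (psi h) = liftH H (%a b. counit H a \<odot>\<^sub>H b) (comult H h)"
  unfolding phi_eq psi_def wind_comp[OF cl chi_lin h] by (rule lift_fcong) (simp add: l)
 also have "... = h" by (rule counit_l[OF hC hV lin_id h])
 finally show ?thesis .
 qed
 have 2: "psi (\<phi> h) = h" if h: "h : carrier H" for h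
 proof -
 have "psi (\<phi> h) = liftH H (%a b. counit H a \<odot>\<^sub>H b) (comult H h)"
  unfolding phi_eq psi_def wind_comp[OF chi_lin cl h] by (rule lift_fcong) (simp add: r)
 also have "... = h" by (rule counit_l[OF hC hV lin_id h])
 finally show ?thesis .
 qed
 have psic: "h : carrier H ==> psi h : carrier H" for h
 unfolding psi_def by (assumption | rule lin)+
 show ?thesis by (rule bij_betw_byWitness[where f'=psi]) (auto simp: 1 2 psic phi_mem)
qed

lemma lift_comult_phin:
 assumes M: "vectorspace K M" and h: "h : carrier H"
 shows "bilinear_map K H H M F ==>
 liftH M F (comult H ((\<phi> ^^ n) h)) = liftH M (%x y. F ((\<phi> ^^ n) x) y) (comult H h)"
proof (induction n arbitrary: F)
 case (Suc n)
 note F = Suc.prems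
 have b: "bilinear_map K H H M (%x y. F (\<phi> x) y)"
 by (assumption | rule M bilin_comp1[OF F] bilin_comp2[OF F] lin)+
 have "liftH M F (comult H ((\<phi> ^^ Suc n) h)) = liftH M (%x y. F (\<phi> x) y) (comult H ((\<phi> ^^ n) h))"
 using lift_comult_phi[OF M F phin_mem[OF h]] by simp
 then show ?case using Suc.IH[OF b] by simp
qed simp

text \<open>\<open>\<Sum> \<phi>\<^sup>n(h\<^sub>1) S(h\<^sub>2) = \<chi>\<^sup>n(h) 1\<close>, which becomes the action of \<open>h\<close> on \<open>y\<^sup>n\<close>.\<close>

lemma phin_antipode:
 assumes h: "h : carrier H"
 shows "liftH H (%x y. (\<phi> ^^ n) x \<otimes>\<^sub>H S y) (comult H h) = cp n h \<odot>\<^sub>H \<one>\<^sub>H"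
proof -
 have b: "bilinear_map K H H H (%x y. x \<otimes>\<^sub>H S y)" by (assumption | rule lin)+
 show ?thesis
 using lift_comult_phin[OF hV h b, of n] antipode_r[OF hS phin_mem[OF h]] by (simp add: counit_phin h)
qed

text \<open>The right-handed companion \<open>h \<mapsto> \<Sum> h\<^sub>1 \<chi>\<^sup>n(h\<^sub>2)\<close> of \<open>\<phi>\<^sup>n\<close>; the condition on a Yetter-Drinfeld datum relates the two by \<open>g\<close>.\<close>

definition rw :: "nat => 'h => 'h" where
 "rw n h = liftH H (%x y. cp n y \<odot>\<^sub>H x) (comult H h)"

lemma rw_bilin: "bilinear_map K H H H (%x y. cp n y \<odot>\<^sub>H x)"
 by (assumption | rule lin)+

lemma rw_lin: "rw n : lin_maps K H H"
 using comultH_lift_lin[OF hV rw_bilin] by (simp add: rw_def[abs_def])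

lemma rw_closed: "h : carrier H ==> rw n h : carrier H"
 using lin_mem[OF rw_lin] .

lemma rw_0: "h : carrier H ==> rw 0 h = h"
 using counit_r[OF hC hV lin_id] by (simp add: rw_def)

lemma rw_phi: assumes h: "h : carrier H" shows "rw n (\<phi> h) = \<phi> (rw n h)"
proof -
 have "rw n (\<phi> h) = liftH H (%x y. cp n y \<odot>\<^sub>H \<phi> x) (comult H h)"
 unfolding rw_def by (rule lift_comult_phi[OF hV rw_bilin h])
 also have "... = liftH H (%x y. \<phi> (cp n y \<odot>\<^sub>H x)) (comult H h)"
 by (rule lift_fcong) (simp add: lin_smultD[OF phi_lin] cp_mem)
 also have "... = \<phi> (rw n h)" unfolding rw_def by (rule liftH_out[symmetric, OF hV rw_bilin hV phi_lin h])
 finally show ?thesis .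
qed

lemma rw_phin: "h : carrier H ==> rw m ((\<phi> ^^ n) h) = (\<phi> ^^ n) (rw m h)"
 by (induction n) (simp_all add: rw_phi phin_mem)

lemma rw_Suc: assumes h: "h : carrier H" shows "rw n (rw (Suc 0) h) = rw (Suc n) h"
proof -
 have "rw n (rw (Suc 0) h) = liftH H (%a b. rw n (cp (Suc 0) b \<odot>\<^sub>H a)) (comult H h)"
 unfolding rw_def[of "Suc 0"] by (rule liftH_out[OF hV rw_bilin hV rw_lin h])
 also have "... = liftH H (%a b. liftH H (%x y. (cp n y \<otimes>\<^sub>K \<chi> b) \<odot>\<^sub>H x) (comult H a)) (comult H h)"
 proof (rule lift_fcong)
 fix a b assume a: "a : carrier H" and b: "b : carrier H"
 have "rw n (cp (Suc 0) b \<odot>\<^sub>H a) = \<chi> b \<odot>\<^sub>H rw n a"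
  unfolding cp_1[OF b] by (rule lin_smultD[OF rw_lin chi_mem[OF b] a])
 also have "... = liftH H (%x y. \<chi> b \<odot>\<^sub>H (cp n y \<odot>\<^sub>H x)) (comult H a)"
  unfolding rw_def by (rule liftH_out[OF hV rw_bilin hV _ a]) (assumption | rule b lin)+
 also have "... = liftH H (%x y. (cp n y \<otimes>\<^sub>K \<chi> b) \<odot>\<^sub>H x) (comult H a)"
  by (rule lift_fcong) (simp add: HV.smult_assoc1[symmetric] cp_mem b chi_mem K.m_comm)
 finally show "rw n (cp (Suc 0) b \<odot>\<^sub>H a) = ..." .
 qed
 also have "... = liftH H (%a b. liftH H (%x y. (cp n x \<otimes>\<^sub>K \<chi> y) \<odot>\<^sub>H a) (comult H b)) (comult H h)"
 by (rule coassoc[OF hC hV _ h]) (assumption | rule lin)+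
 also have "... = rw (Suc n) h" unfolding rw_def
 proof (rule lift_fcong)
 fix a b assume a: "a : carrier H" and b: "b : carrier H"
 have bk: "bilinear_map K H H KB (%x y. cp n x \<otimes>\<^sub>K \<chi> y)" by (assumption | rule lin)+
 have "(%k. k \<odot>\<^sub>H a) : lin_maps K KB H" by (assumption | rule a lin)+
 from liftH_out[OF baseV bk hV this b]
 show "liftH H (%x y. (cp n x \<otimes>\<^sub>K \<chi> y) \<odot>\<^sub>H a) (comult H b) = cp (Suc n) b \<odot>\<^sub>H a"
  by (simp add: sweedler_def)
 qed
 finally show ?thesis .
qed

lemma g_phi: "h : carrier H ==> g \<otimes>\<^sub>H \<phi> h = rw (Suc 0) h \<otimes>\<^sub>H g"
proof -
 assume h: "h : carrier H"
 have "rw (Suc 0) h = liftH H (%x y. \<chi> y \<odot>\<^sub>H x) (comult H h)"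
 unfolding rw_def by (rule lift_fcong) (simp only: cp_1)
 then show ?thesis using yd h by (simp add: yd_datum_def phi_def sweedler_def)
qed

lemma gpow_mem: "g [^]\<^sub>H (n::nat) : carrier H"
 by (rule alg_pow_closed[OF hA g_mem])

lemmas [lin] = gpow_mem

lemma gpow_phin: "h : carrier H ==> g [^]\<^sub>H n \<otimes>\<^sub>H (\<phi> ^^ n) h = rw n h \<otimes>\<^sub>H g [^]\<^sub>H n"
proof (induction n arbitrary: h)
 case 0 then show ?case by (simp add: rw_0)
next
 case (Suc n)
 note h = Suc.prems
 have "g [^]\<^sub>H Suc n \<otimes>\<^sub>H (\<phi> ^^ Suc n) h = g [^]\<^sub>H n \<otimes>\<^sub>H (g \<otimes>\<^sub>H \<phi> ((\<phi> ^^ n) h))"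
 using h by (simp add: HR.m_assoc gpow_mem g_mem phin_mem phi_mem)
 also have "... = (g [^]\<^sub>H n \<otimes>\<^sub>H (\<phi> ^^ n) (rw (Suc 0) h)) \<otimes>\<^sub>H g"
 using h by (simp add: g_phi phin_mem rw_phin HR.m_assoc gpow_mem g_mem rw_closed)
 also have "... = rw (Suc n) h \<otimes>\<^sub>H g [^]\<^sub>H Suc n"
 using h by (simp add: Suc.IH rw_closed rw_Suc HR.m_assoc gpow_mem g_mem)
 finally show ?case .
qed

text \<open>The compatibility of action and coaction on \<open>y\<^sup>n\<close>, where \<open>h\<close> acts by \<open>\<chi>\<^sup>n(h)\<close> and the
  coaction is \<open>g\<^sup>n \<otimes> -\<close>.\<close>

lemma gpow_adjoint:
 assumes h: "h : carrier H"
 shows "liftH H (%a b. liftH H (%x y. cp n y \<odot>\<^sub>H (x \<otimes>\<^sub>H g [^]\<^sub>H n \<otimes>\<^sub>H S b)) (comult H a)) (comult H h) =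
 cp n h \<odot>\<^sub>H g [^]\<^sub>H n"
proof -
 have Sc: "b : carrier H ==> S b : carrier H" for b by (rule lin_mem[OF S_lin])
 have bS: "bilinear_map K H H H (%x y. (\<phi> ^^ n) x \<otimes>\<^sub>H S y)" by (assumption | rule lin)+
 have "liftH H (%a b. liftH H (%x y. cp n y \<odot>\<^sub>H (x \<otimes>\<^sub>H g [^]\<^sub>H n \<otimes>\<^sub>H S b)) (comult H a)) (comult H h) =
  liftH H (%a b. g [^]\<^sub>H n \<otimes>\<^sub>H ((\<phi> ^^ n) a \<otimes>\<^sub>H S b)) (comult H h)"
 proof (rule lift_fcong)
 fix a b assume a: "a : carrier H" and b: "b : carrier H"
 have "liftH H (%x y. cp n y \<odot>\<^sub>H (x \<otimes>\<^sub>H g [^]\<^sub>H n \<otimes>\<^sub>H S b)) (comult H a) =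
  liftH H (%x y. (cp n y \<odot>\<^sub>H x) \<otimes>\<^sub>H g [^]\<^sub>H n \<otimes>\<^sub>H S b) (comult H a)"
  by (rule lift_fcong) (simp add: alg_smult_l[OF hA] cp_mem gpow_mem Sc b)
 also have "... = rw n a \<otimes>\<^sub>H g [^]\<^sub>H n \<otimes>\<^sub>H S b"
  unfolding rw_def by (rule liftH_out[symmetric, OF hV rw_bilin hV _ a]) (assumption | rule b lin)+
 also have "... = g [^]\<^sub>H n \<otimes>\<^sub>H ((\<phi> ^^ n) a \<otimes>\<^sub>H S b)"
  by (simp add: gpow_phin[symmetric] a b HR.m_assoc gpow_mem Sc phin_mem)
 finally show "liftH H (%x y. cp n y \<odot>\<^sub>H (x \<otimes>\<^sub>H g [^]\<^sub>H n \<otimes>\<^sub>H S b)) (comult H a) = ..." .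
 qed
 also have "... = g [^]\<^sub>H n \<otimes>\<^sub>H liftH H (%x y. (\<phi> ^^ n) x \<otimes>\<^sub>H S y) (comult H h)"
 by (rule liftH_out[symmetric, OF hV bS hV _ h]) (assumption | rule lin)+
 also have "... = cp n h \<odot>\<^sub>H g [^]\<^sub>H n"
 by (simp add: phin_antipode h alg_smult_r[OF hA] cp_mem gpow_mem)
 finally show ?thesis .
qed

lemma gpow_comult: "comult H (g [^]\<^sub>H (n::nat)) = pure_tensor K H H (g [^]\<^sub>H n) (g [^]\<^sub>H n)"
proof -
 interpret HHa: two_algebras K H H using hA by (simp add: two_algebras_def)
 show ?thesis
 proof (induction n)
 case 0 then show ?case by (simp add: comult_one)
 next
 case (Suc n) then show ?case
  by (simp add: alg_map_mult[OF bialg_comult[OF bialg]] gpow_mem g_mem g_comult HHa.ta_mult_pure)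
 qed
qed

lemma gpow_counit: "counit H (g [^]\<^sub>H (n::nat)) = \<one>\<^sub>K"
 by (induction n) (simp_all add: counit_one counit_mult gpow_mem g_mem g_counit)

lemma phi_g: "\<phi> g = q \<odot>\<^sub>H g"
 unfolding phi_eq g_comult lift_pure[OF hV hV hV phi_bilin g_mem g_mem] by (simp add: chi_g)

lemma phi_gpow: "\<phi> (g [^]\<^sub>H (n::nat)) = q [^]\<^sub>K n \<odot>\<^sub>H g [^]\<^sub>H n"
 by (simp add: alg_map_pow[OF phi_alg hA hA g_mem] phi_g smult_pow[OF hA q_closed g_mem])

lemma phi_gN: "\<phi> (g [^]\<^sub>H N) = g [^]\<^sub>H N"
 by (simp add: phi_gpow q_N gpow_mem)

lemma phin_gpow: "(\<phi> ^^ j) (g [^]\<^sub>H n) = q [^]\<^sub>K (j * n) \<odot>\<^sub>H g [^]\<^sub>H n"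
proof (induction j)
 case 0 then show ?case by (simp add: gpow_mem)
next
 case (Suc j)
 have "q [^]\<^sub>K (j * n) \<otimes>\<^sub>K q [^]\<^sub>K n = q [^]\<^sub>K (n + j * n)"
 by (simp add: K.nat_pow_mult q_closed add.commute)
 then show ?case using Suc
 by (simp add: lin_smultD[OF phi_lin] phi_gpow gpow_mem q_closed HV.smult_assoc1[symmetric])
qed

lemma cp_gpow: "cp j (g [^]\<^sub>H n) = q [^]\<^sub>K (j * n)"
 unfolding counit_phin[OF gpow_mem, symmetric] phin_gpow
 by (simp add: lin_smultD[OF counit_lin[OF hC]] gpow_mem q_closed gpow_counit)

lemma antipode_g: "S g \<otimes>\<^sub>H g = \<one>\<^sub>H" "g \<otimes>\<^sub>H S g = \<one>\<^sub>H"
proof -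
 have bl: "bilinear_map K H H H (%x y. S x \<otimes>\<^sub>H y)" and br: "bilinear_map K H H H (%x y. x \<otimes>\<^sub>H S y)"
 by (assumption | rule lin)+
 show "S g \<otimes>\<^sub>H g = \<one>\<^sub>H" using antipode_l[OF hS g_mem]
 by (simp add: g_comult lift_pure[OF hV hV hV bl g_mem g_mem] g_counit)
 show "g \<otimes>\<^sub>H S g = \<one>\<^sub>H" using antipode_r[OF hS g_mem]
 by (simp add: g_comult lift_pure[OF hV hV hV br g_mem g_mem] g_counit)
qed

definition zz :: 'h where "zz = lam \<odot>\<^sub>H (\<one>\<^sub>H \<ominus>\<^sub>H g [^]\<^sub>H N)"

lemma zz_closed: "zz : carrier H"
 by (simp add: zz_def gpow_mem lam_closed)

lemmas [lin] = zz_closed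

lemma phi_zz: "\<phi> zz = zz"
 by (simp add: zz_def lin_smultD[OF phi_lin] lin_minusD[OF phi_lin hV hV] lam_closed gpow_mem
  alg_map_one[OF phi_alg] phi_gN)

lemma counit_zz: "counit H zz = \<zero>\<^sub>K"
proof -
 interpret BV: vectorspace K KB by (rule baseV)
 have "counit H (\<one>\<^sub>H \<ominus>\<^sub>H g [^]\<^sub>H N) = \<one>\<^sub>K \<ominus>\<^sub>KB \<one>\<^sub>K"
 unfolding lin_minusD[OF counit_lin[OF hC] hV baseV HR.one_closed gpow_mem] counit_one gpow_counit ..
 also have "... = \<zero>\<^sub>K" using BV.M.r_neg[of "\<one>\<^sub>K"] by (simp add: a_minus_def)
 finally show ?thesis
 by (simp add: zz_def lin_smultD[OF counit_lin[OF hC]] lam_closed gpow_mem)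
qed

lemma comult_zz: "comult H zz = pure_tensor K H H zz \<one>\<^sub>H \<oplus>\<^sub>HH pure_tensor K H H (g [^]\<^sub>H N) zz"
proof -
 interpret T: vectorspace K HH by (rule hHH)
 let ?p = "pure_tensor K H H" and ?G = "g [^]\<^sub>H N"
 note c = HR.one_closed gpow_mem[of N]
 have pc: "a : carrier H ==> b : carrier H ==> ?p a b : carrier HH" for a b by (rule pure_mem[OF hV hV])
 have l: "?p zz \<one>\<^sub>H = lam \<odot>\<^sub>HH (?p \<one>\<^sub>H \<one>\<^sub>H \<ominus>\<^sub>HH ?p ?G \<one>\<^sub>H)"
 using bilin_lin2[OF bilin_pure[OF hV hV] HR.one_closed] c lam_closed
 by (simp add: zz_def lin_smultD[of "%v. ?p v \<one>\<^sub>H"] lin_minusD[of "%v. ?p v \<one>\<^sub>H", OF _ hV hHH])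
 have r: "?p ?G zz = lam \<odot>\<^sub>HH (?p ?G \<one>\<^sub>H \<ominus>\<^sub>HH ?p ?G ?G)"
 using bilin_lin1[OF bilin_pure[OF hV hV] gpow_mem[of N]] c lam_closed
 by (simp add: zz_def lin_smultD[of "?p ?G"] lin_minusD[of "?p ?G", OF _ hV hHH])
 have m: "(a \<ominus>\<^sub>HH b) \<oplus>\<^sub>HH (b \<ominus>\<^sub>HH d) = a \<ominus>\<^sub>HH d"
 if "a : carrier HH" "b : carrier HH" "d : carrier HH" for a b d
 using that by (simp add: T.M.minus_eq T.M.a_assoc T.M.r_neg1 T.M.r_neg2)
 have "comult H zz = lam \<odot>\<^sub>HH (?p \<one>\<^sub>H \<one>\<^sub>H \<ominus>\<^sub>HH ?p ?G ?G)"
 by (simp add: zz_def lin_smultD[OF comult_lin[OF hC]] lin_minusD[OF comult_lin[OF hC] hV hHH] lam_closed c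
  comult_one gpow_comult)
 also have "... = lam \<odot>\<^sub>HH ((?p \<one>\<^sub>H \<one>\<^sub>H \<ominus>\<^sub>HH ?p ?G \<one>\<^sub>H) \<oplus>\<^sub>HH (?p ?G \<one>\<^sub>H \<ominus>\<^sub>HH ?p ?G ?G))"
 by (simp add: m pc c)
 also have "... = ?p zz \<one>\<^sub>H \<oplus>\<^sub>HH ?p ?G zz"
 unfolding l r by (simp add: T.smult_r_distr pc c lam_closed)
 finally show ?thesis .
qed

text \<open>This is what the compatibility condition on \<open>\<lambda>(N)\<close> is for: \<open>h\<close> can be moved past \<open>\<lambda>(N)(1 - g\<^sup>N)\<close>
  in the same way as past \<open>y\<^sup>N\<close>.\<close>

lemma h_zz:
 assumes h: "h : carrier H"
 shows "h \<otimes>\<^sub>H zz = zz \<otimes>\<^sub>H (\<phi> ^^ N) h"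
proof (cases "lam = \<zero>\<^sub>K")
 case True
 have "zz = \<zero>\<^sub>H" by (subst zz_def) (simp add: True gpow_mem)
 then show ?thesis by (simp add: h phin_mem)
next
 case False
 define w where "w = \<one>\<^sub>H \<ominus>\<^sub>H g [^]\<^sub>H N"
 have wc: "w : carrier H" by (simp add: w_def gpow_mem)
 have cond: "cp N a \<odot>\<^sub>H w = liftH H (%x y. x \<otimes>\<^sub>H w \<otimes>\<^sub>H S y) (comult H a)" if "a : carrier H" for a
 using datum False that by (auto simp: compatible_datum_def sweedler_def w_def)
 have Sc: "b : carrier H ==> S b : carrier H" for b by (rule lin_mem[OF S_lin])
 have bS: "bilinear_map K H H H (%x y. S x \<otimes>\<^sub>H y)" by (assumption | rule lin)+
 have bw: "bilinear_map K H H H (%x y. x \<otimes>\<^sub>H w \<otimes>\<^sub>H S y)" by (assumption | rule wc lin)+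
 have bc: "bilinear_map K H H H (%x y. cp N x \<odot>\<^sub>H y)" by (assumption | rule lin)+
 have mw: "(%a. a \<otimes>\<^sub>H w) : lin_maps K H H" by (assumption | rule wc lin)+
 have "h \<otimes>\<^sub>H w = liftH H (%a b. counit H b \<odot>\<^sub>H (a \<otimes>\<^sub>H w)) (comult H h)"
 by (rule counit_r[OF hC hV mw h, symmetric])
 also have "... = liftH H (%a b. liftH H (%x y. a \<otimes>\<^sub>H w \<otimes>\<^sub>H S x \<otimes>\<^sub>H y) (comult H b)) (comult H h)"
 proof (rule lift_fcong)
 fix a b assume a: "a : carrier H" and b: "b : carrier H"
 have "counit H b \<odot>\<^sub>H (a \<otimes>\<^sub>H w) = (a \<otimes>\<^sub>H w) \<otimes>\<^sub>H (counit H b \<odot>\<^sub>H \<one>\<^sub>H)"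
  using a b wc by (simp add: alg_smult_r[OF hA] counitH)
 also have "... = liftH H (%x y. (a \<otimes>\<^sub>H w) \<otimes>\<^sub>H (S x \<otimes>\<^sub>H y)) (comult H b)"
  unfolding antipode_l[OF hS b, symmetric]
  by (rule liftH_out[OF hV bS hV _ b]) (assumption | rule a wc lin)+
 also have "... = liftH H (%x y. a \<otimes>\<^sub>H w \<otimes>\<^sub>H S x \<otimes>\<^sub>H y) (comult H b)"
  by (rule lift_fcong) (simp add: HR.m_assoc a wc Sc)
 finally show "counit H b \<odot>\<^sub>H (a \<otimes>\<^sub>H w) = ..." .
 qed
 also have "... = liftH H (%a b. liftH H (%x y. x \<otimes>\<^sub>H w \<otimes>\<^sub>H S y \<otimes>\<^sub>H b) (comult H a)) (comult H h)"
 by (rule coassoc[OF hC hV _ h, symmetric]) (assumption | rule wc lin)+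
 also have "... = liftH H (%a b. w \<otimes>\<^sub>H (cp N a \<odot>\<^sub>H b)) (comult H h)"
 proof (rule lift_fcong)
 fix a b assume a: "a : carrier H" and b: "b : carrier H"
 have "liftH H (%x y. x \<otimes>\<^sub>H w \<otimes>\<^sub>H S y \<otimes>\<^sub>H b) (comult H a) = (cp N a \<odot>\<^sub>H w) \<otimes>\<^sub>H b"
  unfolding cond[OF a] by (rule liftH_out[symmetric, OF hV bw hV _ a]) (assumption | rule b lin)+
 then show "liftH H (%x y. x \<otimes>\<^sub>H w \<otimes>\<^sub>H S y \<otimes>\<^sub>H b) (comult H a) = w \<otimes>\<^sub>H (cp N a \<odot>\<^sub>H b)"
  by (simp add: alg_smult_l[OF hA] alg_smult_r[OF hA] cp_mem a b wc)
 qed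
 also have "... = w \<otimes>\<^sub>H (\<phi> ^^ N) h"
 unfolding phin_eq[OF h] by (rule liftH_out[symmetric, OF hV bc hV _ h]) (assumption | rule wc lin)+
 finally have e: "h \<otimes>\<^sub>H w = w \<otimes>\<^sub>H (\<phi> ^^ N) h" .
 show ?thesis unfolding zz_def w_def[symmetric]
 by (simp add: alg_smult_l[OF hA] alg_smult_r[OF hA] lam_closed h wc phin_mem e)
qed

end

section \<open>The cyclic extension of an algebra by a skew variable\<close>

text \<open>For an algebra \<open>H\<close> with an endomorphism \<open>\<phi>\<close> and an element \<open>z\<close> that is fixed by \<open>\<phi>\<close> and
  satisfies \<open>h z = z \<phi>\<^sup>N(h)\<close>, this is the quotient of the skew polynomial algebra \<open>H[y; \<phi>]\<close>, in
  which \<open>h y = y \<phi>(h)\<close>, by \<open>y\<^sup>N = z\<close>. The function \<open>f\<close> stands for \<open>\<Sum>\<^bsub>i < N\<^esub> y\<^sup>i f(i)\<close>, and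
  \<open>ext_mono\<close> is \<open>y\<^sup>n h\<close> for an arbitrary exponent \<open>n\<close>, already reduced. The comultiplication \<open>d\<close>
  and the counit \<open>e\<close> are parameters, because they are constructed from the algebra.\<close>

text \<open>The element \<open>y\<^sup>n h\<close> for arbitrary \<open>n\<close>, with \<open>y\<^sup>N = z\<close> used to reduce the exponent: \<open>y\<^sup>n = y\<^bsup>n mod N\<^esup> z\<^bsup>n div N\<^esup>\<close>.\<close>

definition ext_mono :: "('k, 'h, 'm) module_scheme => 'h => nat => nat => 'h => nat => 'h" where
 "ext_mono H z N n h = (%i. if i = n mod N then z [^]\<^sub>H (n div N) \<otimes>\<^sub>H h else \<zero>\<^sub>H)"

definition cyclic_extension ::
 "('k, 'h, 'm) module_scheme => ('h => 'h) => 'h => nat => ((nat => 'h) => (nat => 'h, nat => 'h) tensor) \<Rightarrow>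
  ((nat => 'h) => 'k) => ('k, nat => 'h) bialg" where
 "cyclic_extension H \<phi> z N d e =
  \<lparr>carrier = {f. (ALL i<N. f i : carrier H) & (ALL i>=N. f i = \<zero>\<^sub>H)},
  monoid.mult = (%f f' r. finsum H (%i. finsum H (%j.
   ext_mono H z N (i + j) ((\<phi> ^^ j) (f i) \<otimes>\<^sub>H f' j) r) {..<N}) {..<N}),
  one = ext_mono H z N 0 \<one>\<^sub>H, ring.zero = (%i. \<zero>\<^sub>H), ring.add = (%f f' i. f i \<oplus>\<^sub>H f' i),
  smult = (%k f i. k \<odot>\<^sub>H f i), comult = d, counit = e\<rparr>"

locale cyclic_ext =
 fixes K :: "('k, 'c) ring_scheme" and H :: "('k, 'h, 'm) module_scheme" and \<phi> :: "'h => 'h" and z :: 'h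
 and N :: nat and d :: "(nat => 'h) => (nat => 'h, nat => 'h) tensor" and e :: "(nat => 'h) => 'k"
 assumes H: "k_algebra K H" and phi: "\<phi> : algebra_maps K H H" and z: "z : carrier H" and N: "0 < N"
 and phi_z: "\<phi> z = z" and h_z: "!!h. h : carrier H ==> h \<otimes>\<^sub>H z = z \<otimes>\<^sub>H (\<phi> ^^ N) h"
begin

definition A where "A = cyclic_extension H \<phi> z N d e"
abbreviation mono where "mono == ext_mono H z N"

sublocale V: vectorspace K H by (rule alg_vs[OF H])
sublocale R: ring H by (rule alg_ring[OF H])

lemma A_simps:
 "carrier A = {f. (ALL i<N. f i : carrier H) & (ALL i>=N. f i = \<zero>\<^sub>H)}"
 "f \<otimes>\<^sub>A f' = (%r. finsum H (%i. finsum H (%j.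
   mono (i + j) ((\<phi> ^^ j) (f i) \<otimes>\<^sub>H f' j) r) {..<N}) {..<N})"
 "\<one>\<^sub>A = mono 0 \<one>\<^sub>H" "\<zero>\<^sub>A = (%i. \<zero>\<^sub>H)" "f \<oplus>\<^sub>A f' = (%i. f i \<oplus>\<^sub>H f' i)"
 "k \<odot>\<^sub>A f = (%i. k \<odot>\<^sub>H f i)"
 "comult A = d" "counit A = e"
 by (simp_all add: A_def cyclic_extension_def)

lemma phin_alg: "(\<phi> ^^ n) : algebra_maps K H H"
proof (induction n)
 case 0 show ?case by (rule algebra_mapsI) (auto intro: lin_mapsI)
next
 case (Suc n)
 show ?case using alg_map_comp[OF phi Suc.IH] by (simp add: comp_def)
qed

lemmas phin_lin = alg_map_lin[OF phin_alg]
lemmas phin_mem [simp] = lin_mem[OF phin_lin]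

lemma zpow_closed [simp]: "z [^]\<^sub>H (n::nat) : carrier H" by (rule alg_pow_closed[OF H z])

lemma comp_closed: "f : carrier A ==> f i : carrier H"
 by (cases "i < N") (auto simp: A_simps)

lemma A_memI: "(!!i. i < N ==> f i : carrier H) ==> (!!i. i >= N ==> f i = \<zero>\<^sub>H) ==> f : carrier A"
 by (simp add: A_simps)

lemma A_carrier: "carrier A = {f. (ALL i. f i : carrier H) & (ALL i>=N. f i = \<zero>\<^sub>H)}"
 using comp_closed by (auto simp: A_simps(1))

lemma A_vs: "vectorspace K A"
proof -
 have ag: "abelian_group A"
 proof (rule abelian_groupI)
 fix x assume "x : carrier A"
 then show "EX y:carrier A. y \<oplus>\<^sub>A x = \<zero>\<^sub>A"
  by (intro bexI[of _ "%i. \<ominus>\<^sub>H x i"]) (auto simp: A_carrier A_simps(4,5) fun_eq_iff V.M.l_neg)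
 qed (auto simp: A_carrier A_simps(4,5) fun_eq_iff V.M.a_ac)
 have "module K A"
 by (rule moduleI[OF V.R.is_cring ag])
  (auto simp: A_carrier A_simps(5,6) fun_eq_iff V.smult_l_distr V.smult_r_distr V.smult_assoc1)
 then show ?thesis using V.vectorspace_axioms by (simp add: vectorspace_def)
qed

lemma comp_lin: "(%f. f i) : lin_maps K A H"
 by (rule lin_mapsI) (auto simp: A_simps(5,6) comp_closed)

lemma lin_into_A:
 assumes "!!x. x : carrier U ==> F x : carrier A" "!!r. (%x. F x r) : lin_maps K U H"
 shows "F : lin_maps K U A"
 by (rule lin_mapsI) (auto simp: assms(1) A_simps(5,6) fun_eq_iff lin_addD[OF assms(2)] lin_smultD[OF assms(2)])

lemma mono_mem: "h : carrier H ==> mono n h : carrier A"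
 using mod_less_divisor[OF N, of n] by (intro A_memI) (auto simp: ext_mono_def)

lemma mono_comp_lin: "F : lin_maps K U H ==> (%x. mono n (F x) r) : lin_maps K U H"
 unfolding ext_mono_def by (cases "r = n mod N") (simp_all add: lin_mult_r[OF H] lin_zero[OF alg_vs[OF H]])

lemma mono_lin: "mono n : lin_maps K H A"
 using mono_comp_lin[OF lin_id] by (intro lin_into_A) (auto simp: mono_mem)

lemma mono_red: "h : carrier H ==> mono n (z [^]\<^sub>H a \<otimes>\<^sub>H h) = mono (n + a * N) h"
 using N by (auto simp: ext_mono_def fun_eq_iff R.m_assoc[symmetric] R.nat_pow_mult z add.commute[of a])

lemma mono_split: "h : carrier H ==> mono n h = mono (n mod N) (z [^]\<^sub>H (n div N) \<otimes>\<^sub>H h)"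
 using mono_red[of h "n mod N" "n div N"] by simp

lemma mono_small: "n < N ==> h : carrier H ==> mono n h = (%i. if i = n then h else \<zero>\<^sub>H)"
 by (auto simp: ext_mono_def fun_eq_iff)

lemma A_decomp: "f : carrier A ==> f = finsum A (%i. mono i (f i)) {..<N}"
proof
 interpret AV: vectorspace K A by (rule A_vs)
 fix r assume f: "f : carrier A"
 have "finsum A (%i. mono i (f i)) {..<N} r = finsum H (%i. mono i (f i) r) {..<N}"
 by (rule lin_finsumD[OF comp_lin A_vs V.vectorspace_axioms]) (auto simp: mono_mem comp_closed f)
 also have "... = finsum H (%i. if r = i then f i else \<zero>\<^sub>H) {..<N}"
 by (rule V.finsum_cong') (auto simp: mono_small comp_closed f)
 also have "... = f r"
 proof (cases "r < N")
 case True then show ?thesis using V.M.add.finprod_singleton[of r "{..<N}" f] f by (simp add: comp_closed)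
 next
 case False
 then have "finsum H (%i. if r = i then f i else \<zero>\<^sub>H) {..<N} = finsum H (%i. \<zero>\<^sub>H) {..<N}"
  by (intro V.finsum_cong') auto
 then show ?thesis using False f by (simp add: A_simps)
 qed
 finally show "f r = finsum A (%i. mono i (f i)) {..<N} r" ..
qed

text \<open>Linear maps on the extension are determined by, and can be prescribed on, the \<open>y\<^sup>n h\<close> with \<open>n < N\<close>.\<close>

lemma A_lin_eq:
 assumes M: "vectorspace K M" and F: "F : lin_maps K A M" and G: "G : lin_maps K A M"
 and eq: "!!n h. n < N ==> h : carrier H ==> F (mono n h) = G (mono n h)" and f: "f : carrier A"
 shows "F f = G f"
proof -
 interpret M: vectorspace K M by (rule M)
 have "F f = finsum M (%i. F (mono i (f i))) {..<N}"
 by (subst A_decomp[OF f], rule lin_finsumD[OF F A_vs M]) (auto simp: mono_mem comp_closed f)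
 also have "... = finsum M (%i. G (mono i (f i))) {..<N}"
 by (rule M.finsum_cong') (auto simp: eq comp_closed f intro!: lin_mem[OF G] mono_mem)
 also have "... = G f"
 by (subst (2) A_decomp[OF f], rule lin_finsumD[OF G A_vs M, symmetric]) (auto simp: mono_mem comp_closed f)
 finally show ?thesis .
qed

definition dlift where "dlift M L f = finsum M (%i. L i (f i)) {..<N}"

lemma dlift_lin: "vectorspace K M ==> (!!i. L i : lin_maps K H M) ==> dlift M L : lin_maps K A M"
 unfolding dlift_def[abs_def] by (rule lin_finsum) (simp_all add: lin_comp[OF _ comp_lin])

lemma dlift_mono:
 assumes M: "vectorspace K M" and L: "!!i. L i : lin_maps K H M" and n: "n < N" and h: "h : carrier H"
 shows "dlift M L (mono n h) = L n h"
proof -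
 interpret M: vectorspace K M by (rule M)
 have "dlift M L (mono n h) = finsum M (%i. if n = i then L i h else \<zero>\<^sub>M) {..<N}"
 unfolding dlift_def using h n
 by (intro M.finsum_cong') (auto simp: mono_small lin_mem[OF L] lin_zeroD[OF L V.vectorspace_axioms M])
 also have "... = L n h" using M.M.add.finprod_singleton[of n "{..<N}" "%i. L i h"] n h
 by (simp add: lin_mem[OF L])
 finally show ?thesis .
qed

lemma mult_comp_lin:
 "f' : carrier A ==> (%f. (f \<otimes>\<^sub>A f') r) : lin_maps K A H"
 "f : carrier A ==> (%f'. (f \<otimes>\<^sub>A f') r) : lin_maps K A H"
 unfolding A_simps(2)
 by (intro lin_finsum V.vectorspace_axioms finite_lessThan mono_comp_lin lin_mult_l[OF H] lin_mult_r[OF H]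
  lin_comp[OF phin_lin] comp_lin phin_mem comp_closed; assumption)+

lemma mult_closed: "f : carrier A ==> f' : carrier A ==> f \<otimes>\<^sub>A f' : carrier A"
proof (rule A_memI)
 assume f: "f : carrier A" "f' : carrier A"
 show "(f \<otimes>\<^sub>A f') i : carrier H" for i using lin_mem[OF mult_comp_lin(1)] f by blast
 fix i assume "N <= i"
 moreover have "mono n h i = \<zero>\<^sub>H" if "N <= i" for n h
 proof -
 have "i ~= n mod N" using that mod_less_divisor[OF N, of n] by linarith
 then show ?thesis by (simp add: ext_mono_def)
 qed
 ultimately show "(f \<otimes>\<^sub>A f') i = \<zero>\<^sub>H" by (simp add: A_simps(2))
qed

lemma mult_bilin: "bilinear_map K A A A (monoid.mult A)"
 by (rule bilinI; rule lin_into_A; (rule mult_closed mult_comp_lin; assumption))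

lemma mult_mono_small:
 assumes m: "m < N" and n: "n < N" and h: "h : carrier H" and k: "k : carrier H"
 shows "mono m h \<otimes>\<^sub>A mono n k = mono (m + n) ((\<phi> ^^ n) h \<otimes>\<^sub>H k)"
proof
 fix r
 have zero: "(\<phi> ^^ j) \<zero>\<^sub>H = \<zero>\<^sub>H" "mono i \<zero>\<^sub>H r = \<zero>\<^sub>H" for i j
 by (simp_all add: lin_zeroD[OF phin_lin V.vectorspace_axioms V.vectorspace_axioms] ext_mono_def)
 have mc: "x : carrier H ==> mono i x r : carrier H" for i x using mono_mem comp_closed by blast
 have "(mono m h \<otimes>\<^sub>A mono n k) r =
 finsum H (%i. if m = i then finsum H (%j. if n = j then mono (i + j) ((\<phi> ^^ j) h \<otimes>\<^sub>H k) r else \<zero>\<^sub>H) {..<N} else \<zero>\<^sub>H) {..<N}"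
 unfolding A_simps(2) mono_small[OF m h] mono_small[OF n k]
 proof (rule V.finsum_cong'[OF refl])
 fix i
 show "finsum H (%j. mono (i + j) ((\<phi> ^^ j) (if i = m then h else \<zero>\<^sub>H) \<otimes>\<^sub>H (if j = n then k else \<zero>\<^sub>H)) r) {..<N} =
  (if m = i then finsum H (%j. if n = j then mono (i + j) ((\<phi> ^^ j) h \<otimes>\<^sub>H k) r else \<zero>\<^sub>H) {..<N} else \<zero>\<^sub>H)"
 proof (cases "m = i")
  case True
  have "finsum H (%j. mono (i + j) ((\<phi> ^^ j) h \<otimes>\<^sub>H (if j = n then k else \<zero>\<^sub>H)) r) {..<N} =
  finsum H (%j. if n = j then mono (i + j) ((\<phi> ^^ j) h \<otimes>\<^sub>H k) r else \<zero>\<^sub>H) {..<N}"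
  by (rule V.finsum_cong'[OF refl]) (auto simp: zero mc h k)
  then show ?thesis using True by simp
 next
  case False
  then have "finsum H (%j. mono (i + j) ((\<phi> ^^ j) (if i = m then h else \<zero>\<^sub>H) \<otimes>\<^sub>H (if j = n then k else \<zero>\<^sub>H)) r) {..<N} =
  finsum H (%j. \<zero>\<^sub>H) {..<N}"
  by (intro V.finsum_cong'[OF refl]) (simp_all add: zero k)
  then show ?thesis using False by simp
 qed
 qed (simp add: Pi_def mc h k)
 also have "... = mono (m + n) ((\<phi> ^^ n) h \<otimes>\<^sub>H k) r"
 using V.M.add.finprod_singleton[of m "{..<N}" "%i. finsum H (%j. if n = j then mono (i + j) ((\<phi> ^^ j) h \<otimes>\<^sub>H k) r else \<zero>\<^sub>H) {..<N}"]
  V.M.add.finprod_singleton[of n "{..<N}" "%j. mono (m + j) ((\<phi> ^^ j) h \<otimes>\<^sub>H k) r"] m n h k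
 by (simp add: mc)
 finally show "(mono m h \<otimes>\<^sub>A mono n k) r = mono (m + n) ((\<phi> ^^ n) h \<otimes>\<^sub>H k) r" .
qed

lemma phin_zpow: "(\<phi> ^^ j) (z [^]\<^sub>H (a::nat)) = z [^]\<^sub>H a"
proof -
 have "(\<phi> ^^ j) z = z" by (induction j) (simp_all add: phi_z)
 then show ?thesis by (simp add: alg_map_pow[OF phin_alg H H z])
qed

lemma h_zpow: "h : carrier H ==> h \<otimes>\<^sub>H z [^]\<^sub>H (b::nat) = z [^]\<^sub>H b \<otimes>\<^sub>H (\<phi> ^^ (b * N)) h"
proof (induction b arbitrary: h)
 case (Suc b)
 have "h \<otimes>\<^sub>H z [^]\<^sub>H Suc b = z [^]\<^sub>H b \<otimes>\<^sub>H ((\<phi> ^^ (b * N)) h \<otimes>\<^sub>H z)"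
 using Suc by (simp add: R.m_assoc[symmetric] z)
 also have "(\<phi> ^^ (b * N)) h \<otimes>\<^sub>H z = z \<otimes>\<^sub>H (\<phi> ^^ (Suc b * N)) h"
 by (simp only: h_z[OF phin_mem[OF Suc.prems]] mult_Suc funpow_add comp_apply)
 also have "z [^]\<^sub>H b \<otimes>\<^sub>H ... = z [^]\<^sub>H Suc b \<otimes>\<^sub>H (\<phi> ^^ (Suc b * N)) h"
 using Suc.prems phin_mem[OF Suc.prems, of "Suc b * N"] by (simp add: R.m_assoc z del: mult_Suc)
 finally show ?case .
qed simp

lemma mult_mono:
 assumes h: "h : carrier H" and k: "k : carrier H"
 shows "mono m h \<otimes>\<^sub>A mono n k = mono (m + n) ((\<phi> ^^ n) h \<otimes>\<^sub>H k)"
proof -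
 let ?m = "m mod N" and ?a = "m div N" and ?n = "n mod N" and ?b = "n div N"
 let ?z = "%a::nat. z [^]\<^sub>H a"
 have "mono m h \<otimes>\<^sub>A mono n k = mono (?m + ?n) ((\<phi> ^^ ?n) (?z ?a \<otimes>\<^sub>H h) \<otimes>\<^sub>H (?z ?b \<otimes>\<^sub>H k))"
 using h k N by (subst (1 2) mono_split) (simp_all add: mult_mono_small)
 also have "(\<phi> ^^ ?n) (?z ?a \<otimes>\<^sub>H h) \<otimes>\<^sub>H (?z ?b \<otimes>\<^sub>H k) = ?z ?a \<otimes>\<^sub>H ((\<phi> ^^ ?n) h \<otimes>\<^sub>H ?z ?b) \<otimes>\<^sub>H k"
 using h k by (simp add: alg_map_mult[OF phin_alg] phin_zpow R.m_assoc)
 also have "... = ?z (?a + ?b) \<otimes>\<^sub>H ((\<phi> ^^ n) h \<otimes>\<^sub>H k)"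
 proof -
 have "(\<phi> ^^ (?b * N)) ((\<phi> ^^ ?n) h) = (\<phi> ^^ n) h"
  by (metis comp_apply div_mult_mod_eq funpow_add)
 then have "(\<phi> ^^ ?n) h \<otimes>\<^sub>H ?z ?b = ?z ?b \<otimes>\<^sub>H (\<phi> ^^ n) h"
  using h_zpow[OF phin_mem[OF h], of ?n ?b] by simp
 then show ?thesis using h k by (simp add: R.nat_pow_mult[symmetric] z R.m_assoc)
 qed
 also have "mono (?m + ?n) ... = mono (?m + ?n + (?a + ?b) * N) ((\<phi> ^^ n) h \<otimes>\<^sub>H k)"
 using h k by (simp add: mono_red)
 also have "?m + ?n + (?a + ?b) * N = m + n"
 using mod_div_mult_eq[of m N] mod_div_mult_eq[of n N] by (simp add: algebra_simps)
 finally show ?thesis .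
qed

lemma A_alg: "k_algebra K A"
proof (rule k_algebraI[OF A_vs mult_closed mult_bilin])
 note bl = bilin_lin1[OF mult_bilin] and br = bilin_lin2[OF mult_bilin]
 show one: "\<one>\<^sub>A : carrier A" by (simp add: A_simps(3) mono_mem)
 fix x assume x: "x : carrier A"
 show "\<one>\<^sub>A \<otimes>\<^sub>A x = x"
 by (rule A_lin_eq[OF A_vs bl[OF one] lin_id _ x]) (simp add: A_simps(3) mult_mono alg_map_one[OF phin_alg])
 show "x \<otimes>\<^sub>A \<one>\<^sub>A = x"
 by (rule A_lin_eq[OF A_vs br[OF one] lin_id _ x]) (simp add: A_simps(3) mult_mono)
 fix y u assume y: "y : carrier A" and u: "u : carrier A"
 note c = mult_closed mono_mem x y u
 show "x \<otimes>\<^sub>A y \<otimes>\<^sub>A u = x \<otimes>\<^sub>A (y \<otimes>\<^sub>A u)"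
 proof (rule A_lin_eq[OF A_vs lin_comp[OF br br] br _ x])
 fix m h assume mh: "m < N" "h : carrier H"
 show "mono m h \<otimes>\<^sub>A y \<otimes>\<^sub>A u = mono m h \<otimes>\<^sub>A (y \<otimes>\<^sub>A u)"
 proof (rule A_lin_eq[OF A_vs lin_comp[OF br bl] lin_comp[OF bl br] _ y])
  fix n k assume nk: "n < N" "k : carrier H"
  show "mono m h \<otimes>\<^sub>A mono n k \<otimes>\<^sub>A u = mono m h \<otimes>\<^sub>A (mono n k \<otimes>\<^sub>A u)"
  proof (rule A_lin_eq[OF A_vs bl lin_comp[OF bl bl] _ u])
  fix l i assume li: "l < N" "i : carrier H"
  have "mono m h \<otimes>\<^sub>A mono n k \<otimes>\<^sub>A mono l i = mono (m + n + l) ((\<phi> ^^ l) ((\<phi> ^^ n) h \<otimes>\<^sub>H k) \<otimes>\<^sub>H i)"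
   using mh nk li by (simp add: mult_mono)
  also have "(\<phi> ^^ l) ((\<phi> ^^ n) h \<otimes>\<^sub>H k) \<otimes>\<^sub>H i = (\<phi> ^^ (n + l)) h \<otimes>\<^sub>H ((\<phi> ^^ l) k \<otimes>\<^sub>H i)"
   using mh nk li by (simp add: alg_map_mult[OF phin_alg] R.m_assoc add.commute[of n] funpow_add)
  finally show "mono m h \<otimes>\<^sub>A mono n k \<otimes>\<^sub>A mono l i = mono m h \<otimes>\<^sub>A (mono n k \<otimes>\<^sub>A mono l i)"
   using mh nk li by (simp add: mult_mono add.assoc)
  qed (use mh nk in \<open>auto intro: c\<close>)
 qed (use mh in \<open>auto intro: c\<close>)
 qed (auto intro: c)
qed

abbreviation \<sigma> where "\<sigma> == mono 0"
definition y where "y = mono 1 \<one>\<^sub>H"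

lemma y_mem: "y : carrier A" by (simp add: y_def mono_mem)

lemma sigma_alg: "\<sigma> : algebra_maps K H A"
 by (rule algebra_mapsI[OF mono_lin]) (simp_all add: A_simps(3) mult_mono)

lemma y_pow: "y [^]\<^sub>A n = mono n \<one>\<^sub>H"
 by (induction n) (simp_all add: A_simps(3) y_def mult_mono alg_map_one[OF phi])

lemma y_pow_sigma: "h : carrier H ==> y [^]\<^sub>A n \<otimes>\<^sub>A \<sigma> h = mono n h"
 by (simp add: y_pow mult_mono)

lemma y_pow_N: "y [^]\<^sub>A N = \<sigma> z"
 using mono_red[of "\<one>\<^sub>H" 0 1] z by (simp add: y_pow)

lemma sigma_y_pow: "h : carrier H ==> \<sigma> h \<otimes>\<^sub>A y [^]\<^sub>A n = y [^]\<^sub>A n \<otimes>\<^sub>A \<sigma> ((\<phi> ^^ n) h)"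
 by (simp add: y_pow mult_mono)

lemma commute_pow:
 assumes B: "k_algebra K B" and f: "f : algebra_maps K H B" and b: "b : carrier B"
 and comm: "!!h. h : carrier H ==> f h \<otimes>\<^sub>B b = b \<otimes>\<^sub>B f (\<phi> h)" and h: "h : carrier H"
 shows "f h \<otimes>\<^sub>B b [^]\<^sub>B (n::nat) = b [^]\<^sub>B n \<otimes>\<^sub>B f ((\<phi> ^^ n) h)"
proof (induction n)
 case 0 then show ?case using h lin_mem[OF alg_map_lin[OF f]] by (simp add: alg_one_l[OF B] alg_one_r[OF B])
next
 case (Suc n)
 note fc = lin_mem[OF alg_map_lin[OF f]] and pc = alg_pow_closed[OF B b]
 have ph: "\<phi> ((\<phi> ^^ n) h) : carrier H" using phin_mem[OF h, of "Suc n"] by simp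
 have "f h \<otimes>\<^sub>B b [^]\<^sub>B Suc n = (f h \<otimes>\<^sub>B b [^]\<^sub>B n) \<otimes>\<^sub>B b"
 by (simp add: alg_assoc[OF B] fc pc b h)
 also have "... = b [^]\<^sub>B n \<otimes>\<^sub>B (f ((\<phi> ^^ n) h) \<otimes>\<^sub>B b)"
 by (simp add: Suc.IH alg_assoc[OF B] fc pc b h)
 also have "... = b [^]\<^sub>B Suc n \<otimes>\<^sub>B f ((\<phi> ^^ Suc n) h)"
 by (simp add: comm alg_assoc[OF B] fc pc b h ph)
 finally show ?case .
qed

definition univ where "univ B f b = dlift B (%i h. b [^]\<^sub>B i \<otimes>\<^sub>B f h)"

text \<open>The universal property, at the level of algebras.\<close>

lemma univ_mono:
 assumes B: "k_algebra K B" and f: "f : algebra_maps K H B" and b: "b : carrier B"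
 and bN: "b [^]\<^sub>B N = f z" and h: "h : carrier H"
 shows "univ B f b (mono n h) = b [^]\<^sub>B n \<otimes>\<^sub>B f h"
proof -
 note fc = lin_mem[OF alg_map_lin[OF f]] and pc = alg_pow_closed[OF B b]
 interpret B: ring B by (rule alg_ring[OF B])
 have L: "(%h. b [^]\<^sub>B i \<otimes>\<^sub>B f h) : lin_maps K H B" for i :: nat
 by (rule lin_mult_r[OF B alg_map_lin[OF f] pc])
 have "univ B f b (mono n h) = b [^]\<^sub>B (n mod N) \<otimes>\<^sub>B f (z [^]\<^sub>H (n div N) \<otimes>\<^sub>H h)"
 unfolding univ_def using h N
 by (subst mono_split) (simp_all add: dlift_mono[OF alg_vs[OF B] L])
 also have "f (z [^]\<^sub>H (n div N) \<otimes>\<^sub>H h) = (b [^]\<^sub>B N) [^]\<^sub>B (n div N) \<otimes>\<^sub>B f h"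
 by (simp add: alg_map_mult[OF f] alg_map_pow[OF f H B z] h bN)
 also have "b [^]\<^sub>B (n mod N) \<otimes>\<^sub>B ... = b [^]\<^sub>B (n mod N + N * (n div N)) \<otimes>\<^sub>B f h"
 using b h fc by (simp add: B.nat_pow_pow B.m_assoc[symmetric] B.nat_pow_mult)
 finally show ?thesis by simp
qed

lemma univ_alg:
 assumes B: "k_algebra K B" and f: "f : algebra_maps K H B" and b: "b : carrier B"
 and comm: "!!h. h : carrier H ==> f h \<otimes>\<^sub>B b = b \<otimes>\<^sub>B f (\<phi> h)" and bN: "b [^]\<^sub>B N = f z"
 shows "univ B f b : algebra_maps K A B"
proof (rule algebra_mapsI)
 note fc = lin_mem[OF alg_map_lin[OF f]] and pc = alg_pow_closed[OF B b]
 note um = univ_mono[OF B f b bN]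
 interpret B: ring B by (rule alg_ring[OF B])
 show lin: "univ B f b : lin_maps K A B"
 unfolding univ_def by (rule dlift_lin[OF alg_vs[OF B]]) (rule lin_mult_r[OF B alg_map_lin[OF f] pc])
 show "univ B f b \<one>\<^sub>A = \<one>\<^sub>B" by (simp add: A_simps(3) um alg_map_one[OF f])
 fix x x' assume x: "x : carrier A" and x': "x' : carrier A"
 let ?U = "univ B f b"
 note Uc = lin_mem[OF lin]
 have l1: "(%x. ?U (x \<otimes>\<^sub>A c)) : lin_maps K A B" "(%x. ?U (c \<otimes>\<^sub>A x)) : lin_maps K A B" if "c : carrier A" for c
 by (rule lin_comp[OF lin bilin_lin2[OF mult_bilin that]], rule lin_comp[OF lin bilin_lin1[OF mult_bilin that]])
 have l2: "(%x. ?U x \<otimes>\<^sub>B c) : lin_maps K A B" "(%x. c \<otimes>\<^sub>B ?U x) : lin_maps K A B" if "c : carrier B" for c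
 by (rule lin_mult_l[OF B lin that], rule lin_mult_r[OF B lin that])
 have mm: "?U (mono m h \<otimes>\<^sub>A mono n k) = ?U (mono m h) \<otimes>\<^sub>B ?U (mono n k)"
 if h: "h : carrier H" and k: "k : carrier H" for m n h k
 proof -
 have "?U (mono m h \<otimes>\<^sub>A mono n k) = b [^]\<^sub>B m \<otimes>\<^sub>B (b [^]\<^sub>B n \<otimes>\<^sub>B f ((\<phi> ^^ n) h)) \<otimes>\<^sub>B f k"
  using h k by (simp add: mult_mono um alg_map_mult[OF f] B.nat_pow_mult[symmetric] b fc pc B.m_assoc)
 also have "b [^]\<^sub>B n \<otimes>\<^sub>B f ((\<phi> ^^ n) h) = f h \<otimes>\<^sub>B b [^]\<^sub>B n"
  by (rule commute_pow[OF B f b comm h, symmetric])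
 also have "b [^]\<^sub>B m \<otimes>\<^sub>B (f h \<otimes>\<^sub>B b [^]\<^sub>B n) \<otimes>\<^sub>B f k = ?U (mono m h) \<otimes>\<^sub>B ?U (mono n k)"
  unfolding um[OF h] um[OF k] using h k by (simp add: B.m_assoc fc pc)
 finally show ?thesis .
 qed
 have ms: "?U (mono m h \<otimes>\<^sub>A x') = ?U (mono m h) \<otimes>\<^sub>B ?U x'" if h: "h : carrier H" for m h
 by (rule A_lin_eq[OF alg_vs[OF B] l1(2)[OF mono_mem[OF h]] l2(2)[OF Uc[OF mono_mem[OF h]]] _ x'])
  (rule mm[OF h])
 show "?U (x \<otimes>\<^sub>A x') = ?U x \<otimes>\<^sub>B ?U x'"
 by (rule A_lin_eq[OF alg_vs[OF B] l1(1)[OF x'] l2(1)[OF Uc[OF x']] _ x]) (rule ms)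
qed

lemma alg_map_mono:
 assumes B: "k_algebra K B" and F: "F : algebra_maps K A B" and h: "h : carrier H"
 shows "F (mono n h) = F y [^]\<^sub>B n \<otimes>\<^sub>B F (\<sigma> h)"
proof -
 have "F (mono n h) = F (y [^]\<^sub>A n \<otimes>\<^sub>A \<sigma> h)" by (simp only: y_pow_sigma[OF h])
 also have "... = F y [^]\<^sub>B n \<otimes>\<^sub>B F (\<sigma> h)"
 unfolding alg_map_mult[OF F alg_pow_closed[OF A_alg y_mem] mono_mem[OF h]] alg_map_pow[OF F A_alg B y_mem] ..
 finally show ?thesis .
qed

lemma alg_map_eq:
 assumes B: "k_algebra K B" and F: "F : algebra_maps K A B" and G: "G : algebra_maps K A B"
 and y: "F y = G y" and s: "!!h. h : carrier H ==> F (\<sigma> h) = G (\<sigma> h)" and x: "x : carrier A"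
 shows "F x = G x"
proof (rule A_lin_eq[OF alg_vs[OF B] alg_map_lin[OF F] alg_map_lin[OF G] _ x])
 fix n h assume h: "h : carrier H"
 show "F (mono n h) = G (mono n h)"
 by (subst alg_map_mono[OF B F h], subst alg_map_mono[OF B G h]) (simp only: y s[OF h])
qed

end

section \<open>The bialgebra \<open>\<O>\<close>\<close>

lemma tensor_algebra_cong:
 assumes "carrier A' = carrier A" "ring.add A' = ring.add A" "smult A' = smult A" "monoid.mult A' = monoid.mult A"
 "one A' = one A"
 shows "tensor_algebra K A' A' = tensor_algebra K A A"
proof -
 have t: "tensor K A' A' = tensor K A A" and p: "pure_tensor K A' A' = pure_tensor K A A"
 by (rule tensor_cong; rule assms)+
 have l: "tensor_lift K A' A' (tensor K A A) = tensor_lift K A A (tensor K A A)"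
 by (rule tensor_lift_cong_space) (simp_all add: assms)
 show ?thesis by (simp add: tensor_algebra_def t p l assms)
qed

lemma alg_map_cong:
 assumes f: "f : algebra_maps K A B" and A: "k_algebra K A" and eq: "!!x. x : carrier A ==> g x = f x"
 shows "g : algebra_maps K A B"
proof (rule algebra_mapsI)
 show "g : lin_maps K A B" by (rule lin_cong[OF alg_map_lin[OF f] alg_vs[OF A] eq])
qed (simp_all add: eq alg_one_mem[OF A] alg_mult_mem[OF A] alg_map_one[OF f] alg_map_mult[OF f])

lemma lift_pure_mult:
 assumes A: "k_algebra K A" and B: "k_algebra K B" and M: "vectorspace K M" and F: "bilinear_map K A B M F"
 and a: "a : carrier A" and b: "b : carrier B" and t: "t : carrier (tensor K A B)"
 shows "tensor_lift K A B M F (pure_tensor K A B a b \<otimes>\<^bsub>tensor_algebra K A B\<^esub> t) =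
 tensor_lift K A B M (%a' b'. F (a \<otimes>\<^sub>A a') (b \<otimes>\<^sub>B b')) t"
proof -
 note r = alg_vs[OF A] alg_vs[OF B] A B M bilin_comp1[OF F] bilin_comp2[OF F] t lin_mult_l lin_mult_r alg_mult_mem
 have b2: "bilinear_map K A B M (%a b. tensor_lift K A B M (%a' b'. F (a \<otimes>\<^sub>A a') (b \<otimes>\<^sub>B b')) t)"
 by (assumption | rule r lin)+
 show ?thesis
 unfolding lift_ta_mult[OF A B M F pure_mem[OF alg_vs[OF A] alg_vs[OF B] a b] t]
 by (rule lift_pure[OF alg_vs[OF A] alg_vs[OF B] M b2 a b])
qed

context yd_setting
begin

definition E0 where "E0 = cyclic_extension H \<phi> zz N undefined undefined"

definition DO where
 "DO = (let T = tensor_algebra K E0 E0; s = ext_mono H zz N 0; v = ext_mono H zz N 1 \<one>\<^sub>H in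
  (%f. finsum T (%i. (pure_tensor K E0 E0 v \<one>\<^sub>E0 \<oplus>\<^sub>T pure_tensor K E0 E0 (s g) v) [^]\<^sub>T i \<otimes>\<^sub>T
  tensor_map K H H E0 E0 s s (comult H (f i))) {..<N}))"

definition EO where "EO = (%f. finsum KB (%i. \<zero>\<^sub>K [^]\<^sub>KB i \<otimes>\<^sub>KB counit H (f i)) {..<N})"

sublocale O: cyclic_ext K H "phi K H \<chi>" zz N DO EO
 by unfold_locales (simp_all add: hA phi_alg zz_closed N_pos phi_zz h_zz)

abbreviation A where "A == O.A"
abbreviation AA where "AA == tensor K O.A O.A"
abbreviation TA where "TA == tensor_algebra K O.A O.A"
abbreviation ptA where "ptA == pure_tensor K O.A O.A"
abbreviation mono where "mono == ext_mono H zz N"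
abbreviation sig (\<open>\<sigma>\<close>) where "\<sigma> == ext_mono H zz N 0"
abbreviation y where "y == O.y"
abbreviation liftA where "liftA M == tensor_lift K O.A O.A M"

lemmas aA = O.A_alg and vA = O.A_vs and vAA = vs_tensor[OF O.A_vs O.A_vs]

sublocale AR: ring O.A by (rule alg_ring[OF O.A_alg])
sublocale AV: vectorspace K O.A by (rule O.A_vs)
sublocale T2: two_algebras K O.A O.A by (simp add: two_algebras_def O.A_alg)

lemmas sig_alg = O.sigma_alg and sig_lin = alg_map_lin[OF O.sigma_alg] and mono_mem = O.mono_mem
lemmas aT = T2.tensor_k_algebra

lemmas [lin] = aA vA vAA lin_comp[OF O.mono_lin] O.mono_mem O.y_mem

sublocale TR: ring "tensor_algebra K O.A O.A" by (rule alg_ring[OF aT])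
sublocale TV: vectorspace K "tensor K O.A O.A" by (rule vAA)

text \<open>The images \<open>fO\<close> of \<open>H\<close> and \<open>bO\<close> of \<open>y\<close> that the universal property is to extend to the comultiplication.\<close>

definition fO :: "'h => (nat => 'h, nat => 'h) tensor" where
 "fO h = tensor_map K H H A A \<sigma> \<sigma> (comult H h)"

definition bO :: "(nat => 'h, nat => 'h) tensor" where
 "bO = ptA y \<one>\<^sub>A \<oplus>\<^sub>AA ptA (\<sigma> g) y"

lemma E0_eq: "tensor_algebra K E0 E0 = TA" "pure_tensor K E0 E0 = ptA" "tensor_map K H H E0 E0 = tensor_map K H H A A"
 "\<one>\<^sub>E0 = \<one>\<^sub>A"
proof -
 have f: "carrier E0 = carrier A" "ring.add E0 = ring.add A" "smult E0 = smult A" "monoid.mult E0 = monoid.mult A"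
 "\<one>\<^sub>E0 = \<one>\<^sub>A"
 by (simp_all add: E0_def O.A_def cyclic_extension_def)
 show "tensor_algebra K E0 E0 = TA" by (rule tensor_algebra_cong) (rule f)+
 show p: "pure_tensor K E0 E0 = ptA" by (rule tensor_cong(2); rule f)
 have t: "tensor K E0 E0 = AA" by (rule tensor_cong(1); rule f)
 show "tensor_map K H H E0 E0 = tensor_map K H H A A" by (simp add: tensor_map_def[abs_def] p t)
 show "\<one>\<^sub>E0 = \<one>\<^sub>A" by (rule f)
qed

lemma comult_A: "comult A = O.univ TA fO bO"
proof -
 have "DO = (%f. finsum TA (%i. bO [^]\<^sub>TA i \<otimes>\<^sub>TA fO (f i)) {..<N})"
 by (subst DO_def, unfold Let_def E0_eq bO_def fO_def O.y_def, simp only: tensor_algebra_simps)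
 then show ?thesis by (simp only: O.A_simps(7) O.univ_def O.dlift_def[abs_def])
qed

lemma counit_A: "counit A = O.univ KB (counit H) \<zero>\<^sub>K"
 by (rule trans[OF O.A_simps(8)], subst EO_def) (simp only: O.univ_def O.dlift_def[abs_def])

lemma fO_eq: "fO h = liftH AA (%x z. ptA (\<sigma> x) (\<sigma> z)) (comult H h)"
 by (simp add: fO_def tensor_map_def)

lemma fO_alg: "fO : algebra_maps K H TA"
 using alg_map_comp[OF tensor_map_algebra_map[OF hA hA aA aA sig_alg sig_alg] bialg_comult[OF bialg]]
 by (simp add: fO_def[abs_def])

lemmas fO_lin = alg_map_lin[OF fO_alg] and fO_mem = lin_mem[OF alg_map_lin[OF fO_alg]]

lemma fO_mem': "h : carrier H ==> fO h : carrier AA"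
 using fO_mem by simp

lemma pt_mem: "a : carrier A ==> b : carrier A ==> ptA a b : carrier AA"
 by (rule pure_mem[OF vA vA])

lemma bO_mem: "bO : carrier TA"
 unfolding bO_def by (simp add: pt_mem O.y_mem mono_mem g_mem)

lemma sig_mult: "h : carrier H ==> k : carrier H ==> \<sigma> h \<otimes>\<^sub>A \<sigma> k = \<sigma> (h \<otimes>\<^sub>H k)"
 by (simp add: O.mult_mono)

lemma sig_y: "h : carrier H ==> \<sigma> h \<otimes>\<^sub>A y = y \<otimes>\<^sub>A \<sigma> (\<phi> h)"
 by (simp add: O.mult_mono O.y_def phi_mem)

text \<open>\<open>\<Sum> h\<^sub>1 \<chi>(h\<^sub>2) \<otimes> h\<^sub>3\<close> can be read with \<open>\<chi>\<close> attached to either factor.\<close>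

lemma lift_rw:
 assumes M: "vectorspace K M" and F: "bilinear_map K H H M F" and h: "h : carrier H"
 shows "liftH M (%x z. F (rw (Suc 0) x) z) (comult H h) = liftH M (%x z. F x (\<phi> z)) (comult H h)"
proof -
 note r = M bilin_comp1[OF F] bilin_comp2[OF F] bilin_closed[OF F]
 have "liftH M (%x z. F (rw (Suc 0) x) z) (comult H h) =
 liftH M (%a b. liftH M (%x z. \<chi> z \<odot>\<^sub>M F x b) (comult H a)) (comult H h)"
 proof (rule lift_fcong)
 fix a b assume a: "a : carrier H" and b: "b : carrier H"
 have "F (rw (Suc 0) a) b = liftH M (%x z. F (cp (Suc 0) z \<odot>\<^sub>H x) b) (comult H a)"
  unfolding rw_def by (rule liftH_out[OF hV rw_bilin M bilin_lin2[OF F b] a])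
 also have "... = liftH M (%x z. \<chi> z \<odot>\<^sub>M F x b) (comult H a)"
  by (rule lift_fcong) (simp only: cp_1 lin_smultD[OF bilin_lin2[OF F b]] chi_mem)
 finally show "F (rw (Suc 0) a) b = ..." .
 qed
 also have "... = liftH M (%a b. liftH M (%x z. \<chi> x \<odot>\<^sub>M F a z) (comult H b)) (comult H h)"
 by (rule coassoc[OF hC M _ h]) (assumption | rule r lin)+
 also have "... = liftH M (%x z. F x (\<phi> z)) (comult H h)"
 proof (rule lift_fcong)
 fix a b assume a: "a : carrier H" and b: "b : carrier H"
 have "F a (\<phi> b) = liftH M (%x z. F a (\<chi> x \<odot>\<^sub>H z)) (comult H b)"
  unfolding phi_eq by (rule liftH_out[OF hV phi_bilin M bilin_lin1[OF F a] b])
 also have "... = liftH M (%x z. \<chi> x \<odot>\<^sub>M F a z) (comult H b)"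
  by (rule lift_fcong) (simp only: lin_smultD[OF bilin_lin1[OF F a]] chi_mem)
 finally show "liftH M (%x z. \<chi> x \<odot>\<^sub>M F a z) (comult H b) = F a (\<phi> b)" ..
 qed
 finally show ?thesis .
qed

lemma TA_lin_l: "u : carrier AA ==> (%s. u \<otimes>\<^sub>TA s) : lin_maps K AA AA"
 and TA_lin_r: "u : carrier AA ==> (%s. s \<otimes>\<^sub>TA u) : lin_maps K AA AA"
 by (rule bilin_lin1[OF T2.ta_bilin], assumption) (rule bilin_lin2[OF T2.ta_bilin])

lemma pt_sig_bilin: "bilinear_map K H H AA (%x z. ptA (\<sigma> x) (\<sigma> z))"
 by (assumption | rule lin)+

lemma fO_bO_comm:
 assumes h: "h : carrier H"
 shows "fO h \<otimes>\<^sub>TA bO = bO \<otimes>\<^sub>TA fO (\<phi> h)"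
proof -
 let ?X = "ptA y \<one>\<^sub>A" and ?Y = "ptA (\<sigma> g) y"
 have XY: "?X : carrier AA" "?Y : carrier AA"
 by (simp_all add: pt_mem O.y_mem mono_mem g_mem)
 have rwc: "rw (Suc 0) x : carrier H" if "x : carrier H" for x using that by (rule rw_closed)
 have r: "fO h \<otimes>\<^sub>TA u = liftH AA (%x z. ptA (\<sigma> x) (\<sigma> z) \<otimes>\<^sub>TA u) (comult H h)" if "u : carrier AA" for u
 unfolding fO_eq by (rule liftH_out[OF vAA pt_sig_bilin vAA TA_lin_r[OF that] h])
 have l: "u \<otimes>\<^sub>TA fO (\<phi> h) = liftH AA (%x z. u \<otimes>\<^sub>TA ptA (\<sigma> (\<phi> x)) (\<sigma> z)) (comult H h)" if u: "u : carrier AA" for u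
 proof -
 have b: "bilinear_map K H H AA (%x z. u \<otimes>\<^sub>TA ptA (\<sigma> x) (\<sigma> z))"
  by (assumption | rule lin_comp[OF TA_lin_l[OF u]] lin)+
 have "u \<otimes>\<^sub>TA fO (\<phi> h) = liftH AA (%x z. u \<otimes>\<^sub>TA ptA (\<sigma> x) (\<sigma> z)) (comult H (\<phi> h))"
  unfolding fO_eq by (rule liftH_out[OF vAA pt_sig_bilin vAA TA_lin_l[OF u] phi_mem[OF h]])
 also have "... = liftH AA (%x z. u \<otimes>\<^sub>TA ptA (\<sigma> (\<phi> x)) (\<sigma> z)) (comult H h)"
  by (rule lift_comult_phi[OF vAA b h])
 finally show ?thesis .
 qed
 have X: "fO h \<otimes>\<^sub>TA ?X = ?X \<otimes>\<^sub>TA fO (\<phi> h)"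
 unfolding r[OF XY(1)] l[OF XY(1)]
 by (rule lift_fcong) (simp add: T2.ta_mult_pure mono_mem O.y_mem phi_mem sig_y)
 have bY: "bilinear_map K H H AA (%x z. ptA (\<sigma> (x \<otimes>\<^sub>H g)) (y \<otimes>\<^sub>A \<sigma> z))"
 by (assumption | rule lin)+
 have "fO h \<otimes>\<^sub>TA ?Y = liftH AA (%x z. ptA (\<sigma> (x \<otimes>\<^sub>H g)) (y \<otimes>\<^sub>A \<sigma> (\<phi> z))) (comult H h)"
 unfolding r[OF XY(2)]
 by (rule lift_fcong) (simp add: T2.ta_mult_pure mono_mem O.y_mem g_mem sig_y sig_mult)
 also have "... = liftH AA (%x z. ptA (\<sigma> (rw (Suc 0) x \<otimes>\<^sub>H g)) (y \<otimes>\<^sub>A \<sigma> z)) (comult H h)"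
 by (rule lift_rw[OF vAA bY h, symmetric])
 also have "... = ?Y \<otimes>\<^sub>TA fO (\<phi> h)"
 unfolding l[OF XY(2)]
 by (rule lift_fcong) (simp add: T2.ta_mult_pure mono_mem O.y_mem g_mem sig_mult phi_mem g_phi)
 finally have Y: "fO h \<otimes>\<^sub>TA ?Y = ?Y \<otimes>\<^sub>TA fO (\<phi> h)" .
 show ?thesis unfolding bO_def
 using fO_mem'[OF h] fO_mem'[OF phi_mem[OF h]] XY by (simp add: T2.ta_addl T2.ta_addr X Y)
qed

text \<open>The terms of the \<open>q\<close>-binomial expansion of \<open>bO\<^sup>n\<close>, for \<open>i + j = n\<close>. Right multiplication by \<open>bO\<close> raises \<open>i\<close>, with a factor \<open>q\<^sup>j\<close>, or \<open>j\<close>.\<close>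

definition ee :: "nat => nat => (nat => 'h, nat => 'h) tensor" where
 "ee i j = ptA (mono i (g [^]\<^sub>H j)) (mono j \<one>\<^sub>H)"

lemma ee_closed: "ee i j : carrier AA"
 by (simp add: ee_def pt_mem mono_mem gpow_mem)

lemma ee_step: "ee i j \<otimes>\<^sub>TA bO = q [^]\<^sub>K j \<odot>\<^sub>AA ee (Suc i) j \<oplus>\<^sub>AA ee i (Suc j)"
proof -
 have "ee i j \<otimes>\<^sub>TA ptA y \<one>\<^sub>A = ptA (mono (Suc i) (\<phi> (g [^]\<^sub>H j))) (mono j \<one>\<^sub>H)"
 by (simp add: ee_def T2.ta_mult_pure mono_mem gpow_mem O.y_mem)
  (simp add: O.y_def O.mult_mono gpow_mem phi_mem)
 also have "... = q [^]\<^sub>K j \<odot>\<^sub>AA ee (Suc i) j"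
 by (simp add: ee_def phi_gpow lin_smultD[OF O.mono_lin] gpow_mem q_closed mono_mem
  lin_smultD[OF bilin_lin2[OF bilin_pure[OF vA vA]]])
 finally have X: "ee i j \<otimes>\<^sub>TA ptA y \<one>\<^sub>A = q [^]\<^sub>K j \<odot>\<^sub>AA ee (Suc i) j" .
 have Y: "ee i j \<otimes>\<^sub>TA ptA (\<sigma> g) y = ee i (Suc j)"
 by (simp add: ee_def T2.ta_mult_pure mono_mem gpow_mem g_mem O.y_mem)
  (simp add: O.y_def O.mult_mono gpow_mem g_mem phi_mem alg_map_one[OF phi_alg])
 show ?thesis unfolding bO_def
 by (simp add: T2.ta_addr ee_closed pt_mem O.y_mem mono_mem g_mem X Y)
qed

lemma bO_pow: "bO [^]\<^sub>TA n = ((%s. s \<otimes>\<^sub>TA bO) ^^ n) (ee 0 0)"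
proof (induction n)
 case 0 show ?case by (simp add: ee_def O.A_simps(3))
next
 case (Suc n) then show ?case by simp
qed

lemma bO_mem': "bO : carrier AA" using bO_mem by simp

lemma bO_pow_expand: "bO [^]\<^sub>TA n = finsum AA (%k. K.gauss q n k \<odot>\<^sub>AA ee k (n - k)) {..n}"
 unfolding bO_pow
 by (rule q_binomial_operator[where P="%s. s \<otimes>\<^sub>TA bO" and e=ee, OF vAA q_closed TA_lin_r[OF bO_mem']]) (rule ee_closed ee_step)+

text \<open>The two outer terms are \<open>z \<otimes> 1\<close> and \<open>g\<^sup>N \<otimes> z\<close>, and \<open>z\<close> is skew primitive.\<close>

lemma bO_pow_N: "bO [^]\<^sub>TA N = fO zz"
proof -
 have "bO [^]\<^sub>TA N = ee N 0 \<oplus>\<^sub>AA ee 0 N"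
 unfolding bO_pow
 by (rule q_binomial_root_of_unity[where P="%s. s \<otimes>\<^sub>TA bO" and e=ee, OF vAA root TA_lin_r[OF bO_mem']]) (rule ee_closed ee_step)+
 also have "... = ptA (\<sigma> zz) (\<sigma> \<one>\<^sub>H) \<oplus>\<^sub>AA ptA (\<sigma> (g [^]\<^sub>H N)) (\<sigma> zz)"
 using O.y_pow_N by (simp add: ee_def O.y_pow)
 also have "... = fO zz"
 by (simp add: fO_def comult_zz lin_addD[OF tensor_map_lin[OF hV hV vA vA sig_lin sig_lin lin_id]]
  tensor_map_pure[OF hV hV vA vA sig_lin sig_lin] pure_mem[OF hV hV] zz_closed gpow_mem)
 finally show ?thesis .
qed

lemma comult_A_alg: "comult A : algebra_maps K A TA"
 unfolding comult_A by (rule O.univ_alg[OF aT fO_alg bO_mem fO_bO_comm bO_pow_N])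

lemma comult_mono: "h : carrier H ==> comult A (mono n h) = bO [^]\<^sub>TA n \<otimes>\<^sub>TA fO h"
 unfolding comult_A by (rule O.univ_mono[OF aT fO_alg bO_mem bO_pow_N])

lemma comult_sig: "h : carrier H ==> comult A (\<sigma> h) = fO h"
 using fO_mem by (simp add: comult_mono alg_one_l[OF aT, simplified])

lemma comult_y: "comult A y = bO"
 using bO_mem comult_mono[of "\<one>\<^sub>H" 1]
 by (simp add: O.y_def alg_map_one[OF fO_alg] alg_one_l[OF aT, simplified] alg_one_r[OF aT, simplified])

lemma counit_zero_pow: "\<zero>\<^sub>K [^]\<^sub>KB (n::nat) = (if n = 0 then \<one>\<^sub>K else \<zero>\<^sub>K)"
 by (induction n) simp_all

lemma counit_A_facts:
 shows counit_A_alg: "counit A : algebra_maps K A KB"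
 and counit_mono: "h : carrier H ==> counit A (mono n h) = (if n = 0 then counit H h else \<zero>\<^sub>K)"
proof -
 have bN: "\<zero>\<^sub>K [^]\<^sub>KB N = counit H zz" using N_pos by (simp add: counit_zero_pow counit_zz)
 note b = base_algebra[OF field]
 show "counit A : algebra_maps K A KB"
 unfolding counit_A by (rule O.univ_alg[OF b bialg_counit[OF bialg] _ _ bN]) (simp_all add: counitH phi_mem)
 show "h : carrier H ==> counit A (mono n h) = (if n = 0 then counit H h else \<zero>\<^sub>K)"
 unfolding counit_A by (subst O.univ_mono[OF b bialg_counit[OF bialg] _ bN]) (simp_all add: counit_zero_pow counitH)
qed

lemma counit_A_closed: "c : carrier A ==> counit A c : carrier K"
 using lin_mem[OF alg_map_lin[OF counit_A_alg]] by simp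

lemma comult_A_closed: "c : carrier A ==> comult A c : carrier AA"
 using lin_mem[OF alg_map_lin[OF comult_A_alg]] by simp

lemma comult_A_lin: "comult A : lin_maps K A AA"
 using alg_map_lin[OF comult_A_alg] by simp

lemmas [lin] = comult_A_closed counit_A_closed lin_comp[OF comult_A_lin] lin_comp[OF alg_map_lin[OF counit_A_alg]]

text \<open>Both sides are algebra maps in \<open>c\<close>, so it is enough to compare them on \<open>H\<close> and at \<open>y\<close>.\<close>

lemma counit_law_l: "c : carrier A ==> liftA A (%u v. counit A u \<odot>\<^sub>A v) (comult A c) = c"
 and counit_law_r: "c : carrier A ==> liftA A (%u v. counit A v \<odot>\<^sub>A u) (comult A c) = c"
proof -
 let ?l = "%u v. counit A u \<odot>\<^sub>A v" and ?r = "%u v. counit A v \<odot>\<^sub>A u"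
 have bl: "bilinear_map K A A A ?l" and br: "bilinear_map K A A A ?r" by (assumption | rule lin)+
 have cm: "counit A (u \<otimes>\<^sub>A v) = counit A u \<otimes>\<^sub>K counit A v" if "u : carrier A" "v : carrier A" for u v
 using alg_map_mult[OF counit_A_alg that] by simp
 have c1: "counit A \<one>\<^sub>A = \<one>\<^sub>K" using alg_map_one[OF counit_A_alg] by simp
 have al: "(%c. liftA A ?l (comult A c)) : algebra_maps K A A"
 by (rule alg_map_comp[OF T2.lift_algebra_map[OF aA bl] comult_A_alg])
  (simp_all add: c1 cm alg_smult_l[OF aA] alg_smult_r[OF aA] counit_A_closed AV.smult_assoc1[symmetric] K.m_comm)
 have ar: "(%c. liftA A ?r (comult A c)) : algebra_maps K A A"
 by (rule alg_map_comp[OF T2.lift_algebra_map[OF aA br] comult_A_alg])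
  (simp_all add: c1 cm alg_smult_l[OF aA] alg_smult_r[OF aA] counit_A_closed AV.smult_assoc1[symmetric] K.m_comm)
 have i: "(%c. c) : algebra_maps K A A" by (rule algebra_mapsI[OF lin_id]) simp_all
 have ey: "counit A y = \<zero>\<^sub>K" and es: "!!h. h : carrier H ==> counit A (\<sigma> h) = counit H h"
 by (simp_all add: O.y_def counit_mono)
 have yl: "liftA A ?l (comult A y) = y" and yr: "liftA A ?r (comult A y) = y"
 by (simp_all add: comult_y bO_def lift_addD[OF vA vA vA bl] lift_addD[OF vA vA vA br] lift_pure[OF vA vA vA bl]
  lift_pure[OF vA vA vA br] pt_mem O.y_mem mono_mem g_mem ey es c1 g_counit)
 have sl: "liftA A ?l (comult A (\<sigma> h)) = \<sigma> h" if h: "h : carrier H" for h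
 proof -
 have "liftA A ?l (comult A (\<sigma> h)) = liftH A (%u v. counit A (\<sigma> u) \<odot>\<^sub>A \<sigma> v) (comult H h)"
  unfolding comult_sig[OF h] fO_def by (rule lift_tensor_map[OF hV hV vA vA sig_lin sig_lin vA bl comultH[OF h]])
 also have "... = liftH A (%u v. counit H u \<odot>\<^sub>A \<sigma> v) (comult H h)" by (rule lift_fcong) (simp only: es)
 also have "... = \<sigma> h" by (rule counit_l[OF hC vA sig_lin h])
 finally show ?thesis .
 qed
 have sr: "liftA A ?r (comult A (\<sigma> h)) = \<sigma> h" if h: "h : carrier H" for h
 proof -
 have "liftA A ?r (comult A (\<sigma> h)) = liftH A (%u v. counit A (\<sigma> v) \<odot>\<^sub>A \<sigma> u) (comult H h)"
  unfolding comult_sig[OF h] fO_def by (rule lift_tensor_map[OF hV hV vA vA sig_lin sig_lin vA br comultH[OF h]])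
 also have "... = liftH A (%u v. counit H v \<odot>\<^sub>A \<sigma> u) (comult H h)" by (rule lift_fcong) (simp only: es)
 also have "... = \<sigma> h" by (rule counit_r[OF hC vA sig_lin h])
 finally show ?thesis .
 qed
 assume c: "c : carrier A"
 show "liftA A ?l (comult A c) = c" by (rule O.alg_map_eq[OF aA al i yl sl c])
 show "liftA A ?r (comult A c) = c" by (rule O.alg_map_eq[OF aA ar i yr sr c])
qed

abbreviation A3 where "A3 == tensor K O.A (tensor K O.A O.A)"

text \<open>As for the counit laws: both sides are algebra maps into a threefold tensor product, and they agree on \<open>H\<close> and at \<open>y\<close>.\<close>

lemma coassoc_A:
 assumes c: "c : carrier A"
 shows "liftA A3 (%a b. liftA A3 (%u v. pure_tensor K A AA u (ptA v b)) (comult A a)) (comult A c) =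
 liftA A3 (%u v. pure_tensor K A AA u (comult A v)) (comult A c)"
proof -
 let ?p3 = "pure_tensor K A AA" and ?TA3 = "tensor_algebra K A TA"
 interpret T3: two_algebras K A TA by (simp add: two_algebras_def aA aT)
 interpret TL: two_algebras K TA A by (simp add: two_algebras_def aA aT)
 have vT: "vectorspace K TA" by (rule alg_vs[OF aT])
 have t3: "tensor K A TA = A3" and p3: "pure_tensor K A TA = ?p3" by (rule tensor_cong; simp)+
 have v3: "vectorspace K A3" by (rule vs_tensor[OF vA vAA])
 have l3: "tensor_lift K TA A ?TA3 = tensor_lift K AA A A3" and l3': "liftA ?TA3 = liftA A3"
 by (rule tensor_lift_cong_space; simp add: t3)+
 have m3: "?p3 u s \<otimes>\<^sub>?TA3 ?p3 u' s' = ?p3 (u \<otimes>\<^sub>A u') (s \<otimes>\<^sub>TA s')"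
 if "u : carrier A" "s : carrier AA" "u' : carrier A" "s' : carrier AA" for u s u' s'
 using T3.ta_mult_pure[of u s u' s'] that by (simp add: p3)
 define G where "G s b = liftA A3 (%u v. ?p3 u (ptA v b)) s" for s b
 have bG: "bilinear_map K A A A3 (%u v. ?p3 u (ptA v b))" if "b : carrier A" for b
 by (assumption | rule that v3 lin)+
 have Gc: "G s b : carrier A3" if "s : carrier AA" "b : carrier A" for s b
 unfolding G_def using that by (intro lift_closed vA v3 bG)
 have Gb: "bilinear_map K AA A A3 G" unfolding G_def
 by (assumption | rule v3 lin)+
 then have Gb': "bilinear_map K TA A ?TA3 G"
 unfolding bilinear_map_def by (simp add: t3)
 have G1: "G \<one>\<^sub>TA \<one>\<^sub>A = \<one>\<^sub>?TA3"
 by (simp add: G_def lift_pure[OF vA vA v3 bG] p3)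
 have ml: "(%t. t \<otimes>\<^sub>?TA3 w) : lin_maps K A3 A3" "(%t. w \<otimes>\<^sub>?TA3 t) : lin_maps K A3 A3" if "w : carrier A3" for w
 using bilin_lin1[OF T3.ta_bilin] bilin_lin2[OF T3.ta_bilin] that by (simp_all add: t3)
 have Gm: "G (s \<otimes>\<^sub>TA s') (b \<otimes>\<^sub>A b') = G s b \<otimes>\<^sub>?TA3 G s' b'"
 if s: "s : carrier AA" and b: "b : carrier A" and s': "s' : carrier AA" and b': "b' : carrier A" for s b s' b'
 proof -
 have bb: "b \<otimes>\<^sub>A b' : carrier A" using b b' by simp
 have "G (s \<otimes>\<^sub>TA s') (b \<otimes>\<^sub>A b') = liftA A3 (%u v. liftA A3 (%u' v'. ?p3 (u \<otimes>\<^sub>A u') (ptA (v \<otimes>\<^sub>A v') (b \<otimes>\<^sub>A b'))) s') s"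
  unfolding G_def by (rule lift_ta_mult[OF aA aA v3 bG[OF bb] s s'])
 also have "... = liftA A3 (%u v. ?p3 u (ptA v b) \<otimes>\<^sub>?TA3 G s' b') s"
 proof (rule lift_fcong)
  fix u v assume u: "u : carrier A" and v: "v : carrier A"
  have pc: "?p3 u (ptA v b) : carrier A3" using u v b by (intro pure_mem vA vAA)
  have "?p3 u (ptA v b) \<otimes>\<^sub>?TA3 G s' b' = liftA A3 (%u' v'. ?p3 u (ptA v b) \<otimes>\<^sub>?TA3 ?p3 u' (ptA v' b')) s'"
  unfolding G_def by (rule lin_lift_comp[OF vA vA v3 bG[OF b'] v3 ml(2)[OF pc] s'])
  also have "... = liftA A3 (%u' v'. ?p3 (u \<otimes>\<^sub>A u') (ptA (v \<otimes>\<^sub>A v') (b \<otimes>\<^sub>A b'))) s'"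
  using u v b b' by (intro lift_fcong) (simp add: m3 pt_mem T2.ta_mult_pure)
  finally show "liftA A3 (%u' v'. ?p3 (u \<otimes>\<^sub>A u') (ptA (v \<otimes>\<^sub>A v') (b \<otimes>\<^sub>A b'))) s' = ?p3 u (ptA v b) \<otimes>\<^sub>?TA3 G s' b'" ..
 qed
 also have "... = G s b \<otimes>\<^sub>?TA3 G s' b'"
  unfolding G_def[of s b] by (rule lin_lift_comp[OF vA vA v3 bG[OF b] v3 ml(1)[OF Gc[OF s' b']] s, symmetric])
 finally show ?thesis .
 qed
 have a1: "tensor_lift K TA A ?TA3 G : algebra_maps K TL.TA ?TA3"
 by (rule TL.lift_algebra_map[OF T3.tensor_k_algebra Gb' G1]) (simp add: Gm)
 have i: "(%c. c) : algebra_maps K A A" by (rule algebra_mapsI[OF lin_id]) simp_all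
 have D: "comult A : algebra_maps K A TA" by (rule comult_A_alg)
 have a2: "(%c. tensor_map K A A TA A (comult A) (%c. c) (comult A c)) : algebra_maps K A TL.TA"
 by (rule alg_map_comp[OF tensor_map_algebra_map[OF aA aA aT aA D i] D])
 have bF1: "bilinear_map K A A A3 (%a b. liftA A3 (%u v. ?p3 u (ptA v b)) (comult A a))"
 and bF2: "bilinear_map K A A A3 (%u v. ?p3 u (comult A v))"
 by (assumption | rule v3 lin)+
 have L1: "(%c. liftA A3 (%a b. liftA A3 (%u v. ?p3 u (ptA v b)) (comult A a)) (comult A c)) : algebra_maps K A ?TA3"
 proof (rule alg_map_cong[OF alg_map_comp[OF a1 a2] aA])
 fix c assume c: "c : carrier A"
 show "liftA A3 (%a b. liftA A3 (%u v. ?p3 u (ptA v b)) (comult A a)) (comult A c) =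
  tensor_lift K TA A ?TA3 G (tensor_map K A A TA A (comult A) (%c. c) (comult A c))"
  unfolding lift_tensor_map[OF vA vA vT vA alg_map_lin[OF D] lin_id alg_vs[OF T3.tensor_k_algebra] Gb' comult_A_closed[OF c]]
  l3' G_def ..
 qed
 have L2: "(%c. liftA A3 (%u v. ?p3 u (comult A v)) (comult A c)) : algebra_maps K A ?TA3"
 using alg_map_comp[OF tensor_map_algebra_map[OF aA aA aA aT i D] D]
 by (simp add: tensor_map_def[abs_def] t3 p3)
 note lp = lift_pure[OF vA vA v3 bF1] lift_pure[OF vA vA v3 bF2] lift_pure[OF vA vA v3 bG]
 have sg: "comult A (\<sigma> g) = ptA (\<sigma> g) (\<sigma> g)"
 by (simp add: comult_sig g_mem fO_def g_comult tensor_map_pure[OF hV hV vA vA sig_lin sig_lin])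
 have d1: "comult A \<one>\<^sub>A = ptA \<one>\<^sub>A \<one>\<^sub>A" using alg_map_one[OF D] by simp
 interpret V3: vectorspace K A3 by (rule v3)
 have p3c: "u : carrier A ==> s : carrier AA ==> ?p3 u s : carrier A3" for u s by (rule pure_mem[OF vA vAA])
 have p3a: "?p3 u (s \<oplus>\<^sub>AA s') = ?p3 u s \<oplus>\<^sub>A3 ?p3 u s'" if "u : carrier A" "s : carrier AA" "s' : carrier AA" for u s s'
 by (rule lin_addD[OF bilin_lin1[OF bilin_pure[OF vA vAA]]]) (rule that)+
 note cl = pt_mem O.y_mem mono_mem g_mem AR.one_closed HR.one_closed
 have y: "liftA A3 (%a b. liftA A3 (%u v. ?p3 u (ptA v b)) (comult A a)) (comult A y) =
  liftA A3 (%u v. ?p3 u (comult A v)) (comult A y)"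
 unfolding comult_y
 apply (subst (1 2) bO_def)
 apply (simp add: lift_addD[OF vA vA v3 bF1] lift_addD[OF vA vA v3 bF2] lp(1,2) cl sg d1 comult_y)
 apply (simp add: bO_def lift_addD[OF vA vA v3 bG] lp(3) cl p3a p3c V3.M.a_assoc)
 done
 have s: "liftA A3 (%a b. liftA A3 (%u v. ?p3 u (ptA v b)) (comult A a)) (comult A (\<sigma> h)) =
  liftA A3 (%u v. ?p3 u (comult A v)) (comult A (\<sigma> h))" if h: "h : carrier H" for h
 proof -
 have "liftA A3 (%a b. liftA A3 (%u v. ?p3 u (ptA v b)) (comult A a)) (comult A (\<sigma> h)) =
  liftH A3 (%a b. liftA A3 (%u v. ?p3 u (ptA v (\<sigma> b))) (comult A (\<sigma> a))) (comult H h)"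
  unfolding comult_sig[OF h] fO_def by (rule lift_tensor_map[OF hV hV vA vA sig_lin sig_lin v3 bF1 comultH[OF h]])
 also have "... = liftH A3 (%a b. liftH A3 (%u v. ?p3 (\<sigma> u) (ptA (\<sigma> v) (\<sigma> b))) (comult H a)) (comult H h)"
 proof (rule lift_fcong)
  fix a b assume a: "a : carrier H" and b: "b : carrier H"
  show "liftA A3 (%u v. ?p3 u (ptA v (\<sigma> b))) (comult A (\<sigma> a)) =
   liftH A3 (%u v. ?p3 (\<sigma> u) (ptA (\<sigma> v) (\<sigma> b))) (comult H a)"
  unfolding comult_sig[OF a] fO_def
  by (rule lift_tensor_map[OF hV hV vA vA sig_lin sig_lin v3 bG[OF mono_mem[OF b]] comultH[OF a]])
 qed
 also have "... = liftH A3 (%a b. liftH A3 (%u v. ?p3 (\<sigma> a) (ptA (\<sigma> u) (\<sigma> v))) (comult H b)) (comult H h)"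
  by (rule coassoc[OF hC v3 _ h]) (assumption | rule v3 lin)+
 also have "... = liftH A3 (%u v. ?p3 (\<sigma> u) (comult A (\<sigma> v))) (comult H h)"
 proof (rule lift_fcong)
  fix a b assume a: "a : carrier H" and b: "b : carrier H"
  show "liftH A3 (%u v. ?p3 (\<sigma> a) (ptA (\<sigma> u) (\<sigma> v))) (comult H b) = ?p3 (\<sigma> a) (comult A (\<sigma> b))"
  unfolding comult_sig[OF b] fO_eq
  by (rule liftH_out[OF vAA pt_sig_bilin v3 bilin_lin1[OF bilin_pure[OF vA vAA] mono_mem[OF a]] b, symmetric])
 qed
 also have "... = liftA A3 (%u v. ?p3 u (comult A v)) (comult A (\<sigma> h))"
  unfolding comult_sig[OF h] fO_def by (rule lift_tensor_map[OF hV hV vA vA sig_lin sig_lin v3 bF2 comultH[OF h], symmetric])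
 finally show ?thesis .
 qed
 from O.alg_map_eq[OF T3.tensor_k_algebra L1 L2 _ _ c] y s show ?thesis by blast
qed

lemma coalg_A: "coalgebra K A"
 unfolding coalgebra_def sweedler_def sweedler3_def
 using vA comult_A_lin alg_map_lin[OF counit_A_alg] coassoc_A counit_law_l counit_law_r by blast

lemma bialg_A: "bialgebra K A"
 unfolding bialgebra_def using aA coalg_A comult_A_alg counit_A_alg by blast

end

section \<open>The antipode of \<open>\<O>\<close>\<close>

text \<open>A sequence whose \<open>n\<close>-th term is prescribed by the earlier ones. The auxiliary recursion carries the whole sequence constructed so far.\<close>

lemma course_of_values:
 fixes G :: "nat => (nat => 'a) => 'a"
 assumes c: "c : C" and G: "!!n s. (!!k. s k : C) ==> G n s : C"
 and cong: "!!n s s'. (!!k. s k : C) ==> (!!k. s' k : C) ==> (!!k. k < n ==> s k = s' k) ==> G n s = G n s'"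
 obtains s where "!!n. s n : C" "!!n. s n = G n s"
proof -
 define a where "a = rec_nat (%_. c) (%n s. s(n := G n s))"
 have a: "a 0 k = c" "a (Suc n) k = (if k = n then G n (a n) else a n k)" for n k
 by (simp_all add: a_def)
 have aC: "a n k : C" for n k
 proof (induction n arbitrary: k)
 case (Suc n) then show ?case using G[of "a n" n] by (simp add: a)
 qed (simp add: a c)
 have st: "k < n ==> a n k = a (Suc k) k" for n k
 by (induction n) (auto simp: a less_Suc_eq)
 define s where "s n = a (Suc n) n" for n
 have "s n = G n s" for n
 proof -
 have "G n (a n) = G n s" by (rule cong, rule aC, unfold s_def, rule aC, rule st)
 then show ?thesis by (simp add: s_def a(2))
 qed
 moreover have "s n : C" for n by (simp add: s_def aC)
 ultimately show thesis using that by blast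
qed

context yd_setting
begin

abbreviation gs where "gs == field.gauss K q"

lemma gs_mem: "gs n k : carrier K" by (simp add: q_closed)

lemma mono_mult: "h : carrier H ==> k : carrier H ==> mono m h \<otimes>\<^sub>A \<sigma> k = mono m (h \<otimes>\<^sub>H k)"
 by (simp add: O.mult_mono)

lemma lift_comult_mono:
 assumes M: "vectorspace K M" and F: "bilinear_map K A A M F" and h: "h : carrier H"
 shows "liftA M F (comult A (mono n h)) =
 finsum M (%k. gs n k \<odot>\<^sub>M liftH M (%x v. F (mono k (g [^]\<^sub>H (n - k) \<otimes>\<^sub>H x)) (mono (n - k) v)) (comult H h)) {..n}"
proof -
 interpret M: vectorspace K M by (rule M)
 define L where "L s = liftA M F (s \<otimes>\<^sub>TA fO h)" for s
 have L: "L : lin_maps K AA M"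
 unfolding L_def[abs_def] by (rule lin_comp[OF lift_spec(1)[OF vA vA M F] TA_lin_r[OF fO_mem'[OF h]]])
 have Le: "L (ee i j) = liftH M (%x v. F (mono i (g [^]\<^sub>H j \<otimes>\<^sub>H x)) (mono j v)) (comult H h)" for i j
 proof -
 have b: "bilinear_map K A A M (%a b. F (mono i (g [^]\<^sub>H j) \<otimes>\<^sub>A a) (mono j \<one>\<^sub>H \<otimes>\<^sub>A b))"
  by (assumption | rule bilin_comp1[OF F] bilin_comp2[OF F] HR.one_closed lin)+
 have "L (ee i j) = liftA M (%a b. F (mono i (g [^]\<^sub>H j) \<otimes>\<^sub>A a) (mono j \<one>\<^sub>H \<otimes>\<^sub>A b)) (fO h)"
  unfolding L_def ee_def
  by (rule lift_pure_mult[OF aA aA M F mono_mem[OF gpow_mem] mono_mem[OF HR.one_closed] fO_mem'[OF h]])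
 also have "... = liftH M (%x v. F (mono i (g [^]\<^sub>H j) \<otimes>\<^sub>A \<sigma> x) (mono j \<one>\<^sub>H \<otimes>\<^sub>A \<sigma> v)) (comult H h)"
  unfolding fO_def by (rule lift_tensor_map[OF hV hV vA vA sig_lin sig_lin M b comultH[OF h]])
 also have "... = liftH M (%x v. F (mono i (g [^]\<^sub>H j \<otimes>\<^sub>H x)) (mono j v)) (comult H h)"
  by (rule lift_fcong) (simp add: mono_mult gpow_mem)
 finally show ?thesis .
 qed
 have Lc: "L s : carrier M" if "s : carrier AA" for s using lin_mem[OF L that] .
 have "liftA M F (comult A (mono n h)) = L (finsum AA (%k. gs n k \<odot>\<^sub>AA ee k (n - k)) {..n})"
 unfolding comult_mono[OF h] bO_pow_expand L_def ..
 also have "... = finsum M (%k. L (gs n k \<odot>\<^sub>AA ee k (n - k))) {..n}"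
 by (rule lin_finsumD[OF L vAA M]) (simp_all add: gs_mem ee_closed)
 also have "... = finsum M (%k. gs n k \<odot>\<^sub>M L (ee k (n - k))) {..n}"
 by (rule M.finsum_cong') (auto simp: lin_smultD[OF L] gs_mem ee_closed Lc)
 finally show ?thesis unfolding Le .
qed

abbreviation gi where "gi == S g"

lemma gi_closed: "gi : carrier H" by (rule lin_mem[OF S_lin g_mem])

lemma gipow_closed: "gi [^]\<^sub>H (n::nat) : carrier H" by (rule alg_pow_closed[OF hA gi_closed])

lemma gpow_gipow: "g [^]\<^sub>H (n::nat) \<otimes>\<^sub>H gi [^]\<^sub>H n = \<one>\<^sub>H"
proof (induction n)
 case (Suc n)
 have "g [^]\<^sub>H Suc n \<otimes>\<^sub>H gi [^]\<^sub>H Suc n = g [^]\<^sub>H n \<otimes>\<^sub>H (g \<otimes>\<^sub>H gi) \<otimes>\<^sub>H gi [^]\<^sub>H n"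
 by (simp only: HR.nat_pow_Suc[of g] HR.nat_pow_Suc2[OF gi_closed])
  (simp add: HR.m_assoc g_mem gi_closed gpow_mem gipow_closed)
 then show ?case using Suc by (simp add: antipode_g gpow_mem)
qed simp

lemma antipode_g_mult: assumes h: "h : carrier H" shows "S (g \<otimes>\<^sub>H h) = S h \<otimes>\<^sub>H gi"
proof -
 have Sc: "!!x. x : carrier H ==> S x : carrier H" by (rule lin_mem[OF S_lin])
 have bl: "bilinear_map K H H H (%x v. S x \<otimes>\<^sub>H v)" by (assumption | rule lin)+
 have "S (g \<otimes>\<^sub>H h) \<otimes>\<^sub>H g = S h"
 proof (rule convolution_inverse_unique[OF hC hA _ lin_id S_lin _ antipode_r[OF hS] h, where f="%h. S (g \<otimes>\<^sub>H h) \<otimes>\<^sub>H g"])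
 show "(%h. S (g \<otimes>\<^sub>H h) \<otimes>\<^sub>H g) : lin_maps K H H" by (assumption | rule lin)+
 fix c assume c: "c : carrier H"
 have b2: "bilinear_map K H H H (%x v. liftH H (%x' v'. S (x \<otimes>\<^sub>H x') \<otimes>\<^sub>H (v \<otimes>\<^sub>H v')) (comult H c))"
  by (assumption | rule c lin)+
 have "counit H c \<odot>\<^sub>H \<one>\<^sub>H = liftH H (%x v. S x \<otimes>\<^sub>H v) (comult H (g \<otimes>\<^sub>H c))"
  using antipode_l[OF hS, of "g \<otimes>\<^sub>H c"] by (simp add: c g_mem counit_mult g_counit counitH)
 also have "... = liftH H (%x v. S (g \<otimes>\<^sub>H x) \<otimes>\<^sub>H (g \<otimes>\<^sub>H v)) (comult H c)"
  unfolding lift_comult_mult[OF bialg hV bl g_mem c] g_comult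
  by (rule lift_pure[OF hV hV hV b2 g_mem g_mem])
 also have "... = liftH H (%x v. S (g \<otimes>\<^sub>H x) \<otimes>\<^sub>H g \<otimes>\<^sub>H v) (comult H c)"
  by (rule lift_fcong) (simp add: HR.m_assoc Sc g_mem)
 finally show "liftH H (%x v. S (g \<otimes>\<^sub>H x) \<otimes>\<^sub>H g \<otimes>\<^sub>H v) (comult H c) = counit H c \<odot>\<^sub>H \<one>\<^sub>H" ..
 qed
 then have "S h \<otimes>\<^sub>H gi = S (g \<otimes>\<^sub>H h) \<otimes>\<^sub>H (g \<otimes>\<^sub>H gi)"
 using h by (simp add: HR.m_assoc[symmetric] Sc g_mem)
 then show ?thesis using h by (simp add: antipode_g Sc g_mem)
qed

lemma antipode_gpow_mult: "h : carrier H ==> S (g [^]\<^sub>H (n::nat) \<otimes>\<^sub>H h) = S h \<otimes>\<^sub>H gi [^]\<^sub>H n"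
proof (induction n arbitrary: h)
 case 0 then show ?case by (simp add: lin_mem[OF S_lin])
next
 case (Suc n)
 have "S (g [^]\<^sub>H Suc n \<otimes>\<^sub>H h) = S (g [^]\<^sub>H n \<otimes>\<^sub>H (g \<otimes>\<^sub>H h))"
 using Suc.prems by (simp add: HR.m_assoc gpow_mem g_mem)
 also have "... = S h \<otimes>\<^sub>H gi [^]\<^sub>H Suc n"
 unfolding HR.nat_pow_Suc2[OF gi_closed]
 using Suc by (simp add: antipode_g_mult HR.m_assoc g_mem gi_closed gipow_closed lin_mem[OF S_lin])
 finally show ?case .
qed

text \<open>The values at \<open>y\<^sup>n\<close> of a left and of a right convolution inverse of the identity. Because
  \<open>\<Delta>(y\<^sup>n)\<close> is \<open>y\<^sup>n \<otimes> 1\<close> (or \<open>g\<^sup>n \<otimes> y\<^sup>n\<close>) plus terms of smaller degree on the left (on the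
  right), the defining equation of an inverse determines them by recursion, so that no closed
  formula has to be checked.\<close>

lemma left_inverse_values:
 "EX s. (ALL n. s n : carrier A) & (ALL n. finsum A (%k. gs n k \<odot>\<^sub>A
  (\<sigma> (gi [^]\<^sub>H (n - k)) \<otimes>\<^sub>A s k \<otimes>\<^sub>A mono (n - k) \<one>\<^sub>H)) {..n} = (if n = 0 then \<one>\<^sub>A else \<zero>\<^sub>A))"
proof -
 define t where "t n s k = gs n k \<odot>\<^sub>A (\<sigma> (gi [^]\<^sub>H (n - k)) \<otimes>\<^sub>A s k \<otimes>\<^sub>A mono (n - k) \<one>\<^sub>H)" for n s k
 have tc: "t n s k : carrier A" if "s k : carrier A" for n s k
 using that by (simp add: t_def gs_mem mono_mem gipow_closed)
 define G where "G n s = (if n = 0 then \<one>\<^sub>A else \<ominus>\<^sub>A finsum A (t n s) {..<n})" for n s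
 obtain s where s: "!!n. s n : carrier A" and sG: "!!n. s n = G n s"
 proof (rule course_of_values[of "\<one>\<^sub>A" "carrier A" G])
 show "G n s : carrier A" if "!!k. s k : carrier A" for n s
  using that by (auto simp: G_def tc)
 show "G n s = G n s'" if "!!k. s k : carrier A" "!!k. s' k : carrier A" "!!k. k < n ==> s k = s' k" for n s s'
 proof -
  have "finsum A (t n s) {..<n} = finsum A (t n s') {..<n}"
  by (rule AR.finsum_cong'[OF refl]) (auto simp: tc that, simp add: t_def that)
  then show ?thesis by (simp add: G_def)
 qed
 qed auto
 have "finsum A (t n s) {..n} = (if n = 0 then \<one>\<^sub>A else \<zero>\<^sub>A)" for n
 proof -
 have tn: "t n s n = s n"
  using s[of n] by (simp add: t_def q_closed O.A_simps(3)[symmetric])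
 have fc: "finsum A (t n s) {..<n} : carrier A" by (rule AR.finsum_closed) (simp add: tc s)
 have "finsum A (t n s) (insert n {..<n}) = t n s n \<oplus>\<^sub>A finsum A (t n s) {..<n}"
  by (rule AR.finsum_insert) (auto simp: tc s)
 then have "finsum A (t n s) {..n} = s n \<oplus>\<^sub>A finsum A (t n s) {..<n}"
  by (simp add: tn lessThan_Suc_atMost[symmetric] lessThan_Suc)
 then show ?thesis using sG[of n] fc by (simp add: G_def AR.l_neg)
 qed
 then show ?thesis using s unfolding t_def by blast
qed

lemma right_inverse_values:
 "EX s. (ALL n. s n : carrier A) & (ALL n. finsum A (%k. gs n k \<odot>\<^sub>A
  (mono k (g [^]\<^sub>H (n - k)) \<otimes>\<^sub>A s (n - k))) {..n} = (if n = 0 then \<one>\<^sub>A else \<zero>\<^sub>A))"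
proof -
 define t where "t n s k = gs n k \<odot>\<^sub>A (mono k (g [^]\<^sub>H (n - k)) \<otimes>\<^sub>A s (n - k))" for n s k
 have tc: "t n s k : carrier A" if "s (n - k) : carrier A" for n s k
 using that by (simp add: t_def gs_mem mono_mem gpow_mem)
 define G where "G n s = (if n = 0 then \<one>\<^sub>A else \<sigma> (gi [^]\<^sub>H n) \<otimes>\<^sub>A (\<ominus>\<^sub>A finsum A (t n s) {1..n}))" for n s
 obtain s where s: "!!n. s n : carrier A" and sG: "!!n. s n = G n s"
 proof (rule course_of_values[of "\<one>\<^sub>A" "carrier A" G])
 show "G n s : carrier A" if "!!k. s k : carrier A" for n s
  using that by (auto simp: G_def tc mono_mem gipow_closed)
 show "G n s = G n s'" if "!!k. s k : carrier A" "!!k. s' k : carrier A" "!!k. k < n ==> s k = s' k" for n s s'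
 proof -
  have "finsum A (t n s) {1..n} = finsum A (t n s') {1..n}"
  by (rule AR.finsum_cong'[OF refl]) (auto simp: tc that, simp add: t_def that)
  then show ?thesis by (simp add: G_def)
 qed
 qed auto
 have "finsum A (t n s) {..n} = (if n = 0 then \<one>\<^sub>A else \<zero>\<^sub>A)" for n
 proof -
 have t0: "t n s 0 = \<sigma> (g [^]\<^sub>H n) \<otimes>\<^sub>A s n"
  using s[of n] by (simp add: t_def mono_mem gpow_mem)
 have fc: "finsum A (t n s) {1..n} : carrier A" by (rule AR.finsum_closed) (simp add: tc s)
 have "finsum A (t n s) (insert 0 {1..n}) = t n s 0 \<oplus>\<^sub>A finsum A (t n s) {1..n}"
  by (rule AR.finsum_insert) (auto simp: tc s)
 moreover have "insert 0 {1..n} = {..n}" by auto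
 ultimately have e: "finsum A (t n s) {..n} = \<sigma> (g [^]\<^sub>H n) \<otimes>\<^sub>A s n \<oplus>\<^sub>A finsum A (t n s) {1..n}"
  by (simp add: t0)
 show ?thesis
 proof (cases "n = 0")
  case True then show ?thesis using e sG[of 0] by (simp add: G_def O.A_simps(3)[symmetric])
 next
  case False
  have "\<sigma> (g [^]\<^sub>H n) \<otimes>\<^sub>A s n = \<sigma> (g [^]\<^sub>H n) \<otimes>\<^sub>A \<sigma> (gi [^]\<^sub>H n) \<otimes>\<^sub>A (\<ominus>\<^sub>A finsum A (t n s) {1..n})"
  using False fc sG[of n] by (simp add: G_def AR.m_assoc mono_mem gpow_mem gipow_closed)
  also have "... = \<ominus>\<^sub>A finsum A (t n s) {1..n}"
  using fc by (simp add: sig_mult gpow_mem gipow_closed gpow_gipow O.A_simps(3)[symmetric])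
  finally show ?thesis using e False fc by (simp add: AR.l_neg)
 qed
 qed
 then show ?thesis using s unfolding t_def by blast
qed

lemma hopf_A: "hopf_algebra K A"
proof -
 obtain s where s: "!!n. s n : carrier A" and ss: "!!n. finsum A (%k. gs n k \<odot>\<^sub>A
  (\<sigma> (gi [^]\<^sub>H (n - k)) \<otimes>\<^sub>A s k \<otimes>\<^sub>A mono (n - k) \<one>\<^sub>H)) {..n} = (if n = 0 then \<one>\<^sub>A else \<zero>\<^sub>A)"
 using left_inverse_values by blast
 obtain r where r: "!!n. r n : carrier A" and rr: "!!n. finsum A (%k. gs n k \<odot>\<^sub>A
  (mono k (g [^]\<^sub>H (n - k)) \<otimes>\<^sub>A r (n - k))) {..n} = (if n = 0 then \<one>\<^sub>A else \<zero>\<^sub>A)"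
 using right_inverse_values by blast
 have Sc: "!!x. x : carrier H ==> S x : carrier H" by (rule lin_mem[OF S_lin])
 note cl = mono_mem gpow_mem gipow_closed Sc s r
 define SL where "SL = O.dlift A (%i h. \<sigma> (S h) \<otimes>\<^sub>A s i)"
 define SR where "SR = O.dlift A (%i h. \<sigma> (S h) \<otimes>\<^sub>A r i)"
 have L1: "(%h. \<sigma> (S h) \<otimes>\<^sub>A s i) : lin_maps K H A" and L2: "(%h. \<sigma> (S h) \<otimes>\<^sub>A r i) : lin_maps K H A" for i
 by (assumption | rule s r lin)+
 have SL: "SL : lin_maps K A A" and SR: "SR : lin_maps K A A"
 unfolding SL_def SR_def by (rule O.dlift_lin[OF vA L1] O.dlift_lin[OF vA L2])+
 have SLm: "SL (mono n h) = \<sigma> (S h) \<otimes>\<^sub>A s n" and SRm: "SR (mono n h) = \<sigma> (S h) \<otimes>\<^sub>A r n"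
 if "n < N" "h : carrier H" for n h
 unfolding SL_def SR_def by (rule O.dlift_mono[OF vA L1 that] O.dlift_mono[OF vA L2 that])+
 have bL: "bilinear_map K A A A (%u v. SL u \<otimes>\<^sub>A v)" and bR: "bilinear_map K A A A (%u v. u \<otimes>\<^sub>A SR v)"
 by (assumption | rule lin_comp[OF SL] lin_comp[OF SR] lin_mem[OF SL] lin_mem[OF SR] lin)+
 have e1: "(%c. counit A c \<odot>\<^sub>A \<one>\<^sub>A) : lin_maps K A A"
 by (assumption | rule AR.one_closed lin)+
 have l: "liftA A (%u v. SL u \<otimes>\<^sub>A v) (comult A c) = counit A c \<odot>\<^sub>A \<one>\<^sub>A" if c: "c : carrier A" for c
 proof (rule O.A_lin_eq[OF vA _ e1 _ c, where F="%c. liftA A (%u v. SL u \<otimes>\<^sub>A v) (comult A c)"])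
 show "(%c. liftA A (%u v. SL u \<otimes>\<^sub>A v) (comult A c)) : lin_maps K A A"
  by (rule lin_comp[OF lift_spec(1)[OF vA vA vA bL] comult_A_lin])
 fix n h assume n: "n < N" and h: "h : carrier H"
 define Q where "Q W = liftH A (%x v. \<sigma> (S x) \<otimes>\<^sub>A W \<otimes>\<^sub>A \<sigma> v) (comult H h)" for W
 define W where "W k = \<sigma> (gi [^]\<^sub>H (n - k)) \<otimes>\<^sub>A s k \<otimes>\<^sub>A mono (n - k) \<one>\<^sub>H" for k
 have Wc: "W k : carrier A" for k by (simp add: W_def cl)
 have Q: "Q : lin_maps K A A" unfolding Q_def[abs_def] by (assumption | rule h lin)+
 have "liftA A (%u v. SL u \<otimes>\<^sub>A v) (comult A (mono n h)) =
  finsum A (%k. gs n k \<odot>\<^sub>A liftH A (%x v. SL (mono k (g [^]\<^sub>H (n - k) \<otimes>\<^sub>H x)) \<otimes>\<^sub>A mono (n - k) v) (comult H h)) {..n}"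
  by (rule lift_comult_mono[OF vA bL h])
 also have "... = finsum A (%k. Q (gs n k \<odot>\<^sub>A W k)) {..n}"
 proof (rule AR.finsum_cong'[OF refl])
  fix k assume "k : {..n}"
  then have kN: "k < N" using n by simp
  have "liftH A (%x v. SL (mono k (g [^]\<^sub>H (n - k) \<otimes>\<^sub>H x)) \<otimes>\<^sub>A mono (n - k) v) (comult H h) = Q (W k)"
  unfolding Q_def
  proof (rule lift_fcong)
  fix x v assume x: "x : carrier H" and v: "v : carrier H"
  have "SL (mono k (g [^]\<^sub>H (n - k) \<otimes>\<^sub>H x)) = \<sigma> (S x) \<otimes>\<^sub>A \<sigma> (gi [^]\<^sub>H (n - k)) \<otimes>\<^sub>A s k"
   using x by (simp add: SLm[OF kN] antipode_gpow_mult sig_mult cl)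
  moreover have "mono (n - k) v = mono (n - k) \<one>\<^sub>H \<otimes>\<^sub>A \<sigma> v" using v by (simp add: mono_mult)
  ultimately show "SL (mono k (g [^]\<^sub>H (n - k) \<otimes>\<^sub>H x)) \<otimes>\<^sub>A mono (n - k) v = \<sigma> (S x) \<otimes>\<^sub>A W k \<otimes>\<^sub>A \<sigma> v"
   using x v by (simp only: W_def AR.m_assoc cl AR.m_closed HR.one_closed)
  qed
  then show "gs n k \<odot>\<^sub>A liftH A (%x v. SL (mono k (g [^]\<^sub>H (n - k) \<otimes>\<^sub>H x)) \<otimes>\<^sub>A mono (n - k) v) (comult H h) = Q (gs n k \<odot>\<^sub>A W k)"
  by (simp only: lin_smultD[OF Q gs_mem Wc])
 qed (use lin_mem[OF Q] Wc gs_mem in auto)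
 also have "... = Q (finsum A (%k. gs n k \<odot>\<^sub>A W k) {..n})"
  by (rule lin_finsumD[OF Q vA vA, symmetric]) (simp_all add: gs_mem Wc)
 also have "... = Q (if n = 0 then \<one>\<^sub>A else \<zero>\<^sub>A)" unfolding W_def ss ..
 also have "... = counit A (mono n h) \<odot>\<^sub>A \<one>\<^sub>A"
 proof (cases "n = 0")
  case True
  have bS: "bilinear_map K H H H (%x y. S x \<otimes>\<^sub>H y)" by (assumption | rule lin)+
  have "Q \<one>\<^sub>A = liftH A (%x v. \<sigma> (S x \<otimes>\<^sub>H v)) (comult H h)"
  unfolding Q_def by (rule lift_fcong) (simp add: cl sig_mult)
  also have "... = \<sigma> (counit H h \<odot>\<^sub>H \<one>\<^sub>H)"
  unfolding antipode_l[OF hS h, symmetric] by (rule liftH_out[OF hV bS vA sig_lin h, symmetric])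
  also have "... = counit H h \<odot>\<^sub>A \<one>\<^sub>A" by (simp add: lin_smultD[OF sig_lin] counitH h O.A_simps(3))
  finally show ?thesis using True h by (simp add: counit_mono)
 next
  case False then show ?thesis using h by (simp add: counit_mono lin_zeroD[OF Q vA vA])
 qed
 finally show "liftA A (%u v. SL u \<otimes>\<^sub>A v) (comult A (mono n h)) = counit A (mono n h) \<odot>\<^sub>A \<one>\<^sub>A" .
 qed
 have rt: "liftA A (%u v. u \<otimes>\<^sub>A SR v) (comult A c) = counit A c \<odot>\<^sub>A \<one>\<^sub>A" if c: "c : carrier A" for c
 proof (rule O.A_lin_eq[OF vA _ e1 _ c, where F="%c. liftA A (%u v. u \<otimes>\<^sub>A SR v) (comult A c)"])
 show "(%c. liftA A (%u v. u \<otimes>\<^sub>A SR v) (comult A c)) : lin_maps K A A"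
  by (rule lin_comp[OF lift_spec(1)[OF vA vA vA bR] comult_A_lin])
 fix n h assume n: "n < N" and h: "h : carrier H"
 define W where "W k = mono k (g [^]\<^sub>H (n - k)) \<otimes>\<^sub>A r (n - k)" for k
 have Wc: "W k : carrier A" for k by (simp add: W_def cl)
 have bS: "bilinear_map K H H H (%x y. x \<otimes>\<^sub>H S y)" by (assumption | rule lin)+
 have "liftA A (%u v. u \<otimes>\<^sub>A SR v) (comult A (mono n h)) =
  finsum A (%k. gs n k \<odot>\<^sub>A liftH A (%x v. mono k (g [^]\<^sub>H (n - k) \<otimes>\<^sub>H x) \<otimes>\<^sub>A SR (mono (n - k) v)) (comult H h)) {..n}"
  by (rule lift_comult_mono[OF vA bR h])
 also have "... = finsum A (%k. counit H h \<odot>\<^sub>A (gs n k \<odot>\<^sub>A W k)) {..n}"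
 proof (rule AR.finsum_cong'[OF refl])
  fix k assume "k : {..n}"
  have kN: "n - k < N" using n by simp
  have lw: "(%w. mono k (g [^]\<^sub>H (n - k)) \<otimes>\<^sub>A \<sigma> w \<otimes>\<^sub>A r (n - k)) : lin_maps K H A"
  by (assumption | rule r lin)+
  have "liftH A (%x v. mono k (g [^]\<^sub>H (n - k) \<otimes>\<^sub>H x) \<otimes>\<^sub>A SR (mono (n - k) v)) (comult H h) =
  liftH A (%x v. mono k (g [^]\<^sub>H (n - k)) \<otimes>\<^sub>A \<sigma> (x \<otimes>\<^sub>H S v) \<otimes>\<^sub>A r (n - k)) (comult H h)"
  proof (rule lift_fcong)
  fix x v assume x: "x : carrier H" and v: "v : carrier H"
  have "mono k (g [^]\<^sub>H (n - k) \<otimes>\<^sub>H x) = mono k (g [^]\<^sub>H (n - k)) \<otimes>\<^sub>A \<sigma> x"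
   using x by (simp add: mono_mult gpow_mem)
  moreover have "\<sigma> (x \<otimes>\<^sub>H S v) = \<sigma> x \<otimes>\<^sub>A \<sigma> (S v)" using x v by (simp add: sig_mult cl)
  ultimately show "mono k (g [^]\<^sub>H (n - k) \<otimes>\<^sub>H x) \<otimes>\<^sub>A SR (mono (n - k) v) =
   mono k (g [^]\<^sub>H (n - k)) \<otimes>\<^sub>A \<sigma> (x \<otimes>\<^sub>H S v) \<otimes>\<^sub>A r (n - k)"
   using x v by (simp only: SRm[OF kN] AR.m_assoc cl AR.m_closed)
  qed
  also have "... = mono k (g [^]\<^sub>H (n - k)) \<otimes>\<^sub>A \<sigma> (counit H h \<odot>\<^sub>H \<one>\<^sub>H) \<otimes>\<^sub>A r (n - k)"
  unfolding antipode_r[OF hS h, symmetric] by (rule liftH_out[OF hV bS vA lw h, symmetric])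
  also have "... = counit H h \<odot>\<^sub>A W k"
  using h by (simp add: lin_smultD[OF lw] counitH) (simp add: W_def O.A_simps(3)[symmetric] cl)
  finally show "gs n k \<odot>\<^sub>A liftH A (%x v. mono k (g [^]\<^sub>H (n - k) \<otimes>\<^sub>H x) \<otimes>\<^sub>A SR (mono (n - k) v)) (comult H h) =
   counit H h \<odot>\<^sub>A (gs n k \<odot>\<^sub>A W k)"
  using Wc[of k] gs_mem[of n k] counitH[OF h] by (simp only: AV.smult_assoc1[symmetric] K.m_comm)
 qed (use Wc gs_mem counitH[OF h] in auto)
 also have "... = counit H h \<odot>\<^sub>A finsum A (%k. gs n k \<odot>\<^sub>A W k) {..n}"
  by (rule lin_finsumD[OF lin_smult_const[OF vA lin_id counitH[OF h]] vA vA, symmetric]) (simp_all add: gs_mem Wc)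
 also have "... = counit H h \<odot>\<^sub>A (if n = 0 then \<one>\<^sub>A else \<zero>\<^sub>A)" unfolding W_def rr ..
 also have "... = counit A (mono n h) \<odot>\<^sub>A \<one>\<^sub>A" using h by (simp add: counit_mono counitH)
 finally show "liftA A (%u v. u \<otimes>\<^sub>A SR v) (comult A (mono n h)) = counit A (mono n h) \<odot>\<^sub>A \<one>\<^sub>A" .
 qed
 show ?thesis by (rule hopf_algebra_one_sided[OF bialg_A SL SR l rt])
qed

lemma sig_coalg: "\<sigma> : coalgebra_maps K H A"
 unfolding coalgebra_maps_def using sig_lin by (auto simp: comult_sig fO_def counit_mono)

lemma sig_hopf: "\<sigma> : hopf_maps K H A"
 by (rule bialg_map_hopf[OF hopf hopf_A]) (simp add: bialgebra_maps_def sig_alg sig_coalg)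

lemma sig_inj: "inj_on \<sigma> (carrier H)"
proof (rule inj_onI)
 fix h k assume hk: "h : carrier H" "k : carrier H" "\<sigma> h = \<sigma> k"
 from fun_cong[OF hk(3), of 0] show "h = k"
 unfolding O.mono_small[OF N_pos hk(1)] O.mono_small[OF N_pos hk(2)] by simp
qed

end

section \<open>Bases and their dual functionals\<close>

lemma submodule_span_induct:
 assumes V: "vectorspace K V" and B: "B \<subseteq> carrier V" and sp: "vectorspace.basis K V B"
 and v: "v : carrier V" and P: "submodule K W V" "B \<subseteq> W"
 shows "v : W"
proof -
 interpret V: vectorspace K V by (rule V)
 have "v : V.span B" using sp v by (simp add: V.basis_def)
 then show ?thesis using V.span_is_subset[OF P(2,1)] by blast
qed

lemma submoduleI':
 assumes V: "vectorspace K V" and "W \<subseteq> carrier V" "\<zero>\<^sub>V : W"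
 "!!v w. v : W ==> w : W ==> v \<oplus>\<^sub>V w : W" "!!c v. c : carrier K ==> v : W ==> c \<odot>\<^sub>V v : W"
 shows "submodule K W V"
 using assms(2-) by (intro submodule.intro vs_module[OF V])

lemma basis_lin_eq:
 assumes V: "vectorspace K V" and M: "vectorspace K M" and B: "vectorspace.basis K V B"
 and F: "F : lin_maps K V M" and G: "G : lin_maps K V M" and eq: "!!b. b : B ==> F b = G b"
 and v: "v : carrier V"
 shows "F v = G v"
proof -
 interpret V: vectorspace K V by (rule V)
 have Bc: "B \<subseteq> carrier V" using B by (simp add: V.basis_def)
 have "v : {v : carrier V. F v = G v}"
 by (rule submodule_span_induct[OF V Bc B v], rule submoduleI'[OF V])
  (use Bc eq in \<open>auto simp: lin_addD[OF F] lin_addD[OF G] lin_smultD[OF F] lin_smultD[OF G]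
  lin_zeroD[OF F V M] lin_zeroD[OF G V M]\<close>)
 then show ?thesis by simp
qed

definition dual_to :: "('k, 'c) ring_scheme => ('k, 'a, 'm) module_scheme => 'a set => 'a => ('a => 'k) => bool" where
 "dual_to K V B b l \<longleftrightarrow> l : lin_maps K V (base_module K) & l b = \<one>\<^sub>K & (ALL b':B. b' ~= b --> l b' = \<zero>\<^sub>K)"

lemma dual_lincomb:
 assumes V: "vectorspace K V" and l: "dual_to K V B b l" and A: "finite A" "A \<subseteq> B" "B \<subseteq> carrier V"
 and a: "a : A \<rightarrow> carrier K" and b: "b : A"
 shows "l (module.lincomb V a A) = a b"
proof -
 interpret V: vectorspace K V by (rule V)
 interpret KB: vectorspace K "base_module K" by (rule base_vs[OF vs_field[OF V]])
 have ll: "l : lin_maps K V (base_module K)" using l by (simp add: dual_to_def)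
 have lc: "l v : carrier K" if "v : carrier V" for v using lin_mem[OF ll that] by simp
 have "l (module.lincomb V a A) = finsum (base_module K) (%v. l (a v \<odot>\<^sub>V v)) A"
 unfolding V.lincomb_def by (rule lin_finsumD[OF ll V KB.vectorspace_axioms A(1)]) (use A a in \<open>auto intro!: V.smult_closed\<close>)
 also have "... = finsum (base_module K) (%v. if b = v then a v else \<zero>\<^bsub>base_module K\<^esub>) A"
 proof (rule KB.finsum_cong'[OF refl])
 fix v assume v: "v : A"
 then have "a v : carrier K" "v : carrier V" "v : B" using A a by auto
 then show "l (a v \<odot>\<^sub>V v) = (if b = v then a v else \<zero>\<^bsub>base_module K\<^esub>)"
  using l lin_smultD[OF ll] by (auto simp: dual_to_def)
 qed (use a in auto)
 also have "... = a b" using KB.M.add.finprod_singleton[OF b A(1), of a] a by auto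
 finally show ?thesis .
qed

text \<open>A dual functional for each element of a spanning set shows its linear independence. In this form a basis can be recognised without coordinates.\<close>

lemma dual_imp_basis:
 assumes V: "vectorspace K V" and B: "B \<subseteq> carrier V"
 and sp: "!!W. submodule K W V ==> B \<subseteq> W ==> carrier V \<subseteq> W"
 and dual: "!!b. b : B ==> EX l. dual_to K V B b l"
 shows "vectorspace.basis K V B"
proof -
 interpret V: vectorspace K V by (rule V)
 have "V.gen_set B"
 using sp[OF V.span_is_submodule[OF B] V.in_own_span[OF B]] V.span_is_subset2[OF B] by blast
 moreover have "V.lin_indpt B"
 proof
 assume "V.lin_dep B"
 then obtain A a v where A: "finite A" "A \<subseteq> B" "a : A \<rightarrow> carrier K" "V.lincomb a A = \<zero>\<^sub>V" "v : A" "a v ~= \<zero>\<^sub>K"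
  unfolding V.lin_dep_def by blast
 then obtain l where l: "dual_to K V B v l" using dual by blast
 have "a v = l \<zero>\<^sub>V" using dual_lincomb[OF V l A(1,2) B A(3,5)] A(4) by simp
 also have "... = \<zero>\<^sub>K" using l lin_zeroD[of l K V "base_module K"] V base_vs[OF vs_field[OF V]]
  by (simp add: dual_to_def)
 finally show False using A(6) by simp
 qed
 ultimately show ?thesis using B by (simp add: V.basis_def)
qed

text \<open>Every vector is \<open>k b + w\<close> with \<open>w\<close> in the span of the other basis vectors, in a unique way; the functional is \<open>k\<close>.\<close>

lemma basis_dual_exists:
 assumes V: "vectorspace K V" and B: "vectorspace.basis K V B" and b: "b : B"
 shows "EX l. dual_to K V B b l"
proof -
 interpret V: vectorspace K V by (rule V)
 have Bc: "B \<subseteq> carrier V" and li: "V.lin_indpt B" using B by (auto simp: V.basis_def)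
 define W where "W = V.span (B - {b})"
 have bc: "b : carrier V" using b Bc by auto
 have sub: "submodule K W V" unfolding W_def by (rule V.span_is_submodule) (use Bc in auto)
 interpret W: submodule K W V by (rule sub)
 have WV: "w : W ==> w : carrier V" for w using W.subset by blast
 have bW: "b \<notin> W"
 proof
 assume "b : W"
 then have "V.lin_dep ((B - {b}) \<union> {b})"
  using V.lin_dep_iff_in_span[of "B - {b}" b] V.subset_li_is_li[OF li, of "B - {b}"] Bc bc by (auto simp: W_def)
 moreover have "(B - {b}) \<union> {b} = B" using b by auto
 ultimately show False using li by simp
 qed
 have neg: "\<ominus>\<^sub>V w : W" if "w : W" for w
 proof -
 have "(\<ominus>\<^sub>K \<one>\<^sub>K) \<odot>\<^sub>V w : W" using that by (intro W.smult_closed) auto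
 then show ?thesis using WV[OF that] by (simp add: V.smult_l_minus)
 qed
 define R where "R v k \<longleftrightarrow> k : carrier K & (EX w:W. v = w \<oplus>\<^sub>V k \<odot>\<^sub>V b)" for v k
 have Radd: "R (v \<oplus>\<^sub>V v') (k \<oplus>\<^sub>K k')" if r: "R v k" "R v' k'" for v v' k k'
 proof -
 obtain w w' where w: "w : W" "w' : W" "v = w \<oplus>\<^sub>V k \<odot>\<^sub>V b" "v' = w' \<oplus>\<^sub>V k' \<odot>\<^sub>V b" "k : carrier K" "k' : carrier K"
  using r unfolding R_def by blast
 then have "v \<oplus>\<^sub>V v' = (w \<oplus>\<^sub>V w') \<oplus>\<^sub>V (k \<oplus>\<^sub>K k') \<odot>\<^sub>V b"
  using WV bc by (simp add: V.smult_l_distr V.M.a_ac)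
 then show ?thesis using w unfolding R_def by blast
 qed
 have Rsm: "R (c \<odot>\<^sub>V v) (c \<otimes>\<^sub>K k)" if r: "R v k" and c: "c : carrier K" for v k c
 proof -
 obtain w where w: "w : W" "v = w \<oplus>\<^sub>V k \<odot>\<^sub>V b" "k : carrier K" using r unfolding R_def by blast
 then have "c \<odot>\<^sub>V v = c \<odot>\<^sub>V w \<oplus>\<^sub>V (c \<otimes>\<^sub>K k) \<odot>\<^sub>V b"
  using WV bc c by (simp add: V.smult_r_distr V.smult_assoc1)
 then show ?thesis using w c unfolding R_def by blast
 qed
 have R0: "R w \<zero>\<^sub>K" if "w : W" for w using that WV bc unfolding R_def by auto
 have Rb: "R b \<one>\<^sub>K" using bc unfolding R_def by (auto intro!: bexI[of _ "\<zero>\<^sub>V"])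
 have ex: "EX k. R v k" if v: "v : carrier V" for v
 proof -
 have "v : {v : carrier V. EX k. R v k}"
 proof (rule submodule_span_induct[OF V Bc B v], rule submoduleI'[OF V])
  show "B \<subseteq> {v : carrier V. EX k. R v k}"
  proof
  fix b' assume b': "b' : B"
  show "b' : {v : carrier V. EX k. R v k}"
  proof (cases "b' = b")
   case False
   then have "b' : W" unfolding W_def using V.in_own_span[of "B - {b}"] b' Bc by auto
   then show ?thesis using R0 WV by blast
  qed (use Rb bc in auto)
  qed
  show "\<zero>\<^sub>V : {v : carrier V. EX k. R v k}" using R0[OF W.zero_closed] by auto
  show "v \<oplus>\<^sub>V w : {v : carrier V. EX k. R v k}"
  if "v : {v : carrier V. EX k. R v k}" "w : {v : carrier V. EX k. R v k}" for v w
  using that Radd by blast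
  show "c \<odot>\<^sub>V v : {v : carrier V. EX k. R v k}"
  if "c : carrier K" "v : {v : carrier V. EX k. R v k}" for v c
  using that Rsm by blast
 qed auto
 then show ?thesis by simp
 qed
 have uniq: "k = k'" if r: "R v k" "R v k'" for v k k'
 proof (rule ccontr)
 assume ne: "k ~= k'"
 have k: "k : carrier K" "k' : carrier K" using r by (auto simp: R_def)
 let ?d = "k \<ominus>\<^sub>K k'"
 have "R ((\<ominus>\<^sub>K \<one>\<^sub>K) \<odot>\<^sub>V v) ((\<ominus>\<^sub>K \<one>\<^sub>K) \<otimes>\<^sub>K k')" by (rule Rsm[OF r(2)]) simp
 from Radd[OF r(1) this] have "R (v \<oplus>\<^sub>V (\<ominus>\<^sub>K \<one>\<^sub>K) \<odot>\<^sub>V v) ?d" using k by (simp add: V.R.minus_eq V.R.l_minus)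
 moreover have "v : carrier V" using r(1) WV bc unfolding R_def by auto
 ultimately have "R \<zero>\<^sub>V ?d" by (simp add: V.smult_l_minus V.M.r_neg)
 then obtain w where w: "w : W" "\<zero>\<^sub>V = w \<oplus>\<^sub>V ?d \<odot>\<^sub>V b" unfolding R_def by blast
 have dc: "?d : carrier K" using k by simp
 have "?d \<odot>\<^sub>V b = \<ominus>\<^sub>V w"
  using w(2) WV[OF w(1)] bc dc by (metis V.M.add.inv_equality V.M.add.m_comm V.smult_closed V.M.minus_equality)
 then have dW: "?d \<odot>\<^sub>V b : W" using neg[OF w(1)] by simp
 have du: "?d : Units K" using ne k V.field_Units by (simp add: V.R.r_right_minus_eq)
 have ic: "inv\<^bsub>K\<^esub> ?d : carrier K" using du V.R.Units_inv_closed by blast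
 have "inv\<^bsub>K\<^esub> ?d \<odot>\<^sub>V (?d \<odot>\<^sub>V b) = (inv\<^bsub>K\<^esub> ?d \<otimes>\<^sub>K ?d) \<odot>\<^sub>V b"
  by (rule V.smult_assoc1[OF ic dc bc, symmetric])
 also have "... = b" using V.R.Units_l_inv[OF du] bc by simp
 finally show False using W.smult_closed[OF ic dW] bW by simp
 qed
 define l where "l v = (THE k. R v k)" for v
 have l: "l v = k" if "R v k" for v k unfolding l_def using that uniq by blast
 have Rl: "R v (l v)" if "v : carrier V" for v using ex[OF that] l by metis
 have "l : lin_maps K V (base_module K)"
 proof (rule lin_mapsI)
 show "l v : carrier (base_module K)" if "v : carrier V" for v using Rl[OF that] by (simp add: R_def)
 show "l (v \<oplus>\<^sub>V v') = l v \<oplus>\<^bsub>base_module K\<^esub> l v'" if "v : carrier V" "v' : carrier V" for v v'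
  using l[OF Radd[OF Rl[OF that(1)] Rl[OF that(2)]]] by simp
 show "l (c \<odot>\<^sub>V v) = c \<odot>\<^bsub>base_module K\<^esub> l v" if "c : carrier K" "v : carrier V" for c v
  using l[OF Rsm[OF Rl[OF that(2)] that(1)]] by simp
 qed
 moreover have "l b = \<one>\<^sub>K" using l Rb by blast
 moreover have "l b' = \<zero>\<^sub>K" if "b' : B" "b' ~= b" for b'
 using l[OF R0[of b']] V.in_own_span[of "B - {b}"] that Bc unfolding W_def by auto
 ultimately show ?thesis unfolding dual_to_def by blast
qed

lemma basis_dual_zero:
 assumes V: "vectorspace K V" and B: "vectorspace.basis K V B" and v: "v : carrier V"
 and z: "!!b l. b : B ==> dual_to K V B b l ==> l v = \<zero>\<^sub>K"
 shows "v = \<zero>\<^sub>V"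
proof -
 interpret V: vectorspace K V by (rule V)
 have Bc: "B \<subseteq> carrier V" using B by (simp add: V.basis_def)
 have "v : V.span B" using B v by (simp add: V.basis_def)
 then obtain a A where A: "finite A" "A \<subseteq> B" "a : A \<rightarrow> carrier K" "v = V.lincomb a A"
 unfolding V.span_def by blast
 have "a b = \<zero>\<^sub>K" if b: "b : A" for b
 proof -
 obtain l where l: "dual_to K V B b l" using basis_dual_exists[OF V B] b A by blast
 show ?thesis using dual_lincomb[OF V l A(1,2) Bc A(3) b] z[OF _ l] A b by auto
 qed
 then have "V.lincomb a A = finsum V (%_. \<zero>\<^sub>V) A"
 unfolding V.lincomb_def using A Bc by (intro V.finsum_cong'[OF refl]) auto
 then show ?thesis using A(4) by simp
qed

lemma basis_exists:
 assumes V: "vectorspace K V"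
 shows "EX B. vectorspace.basis K V B"
proof -
 interpret V: vectorspace K V by (rule V)
 let ?P = "%B. B \<subseteq> carrier V & V.lin_indpt B"
 have "EX M:(Collect ?P). ALL D:(Collect ?P). M \<subseteq> D --> D = M"
 proof (rule subset_Zorn)
 fix C assume C: "subset.chain (Collect ?P) C"
 have ch: "D \<subseteq> E \<or> E \<subseteq> D" if "D : C" "E : C" for D E
  using C that unfolding subset.chain_def by blast
 have CP: "?P D" if "D : C" for D using C that by (auto simp: subset.chain_def)
 show "EX U:(Collect ?P). ALL D:C. D \<subseteq> U"
 proof (cases "C = {}")
  case True
  then show ?thesis by (intro bexI[of _ "{}"]) (auto simp: V.lin_dep_def)
 next
  case False
  have fin: "finite A ==> A \<subseteq> (\<Union>C) ==> EX D:C. A \<subseteq> D" for A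
  proof (induction A rule: finite_induct)
  case empty then show ?case using False by auto
  next
  case (insert a A)
  then obtain D E where "D : C" "A \<subseteq> D" "E : C" "a : E" by auto
  then show ?case using ch[of D E] by (metis insert_subset subset_trans subsetD)
  qed
  have "V.lin_indpt ((\<Union>C))"
  proof
  assume "V.lin_dep ((\<Union>C))"
  then obtain A a v where A: "finite A" "A \<subseteq> (\<Union>C)" "a : A \<rightarrow> carrier K" "V.lincomb a A = \<zero>\<^sub>V" "v : A" "a v ~= \<zero>\<^sub>K"
   unfolding V.lin_dep_def by blast
  then obtain D where "D : C" "A \<subseteq> D" using fin by blast
  then have "V.lin_dep D" using A unfolding V.lin_dep_def by blast
  then show False using CP \<open>D \<in> C\<close> by blast
  qed
  then show ?thesis using CP by (intro bexI[of _ "(\<Union>C)"]) auto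
 qed
 qed
 then obtain M where M: "?P M" "!!D. ?P D ==> M \<subseteq> D ==> D = M" by auto
 have "maximal M ?P" unfolding maximal_def using M by blast
 from V.max_li_is_gen[OF this] show ?thesis using M(1) unfolding V.basis_def by blast
qed

lemma submodule_finsum:
 assumes V: "vectorspace K V" and W: "submodule K W V" and f: "finite I" "!!i. i : I ==> f i : W"
 shows "finsum V f I : W"
 using f
proof (induction I rule: finite_induct)
 interpret V: vectorspace K V by (rule V)
 interpret W: submodule K W V by (rule W)
 { case empty then show ?case by simp }
 case (insert i I)
 then have "f : insert i I \<rightarrow> carrier V" using W.subset by auto
 then show ?case using insert by (subst V.finsum_insert) auto
qed

section \<open>Transport of structure along bijections\<close>

lemma lin_inverse:
 assumes f: "f : lin_maps K V W" and V: "vectorspace K V" and W: "vectorspace K W" and bij: "bij_betw f (carrier V) (carrier W)"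
 shows "inv_into (carrier V) f : lin_maps K W V"
 and "!!w. w : carrier W ==> f (inv_into (carrier V) f w) = w"
 and "!!v. v : carrier V ==> inv_into (carrier V) f (f v) = v"
proof -
 let ?g = "inv_into (carrier V) f"
 show fg: "f (?g w) = w" if "w : carrier W" for w using bij_betw_inv_into_right[OF bij that] .
 show gf: "?g (f v) = v" if "v : carrier V" for v using bij_betw_inv_into_left[OF bij that] .
 have gc: "?g w : carrier V" if "w : carrier W" for w using bij that by (metis bij_betw_def inv_into_into)
 show "?g : lin_maps K W V"
 proof (rule lin_mapsI)
 show "?g (x \<oplus>\<^sub>W z) = ?g x \<oplus>\<^sub>V ?g z" if "x : carrier W" "z : carrier W" for x z
 proof -
  have "f (?g x \<oplus>\<^sub>V ?g z) = x \<oplus>\<^sub>W z" using that by (simp add: lin_addD[OF f] gc fg)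
  then show ?thesis using gf[of "?g x \<oplus>\<^sub>V ?g z"] gc that V by (simp add: vs_add_closed)
 qed
 show "?g (k \<odot>\<^sub>W x) = k \<odot>\<^sub>V ?g x" if "k : carrier K" "x : carrier W" for k x
 proof -
  have "f (k \<odot>\<^sub>V ?g x) = k \<odot>\<^sub>W x" using that by (simp add: lin_smultD[OF f] gc fg)
  then show ?thesis using gf[of "k \<odot>\<^sub>V ?g x"] gc that V by (simp add: vs_smult_closed)
 qed
 qed (rule gc)
qed

lemma tensor_map_comp:
 assumes "vectorspace K V" "vectorspace K W" "vectorspace K V'" "vectorspace K W'" "vectorspace K V''" "vectorspace K W''"
 "f : lin_maps K V V'" "h : lin_maps K W W'" "f' : lin_maps K V' V''" "h' : lin_maps K W' W''" "t : carrier (tensor K V W)"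
 shows "tensor_map K V' W' V'' W'' f' h' (tensor_map K V W V' W' f h t) =
 tensor_map K V W V'' W'' (%x. f' (f x)) (%x. h' (h x)) t"
 unfolding tensor_map_def[of K V' W'] tensor_map_def[of K V W V'' W'']
 by (rule lift_tensor_map[OF assms(1-4,7,8) vs_tensor[OF assms(5,6)] bilin_pure_map[OF assms(3-6,9,10)] assms(11)])

lemma tensor_map_cong:
 assumes "!!v. v : carrier V ==> f v = f' v" "!!w. w : carrier W ==> h w = h' w"
 shows "tensor_map K V W V' W' f h t = tensor_map K V W V' W' f' h' t"
 unfolding tensor_map_def by (rule lift_fcong) (simp add: assms)

lemma tensor_map_id:
 assumes "vectorspace K V" "vectorspace K W" "!!v. v : carrier V ==> f v = v" "!!w. w : carrier W ==> h w = w"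
 "t : carrier (tensor K V W)"
 shows "tensor_map K V W V W f h t = t"
proof -
 have "tensor_map K V W V W f h t = tensor_lift K V W (tensor K V W) (pure_tensor K V W) t"
 unfolding tensor_map_def by (rule lift_fcong) (simp add: assms)
 then show ?thesis using lift_pure_id[OF assms(1,2,5)] by simp
qed

lemma bialg_map_comp:
 assumes A: "bialgebra K A" and B: "bialgebra K B" and C: "bialgebra K C"
 and f: "f : bialgebra_maps K A B" and h: "h : bialgebra_maps K B C"
 shows "(%x. h (f x)) : bialgebra_maps K A C"
proof -
 note vA = alg_vs[OF bialg_alg[OF A]] and vB = alg_vs[OF bialg_alg[OF B]] and vC = alg_vs[OF bialg_alg[OF C]]
 have fa: "f : algebra_maps K A B" and fc: "f : coalgebra_maps K A B" and ha: "h : algebra_maps K B C" and hc: "h : coalgebra_maps K B C"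
 using f h by (auto simp: bialgebra_maps_def)
 note fl = alg_map_lin[OF fa] and hl = alg_map_lin[OF ha]
 have "comult C (h (f x)) = tensor_map K A A C C (%x. h (f x)) (%x. h (f x)) (comult A x)" if x: "x : carrier A" for x
 using tensor_map_comp[OF vA vA vB vB vC vC fl fl hl hl comult_mem[OF bialg_coalg[OF A] x]]
 by (simp add: coalg_map_comult[OF hc lin_mem[OF fl x]] coalg_map_comult[OF fc x])
 then show ?thesis
 unfolding bialgebra_maps_def coalgebra_maps_def
 using alg_map_comp[OF ha fa] lin_comp[OF hl fl] coalg_map_counit[OF hc] coalg_map_counit[OF fc] lin_mem[OF fl] by auto
qed

lemma bialg_map_inverse:
 assumes A: "bialgebra K A" and B: "bialgebra K B" and f: "f : bialgebra_maps K A B"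
 and bij: "bij_betw f (carrier A) (carrier B)"
 shows "inv_into (carrier A) f : bialgebra_maps K B A"
proof -
 note aA = bialg_alg[OF A] and aB = bialg_alg[OF B]
 note vA = alg_vs[OF aA] and vB = alg_vs[OF aB]
 have fa: "f : algebra_maps K A B" and fc: "f : coalgebra_maps K A B" using f by (auto simp: bialgebra_maps_def)
 note fl = alg_map_lin[OF fa]
 note i = lin_inverse[OF fl vA vB bij]
 let ?g = "inv_into (carrier A) f"
 note gc = lin_mem[OF i(1)]
 have "?g : algebra_maps K B A"
 proof (rule algebra_mapsI[OF i(1)])
 show "?g \<one>\<^sub>B = \<one>\<^sub>A" using i(3)[OF alg_one_mem[OF aA]] by (simp add: alg_map_one[OF fa])
 show "?g (x \<otimes>\<^sub>B z) = ?g x \<otimes>\<^sub>A ?g z" if "x : carrier B" "z : carrier B" for x z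
  using i(3)[OF alg_mult_mem[OF aA gc[OF that(1)] gc[OF that(2)]]] that
  by (simp add: alg_map_mult[OF fa] gc i(2))
 qed
 moreover have "?g : coalgebra_maps K B A"
 proof -
 have "comult A (?g x) = tensor_map K B B A A ?g ?g (comult B x)" if x: "x : carrier B" for x
 proof -
  have "tensor_map K B B A A ?g ?g (comult B x) = tensor_map K B B A A ?g ?g (tensor_map K A A B B f f (comult A (?g x)))"
  using coalg_map_comult[OF fc gc[OF x]] x by (simp add: i(2))
  also have "... = tensor_map K A A A A (%x. ?g (f x)) (%x. ?g (f x)) (comult A (?g x))"
  by (rule tensor_map_comp[OF vA vA vB vB vA vA fl fl i(1) i(1) comult_mem[OF bialg_coalg[OF A] gc[OF x]]])
  also have "... = comult A (?g x)"
  by (rule tensor_map_id[OF vA vA i(3) i(3) comult_mem[OF bialg_coalg[OF A] gc[OF x]]])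
  finally show ?thesis ..
 qed
 moreover have "counit A (?g x) = counit B x" if "x : carrier B" for x
  using coalg_map_counit[OF fc gc[OF that]] that by (simp add: i(2))
 ultimately show ?thesis using i(1) by (simp add: coalgebra_maps_def)
 qed
 ultimately show ?thesis by (simp add: bialgebra_maps_def)
qed

lemma bialg_map_cong:
 assumes A: "bialgebra K A" and f: "f : bialgebra_maps K A B" and eq: "!!x. x : carrier A ==> h x = f x"
 shows "h : bialgebra_maps K A B"
proof -
 note aA = bialg_alg[OF A]
 have fa: "f : algebra_maps K A B" and fc: "f : coalgebra_maps K A B" using f by (auto simp: bialgebra_maps_def)
 have t: "tensor_map K A A B B h h t = tensor_map K A A B B f f t" for t by (rule tensor_map_cong) (simp_all add: eq)
 have "h : lin_maps K A B" by (rule lin_cong[OF alg_map_lin[OF fa] alg_vs[OF aA] eq])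
 then have "h : coalgebra_maps K A B"
 using fc by (auto simp: coalgebra_maps_def eq t)
 then show ?thesis using alg_map_cong[OF fa aA eq] by (simp add: bialgebra_maps_def)
qed

text \<open>A structure that a bijection carries to the structure of a Hopf algebra is a Hopf algebra.\<close>

lemma hopf_transport:
 assumes A: "hopf_algebra K A" and Z: "vectorspace K Z" and w: "w : lin_maps K Z A"
 and bij: "bij_betw w (carrier Z) (carrier A)"
 and mc: "!!x z. x : carrier Z ==> z : carrier Z ==> x \<otimes>\<^sub>Z z : carrier Z"
 and m: "!!x z. x : carrier Z ==> z : carrier Z ==> w (x \<otimes>\<^sub>Z z) = w x \<otimes>\<^sub>A w z"
 and oc: "\<one>\<^sub>Z : carrier Z" and o: "w \<one>\<^sub>Z = \<one>\<^sub>A"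
 and dc: "!!x. x : carrier Z ==> comult Z x : carrier (tensor K Z Z)"
 and d: "!!x. x : carrier Z ==> tensor_map K Z Z A A w w (comult Z x) = comult A (w x)"
 and e: "!!x. x : carrier Z ==> counit Z x = counit A (w x)"
 shows "hopf_algebra K Z" and "w : hopf_maps K Z A"
proof -
 note bA = hopf_bialg[OF A] and SA = antipode_is_antipode[OF A]
 note aA = bialg_alg[OF bA] and cA = bialg_coalg[OF bA]
 note vA = alg_vs[OF aA]
 note i = lin_inverse[OF w Z vA bij]
 define u where "u = inv_into (carrier Z) w"
 have u: "u : lin_maps K A Z" and wu: "!!a. a : carrier A ==> w (u a) = a" and uw: "!!x. x : carrier Z ==> u (w x) = x"
 using i by (simp_all add: u_def)
 note uc = lin_mem[OF u] and wc = lin_mem[OF w]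
 interpret RA: ring A by (rule alg_ring[OF aA])
 have inj: "x = z" if "x : carrier Z" "z : carrier Z" "w x = w z" for x z using uw that by metis
 have aX: "k_algebra K Z"
 proof (rule k_algebraI[OF Z mc])
 have e: "x \<otimes>\<^sub>Z z = u (w x \<otimes>\<^sub>A w z)" if "x : carrier Z" "z : carrier Z" for x z
  using uw[OF mc[OF that]] m[OF that] by simp
 have b: "bilinear_map K Z Z Z (%x z. u (w x \<otimes>\<^sub>A w z))"
  by (assumption | rule lin_comp[OF u] lin_comp[OF w] wc aA lin)+
 show "bilinear_map K Z Z Z (monoid.mult Z)"
 proof (rule bilinI)
  show "(%z. x \<otimes>\<^sub>Z z) : lin_maps K Z Z" if x: "x : carrier Z" for x
  by (rule lin_cong[OF bilin_lin1[OF b x] Z]) (rule e[OF x])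
  show "(%x. x \<otimes>\<^sub>Z z) : lin_maps K Z Z" if z: "z : carrier Z" for z
  by (rule lin_cong[OF bilin_lin2[OF b z] Z]) (rule e[OF _ z])
 qed
 show "\<one>\<^sub>Z : carrier Z" by (rule oc)
 show "x \<otimes>\<^sub>Z z \<otimes>\<^sub>Z t = x \<otimes>\<^sub>Z (z \<otimes>\<^sub>Z t)" if "x : carrier Z" "z : carrier Z" "t : carrier Z" for x z t
  using that by (intro inj) (simp_all add: mc m wc RA.m_assoc)
 show "\<one>\<^sub>Z \<otimes>\<^sub>Z x = x" if "x : carrier Z" for x using that by (intro inj) (simp_all add: mc m oc o wc)
 show "x \<otimes>\<^sub>Z \<one>\<^sub>Z = x" if "x : carrier Z" for x using that by (intro inj) (simp_all add: mc m oc o wc)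
 qed
 have wa: "w : algebra_maps K Z A" by (rule algebra_mapsI[OF w o m])
 have ua: "u : algebra_maps K A Z"
 by (rule algebra_mapsI[OF u])
  (use uw[OF oc] o in simp, use uw[OF mc[OF uc uc]] in \<open>simp add: m uc wu\<close>)
 define D where "D x = tensor_map K A A Z Z u u (comult A (w x))" for x
 have Dx: "comult Z x = D x" if x: "x : carrier Z" for x
 proof -
 have "D x = tensor_map K A A Z Z u u (tensor_map K Z Z A A w w (comult Z x))" unfolding D_def d[OF x] ..
 also have "... = tensor_map K Z Z Z Z (%x. u (w x)) (%x. u (w x)) (comult Z x)"
  by (rule tensor_map_comp[OF Z Z vA vA Z Z w w u u dc[OF x]])
 also have "... = comult Z x" by (rule tensor_map_id[OF Z Z uw uw dc[OF x]])
 finally show ?thesis ..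
 qed
 have Da: "comult Z : algebra_maps K Z (tensor_algebra K Z Z)"
 proof (rule alg_map_cong[OF _ aX Dx])
 show "D : algebra_maps K Z (tensor_algebra K Z Z)"
  unfolding D_def[abs_def]
  using alg_map_comp[OF tensor_map_algebra_map[OF aA aA aX aX ua ua] alg_map_comp[OF bialg_comult[OF bA] wa]] .
 qed
 have Ea: "counit Z : algebra_maps K Z (base_module K)"
 by (rule alg_map_cong[where f="%x. counit A (w x)", OF alg_map_comp[OF bialg_counit[OF bA] wa] aX e])
 have sw: "tensor_lift K Z Z M F (comult Z x) = tensor_lift K A A M (%a b. F (u a) (u b)) (comult A (w x))"
 if "vectorspace K M" "bilinear_map K Z Z M F" "x : carrier Z" for M F x
 unfolding Dx[OF that(3)] D_def
 by (rule lift_tensor_map[OF vA vA Z Z u u that(1,2) comult_mem[OF cA wc[OF that(3)]]])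
 note Dl = alg_map_lin[OF Da, simplified] and El = alg_map_lin[OF Ea]
 have ec: "x : carrier Z ==> counit Z x : carrier K" for x using lin_mem[OF El] by simp
 let ?T = "tensor K Z Z" let ?T3 = "tensor K Z ?T" let ?p3 = "pure_tensor K Z ?T" let ?p = "pure_tensor K Z Z"
 note r = Z vA aX aA dc lin_comp[OF Dl] lin_comp[OF El] ec uc wc lin_comp[OF u] lin_comp[OF w]
 have bp: "bilinear_map K Z Z ?T (%s t. ?p s t)" by (assumption | rule r lin)+
 have v3: "vectorspace K ?T3" by (assumption | rule r lin)+
 have cX: "coalgebra K Z"
 unfolding coalgebra_def sweedler_def sweedler3_def
 proof (intro conjI ballI Z Dl El)
 fix x assume x: "x : carrier Z"
 have b1: "bilinear_map K Z Z ?T3 (%a b. tensor_lift K Z Z ?T3 (%s t. ?p3 s (?p t b)) (comult Z a))"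
  by (assumption | rule r lin)+
 have b2: "bilinear_map K Z Z ?T3 (%s t. ?p3 s (comult Z t))" by (assumption | rule r lin)+
 have b3: "bilinear_map K Z Z ?T3 (%s t. ?p3 s (?p t b))" if "b : carrier Z" for b by (assumption | rule that r lin)+
 have "tensor_lift K Z Z ?T3 (%a b. tensor_lift K Z Z ?T3 (%s t. ?p3 s (?p t b)) (comult Z a)) (comult Z x) =
  tensor_lift K A A ?T3 (%a b. tensor_lift K A A ?T3 (%s t. ?p3 (u s) (?p (u t) (u b))) (comult A a)) (comult A (w x))"
  unfolding sw[OF v3 b1 x] by (rule lift_fcong) (simp add: sw[OF v3 b3] uc wu)
 also have "... = tensor_lift K A A ?T3 (%a b. tensor_lift K A A ?T3 (%s t. ?p3 (u a) (?p (u s) (u t))) (comult A b)) (comult A (w x))"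
  by (rule coassoc[OF cA v3 _ wc[OF x]]) (assumption | rule r v3 lin)+
 also have "... = tensor_lift K Z Z ?T3 (%s t. ?p3 s (comult Z t)) (comult Z x)"
  unfolding sw[OF v3 b2 x]
 proof (rule lift_fcong)
  fix a b assume ab: "a : carrier A" "b : carrier A"
  have b4: "bilinear_map K A A ?T (%s t. ?p (u s) (u t))" by (assumption | rule r lin)+
  have "?p3 (u a) (comult Z (u b)) = ?p3 (u a) (tensor_lift K A A ?T (%s t. ?p (u s) (u t)) (comult A b))"
  using ab by (simp add: Dx uc D_def wu tensor_map_def)
  also have "... = tensor_lift K A A ?T3 (%s t. ?p3 (u a) (?p (u s) (u t))) (comult A b)"
  by (rule lin_lift_comp[OF vA vA vs_tensor[OF Z Z] b4 v3 _ comult_mem[OF cA ab(2)]]) (assumption | rule ab r lin)+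
  finally show "tensor_lift K A A ?T3 (%s t. ?p3 (u a) (?p (u s) (u t))) (comult A b) = ?p3 (u a) (comult Z (u b))" ..
 qed
 finally show "tensor_lift K Z Z ?T3 (%a b. tensor_lift K Z Z ?T3 (%s t. ?p3 s (?p t b)) (comult Z a)) (comult Z x) =
  tensor_lift K Z Z ?T3 (%s t. ?p3 s (comult Z t)) (comult Z x)" .
 have bl: "bilinear_map K Z Z Z (%s t. counit Z s \<odot>\<^sub>Z t)" and br: "bilinear_map K Z Z Z (%s t. counit Z t \<odot>\<^sub>Z s)"
  by (assumption | rule r lin)+
 have "tensor_lift K Z Z Z (%s t. counit Z s \<odot>\<^sub>Z t) (comult Z x) = tensor_lift K A A Z (%s t. counit A s \<odot>\<^sub>Z u t) (comult A (w x))"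
  unfolding sw[OF Z bl x] by (rule lift_fcong) (simp add: e uc wu)
 then show "tensor_lift K Z Z Z (%s t. counit Z s \<odot>\<^sub>Z t) (comult Z x) = x"
  using counit_l[OF cA Z u wc[OF x]] uw[OF x] by simp
 have "tensor_lift K Z Z Z (%s t. counit Z t \<odot>\<^sub>Z s) (comult Z x) = tensor_lift K A A Z (%s t. counit A t \<odot>\<^sub>Z u s) (comult A (w x))"
  unfolding sw[OF Z br x] by (rule lift_fcong) (simp add: e uc wu)
 then show "tensor_lift K Z Z Z (%s t. counit Z t \<odot>\<^sub>Z s) (comult Z x) = x"
  using counit_r[OF cA Z u wc[OF x]] uw[OF x] by simp
 qed
 have bX: "bialgebra K Z" unfolding bialgebra_def using aX cX Da Ea by blast
 have wb: "w : bialgebra_maps K Z A"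
 unfolding bialgebra_maps_def coalgebra_maps_def using wa w d e by auto
 let ?S = "antipode K A"
 define SX where "SX x = u (?S (w x))" for x
 note Sl = antipode_lin[OF SA] and Sc = lin_mem[OF antipode_lin[OF SA]]
 have SX: "SX : lin_maps K Z Z" unfolding SX_def[abs_def] by (assumption | rule lin_comp[OF Sl] r lin)+
 have um: "u (a \<otimes>\<^sub>A b) = u a \<otimes>\<^sub>Z u b" if "a : carrier A" "b : carrier A" for a b by (rule alg_map_mult[OF ua that])
 have bS: "bilinear_map K A A A (%s t. ?S s \<otimes>\<^sub>A t)" "bilinear_map K A A A (%s t. s \<otimes>\<^sub>A ?S t)"
 by (assumption | rule lin_comp[OF Sl] Sc r lin)+
 have bSX: "bilinear_map K Z Z Z (%s t. SX s \<otimes>\<^sub>Z t)" "bilinear_map K Z Z Z (%s t. s \<otimes>\<^sub>Z SX t)"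
 by (assumption | rule lin_comp[OF SX] lin_mem[OF SX] r lin)+
 have anti: "tensor_lift K Z Z Z (%s t. SX s \<otimes>\<^sub>Z t) (comult Z x) = counit Z x \<odot>\<^sub>Z \<one>\<^sub>Z"
  "tensor_lift K Z Z Z (%s t. s \<otimes>\<^sub>Z SX t) (comult Z x) = counit Z x \<odot>\<^sub>Z \<one>\<^sub>Z"
 if x: "x : carrier Z" for x
 proof -
 have "u (counit A (w x) \<odot>\<^sub>A \<one>\<^sub>A) = counit Z x \<odot>\<^sub>Z \<one>\<^sub>Z"
  using x by (simp add: lin_smultD[OF u] counit_mem[OF cA] wc alg_map_one[OF ua] e)
 note E = this
 have "tensor_lift K Z Z Z (%s t. SX s \<otimes>\<^sub>Z t) (comult Z x) = tensor_lift K A A Z (%s t. u (?S s \<otimes>\<^sub>A t)) (comult A (w x))"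
  unfolding sw[OF Z bSX(1) x] by (rule lift_fcong) (simp add: SX_def um Sc wu)
 also have "... = u (counit A (w x) \<odot>\<^sub>A \<one>\<^sub>A)"
  unfolding antipode_l[OF SA wc[OF x], symmetric]
  by (rule lin_lift_comp[OF vA vA vA bS(1) Z u comult_mem[OF cA wc[OF x]], symmetric])
 finally show "tensor_lift K Z Z Z (%s t. SX s \<otimes>\<^sub>Z t) (comult Z x) = counit Z x \<odot>\<^sub>Z \<one>\<^sub>Z" unfolding E .
 have "tensor_lift K Z Z Z (%s t. s \<otimes>\<^sub>Z SX t) (comult Z x) = tensor_lift K A A Z (%s t. u (s \<otimes>\<^sub>A ?S t)) (comult A (w x))"
  unfolding sw[OF Z bSX(2) x] by (rule lift_fcong) (simp add: SX_def um[OF _ Sc] Sc wu wc)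
 also have "... = u (tensor_lift K A A A (%s t. s \<otimes>\<^sub>A ?S t) (comult A (w x)))"
  by (rule sym, rule lin_lift_comp[OF vA vA vA bS(2) Z u comult_mem[OF cA wc[OF x]]])
 also have "... = u (counit A (w x) \<odot>\<^sub>A \<one>\<^sub>A)" by (simp only: antipode_r[OF SA wc[OF x]])
 finally show "tensor_lift K Z Z Z (%s t. s \<otimes>\<^sub>Z SX t) (comult Z x) = counit Z x \<odot>\<^sub>Z \<one>\<^sub>Z" unfolding E .
 qed
 show hX: "hopf_algebra K Z" by (rule hopf_algebra_one_sided[OF bX SX SX anti])
 show "w : hopf_maps K Z A" by (rule bialg_map_hopf[OF hX A wb])
qed

section \<open>Braided bialgebras with the structure of a quantum line\<close>

text \<open>The axioms need only be checked on images under the surjection, where they are the images of the axioms upstairs.\<close>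

lemma coalgebra_quotient:
 assumes C: "coalgebra K C" and Q: "vectorspace K Q" and f: "f : lin_maps K C Q"
 and surj: "!!v. v : carrier Q ==> EX c:carrier C. v = f c"
 and Dl: "comult Q : lin_maps K Q (tensor K Q Q)" and El: "counit Q : lin_maps K Q (base_module K)"
 and D: "!!c. c : carrier C ==> comult Q (f c) = tensor_map K C C Q Q f f (comult C c)"
 and E: "!!c. c : carrier C ==> counit Q (f c) = counit C c"
 shows "coalgebra K Q"
proof -
 note V = coalg_vs[OF C] and fc = lin_mem[OF f]
 let ?T = "tensor K Q Q" let ?T3 = "tensor K Q ?T" let ?p3 = "pure_tensor K Q ?T" let ?p = "pure_tensor K Q Q"
 have ec: "counit Q v : carrier K" if "v : carrier Q" for v using lin_mem[OF El that] by simp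
 note r = Q V comult_mem[OF C] comult_comp[OF C] counit_mem[OF C] counit_comp[OF C] lin_comp[OF Dl]
 lin_mem[OF Dl] lin_comp[OF El] ec fc lin_comp[OF f]
 have sw: "tensor_lift K Q Q M F (comult Q (f c)) = tensor_lift K C C M (%a b. F (f a) (f b)) (comult C c)"
 if "vectorspace K M" "bilinear_map K Q Q M F" "c : carrier C" for M F c
 unfolding D[OF that(3)] by (rule lift_tensor_map[OF V V Q Q f f that(1,2) comult_mem[OF C that(3)]])
 have v3: "vectorspace K ?T3" by (assumption | rule r lin)+
 have b1: "bilinear_map K Q Q ?T3 (%a b. tensor_lift K Q Q ?T3 (%s t. ?p3 s (?p t b)) (comult Q a))"
 by (assumption | rule r lin)+
 have b2: "bilinear_map K Q Q ?T3 (%s t. ?p3 s (comult Q t))" by (assumption | rule r lin)+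
 have b3: "bilinear_map K Q Q ?T3 (%s t. ?p3 s (?p t b))" if "b : carrier Q" for b by (assumption | rule that r lin)+
 have b4: "bilinear_map K C C ?T (%s t. ?p (f s) (f t))" by (assumption | rule r lin)+
 have bl: "bilinear_map K Q Q Q (%s t. counit Q s \<odot>\<^sub>Q t)" and br: "bilinear_map K Q Q Q (%s t. counit Q t \<odot>\<^sub>Q s)"
 by (assumption | rule r lin)+
 have 1: "tensor_lift K Q Q ?T3 (%a b. tensor_lift K Q Q ?T3 (%s t. ?p3 s (?p t b)) (comult Q a)) (comult Q (f c)) =
  tensor_lift K Q Q ?T3 (%s t. ?p3 s (comult Q t)) (comult Q (f c))" if c: "c : carrier C" for c
 proof -
 have "tensor_lift K Q Q ?T3 (%a b. tensor_lift K Q Q ?T3 (%s t. ?p3 s (?p t b)) (comult Q a)) (comult Q (f c)) =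
  tensor_lift K C C ?T3 (%a b. tensor_lift K C C ?T3 (%s t. ?p3 (f s) (?p (f t) (f b))) (comult C a)) (comult C c)"
  unfolding sw[OF v3 b1 c] by (rule lift_fcong) (simp add: sw[OF v3 b3] fc)
 also have "... = tensor_lift K C C ?T3 (%a b. tensor_lift K C C ?T3 (%s t. ?p3 (f a) (?p (f s) (f t))) (comult C b)) (comult C c)"
  by (rule coassoc[OF C v3 _ c]) (assumption | rule r v3 lin)+
 also have "... = tensor_lift K Q Q ?T3 (%s t. ?p3 s (comult Q t)) (comult Q (f c))"
  unfolding sw[OF v3 b2 c]
 proof (rule lift_fcong)
  fix a b assume ab: "a : carrier C" "b : carrier C"
  have "?p3 (f a) (comult Q (f b)) = ?p3 (f a) (tensor_lift K C C ?T (%s t. ?p (f s) (f t)) (comult C b))"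
  using ab by (simp add: D tensor_map_def)
  also have "... = tensor_lift K C C ?T3 (%s t. ?p3 (f a) (?p (f s) (f t))) (comult C b)"
  by (rule lin_lift_comp[OF V V vs_tensor[OF Q Q] b4 v3 _ comult_mem[OF C ab(2)]]) (assumption | rule ab r lin)+
  finally show "tensor_lift K C C ?T3 (%s t. ?p3 (f a) (?p (f s) (f t))) (comult C b) = ?p3 (f a) (comult Q (f b))" ..
 qed
 finally show ?thesis .
 qed
 have 2: "tensor_lift K Q Q Q (%s t. counit Q s \<odot>\<^sub>Q t) (comult Q (f c)) = f c"
 "tensor_lift K Q Q Q (%s t. counit Q t \<odot>\<^sub>Q s) (comult Q (f c)) = f c" if c: "c : carrier C" for c
 proof -
 have "tensor_lift K Q Q Q (%s t. counit Q s \<odot>\<^sub>Q t) (comult Q (f c)) = tensor_lift K C C Q (%s t. counit C s \<odot>\<^sub>Q f t) (comult C c)"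
  unfolding sw[OF Q bl c] by (rule lift_fcong) (simp add: E)
 then show "tensor_lift K Q Q Q (%s t. counit Q s \<odot>\<^sub>Q t) (comult Q (f c)) = f c"
  using counit_l[OF C Q f c] by simp
 have "tensor_lift K Q Q Q (%s t. counit Q t \<odot>\<^sub>Q s) (comult Q (f c)) = tensor_lift K C C Q (%s t. counit C t \<odot>\<^sub>Q f s) (comult C c)"
  unfolding sw[OF Q br c] by (rule lift_fcong) (simp add: E)
 then show "tensor_lift K Q Q Q (%s t. counit Q t \<odot>\<^sub>Q s) (comult Q (f c)) = f c"
  using counit_r[OF C Q f c] by simp
 qed
 show ?thesis
 unfolding coalgebra_def sweedler_def sweedler3_def
 proof (intro conjI ballI Q Dl El)
 fix v assume "v : carrier Q"
 then obtain c where c: "c : carrier C" "v = f c" using surj by blast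
 show "tensor_lift K Q Q ?T3 (%a b. tensor_lift K Q Q ?T3 (%s t. ?p3 s (?p t b)) (comult Q a)) (comult Q v) =
  tensor_lift K Q Q ?T3 (%s t. ?p3 s (comult Q t)) (comult Q v)" unfolding c(2) by (rule 1[OF c(1)])
 show "tensor_lift K Q Q Q (%s t. counit Q s \<odot>\<^sub>Q t) (comult Q v) = v" unfolding c(2) by (rule 2(1)[OF c(1)])
 show "tensor_lift K Q Q Q (%s t. counit Q t \<odot>\<^sub>Q s) (comult Q v) = v" unfolding c(2) by (rule 2(2)[OF c(1)])
 qed
qed

lemma yd_tensor_simps [simp]:
 "carrier (yd_tensor K H V W) = carrier (tensor K V W)" "ring.add (yd_tensor K H V W) = ring.add (tensor K V W)"
 "smult (yd_tensor K H V W) = smult (tensor K V W)"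
 "lin_maps K U (yd_tensor K H V W) = lin_maps K U (tensor K V W)"
 "lin_maps K (yd_tensor K H V W) U = lin_maps K (tensor K V W) U"
 "tensor K L (yd_tensor K H V W) = tensor K L (tensor K V W)"
 "pure_tensor K L (yd_tensor K H V W) = pure_tensor K L (tensor K V W)"
 "tensor_lift K L (yd_tensor K H V W) M = tensor_lift K L (tensor K V W) M"
 "act (yd_tensor K H V W) h t = sweedler K H (tensor K V W)
  (%h1 h2. tensor_map K V W V W (act V h1) (act W h2) t) h"
 "coact (yd_tensor K H V W) t = tensor_lift K V W (tensor K H (tensor K V W))
  (%v w. tensor_lift K H V (tensor K H (tensor K V W))
   (%x v0. tensor_lift K H W (tensor K H (tensor K V W))
   (%z w0. pure_tensor K H (tensor K V W) (x \<otimes>\<^sub>H z) (pure_tensor K V W v0 w0))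
   (coact W w)) (coact V v)) t"
 by (rule lin_maps_cong tensor_cong tensor_lift_cong_space | simp add: yd_tensor_def)+

lemma yd_unit_simps [simp]:
 "carrier (yd_unit K H) = carrier K" "ring.add (yd_unit K H) = ring.add K" "smult (yd_unit K H) = monoid.mult K"
 "lin_maps K U (yd_unit K H) = lin_maps K U (base_module K)"
 "lin_maps K (yd_unit K H) U = lin_maps K (base_module K) U"
 "tensor K L (yd_unit K H) = tensor K L (base_module K)"
 "pure_tensor K L (yd_unit K H) = pure_tensor K L (base_module K)"
 "tensor_lift K L (yd_unit K H) M = tensor_lift K L (base_module K) M"
 "act (yd_unit K H) h k = counit H h \<otimes>\<^sub>K k" "coact (yd_unit K H) k = pure_tensor K H (base_module K) \<one>\<^sub>H k"
 by (rule lin_maps_cong tensor_cong tensor_lift_cong_space | simp add: yd_unit_def)+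

lemma yd_map_tensor_simps [simp]:
 "tensor_map K L (yd_tensor K H V W) L' M f h = tensor_map K L (tensor K V W) L' M f h"
 "tensor_map K L M' L' (yd_tensor K H V W) f h' = tensor_map K L M' L' (tensor K V W) f h'"
 "tensor_map K L (yd_unit K H) L' N f k = tensor_map K L (base_module K) L' N f k"
 "tensor_map K L N' L' (yd_unit K H) f k' = tensor_map K L N' L' (base_module K) f k'"
 by (simp_all add: tensor_map_def)

context yd_setting
begin

lemma liftH_cp:
 assumes M: "vectorspace K M" and t: "t : carrier M" and h: "h : carrier H"
 shows "liftH M (%x v. (cp m x \<otimes>\<^sub>K cp n v) \<odot>\<^sub>M t) (comult H h) = cp (m + n) h \<odot>\<^sub>M t"
proof -
 have b: "bilinear_map K H H KB (%x v. cp m x \<otimes>\<^sub>K cp n v)" by (assumption | rule lin)+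
 have L: "(%k. k \<odot>\<^sub>M t) : lin_maps K KB M" by (assumption | rule M t lin)+
 show ?thesis using liftH_out[OF baseV b M L h] cp_add[OF h] by simp
qed

lemma lift_comult_mono_one:
 assumes M: "vectorspace K M" and F: "bilinear_map K A A M F"
 shows "liftA M F (comult A (mono n \<one>\<^sub>H)) =
 finsum M (%k. gs n k \<odot>\<^sub>M F (mono k (g [^]\<^sub>H (n - k))) (mono (n - k) \<one>\<^sub>H)) {..n}"
proof -
 interpret M: vectorspace K M by (rule M)
 show ?thesis
 unfolding lift_comult_mono[OF M F HR.one_closed]
 proof (rule M.finsum_cong'[OF refl])
 fix k
 have b: "bilinear_map K H H M (%x v. F (mono k (g [^]\<^sub>H (n - k) \<otimes>\<^sub>H x)) (mono (n - k) v))"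
  by (assumption | rule bilin_comp1[OF F] bilin_comp2[OF F] lin)+
 show "gs n k \<odot>\<^sub>M liftH M (%x v. F (mono k (g [^]\<^sub>H (n - k) \<otimes>\<^sub>H x)) (mono (n - k) v)) (comult H \<one>\<^sub>H) =
  gs n k \<odot>\<^sub>M F (mono k (g [^]\<^sub>H (n - k))) (mono (n - k) \<one>\<^sub>H)"
  unfolding comult_one lift_pure[OF hV hV M b HR.one_closed HR.one_closed] by (simp add: gpow_mem)
 qed (simp add: gs_mem bilin_closed[OF F] mono_mem gpow_mem)
qed

lemma counit_mono_eps: "h : carrier H ==> N <= n ==> counit H (zz [^]\<^sub>H (n div N) \<otimes>\<^sub>H h) = \<zero>\<^sub>K"
proof -
 assume h: "h : carrier H" and n: "N <= n"
 then have "n div N ~= 0" using N_pos by (simp add: div_eq_0_iff)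
 then obtain m where m: "n div N = Suc m" using not0_implies_Suc by blast
 have c: "zz [^]\<^sub>H m : carrier H" by (rule alg_pow_closed[OF hA zz_closed])
 show ?thesis unfolding m using c h by (simp add: counit_mult zz_closed counit_zz counitH)
qed

end

text \<open>The algebra, coalgebra, action and coaction of a quantum line, given only by their values at \<open>e n\<close>, the \<open>n\<close>-th power of the generator. Indexing by all \<open>n\<close>, with \<open>e n = 0\<close> from \<open>N\<close> on, avoids case distinctions in the multiplication.\<close>

locale line_structure = yd_setting K H g \<chi> q lam N
 for K :: "('k, 'c) ring_scheme" and H :: "('k, 'h, 'm) bialg_scheme"
 and g :: 'h and \<chi> :: "'h => 'k" and q lam :: 'k and N :: nat +
 fixes Q :: "('k, 'h, 'v, 'z) yd_bialg_scheme" and e :: "nat => 'v"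
 assumes QA: "k_algebra K Q" and e_mem: "!!n. e n : carrier Q" and e_0: "e 0 = \<one>\<^sub>Q"
 and e_big: "!!n. N <= n ==> e n = \<zero>\<^sub>Q" and e_mult: "!!m n. m < N ==> n < N ==> e m \<otimes>\<^sub>Q e n = e (m + n)"
 and e_basis: "vectorspace.basis K Q (e ` {..<N})" and e_inj: "inj_on e {..<N}"
 and act_lin: "!!h. h : carrier H ==> act Q h : lin_maps K Q Q"
 and act_lin': "!!v. v : carrier Q ==> (%h. act Q h v) : lin_maps K H Q"
 and act_e: "!!h n. h : carrier H ==> n < N ==> act Q h (e n) = conv_pow K H \<chi> n h \<odot>\<^sub>Q e n"
 and coact_lin: "coact Q : lin_maps K Q (tensor K H Q)"
 and coact_e: "!!n. n < N ==> coact Q (e n) = pure_tensor K H Q (g [^]\<^sub>H n) (e n)"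
 and comult_lin: "comult Q : lin_maps K Q (tensor K Q Q)"
 and comult_e: "!!n. n < N ==> comult Q (e n) =
  finsum (tensor K Q Q) (%k. field.gauss K q n k \<odot>\<^bsub>tensor K Q Q\<^esub> pure_tensor K Q Q (e k) (e (n - k))) {..n}"
 and counit_lin: "counit Q : lin_maps K Q (base_module K)"
 and counit_e: "!!n. n < N ==> counit Q (e n) = (if n = 0 then \<one>\<^sub>K else \<zero>\<^sub>K)"
begin

abbreviation QQ where "QQ == tensor K Q Q"
abbreviation pQ where "pQ == pure_tensor K Q Q"
abbreviation HQ where "HQ == tensor K H Q"
abbreviation pHQ where "pHQ == pure_tensor K H Q"
abbreviation liftQ where "liftQ M == tensor_lift K Q Q M"
abbreviation liftHQ where "liftHQ M == tensor_lift K H Q M"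

lemmas vQ = alg_vs[OF QA]
lemmas vQQ = vs_tensor[OF vQ vQ] and vHQ = vs_tensor[OF hV vQ]

sublocale QV: vectorspace K Q by (rule vQ)
sublocale QR: ring Q by (rule alg_ring[OF QA])
sublocale QQV: vectorspace K "tensor K Q Q" by (rule vQQ)

lemma counit_Q_closed: "v : carrier Q ==> counit Q v : carrier K"
 using lin_mem[OF counit_lin] by simp

lemma act_comp: "h : carrier H ==> f : lin_maps K U Q ==> (%x. act Q h (f x)) : lin_maps K U Q"
 by (rule lin_comp[OF act_lin]; assumption)

lemma act_comp': "v : carrier Q ==> f : lin_maps K U H ==> (%x. act Q (f x) v) : lin_maps K U Q"
 by (rule lin_comp[OF act_lin']; assumption)

lemma act_closed: "h : carrier H ==> v : carrier Q ==> act Q h v : carrier Q"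
 by (rule lin_mem[OF act_lin])

lemmas [lin] = QA vQ e_mem act_lin act_closed act_comp act_comp' lin_comp[OF coact_lin] lin_mem[OF coact_lin]
 lin_comp[OF comult_lin] lin_mem[OF comult_lin] lin_comp[OF counit_lin] counit_Q_closed

lemma Q_lin_eq:
 assumes M: "vectorspace K M" and F: "F : lin_maps K Q M" and G: "G : lin_maps K Q M"
 and eq: "!!n. n < N ==> F (e n) = G (e n)" and v: "v : carrier Q"
 shows "F v = G v"
 by (rule basis_lin_eq[OF vQ M e_basis F G _ v]) (auto simp: eq)

lemma QQ_lin_eq:
 assumes M: "vectorspace K M" and F: "F : lin_maps K QQ M" and G: "G : lin_maps K QQ M"
 and eq: "!!a b. a < N ==> b < N ==> F (pQ (e a) (e b)) = G (pQ (e a) (e b))" and t: "t : carrier QQ"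
 shows "F t = G t"
proof (rule tensor_lin_eq[OF vQ vQ F G _ t])
 fix v w assume v: "v : carrier Q" and w: "w : carrier Q"
 have 1: "F (pQ (e a) w) = G (pQ (e a) w)" if a: "a < N" for a
 by (rule Q_lin_eq[OF M, where F="%w. F (pQ (e a) w)" and G="%w. G (pQ (e a) w)", OF _ _ eq[OF a] w])
  (assumption | rule lin_comp[OF F] lin_comp[OF G] lin)+
 show "F (pQ v w) = G (pQ v w)"
 by (rule Q_lin_eq[OF M, where F="%v. F (pQ v w)" and G="%v. G (pQ v w)", OF _ _ 1 v])
  (assumption | rule w lin_comp[OF F] lin_comp[OF G] lin)+
qed

lemma act_e': "h : carrier H ==> act Q h (e n) = cp n h \<odot>\<^sub>Q e n"
 by (cases "n < N") (simp_all add: act_e e_big lin_zeroD[OF act_lin vQ vQ] cp_mem)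

lemma coact_e': "coact Q (e n) = pHQ (g [^]\<^sub>H n) (e n)"
 by (cases "n < N") (simp_all add: coact_e e_big lin_zeroD[OF coact_lin vQ vHQ]
  lin_zeroD[OF bilin_lin1[OF bilin_pure[OF hV vQ] gpow_mem] vQ vHQ])

lemma counit_e': "counit Q (e n) = (if n = 0 then \<one>\<^sub>K else \<zero>\<^sub>K)"
 using N_pos by (cases "n < N") (simp_all add: counit_e e_big lin_zeroD[OF counit_lin vQ baseV])

lemma e_mult': "e m \<otimes>\<^sub>Q e n = e (m + n)"
 by (cases "m < N"; cases "n < N") (simp_all add: e_mult e_big e_mem)

text \<open>The quotient \<open>A / A H\<^sup>+\<close>: the comultiplication of \<open>Q\<close> is induced from the one of \<open>A\<close>, and this is
  where its properties come from.\<close>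

text \<open>The projection \<open>\<O> \<rightarrow> \<O> / \<O> H\<^sup>+\<close>, \<open>y\<^sup>n h \<mapsto> \<epsilon>(h) e\<^sub>n\<close>, with the target identified with \<open>Q\<close>.\<close>

definition proj where "proj = O.dlift Q (%n h. counit H h \<odot>\<^sub>Q e n)"

lemma proj_term_lin: "(%h. counit H h \<odot>\<^sub>Q e n) : lin_maps K H Q" by (assumption | rule lin)+

lemma proj_lin: "proj : lin_maps K A Q"
 unfolding proj_def by (rule O.dlift_lin[OF vQ proj_term_lin])

lemma proj_mono: "h : carrier H ==> proj (mono n h) = counit H h \<odot>\<^sub>Q e n"
proof (cases "n < N")
 case True
 assume "h : carrier H"
 then show ?thesis using O.dlift_mono[OF vQ proj_term_lin True] by (simp add: proj_def)
next
 case False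
 assume h: "h : carrier H"
 have m: "n mod N < N" using N_pos by simp
 have c: "zz [^]\<^sub>H (n div N) \<otimes>\<^sub>H h : carrier H" using h by simp
 show ?thesis unfolding O.mono_split[OF h, of n]
 using O.dlift_mono[OF vQ proj_term_lin m c] counit_mono_eps[OF h] False by (simp add: proj_def e_big e_mem h counitH)
qed

lemmas [lin] = lin_comp[OF proj_lin] lin_mem[OF proj_lin]

lemma proj_surj: "v : carrier Q ==> EX c:carrier A. v = proj c"
proof -
 assume v: "v : carrier Q"
 have B: "e ` {..<N} \<subseteq> carrier Q" using e_mem by auto
 have "v : proj ` carrier A"
 proof (rule submodule_span_induct[OF vQ B e_basis v], rule submoduleI'[OF vQ])
 show "\<zero>\<^sub>Q : proj ` carrier A" using lin_zeroD[OF proj_lin vA vQ] vs_zero_closed[OF vA] by (metis imageI)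
 have "e n : proj ` carrier A" for n
  by (rule image_eqI[OF _ mono_mem[OF HR.one_closed]], rule sym) (simp only: proj_mono[OF HR.one_closed] counit_one QV.smult_one[OF e_mem])
 then show "e ` {..<N} \<subseteq> proj ` carrier A" by blast
 show "v \<oplus>\<^sub>Q w : proj ` carrier A" if vw: "v : proj ` carrier A" "w : proj ` carrier A" for v w
 proof -
  obtain c d where cd: "c : carrier A" "d : carrier A" "v = proj c" "w = proj d" using vw by blast
  then show ?thesis using lin_addD[OF proj_lin cd(1,2)] vs_add_closed[OF vA cd(1,2)] by (metis imageI)
 qed
 show "k \<odot>\<^sub>Q w : proj ` carrier A" if w: "k : carrier K" "w : proj ` carrier A" for k w
 proof -
  obtain d where d: "d : carrier A" "w = proj d" using w by blast
  then show ?thesis using lin_smultD[OF proj_lin w(1) d(1)] vs_smult_closed[OF vA w(1) d(1)] by (metis imageI)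
 qed
 qed (use lin_mem[OF proj_lin] in auto)
 then show ?thesis by blast
qed

lemma comult_proj: "c : carrier A ==> comult Q (proj c) = tensor_map K A A Q Q proj proj (comult A c)"
proof (rule O.A_lin_eq[OF vQQ, where F="%c. comult Q (proj c)" and G="%c. tensor_map K A A Q Q proj proj (comult A c)"])
 show "(%c. comult Q (proj c)) : lin_maps K A QQ" by (assumption | rule lin)+
 show "(%c. tensor_map K A A Q Q proj proj (comult A c)) : lin_maps K A QQ" by (assumption | rule proj_lin lin)+
 fix n h assume n: "n < N" and h: "h : carrier H"
 have b: "bilinear_map K A A QQ (%u v. pQ (proj u) (proj v))" by (assumption | rule lin)+
 have i: "liftH QQ (%x v. pQ (proj (mono k (g [^]\<^sub>H j \<otimes>\<^sub>H x))) (proj (mono j v))) (comult H h) = counit H h \<odot>\<^sub>QQ pQ (e k) (e j)" for k j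
 proof -
 have "liftH QQ (%x v. pQ (proj (mono k (g [^]\<^sub>H j \<otimes>\<^sub>H x))) (proj (mono j v))) (comult H h) =
  liftH QQ (%x v. (cp 0 x \<otimes>\<^sub>K cp 0 v) \<odot>\<^sub>QQ pQ (e k) (e j)) (comult H h)"
  by (rule lift_fcong) (simp add: proj_mono gpow_mem counit_mult gpow_counit counitH e_mem
   lin_smultD[OF bilin_lin1[OF bilin_pure[OF vQ vQ]]] lin_smultD[OF bilin_lin2[OF bilin_pure[OF vQ vQ]]]
   QQV.smult_assoc1[symmetric] K.m_comm pure_mem[OF vQ vQ])
 then show ?thesis using liftH_cp[OF vQQ pure_mem[OF vQ vQ e_mem e_mem] h, of 0 0 k j] by simp
 qed
 have "comult Q (proj (mono n h)) = counit H h \<odot>\<^sub>QQ finsum QQ (%k. gs n k \<odot>\<^sub>QQ pQ (e k) (e (n - k))) {..n}"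
 by (simp add: proj_mono h lin_smultD[OF comult_lin] counitH e_mem comult_e n)
 also have "... = finsum QQ (%k. counit H h \<odot>\<^sub>QQ (gs n k \<odot>\<^sub>QQ pQ (e k) (e (n - k)))) {..n}"
 by (rule lin_finsumD[OF lin_smult_const[OF vQQ lin_id counitH[OF h]] vQQ vQQ]) (simp_all add: gs_mem pure_mem[OF vQ vQ] e_mem)
 also have "... = finsum QQ (%k. gs n k \<odot>\<^sub>QQ (counit H h \<odot>\<^sub>QQ pQ (e k) (e (n - k)))) {..n}"
 by (rule QQV.finsum_cong'[OF refl]) (simp_all add: gs_mem pure_mem[OF vQ vQ] e_mem counitH h QQV.smult_assoc1[symmetric] K.m_comm)
 also have "... = tensor_map K A A Q Q proj proj (comult A (mono n h))"
 unfolding tensor_map_def lift_comult_mono[OF vQQ b h] i ..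
 finally show "comult Q (proj (mono n h)) = tensor_map K A A Q Q proj proj (comult A (mono n h))" .
qed

lemma counit_proj: "c : carrier A ==> counit Q (proj c) = counit A c"
proof (rule O.A_lin_eq[OF baseV, where F="%c. counit Q (proj c)" and G="counit A"])
 show "(%c. counit Q (proj c)) : lin_maps K A KB" by (assumption | rule lin)+
 show "counit A : lin_maps K A KB" by (rule alg_map_lin[OF counit_A_alg])
 fix n h assume "h : carrier H"
 then show "counit Q (proj (mono n h)) = counit A (mono n h)"
 by (simp add: proj_mono counit_mono lin_smultD[OF counit_lin] counitH e_mem counit_e')
qed

lemma coalg_Q: "coalgebra K Q"
 by (rule coalgebra_quotient[OF coalg_A vQ proj_lin proj_surj comult_lin counit_lin comult_proj counit_proj])

lemma proj_one: "proj (mono n \<one>\<^sub>H) = e n"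
 by (simp add: proj_mono counit_one e_mem)

lemma lift_comult_e:
 assumes M: "vectorspace K M" and F: "bilinear_map K Q Q M F"
 shows "liftQ M F (comult Q (e n)) = finsum M (%k. gs n k \<odot>\<^sub>M F (e k) (e (n - k))) {..n}"
proof -
 have b: "bilinear_map K A A M (%u v. F (proj u) (proj v))"
 by (assumption | rule bilin_comp1[OF F] bilin_comp2[OF F] proj_lin lin)+
 have "liftQ M F (comult Q (e n)) = liftA M (%u v. F (proj u) (proj v)) (comult A (mono n \<one>\<^sub>H))"
 unfolding proj_one[of n, symmetric] comult_proj[OF mono_mem[OF HR.one_closed]]
 by (rule lift_tensor_map[OF vA vA vQ vQ proj_lin proj_lin M F comult_A_closed[OF mono_mem[OF HR.one_closed]]])
 then show ?thesis unfolding lift_comult_mono_one[OF M b]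
 by (simp add: proj_mono gpow_mem gpow_counit counit_one e_mem)
qed

lemma comult_e': "comult Q (e n) = finsum QQ (%k. gs n k \<odot>\<^sub>QQ pQ (e k) (e (n - k))) {..n}"
 using lift_comult_e[OF vQQ bilin_pure[OF vQ vQ], of n] lift_pure_id[OF vQ vQ lin_mem[OF comult_lin e_mem]] by simp

end

context line_structure
begin

abbreviation mm where "mm == mult_map K Q"
abbreviation Q4 where "Q4 == tensor K (tensor K Q Q) (tensor K Q Q)"
abbreviation p4 where "p4 == pure_tensor K (tensor K Q Q) (tensor K Q Q)"

lemmas vQ4 = vs_tensor[OF vQQ vQQ]

lemma mm_lin: "mm : lin_maps K QQ Q"
 and mm_pure: "v : carrier Q ==> w : carrier Q ==> mm (pQ v w) = v \<otimes>\<^sub>Q w"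
 unfolding mult_map_def
 by (rule lift_spec(1)[OF vQ vQ vQ bilin_mult[OF QA]]) (rule lift_spec(2)[OF vQ vQ vQ bilin_mult[OF QA]])

lemmas [lin] = lin_comp[OF mm_lin] lin_mem[OF mm_lin] vQQ

lemma braided_inner:
 "r1 : carrier Q ==> s1 : carrier Q ==> s2 : carrier Q ==>
  bilinear_map K H Q Q4 (%x r0. p4 (pQ r1 (act Q x s1)) (pQ r0 s2))"
 "r1 : carrier Q ==> r2 : carrier Q ==>
  bilinear_map K Q Q Q4 (%s1 s2. liftHQ Q4 (%x r0. p4 (pQ r1 (act Q x s1)) (pQ r0 s2)) (coact Q r2))"
 "s : carrier Q ==>
  bilinear_map K Q Q Q4 (%r1 r2. liftQ Q4 (%s1 s2. liftHQ Q4 (%x r0. p4 (pQ r1 (act Q x s1)) (pQ r0 s2)) (coact Q r2)) (comult Q s))"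
 by (assumption | rule lin)+

lemma braided_lin:
 "s : carrier Q ==> (%r. braided_comult K H Q r s) : lin_maps K Q Q4"
 "r : carrier Q ==> (%s. braided_comult K H Q r s) : lin_maps K Q Q4"
 unfolding braided_comult_def Let_def sweedler_def
 by (assumption | rule lin)+

lemma braided_e:
 "braided_comult K H Q (e a) (e b) = finsum Q4 (%k. gs a k \<odot>\<^sub>Q4 finsum Q4 (%l. gs b l \<odot>\<^sub>Q4
  p4 (pQ (e k) (act Q (g [^]\<^sub>H (a - k)) (e l))) (pQ (e (a - k)) (e (b - l)))) {..b}) {..a}"
proof -
 interpret Q4: vectorspace K Q4 by (rule vQ4)
 note c = act_closed[OF gpow_mem e_mem] e_mem pure_mem[OF vQ vQ] pure_mem[OF vQQ vQQ]
 show ?thesis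
 unfolding braided_comult_def Let_def sweedler_def lift_comult_e[OF vQ4 braided_inner(3)[OF e_mem]]
  lift_comult_e[OF vQ4 braided_inner(2)[OF e_mem e_mem]]
 unfolding coact_e' lift_pure[OF hV vQ vQ4 braided_inner(1)[OF e_mem e_mem e_mem] gpow_mem e_mem] ..
qed

lemma lift_braided_e:
 assumes M: "vectorspace K M" and G: "bilinear_map K QQ QQ M G"
 shows "tensor_lift K QQ QQ M G (braided_comult K H Q (e a) (e b)) =
 finsum M (%k. gs a k \<odot>\<^sub>M finsum M (%l. gs b l \<odot>\<^sub>M
  G (pQ (e k) (act Q (g [^]\<^sub>H (a - k)) (e l))) (pQ (e (a - k)) (e (b - l)))) {..b}) {..a}"
proof -
 interpret Q4: vectorspace K Q4 by (rule vQ4)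
 interpret M: vectorspace K M by (rule M)
 note c = act_closed[OF gpow_mem e_mem] e_mem pure_mem[OF vQ vQ] pure_mem[OF vQQ vQQ] gs_mem
 let ?L = "tensor_lift K QQ QQ M G"
 note L = lift_spec(1)[OF vQQ vQQ M G]
 have t: "p4 (pQ (e k) (act Q (g [^]\<^sub>H (a - k)) (e l))) (pQ (e (a - k)) (e (b - l))) : carrier Q4" for k l
 by (simp add: c)
 have s: "finsum Q4 (%l. gs b l \<odot>\<^sub>Q4 p4 (pQ (e k) (act Q (g [^]\<^sub>H (a - k)) (e l))) (pQ (e (a - k)) (e (b - l)))) {..b} : carrier Q4" for k
 by (rule Q4.finsum_closed) (simp add: t gs_mem)
 have i: "?L (finsum Q4 (%l. gs b l \<odot>\<^sub>Q4 p4 (pQ (e k) (act Q (g [^]\<^sub>H (a - k)) (e l))) (pQ (e (a - k)) (e (b - l)))) {..b}) =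
  finsum M (%l. gs b l \<odot>\<^sub>M G (pQ (e k) (act Q (g [^]\<^sub>H (a - k)) (e l))) (pQ (e (a - k)) (e (b - l)))) {..b}" for k
 by (subst lin_finsumD[OF L vQ4 M]) (simp_all add: t gs_mem lin_smultD[OF L] lift_spec(2)[OF vQQ vQQ M G] c)
 show ?thesis unfolding braided_e
 by (subst lin_finsumD[OF L vQ4 M]) (simp_all add: s gs_mem lin_smultD[OF L] i)
qed

lemma act_gpow_e: "act Q (g [^]\<^sub>H (m::nat)) (e l) = q [^]\<^sub>K (l * m) \<odot>\<^sub>Q e l"
 by (simp add: act_e' gpow_mem cp_gpow)

lemma proj_mult_mono: "h : carrier H ==> k : carrier H ==>
 proj (mono m h \<otimes>\<^sub>A mono n k) = (cp n h \<otimes>\<^sub>K counit H k) \<odot>\<^sub>Q e (m + n)"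
 by (simp add: O.mult_mono proj_mono counit_mult counit_phin phin_mem)

lemma mono_mult_one: "mono a \<one>\<^sub>H \<otimes>\<^sub>A mono b \<one>\<^sub>H = mono (a + b) \<one>\<^sub>H"
 by (simp add: O.mult_mono alg_map_one[OF phi_funpow_alg])

text \<open>Both sides are the double \<open>q\<close>-binomial sum that expands \<open>\<Delta>(y\<^sup>a) \<Delta>(y\<^sup>b)\<close>.\<close>

lemma comult_mult_e:
 "comult Q (e a \<otimes>\<^sub>Q e b) = tensor_map K QQ QQ Q Q mm mm (braided_comult K H Q (e a) (e b))"
proof -
 note mc = mono_mem[OF HR.one_closed]
 have b0: "bilinear_map K A A QQ (%u v. pQ (proj u) (proj v))" by (assumption | rule proj_lin lin)+
 have b1: "bilinear_map K A A QQ (%x v. liftA QQ (%x' v'. pQ (proj (x \<otimes>\<^sub>A x')) (proj (v \<otimes>\<^sub>A v'))) (comult A (mono b \<one>\<^sub>H)))"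
 by (assumption | rule mc proj_lin lin)+
 have b2: "bilinear_map K A A QQ (%x' v'. pQ (proj (x \<otimes>\<^sub>A x')) (proj (v \<otimes>\<^sub>A v')))" if "x : carrier A" "v : carrier A" for x v
 by (assumption | rule that proj_lin lin)+
 have b4: "bilinear_map K QQ QQ QQ (%s t. pQ (mm s) (mm t))" by (assumption | rule mm_lin lin)+
 have t: "pQ (proj (mono k (g [^]\<^sub>H (a - k)) \<otimes>\<^sub>A mono l (g [^]\<^sub>H (b - l)))) (proj (mono (a - k) \<one>\<^sub>H \<otimes>\<^sub>A mono (b - l) \<one>\<^sub>H)) =
 pQ (mm (pQ (e k) (act Q (g [^]\<^sub>H (a - k)) (e l)))) (mm (pQ (e (a - k)) (e (b - l))))" for k l
 by (simp add: proj_mult_mono gpow_mem cp_gpow gpow_counit mono_mult_one proj_one mm_pure act_gpow_e e_mem q_closed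
  alg_smult_r[OF QA] e_mult')
 have "comult Q (e a \<otimes>\<^sub>Q e b) = comult Q (proj (mono a \<one>\<^sub>H \<otimes>\<^sub>A mono b \<one>\<^sub>H))"
 by (simp add: mono_mult_one proj_one e_mult')
 also have "... = liftA QQ (%u v. pQ (proj u) (proj v)) (comult A (mono a \<one>\<^sub>H \<otimes>\<^sub>A mono b \<one>\<^sub>H))"
 unfolding comult_proj[OF alg_mult_mem[OF aA mc mc]] tensor_map_def ..
 also have "... = liftA QQ (%x v. liftA QQ (%x' v'. pQ (proj (x \<otimes>\<^sub>A x')) (proj (v \<otimes>\<^sub>A v'))) (comult A (mono b \<one>\<^sub>H))) (comult A (mono a \<one>\<^sub>H))"
 by (rule lift_comult_mult[OF bialg_A vQQ b0 mc mc])
 also have "... = tensor_map K QQ QQ Q Q mm mm (braided_comult K H Q (e a) (e b))"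
 unfolding tensor_map_def lift_braided_e[OF vQQ b4] lift_comult_mono_one[OF vQQ b1]
  lift_comult_mono_one[OF vQQ b2[OF mono_mem[OF gpow_mem] mc]] t ..
 finally show ?thesis .
qed

lemma comult_mult:
 assumes r: "r : carrier Q" and s: "s : carrier Q"
 shows "comult Q (r \<otimes>\<^sub>Q s) = tensor_map K QQ QQ Q Q mm mm (braided_comult K H Q r s)"
proof -
 note l = lin_comp[OF tensor_map_lin[OF vQQ vQQ vQ vQ mm_lin mm_lin lin_id]]
 have 1: "comult Q (e a \<otimes>\<^sub>Q s) = tensor_map K QQ QQ Q Q mm mm (braided_comult K H Q (e a) s)" for a
 by (rule Q_lin_eq[OF vQQ, where F="%s. comult Q (e a \<otimes>\<^sub>Q s)" and
  G="%s. tensor_map K QQ QQ Q Q mm mm (braided_comult K H Q (e a) s)", OF _ _ comult_mult_e s])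
  (assumption | rule l braided_lin lin)+
 show ?thesis
 by (rule Q_lin_eq[OF vQQ, where F="%r. comult Q (r \<otimes>\<^sub>Q s)" and
  G="%r. tensor_map K QQ QQ Q Q mm mm (braided_comult K H Q r s)", OF _ _ 1 r])
  (assumption | rule s l braided_lin lin)+
qed

text \<open>Each power of the generator is an eigenvector for the action and homogeneous for the coaction, so all conditions reduce to identities in \<open>H\<close>.\<close>

lemma yd_module_Q: "yd_module K H Q"
 unfolding yd_module_def sweedler3_def sweedler_def
proof (intro conjI ballI vQ act_lin act_lin' coact_lin)
 let ?T = "tensor K H HQ" let ?p = "pure_tensor K H HQ"
 note vT = vs_tensor[OF hV vHQ]
 fix v assume v: "v : carrier Q"
 show "act Q \<one>\<^sub>H v = v"
 by (rule Q_lin_eq[OF vQ act_lin lin_id _ v]) (simp_all add: act_e cp_one e_mem)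
 { fix h k assume h: "h : carrier H" and k: "k : carrier H"
 show "act Q (h \<otimes>\<^sub>H k) v = act Q h (act Q k v)"
 proof (rule Q_lin_eq[OF vQ _ _ _ v, where F="%v. act Q (h \<otimes>\<^sub>H k) v" and G="%v. act Q h (act Q k v)"])
  show "act Q (h \<otimes>\<^sub>H k) : lin_maps K Q Q" "(%v. act Q h (act Q k v)) : lin_maps K Q Q"
  by (assumption | rule h k lin)+
  show "act Q (h \<otimes>\<^sub>H k) (e n) = act Q h (act Q k (e n))" for n
  using h k by (simp add: act_e' cp_mult cp_mem lin_smultD[OF act_lin] e_mem QV.smult_assoc1[symmetric] K.m_comm)
 qed }
 have b1: "bilinear_map K H H ?T (%x1 x2. ?p x1 (pHQ x2 w))" if "w : carrier Q" for w
 by (assumption | rule that lin)+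
 have b2: "bilinear_map K H Q ?T (%x w. liftH ?T (%x1 x2. ?p x1 (pHQ x2 w)) (comult H x))"
 by (assumption | rule lin)+
 have b3: "bilinear_map K H Q ?T (%x w. ?p x (coact Q w))" by (assumption | rule lin)+
 have b4: "bilinear_map K H Q Q (%x w. counit H x \<odot>\<^sub>Q w)" by (assumption | rule lin)+
 show "liftHQ ?T (%x w. liftH ?T (%x1 x2. ?p x1 (pHQ x2 w)) (comult H x)) (coact Q v) = liftHQ ?T (%x w. ?p x (coact Q w)) (coact Q v)"
 proof (rule Q_lin_eq[OF vT _ _ _ v, where F="%v. liftHQ ?T (%x w. liftH ?T (%x1 x2. ?p x1 (pHQ x2 w)) (comult H x)) (coact Q v)"
  and G="%v. liftHQ ?T (%x w. ?p x (coact Q w)) (coact Q v)"])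
 show "liftHQ ?T (%x w. liftH ?T (%x1 x2. ?p x1 (pHQ x2 w)) (comult H x)) (coact Q (e n)) = liftHQ ?T (%x w. ?p x (coact Q w)) (coact Q (e n))" for n
  unfolding coact_e' lift_pure[OF hV vQ vT b2 gpow_mem e_mem] lift_pure[OF hV vQ vT b3 gpow_mem e_mem]
  gpow_comult lift_pure[OF hV hV vT b1[OF e_mem] gpow_mem gpow_mem] ..
 qed (assumption | rule coact_lin b2 b3 lin)+
 show "liftHQ Q (%x w. counit H x \<odot>\<^sub>Q w) (coact Q v) = v"
 proof (rule Q_lin_eq[OF vQ _ lin_id _ v, where F="%v. liftHQ Q (%x w. counit H x \<odot>\<^sub>Q w) (coact Q v)"])
 show "liftHQ Q (%x w. counit H x \<odot>\<^sub>Q w) (coact Q (e n)) = e n" for n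
  unfolding coact_e' lift_pure[OF hV vQ vQ b4 gpow_mem e_mem] by (simp add: gpow_counit e_mem)
 qed (assumption | rule coact_lin b4 lin)+
next
 fix h v assume h: "h : carrier H" and v: "v : carrier Q"
 let ?R = "%v. liftH HQ (%a b. liftH HQ (%x u. liftHQ HQ (%z w. pHQ (x \<otimes>\<^sub>H z \<otimes>\<^sub>H S b) (act Q u w)) (coact Q v)) (comult H a)) (comult H h)"
 show "coact Q (act Q h v) = ?R v"
 proof (rule Q_lin_eq[OF vHQ _ _ _ v, where F="%v. coact Q (act Q h v)" and G="?R"])
 show "(%v. coact Q (act Q h v)) : lin_maps K Q HQ" by (assumption | rule h coact_lin lin)+
 show "?R : lin_maps K Q HQ" by (assumption | rule h coact_lin lin)+
 fix n
 let ?F = "%b x u. cp n u \<odot>\<^sub>H (x \<otimes>\<^sub>H g [^]\<^sub>H n \<otimes>\<^sub>H S b)"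
 have L: "(%t. pHQ t (e n)) : lin_maps K H HQ" by (assumption | rule lin)+
 have b1: "bilinear_map K H H H (%a b. liftH H (?F b) (comult H a))" by (assumption | rule lin)+
 have b2: "bilinear_map K H H H (?F b)" if "b : carrier H" for b by (assumption | rule that lin)+
 have b3: "bilinear_map K H Q HQ (%z w. pHQ (x \<otimes>\<^sub>H z \<otimes>\<^sub>H S b) (act Q u w))"
  if "x : carrier H" "b : carrier H" "u : carrier H" for x b u by (assumption | rule that lin)+
 have "coact Q (act Q h (e n)) = pHQ (cp n h \<odot>\<^sub>H g [^]\<^sub>H n) (e n)"
  using h by (simp add: act_e' coact_e' lin_smultD[OF coact_lin] cp_mem e_mem gpow_mem lin_smultD[OF L])
 also have "... = liftH HQ (%a b. pHQ (liftH H (?F b) (comult H a)) (e n)) (comult H h)"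
  unfolding gpow_adjoint[OF h, symmetric] by (rule liftH_out[OF hV b1 vHQ L h])
 also have "... = ?R (e n)"
 proof (rule lift_fcong)
  fix a b assume a: "a : carrier H" and b: "b : carrier H"
  have "pHQ (liftH H (?F b) (comult H a)) (e n) = liftH HQ (%x u. pHQ (?F b x u) (e n)) (comult H a)"
  by (rule liftH_out[OF hV b2[OF b] vHQ L a])
  also have "... = liftH HQ (%x u. liftHQ HQ (%z w. pHQ (x \<otimes>\<^sub>H z \<otimes>\<^sub>H S b) (act Q u w)) (coact Q (e n))) (comult H a)"
  proof (rule lift_fcong)
  fix x u assume x: "x : carrier H" and u: "u : carrier H"
  have c: "x \<otimes>\<^sub>H g [^]\<^sub>H n \<otimes>\<^sub>H S b : carrier H" using x b by (simp add: gpow_mem lin_mem[OF S_lin])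
  show "pHQ (?F b x u) (e n) = liftHQ HQ (%z w. pHQ (x \<otimes>\<^sub>H z \<otimes>\<^sub>H S b) (act Q u w)) (coact Q (e n))"
   unfolding coact_e' lift_pure[OF hV vQ vHQ b3[OF x b u] gpow_mem e_mem] act_e'[OF u]
   lin_smultD[OF L cp_mem[OF u] c]
   by (rule lin_smultD[OF bilin_lin1[OF bilin_pure[OF hV vQ] c] cp_mem[OF u] e_mem, symmetric])
  qed
  finally show "pHQ (liftH H (?F b) (comult H a)) (e n) = liftH HQ (%x u. liftHQ HQ (%z w. pHQ (x \<otimes>\<^sub>H z \<otimes>\<^sub>H S b) (act Q u w)) (coact Q (e n))) (comult H a)" .
 qed
 finally show "coact Q (act Q h (e n)) = ?R (e n)" .
 qed
qed

abbreviation act2 where "act2 h t == liftH QQ (%h1 h2. tensor_map K Q Q Q Q (act Q h1) (act Q h2) t) (comult H h)"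
abbreviation coact2 where "coact2 t == liftQ (tensor K H QQ) (%v w. liftHQ (tensor K H QQ) (%x v0. liftHQ (tensor K H QQ)
 (%z w0. pure_tensor K H QQ (x \<otimes>\<^sub>H z) (pQ v0 w0)) (coact Q w)) (coact Q v)) t"

lemma act2_lin: "h : carrier H ==> act2 h : lin_maps K QQ QQ"
 unfolding tensor_map_def by (assumption | rule lin)+

lemma coact2_lin: "(%t. coact2 t) : lin_maps K QQ (tensor K H QQ)"
 by (assumption | rule lin)+

lemma act2_e: assumes h: "h : carrier H" shows "act2 h (pQ (e a) (e b)) = cp (a + b) h \<odot>\<^sub>QQ pQ (e a) (e b)"
proof -
 have "act2 h (pQ (e a) (e b)) = liftH QQ (%x v. (cp a x \<otimes>\<^sub>K cp b v) \<odot>\<^sub>QQ pQ (e a) (e b)) (comult H h)"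
 by (rule lift_fcong) (simp add: tensor_map_pure[OF vQ vQ vQ vQ act_lin act_lin] e_mem act_e' cp_mem
   lin_smultD[OF bilin_lin1[OF bilin_pure[OF vQ vQ]]] lin_smultD[OF bilin_lin2[OF bilin_pure[OF vQ vQ]]]
   QQV.smult_assoc1[symmetric] K.m_comm pure_mem[OF vQ vQ])
 then show ?thesis using liftH_cp[OF vQQ pure_mem[OF vQ vQ e_mem e_mem] h] by simp
qed

lemma coact2_e: "coact2 (pQ (e a) (e b)) = pure_tensor K H QQ (g [^]\<^sub>H (a + b)) (pQ (e a) (e b))"
proof -
 let ?T = "tensor K H QQ" let ?p = "pure_tensor K H QQ"
 note vT = vs_tensor[OF hV vQQ]
 have b3: "bilinear_map K H Q ?T (%z w0. ?p (x \<otimes>\<^sub>H z) (pQ v w0))" if "x : carrier H" "v : carrier Q" for x v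
 by (assumption | rule that lin)+
 have b2: "bilinear_map K H Q ?T (%x v0. liftHQ ?T (%z w0. ?p (x \<otimes>\<^sub>H z) (pQ v0 w0)) (coact Q w))" if "w : carrier Q" for w
 by (assumption | rule that lin)+
 have b1: "bilinear_map K Q Q ?T (%v w. liftHQ ?T (%x v0. liftHQ ?T (%z w0. ?p (x \<otimes>\<^sub>H z) (pQ v0 w0)) (coact Q w)) (coact Q v))"
 by (assumption | rule lin)+
 show ?thesis
 unfolding lift_pure[OF vQ vQ vT b1 e_mem e_mem] coact_e' lift_pure[OF hV vQ vT b2[OF e_mem] gpow_mem e_mem, unfolded coact_e']
  lift_pure[OF hV vQ vT b3[OF gpow_mem e_mem] gpow_mem e_mem]
 by (simp add: HR.nat_pow_mult g_mem)
qed

text \<open>The terms of \<open>\<Delta>(e n)\<close> all have total degree \<open>n\<close>, and the degree determines the action and the coaction.\<close>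

lemma QQ_homog:
 assumes h: "h : carrier H"
 shows "act2 h (comult Q (e n)) = cp n h \<odot>\<^sub>QQ comult Q (e n)"
 and "coact2 (comult Q (e n)) = pure_tensor K H QQ (g [^]\<^sub>H n) (comult Q (e n))"
proof -
 interpret T: vectorspace K "tensor K H QQ" by (rule vs_tensor[OF hV vQQ])
 note pc = pure_mem[OF vQ vQ e_mem e_mem]
 note L = act2_lin[OF h] and L3 = lin_smult_const[OF vQQ lin_id cp_mem[OF h]] and L4 = bilin_lin1[OF bilin_pure[OF hV vQQ] gpow_mem]
 have tc: "gs n k \<odot>\<^sub>QQ pQ (e k) (e (n - k)) : carrier QQ" for k by (simp add: gs_mem pc)
 show "act2 h (comult Q (e n)) = cp n h \<odot>\<^sub>QQ comult Q (e n)"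
 unfolding comult_e' lin_finsumD[OF L vQQ vQQ finite_atMost tc] lin_finsumD[OF L3 vQQ vQQ finite_atMost tc]
 by (rule QQV.finsum_cong'[OF refl])
  (simp_all add: lin_smultD[OF L gs_mem pc] act2_e[OF h] QQV.smult_assoc1[symmetric] K.m_comm gs_mem cp_mem h pc)
 show "coact2 (comult Q (e n)) = pure_tensor K H QQ (g [^]\<^sub>H n) (comult Q (e n))"
 unfolding comult_e' lin_finsumD[OF coact2_lin vQQ T.vectorspace_axioms finite_atMost tc] lin_finsumD[OF L4 vQQ T.vectorspace_axioms finite_atMost tc]
 by (rule T.finsum_cong'[OF refl])
  (simp_all add: lin_smultD[OF coact2_lin gs_mem pc] coact2_e lin_smultD[OF L4 gs_mem pc] gs_mem gpow_mem pc pure_mem[OF hV vQQ])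
qed

theorem braided_bialgebra_Q: "braided_bialgebra K H Q"
 unfolding braided_bialgebra_def
proof (intro conjI yd_module_Q QA coalg_Q)
 let ?T = "tensor K H QQ"
 note vT = vs_tensor[OF hV vQQ]
 show "mm : yd_maps K H (yd_tensor K H Q Q) Q"
 unfolding yd_maps_def
 proof (simp add: mm_lin sweedler_def, intro ballI conjI)
 fix t assume t: "t : carrier QQ"
 { fix h assume h: "h : carrier H"
  show "mm (act2 h t) = act Q h (mm t)"
  by (rule QQ_lin_eq[OF vQ lin_comp[OF mm_lin act2_lin[OF h]] lin_comp[OF act_lin[OF h] mm_lin] _ t])
   (simp add: act2_e h lin_smultD[OF mm_lin] cp_mem pure_mem[OF vQ vQ] e_mem mm_pure e_mult' act_e') }
 show "coact Q (mm t) = tensor_map K H QQ H Q (%x. x) mm (coact2 t)"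
  by (rule QQ_lin_eq[OF vHQ lin_comp[OF coact_lin mm_lin] tensor_map_lin[OF hV vQQ hV vQ lin_id mm_lin coact2_lin] _ t])
  (simp add: mm_pure e_mem e_mult' coact_e' coact2_e tensor_map_pure[OF hV vQQ hV vQ lin_id mm_lin] gpow_mem pure_mem[OF vQ vQ])
 qed
 show "(%k. k \<odot>\<^sub>Q \<one>\<^sub>Q) : yd_maps K H (yd_unit K H) Q"
 proof -
 have u: "(%k. k \<odot>\<^sub>Q \<one>\<^sub>Q) : lin_maps K KB Q" unfolding e_0[symmetric] by (assumption | rule lin)+
 note ps = lin_smultD[OF bilin_lin1[OF bilin_pure[OF hV vQ]]]
 show ?thesis
  unfolding yd_maps_def
  using act_e'[of _ 0] coact_e'[of 0] e_mem[of 0] u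
  by (auto simp: e_0 lin_smultD[OF act_lin] counitH QV.smult_assoc1[symmetric] K.m_comm lin_smultD[OF coact_lin]
  tensor_map_pure[OF hV baseV hV vQ lin_id u] ps)
 qed
 show "comult Q : yd_maps K H Q (yd_tensor K H Q Q)"
 unfolding yd_maps_def
 proof (simp add: comult_lin sweedler_def, intro ballI conjI)
 fix v assume v: "v : carrier Q"
 { fix h assume h: "h : carrier H"
  show "comult Q (act Q h v) = act2 h (comult Q v)"
  by (rule Q_lin_eq[OF vQQ lin_comp[OF comult_lin act_lin[OF h]] lin_comp[OF act2_lin[OF h] comult_lin] _ v])
   (simp add: QQ_homog h act_e' lin_smultD[OF comult_lin] cp_mem e_mem) }
 show "coact2 (comult Q v) = tensor_map K H Q H QQ (%x. x) (comult Q) (coact Q v)"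
  by (rule Q_lin_eq[OF vT lin_comp[OF coact2_lin comult_lin] tensor_map_lin[OF hV vQ hV vQQ lin_id comult_lin coact_lin] _ v])
  (simp add: QQ_homog(2)[OF HR.one_closed] coact_e' tensor_map_pure[OF hV vQ hV vQQ lin_id comult_lin] gpow_mem e_mem)
 qed
 show "counit Q : yd_maps K H Q (yd_unit K H)"
 unfolding yd_maps_def
 proof (simp add: counit_lin, intro ballI conjI)
 fix v assume v: "v : carrier Q"
 { fix h assume h: "h : carrier H"
  have l: "(%v. counit H h \<otimes>\<^sub>K counit Q v) : lin_maps K Q KB" by (assumption | rule h counit_lin lin)+
  show "counit Q (act Q h v) = counit H h \<otimes>\<^sub>K counit Q v"
  by (rule Q_lin_eq[OF baseV lin_comp[OF counit_lin act_lin[OF h]] l _ v])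
   (simp add: h act_e' lin_smultD[OF counit_lin] cp_mem e_mem counit_e' counitH) }
 have l: "(%v. pure_tensor K H KB \<one>\<^sub>H (counit Q v)) : lin_maps K Q (tensor K H KB)"
  by (assumption | rule HR.one_closed counit_lin lin)+
 show "pure_tensor K H KB \<one>\<^sub>H (counit Q v) = tensor_map K H Q H KB (%x. x) (counit Q) (coact Q v)"
  by (rule Q_lin_eq[OF vs_tensor[OF hV baseV] l tensor_map_lin[OF hV vQ hV baseV lin_id counit_lin coact_lin] _ v])
  (simp add: coact_e' tensor_map_pure[OF hV vQ hV baseV lin_id counit_lin] gpow_mem e_mem counit_e'
   lin_zeroD[OF bilin_lin1[OF bilin_pure[OF hV baseV]] baseV vs_tensor[OF hV baseV], simplified])
 qed
 show "comult Q \<one>\<^sub>Q = pQ \<one>\<^sub>Q \<one>\<^sub>Q"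
 using comult_e'[of 0] by (simp add: e_0 pure_mem[OF vQ vQ])
 show "ALL r:carrier Q. ALL s:carrier Q. comult Q (r \<otimes>\<^sub>Q s) = tensor_map K QQ QQ Q Q mm mm (braided_comult K H Q r s)"
 using comult_mult by blast
 show "counit Q : algebra_maps K Q KB"
 proof (rule algebra_mapsI[OF counit_lin])
 show "counit Q \<one>\<^sub>Q = \<one>\<^sub>KB" using counit_e'[of 0] by (simp add: e_0)
 fix r s assume r: "r : carrier Q" and s: "s : carrier Q"
 note l = lin_mult_r[OF base_algebra[OF field] counit_lin] and l' = lin_mult_l[OF base_algebra[OF field] counit_lin]
 have 1: "counit Q (e a \<otimes>\<^sub>Q s) = counit Q (e a) \<otimes>\<^sub>KB counit Q s" for a
  by (rule Q_lin_eq[OF baseV lin_comp[OF counit_lin lin_mult_r[OF QA lin_id e_mem]] l _ s])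
  (simp_all add: counit_e' e_mult' e_mem counit_Q_closed)
 show "counit Q (r \<otimes>\<^sub>Q s) = counit Q r \<otimes>\<^sub>KB counit Q s"
  by (rule Q_lin_eq[OF baseV lin_comp[OF counit_lin lin_mult_l[OF QA lin_id s]] l' 1 r])
  (simp_all add: counit_Q_closed s)
 qed
qed

end

lemma coordinates_exist:
 assumes V: "vectorspace K V" and B: "vectorspace.basis K V (e ` {..<N::nat})" and inj: "inj_on e {..<N}"
 shows "EX l. (ALL n<N. l n : lin_maps K V (base_module K)) & (ALL m<N. ALL n<N. l n (e m) = (if m = n then \<one>\<^sub>K else \<zero>\<^sub>K))"
proof -
 have "EX f. dual_to K V (e ` {..<N}) (e n) f" if "n < N" for n
 by (rule basis_dual_exists[OF V B]) (use that in simp)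
 then obtain l where l: "!!n. n < N ==> dual_to K V (e ` {..<N}) (e n) (l n)" by metis
 have "l n (e m) = (if m = n then \<one>\<^sub>K else \<zero>\<^sub>K)" if "m < N" "n < N" for m n
 using l[OF that(2)] that inj by (auto simp: dual_to_def inj_on_def)
 moreover have "l n : lin_maps K V (base_module K)" if "n < N" for n using l[OF that] by (simp add: dual_to_def)
 ultimately have "(ALL n<N. l n : lin_maps K V (base_module K)) & (ALL m<N. ALL n<N. l n (e m) = (if m = n then \<one>\<^sub>K else \<zero>\<^sub>K))"
 by blast
 then show ?thesis by (rule exI[where x=l])
qed

lemma coordinate_extension:
 assumes V: "vectorspace K V" and M: "vectorspace K M" and ev: "!!n. n < N ==> e n : carrier V"
 and l: "!!n. n < N ==> l n : lin_maps K V (base_module K)"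
 and le: "!!m n. m < N ==> n < N ==> l n (e m) = (if m = n then \<one>\<^sub>K else \<zero>\<^sub>K)"
 and f: "!!n. n < N ==> f n : carrier M"
 shows "(%v. finsum M (%n. l n v \<odot>\<^sub>M f n) {..<N::nat}) : lin_maps K V M"
 and "m < N ==> finsum M (%n. l n (e m) \<odot>\<^sub>M f n) {..<N} = f m"
proof -
 interpret M: vectorspace K M by (rule M)
 show "(%v. finsum M (%n. l n v \<odot>\<^sub>M f n) {..<N}) : lin_maps K V M"
 by (rule lin_finsum) (auto intro!: lin_smult_fun M f l)
 assume m: "m < N"
 have "finsum M (%n. l n (e m) \<odot>\<^sub>M f n) {..<N} = finsum M (%n. if m = n then f n else \<zero>\<^sub>M) {..<N}"
 by (rule M.finsum_cong'[OF refl]) (use m in \<open>auto simp: le f\<close>)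
 also have "... = f m" by (rule M.M.add.finprod_singleton) (use m f in auto)
 finally show "finsum M (%n. l n (e m) \<odot>\<^sub>M f n) {..<N} = f m" .
qed

lemma (in line_structure) linear_extension:
 assumes M: "vectorspace K M" and f: "!!n. n < N ==> f n : carrier M"
 shows "EX F:lin_maps K Q M. ALL n<N. F (e n) = f n"
proof -
 obtain l where l: "ALL n<N. l n : lin_maps K Q KB" "ALL m<N. ALL n<N. l n (e m) = (if m = n then \<one>\<^sub>K else \<zero>\<^sub>K)"
 using coordinates_exist[OF vQ e_basis e_inj] by blast
 have l1: "n < N ==> l n : lin_maps K Q KB" and l2: "m < N ==> n < N ==> l n (e m) = (if m = n then \<one>\<^sub>K else \<zero>\<^sub>K)" for m n
 using l by blast+
 have c1: "(%v. finsum M (%n. l n v \<odot>\<^sub>M f n) {..<N}) : lin_maps K Q M"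
 by (rule coordinate_extension(1)[where e=e and l=l and f=f]) (assumption | rule vQ M e_mem l1 l2 f)+
 have c2: "finsum M (%n. l n (e m) \<odot>\<^sub>M f n) {..<N} = f m" if "m < N" for m
 by (rule coordinate_extension(2)[where V=Q and e=e and l=l and f=f]) (assumption | rule vQ M e_mem l1 l2 f that)+
 define F where "F = (%v. finsum M (%n. l n v \<odot>\<^sub>M f n) {..<N})"
 have "F : lin_maps K Q M" unfolding F_def by (rule c1)
 moreover have "ALL n<N. F (e n) = f n" unfolding F_def using c2 by blast
 ultimately show ?thesis by blast
qed

text \<open>All structure maps of a line structure are determined by their values at the \<open>e n\<close>, so the map that matches the two bases is an isomorphism.\<close>

lemma line_structure_iso:
 assumes Q: "line_structure K H g \<chi> q lam N Q e" and R: "line_structure K H g \<chi> q lam N R f"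
 shows "EX \<psi>:braided_bialgebra_isos K H Q R. ALL n<N. \<psi> (e n) = f n"
proof -
 interpret Q: line_structure K H g \<chi> q lam N Q e by (fact Q)
 interpret R: line_structure K H g \<chi> q lam N R f by (fact R)
 obtain w where w: "w : lin_maps K Q R" "ALL n<N. w (e n) = f n" by (rule bexE[OF Q.linear_extension[where f=f, OF R.vQ R.e_mem]])
 obtain u where u: "u : lin_maps K R Q" "ALL n<N. u (f n) = e n" by (rule bexE[OF R.linear_extension[where f=e, OF Q.vQ Q.e_mem]])
 have we: "w (e n) = f n" for n
 using w by (cases "n < N") (simp_all add: Q.e_big R.e_big lin_zeroD[OF w(1) Q.vQ R.vQ])
 note wc = lin_mem[OF w(1)] and uc = lin_mem[OF u(1)]
 have uw: "u (w v) = v" if "v : carrier Q" for v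
 by (rule Q.Q_lin_eq[OF Q.vQ lin_comp[OF u(1) w(1)] lin_id _ that]) (simp add: u we)
 have wu: "w (u v) = v" if "v : carrier R" for v
 by (rule R.Q_lin_eq[OF R.vQ lin_comp[OF w(1) u(1)] lin_id _ that]) (simp add: u we)
 have bij: "bij_betw w (carrier Q) (carrier R)"
 by (rule bij_betw_byWitness[where f'=u]) (use uw wu wc uc in auto)
 have act: "w (act Q h v) = act R h (w v)" if h: "h : carrier H" and v: "v : carrier Q" for h v
 by (rule Q.Q_lin_eq[OF R.vQ lin_comp[OF w(1) Q.act_lin[OF h]] lin_comp[OF R.act_lin[OF h] w(1)] _ v])
  (simp add: Q.act_e' R.act_e' h we lin_smultD[OF w(1)] Q.cp_mem Q.e_mem)
 have coact: "coact R (w v) = tensor_map K H Q H R (%x. x) w (coact Q v)" if v: "v : carrier Q" for v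
 by (rule Q.Q_lin_eq[OF R.vHQ lin_comp[OF R.coact_lin w(1)] tensor_map_lin[OF Q.hV Q.vQ Q.hV R.vQ lin_id w(1) Q.coact_lin] _ v])
  (simp add: Q.coact_e' R.coact_e' we tensor_map_pure[OF Q.hV Q.vQ Q.hV R.vQ lin_id w(1)] Q.gpow_mem Q.e_mem)
 have yd: "w : yd_maps K H Q R" unfolding yd_maps_def using w(1) act coact by auto
 have alg: "w : algebra_maps K Q R"
 proof (rule algebra_mapsI[OF w(1)])
 show "w \<one>\<^sub>Q = \<one>\<^sub>R" unfolding Q.e_0[symmetric] R.e_0[symmetric] by (rule we)
 fix r s assume r: "r : carrier Q" and s: "s : carrier Q"
 have 1: "w (e a \<otimes>\<^sub>Q s) = w (e a) \<otimes>\<^sub>R w s" for a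
  by (rule Q.Q_lin_eq[OF R.vQ lin_comp[OF w(1) lin_mult_r[OF Q.QA lin_id Q.e_mem]] lin_mult_r[OF R.QA w(1) wc[OF Q.e_mem]] _ s])
  (simp add: Q.e_mult' R.e_mult' we)
 show "w (r \<otimes>\<^sub>Q s) = w r \<otimes>\<^sub>R w s"
  by (rule Q.Q_lin_eq[OF R.vQ lin_comp[OF w(1) lin_mult_l[OF Q.QA lin_id s]] lin_mult_l[OF R.QA w(1) wc[OF s]] 1 r])
 qed
 have "comult R (w v) = tensor_map K Q Q R R w w (comult Q v)" if v: "v : carrier Q" for v
 proof (rule Q.Q_lin_eq[OF R.vQQ lin_comp[OF R.comult_lin w(1)] tensor_map_lin[OF Q.vQ Q.vQ R.vQ R.vQ w(1) w(1) Q.comult_lin] _ v])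
 show "comult R (w (e n)) = tensor_map K Q Q R R w w (comult Q (e n))" for n
  unfolding tensor_map_def Q.lift_comult_e[OF R.vQQ bilin_pure_map[OF Q.vQ Q.vQ R.vQ R.vQ w(1) w(1)]] we R.comult_e' ..
 qed
 moreover have "counit R (w v) = counit Q v" if v: "v : carrier Q" for v
 by (rule Q.Q_lin_eq[OF Q.baseV lin_comp[OF R.counit_lin w(1)] Q.counit_lin _ v]) (simp add: we Q.counit_e' R.counit_e')
 ultimately have "w : coalgebra_maps K Q R" unfolding coalgebra_maps_def using w(1) by auto
 then have "w : braided_bialgebra_isos K H Q R" using yd alg bij by (simp add: braided_bialgebra_isos_def)
 then show ?thesis by (rule bexI[rotated]) (simp add: we)
qed

text \<open>A braided bialgebra generated by a primitive element of weight \<open>(g, \<chi>)\<close> has no choice: its structure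
  maps on the powers of the generator follow from their compatibility with the product.\<close>

lemma (in yd_setting) line_structure_of_generator:
 fixes Q :: "('k, 'h, 'v, 'z) yd_bialg_scheme"
 assumes B: "braided_bialgebra K H Q" and x: "x : carrier Q" and xN: "x [^]\<^sub>Q N = \<zero>\<^sub>Q"
 and basis: "vectorspace.basis K Q ((%n. x [^]\<^sub>Q n) ` {..<N})" and inj: "inj_on (%n. x [^]\<^sub>Q n) {..<N}"
 and ax: "!!h. h : carrier H ==> act Q h x = \<chi> h \<odot>\<^sub>Q x" and cx: "coact Q x = pure_tensor K H Q g x"
 and dx: "comult Q x = pure_tensor K Q Q x \<one>\<^sub>Q \<oplus>\<^bsub>tensor K Q Q\<^esub> pure_tensor K Q Q \<one>\<^sub>Q x"
 shows "line_structure K H g \<chi> q lam N Q (%n. x [^]\<^sub>Q n)"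
proof -
 have yd: "yd_module K H Q" and QA: "k_algebra K Q" and QC: "coalgebra K Q"
 and mm: "mult_map K Q : yd_maps K H (yd_tensor K H Q Q) Q"
 and un: "(%k. k \<odot>\<^sub>Q \<one>\<^sub>Q) : yd_maps K H (yd_unit K H) Q"
 and c1: "comult Q \<one>\<^sub>Q = pure_tensor K Q Q \<one>\<^sub>Q \<one>\<^sub>Q"
 and cm: "!!r s. r : carrier Q ==> s : carrier Q ==> comult Q (r \<otimes>\<^sub>Q s) =
  tensor_map K (tensor K Q Q) (tensor K Q Q) Q Q (mult_map K Q) (mult_map K Q) (braided_comult K H Q r s)"
 and ea: "counit Q : algebra_maps K Q KB"
 using B unfolding braided_bialgebra_def by simp_all
 note vQ = alg_vs[OF QA]
 interpret QV: vectorspace K Q by (rule vQ)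
 interpret QR: ring Q by (rule alg_ring[OF QA])
 let ?QQ = "tensor K Q Q" let ?HQ = "tensor K H Q" let ?p = "pure_tensor K Q Q" let ?e = "%n::nat. x [^]\<^sub>Q n"
 let ?Q4 = "tensor K ?QQ ?QQ" let ?p4 = "pure_tensor K ?QQ ?QQ" let ?mm = "mult_map K Q"
 note vQQ = vs_tensor[OF vQ vQ] and vHQ = vs_tensor[OF hV vQ] and vQ4 = vs_tensor[OF vs_tensor[OF vQ vQ] vs_tensor[OF vQ vQ]]
 interpret QQV: vectorspace K ?QQ by (rule vQQ)
 have al: "!!h. h : carrier H ==> act Q h : lin_maps K Q Q" and al': "!!v. v : carrier Q ==> (%h. act Q h v) : lin_maps K H Q"
 and cl: "coact Q : lin_maps K Q ?HQ"
 and cu: "!!v. v : carrier Q ==> tensor_lift K H Q Q (%x w. counit H x \<odot>\<^sub>Q w) (coact Q v) = v"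
 using yd unfolding yd_module_def by simp_all
 have ml: "?mm : lin_maps K ?QQ Q" using mm unfolding yd_maps_def by simp
 have mp: "?mm (?p v w) = v \<otimes>\<^sub>Q w" if "v : carrier Q" "w : carrier Q" for v w
 unfolding mult_map_def by (rule lift_spec(2)[OF vQ vQ vQ bilin_mult[OF QA] that])
 have ec: "?e n : carrier Q" for n using x by simp
 have acl: "act Q h v : carrier Q" if "h : carrier H" "v : carrier Q" for h v by (rule lin_mem[OF al[OF that(1)] that(2)])
 note r = x ec vQ QA vQQ QR.one_closed lin_comp[OF al] lin_comp[OF al'] al acl lin_comp[OF cl] lin_mem[OF cl] comult_comp[OF QC]
 comult_mem[OF QC] lin_comp[OF ml] lin_mem[OF ml] counit_mem[OF QC] counit_comp[OF QC]
 note pc = pure_mem[OF vQ vQ]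
 have act_1: "act Q h \<one>\<^sub>Q = counit H h \<odot>\<^sub>Q \<one>\<^sub>Q" if h: "h : carrier H" for h
 proof -
 have "ALL k:carrier K. (counit H h \<otimes>\<^sub>K k) \<odot>\<^sub>Q \<one>\<^sub>Q = act Q h (k \<odot>\<^sub>Q \<one>\<^sub>Q)"
  using un h unfolding yd_maps_def by simp
 from bspec[OF this K.one_closed] show ?thesis using h by (simp add: counitH)
 qed
 have coact_1: "coact Q \<one>\<^sub>Q = pure_tensor K H Q \<one>\<^sub>H \<one>\<^sub>Q"
 proof -
 have u: "(%k. k \<odot>\<^sub>Q \<one>\<^sub>Q) : lin_maps K KB Q" by (assumption | rule r lin)+
 have "ALL k:carrier K. coact Q (k \<odot>\<^sub>Q \<one>\<^sub>Q) = tensor_map K H KB H Q (%x. x) (%k. k \<odot>\<^sub>Q \<one>\<^sub>Q) (pure_tensor K H KB \<one>\<^sub>H k)"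
  using un unfolding yd_maps_def by simp
 from bspec[OF this K.one_closed] show ?thesis
  by (simp add: tensor_map_pure[OF hV baseV hV vQ lin_id u])
 qed
 have act_x: "act Q h (?e n) = cp n h \<odot>\<^sub>Q ?e n" if h: "h : carrier H" for h n
 using h
 proof (induction n arbitrary: h)
 case 0 then show ?case by (simp add: act_1)
 next
 case (Suc n)
 let ?t = "?p (?e n) x"
 have a: "ALL t:carrier ?QQ. ?mm (liftH ?QQ (%h1 h2. tensor_map K Q Q Q Q (act Q h1) (act Q h2) t) (comult H h)) = act Q h (?mm t)"
  using mm Suc.prems unfolding yd_maps_def by (simp add: sweedler_def)
 have "liftH ?QQ (%h1 h2. tensor_map K Q Q Q Q (act Q h1) (act Q h2) ?t) (comult H h) =
  liftH ?QQ (%h1 h2. (cp n h1 \<otimes>\<^sub>K cp (Suc 0) h2) \<odot>\<^sub>?QQ ?t) (comult H h)"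
  by (rule lift_fcong) (simp only: tensor_map_pure[OF vQ vQ vQ vQ al al ec x] Suc.IH ax cp_1
   lin_smultD[OF bilin_lin1[OF bilin_pure[OF vQ vQ]]] lin_smultD[OF bilin_lin2[OF bilin_pure[OF vQ vQ]]]
   QQV.smult_assoc1[symmetric] K.m_comm chi_mem cp_mem ec x pc QV.smult_closed)
 also have "... = cp (n + Suc 0) h \<odot>\<^sub>?QQ ?t" by (rule liftH_cp[OF vQQ pc[OF ec x] Suc.prems])
 finally have "act Q h (?mm ?t) = ?mm (cp (n + Suc 0) h \<odot>\<^sub>?QQ ?t)" using bspec[OF a pc[OF ec x], of n] by (simp only:)
 then show ?case
  by (simp only: lin_smultD[OF ml cp_mem[OF Suc.prems] pc[OF ec x]] mp[OF ec x] QR.nat_pow_Suc add_Suc_right add_0_right)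
 qed
 have coact_x: "coact Q (?e n) = pure_tensor K H Q (g [^]\<^sub>H n) (?e n)" for n
 proof (induction n)
 case 0 show ?case by (simp add: coact_1)
 next
 case (Suc n)
 let ?T = "tensor K H ?QQ" let ?pT = "pure_tensor K H ?QQ"
 note vT = vs_tensor[OF hV vQQ]
 have a: "ALL t:carrier ?QQ. coact Q (?mm t) = tensor_map K H ?QQ H Q (%x. x) ?mm (tensor_lift K Q Q ?T (%v w. tensor_lift K H Q ?T (%x v0. tensor_lift K H Q ?T
  (%z w0. ?pT (x \<otimes>\<^sub>H z) (?p v0 w0)) (coact Q w)) (coact Q v)) t)"
  using mm unfolding yd_maps_def by simp
 have b3: "bilinear_map K H Q ?T (%z w0. ?pT (x \<otimes>\<^sub>H z) (?p v w0))" if "x : carrier H" "v : carrier Q" for x v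
  by (assumption | rule that r lin)+
 have b2: "bilinear_map K H Q ?T (%x v0. tensor_lift K H Q ?T (%z w0. ?pT (x \<otimes>\<^sub>H z) (?p v0 w0)) (coact Q w))" if "w : carrier Q" for w
  by (assumption | rule that r lin)+
 have b1: "bilinear_map K Q Q ?T (%v w. tensor_lift K H Q ?T (%x v0. tensor_lift K H Q ?T (%z w0. ?pT (x \<otimes>\<^sub>H z) (?p v0 w0)) (coact Q w)) (coact Q v))"
  by (assumption | rule r lin)+
 have "coact Q (?mm (?p (?e n) x)) = tensor_map K H ?QQ H Q (%x. x) ?mm (?pT (g [^]\<^sub>H n \<otimes>\<^sub>H g) (?p (?e n) x))"
  unfolding bspec[OF a pc[OF ec x]] lift_pure[OF vQ vQ vT b1 ec x] Suc.IH lift_pure[OF hV vQ vT b2[OF x] gpow_mem ec]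
  unfolding cx lift_pure[OF hV vQ vT b3[OF gpow_mem ec] g_mem x] ..
 also have "... = pure_tensor K H Q (g [^]\<^sub>H n \<otimes>\<^sub>H g) (?mm (?p (?e n) x))"
  by (rule tensor_map_pure[OF hV vQQ hV vQ lin_id ml HR.m_closed[OF gpow_mem g_mem] pc[OF ec x]])
 finally show ?case by (simp only: mp[OF ec x] QR.nat_pow_Suc HR.nat_pow_Suc)
 qed
 \<comment> \<open>\<open>P\<close> is right multiplication by \<open>\<Delta>(x)\<close> in the braided tensor product \<open>Q \<otimes> Q\<close>.\<close>
 let ?PF = "%r1 r2. tensor_lift K H Q ?QQ (%z r0. ?p (r1 \<otimes>\<^sub>Q act Q z x) r0) (coact Q r2) \<oplus>\<^sub>?QQ ?p r1 (r2 \<otimes>\<^sub>Q x)"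
 define P where "P t = tensor_lift K Q Q ?QQ ?PF t" for t
 have bPF: "bilinear_map K Q Q ?QQ ?PF" by (assumption | rule r lin)+
 have Pl: "P : lin_maps K ?QQ ?QQ" unfolding P_def[abs_def] by (rule lift_spec(1)[OF vQ vQ vQQ bPF])
 have Pe: "P (?p (?e i) (?e j)) = q [^]\<^sub>K j \<odot>\<^sub>?QQ ?p (?e (Suc i)) (?e j) \<oplus>\<^sub>?QQ ?p (?e i) (?e (Suc j))" for i j
 proof -
 have b: "bilinear_map K H Q ?QQ (%z r0. ?p (?e i \<otimes>\<^sub>Q act Q z x) r0)" by (assumption | rule r lin)+
 have a: "act Q (g [^]\<^sub>H j) x = q [^]\<^sub>K j \<odot>\<^sub>Q x" for j :: nat
  unfolding ax[OF gpow_mem] cp_1[OF gpow_mem, symmetric] cp_gpow by simp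
 have "tensor_lift K H Q ?QQ (%z r0. ?p (?e i \<otimes>\<^sub>Q act Q z x) r0) (coact Q (?e j)) = q [^]\<^sub>K j \<odot>\<^sub>?QQ ?p (?e (Suc i)) (?e j)"
  unfolding coact_x lift_pure[OF hV vQ vQQ b gpow_mem ec] a
  by (simp add: alg_smult_r[OF QA] x q_closed lin_smultD[OF bilin_lin2[OF bilin_pure[OF vQ vQ]]])
 then show ?thesis unfolding P_def lift_pure[OF vQ vQ vQQ bPF ec ec] by simp
 qed
 have comult_step: "comult Q (s \<otimes>\<^sub>Q x) = P (comult Q s)" if s: "s : carrier Q" for s
 proof -
 let ?L = "tensor_map K ?QQ ?QQ Q Q ?mm ?mm"
 have L: "?L : lin_maps K ?Q4 ?QQ" by (rule tensor_map_lin[OF vQQ vQQ vQ vQ ml ml lin_id])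
 let ?B = "%r1 s1 s2 z r0. ?p4 (?p r1 (act Q z s1)) (?p r0 s2)"
 have b1: "bilinear_map K H Q ?Q4 (?B r1 s1 s2)" if "r1 : carrier Q" "s1 : carrier Q" "s2 : carrier Q" for r1 s1 s2
  by (assumption | rule that r lin)+
 have b2: "bilinear_map K Q Q ?Q4 (%s1 s2. tensor_lift K H Q ?Q4 (?B r1 s1 s2) (coact Q r2))" if "r1 : carrier Q" "r2 : carrier Q" for r1 r2
  by (assumption | rule that r lin)+
 have b3: "bilinear_map K Q Q ?Q4 (%r1 r2. tensor_lift K Q Q ?Q4 (%s1 s2. tensor_lift K H Q ?Q4 (?B r1 s1 s2) (coact Q r2)) (comult Q x))"
  by (assumption | rule r lin)+
 have "comult Q (s \<otimes>\<^sub>Q x) = ?L (braided_comult K H Q s x)" by (rule cm[OF s x])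
 also have "... = tensor_lift K Q Q ?QQ (%r1 r2. ?L (tensor_lift K Q Q ?Q4 (%s1 s2. tensor_lift K H Q ?Q4 (?B r1 s1 s2) (coact Q r2)) (comult Q x))) (comult Q s)"
  unfolding braided_comult_def Let_def sweedler_def
  by (rule lin_lift_comp[OF vQ vQ vQ4 b3 vQQ L comult_mem[OF QC s]])
 also have "... = tensor_lift K Q Q ?QQ ?PF (comult Q s)"
 proof (rule lift_fcong)
  fix r1 r2 assume r1: "r1 : carrier Q" and r2: "r2 : carrier Q"
  have i: "?L (tensor_lift K H Q ?Q4 (?B r1 s1 s2) (coact Q r2)) = tensor_lift K H Q ?QQ (%z r0. ?p (r1 \<otimes>\<^sub>Q act Q z s1) (r0 \<otimes>\<^sub>Q s2)) (coact Q r2)"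
  if s12: "s1 : carrier Q" "s2 : carrier Q" for s1 s2
  unfolding lin_lift_comp[OF hV vQ vQ4 b1[OF r1 s12] vQQ L lin_mem[OF cl r2]]
  by (rule lift_fcong) (simp add: tensor_map_pure[OF vQQ vQQ vQ vQ ml ml] pc acl s12 r1 mp)
  have j: "tensor_lift K H Q ?QQ (%z r0. ?p (r1 \<otimes>\<^sub>Q act Q z \<one>\<^sub>Q) (r0 \<otimes>\<^sub>Q x)) (coact Q r2) = ?p r1 (r2 \<otimes>\<^sub>Q x)"
  proof -
  have l: "(%v. ?p r1 (v \<otimes>\<^sub>Q x)) : lin_maps K Q ?QQ" by (assumption | rule r1 r lin)+
  have bc: "bilinear_map K H Q Q (%z w. counit H z \<odot>\<^sub>Q w)" by (assumption | rule r lin)+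
  have "?p r1 (r2 \<otimes>\<^sub>Q x) = ?p r1 (tensor_lift K H Q Q (%z w. counit H z \<odot>\<^sub>Q w) (coact Q r2) \<otimes>\<^sub>Q x)" by (simp only: cu[OF r2])
  also have "... = tensor_lift K H Q ?QQ (%z w. ?p r1 ((counit H z \<odot>\<^sub>Q w) \<otimes>\<^sub>Q x)) (coact Q r2)"
   by (rule lin_lift_comp[OF hV vQ vQ bc vQQ l lin_mem[OF cl r2]])
  also have "... = tensor_lift K H Q ?QQ (%z r0. ?p (r1 \<otimes>\<^sub>Q act Q z \<one>\<^sub>Q) (r0 \<otimes>\<^sub>Q x)) (coact Q r2)"
   by (rule lift_fcong) (simp add: act_1 alg_smult_r[OF QA] alg_smult_l[OF QA] counitH r1 x
    lin_smultD[OF bilin_lin1[OF bilin_pure[OF vQ vQ]]] lin_smultD[OF bilin_lin2[OF bilin_pure[OF vQ vQ]]])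
  finally show ?thesis ..
  qed
  have k: "tensor_lift K H Q ?QQ (%z r0. ?p (r1 \<otimes>\<^sub>Q act Q z x) (r0 \<otimes>\<^sub>Q \<one>\<^sub>Q)) (coact Q r2) =
  tensor_lift K H Q ?QQ (%z r0. ?p (r1 \<otimes>\<^sub>Q act Q z x) r0) (coact Q r2)"
  by (rule lift_fcong) simp
  have c: "tensor_lift K H Q ?Q4 (?B r1 s1 s2) (coact Q r2) : carrier ?Q4" if "s1 : carrier Q" "s2 : carrier Q" for s1 s2
  by (rule lift_closed[OF hV vQ vQ4 b1[OF r1 that] lin_mem[OF cl r2]])
  show "?L (tensor_lift K Q Q ?Q4 (%s1 s2. tensor_lift K H Q ?Q4 (?B r1 s1 s2) (coact Q r2)) (comult Q x)) = ?PF r1 r2"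
  unfolding dx lift_addD[OF vQ vQ vQ4 b2[OF r1 r2] pc[OF x QR.one_closed] pc[OF QR.one_closed x]]
   lift_pure[OF vQ vQ vQ4 b2[OF r1 r2] x QR.one_closed] lift_pure[OF vQ vQ vQ4 b2[OF r1 r2] QR.one_closed x]
   lin_addD[OF L c[OF x QR.one_closed] c[OF QR.one_closed x]] i[OF x QR.one_closed] i[OF QR.one_closed x] j k ..
 qed
 finally show ?thesis unfolding P_def .
 qed
 have comult_P: "comult Q (?e n) = (P ^^ n) (?p (?e 0) (?e 0))" for n
 by (induction n) (simp_all add: c1 comult_step ec)
 have comult_x: "comult Q (?e n) = finsum ?QQ (%k. gs n k \<odot>\<^sub>?QQ ?p (?e k) (?e (n - k))) {..n}" for n
 unfolding comult_P
 by (rule q_binomial_operator[where P=P and e="%i j. ?p (?e i) (?e j)", OF vQQ q_closed Pl]) (rule pc[OF ec ec] Pe)+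
 have counit_0: "counit Q x = \<zero>\<^sub>K"
 proof -
 have b: "bilinear_map K Q Q Q (%u v. counit Q u \<odot>\<^sub>Q v)" by (assumption | rule r lin)+
 note cc = counit_mem[OF QC x]
 have "x = counit Q x \<odot>\<^sub>Q \<one>\<^sub>Q \<oplus>\<^sub>Q x"
  using counit_l[OF QC vQ lin_id x] alg_map_one[OF ea]
  unfolding dx lift_addD[OF vQ vQ vQ b pc[OF x QR.one_closed] pc[OF QR.one_closed x]]
  lift_pure[OF vQ vQ vQ b x QR.one_closed] lift_pure[OF vQ vQ vQ b QR.one_closed x] by (simp add: x)
 then have "counit Q x \<odot>\<^sub>Q \<one>\<^sub>Q = \<zero>\<^sub>Q"
 proof -
  let ?a = "counit Q x \<odot>\<^sub>Q \<one>\<^sub>Q"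
  assume eq: "x = ?a \<oplus>\<^sub>Q x"
  have ac: "?a : carrier Q" by (rule QV.smult_closed[OF cc QR.one_closed])
  have "?a = (?a \<oplus>\<^sub>Q x) \<oplus>\<^sub>Q \<ominus>\<^sub>Q x" using ac x by (simp add: QV.M.a_assoc QV.M.r_neg)
  also have "... = \<zero>\<^sub>Q" unfolding eq[symmetric] using x by (simp add: QV.M.r_neg)
  finally show ?thesis .
 qed
 then have "counit Q (counit Q x \<odot>\<^sub>Q \<one>\<^sub>Q) = \<zero>\<^sub>K" using lin_zeroD[OF counit_lin[OF QC] vQ baseV] by simp
 then show ?thesis using cc alg_map_one[OF ea] by (simp add: lin_smultD[OF counit_lin[OF QC]])
 qed
 have counit_x: "counit Q (?e n) = (if n = 0 then \<one>\<^sub>K else \<zero>\<^sub>K)" for n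
 unfolding alg_map_pow[OF ea QA base_algebra[OF field] x] counit_0 by (rule counit_zero_pow)
 have big: "?e n = \<zero>\<^sub>Q" if "N <= n" for n
 proof -
 have "?e n = ?e N \<otimes>\<^sub>Q ?e (n - N)" using that x by (simp add: QR.nat_pow_mult)
 then show ?thesis using ec by (simp add: xN)
 qed
 show ?thesis
 by (rule line_structure.intro[OF yd_setting_axioms], rule line_structure_axioms.intro)
  (assumption | rule QA ec big QR.nat_pow_0 QR.nat_pow_mult[OF x] basis inj al al' act_x cl coact_x comult_lin[OF QC] comult_x
  counit_lin[OF QC] counit_x)+
qed

section \<open>Truncated polynomials and the existence of the quantum line\<close>

text \<open>The class map \<open>K[X] \<rightarrow> K[X] / (X\<^sup>N)\<close> is linear and multiplicative.\<close>

locale truncated_polynomials =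
 fixes K :: "('k, 'c) ring_scheme" and N :: nat
 assumes field: "field K" and N_pos: "0 < N"
begin

abbreviation PK where "PK == UP K"
abbreviation T where "T == trunc_poly K N"
abbreviation I where "I == trunc_ideal K N"
abbreviation pr where "pr p == I +>\<^sub>PK p"
abbreviation tm where "tm n == pr (monom PK \<one>\<^sub>K n)"

sublocale K: field K by (rule field)
sublocale UP: UP_domain K PK by unfold_locales simp

lemma monN: "monom PK \<one>\<^sub>K N : carrier PK" by simp

lemma ideal_I: "ideal I PK" unfolding trunc_ideal_def by (rule UP.P.cgenideal_ideal[OF monN])

lemma I_mem: "I = {r \<otimes>\<^sub>PK monom PK \<one>\<^sub>K N |r. r : carrier PK}"
 by (simp add: trunc_ideal_def cgenideal_def)

lemma T_simps:
 "carrier T = carrier (PK Quot I)" "S \<otimes>\<^sub>T S' = S \<otimes>\<^bsub>PK Quot I\<^esub> S'" "\<one>\<^sub>T = pr \<one>\<^sub>PK" "\<zero>\<^sub>T = I"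
 "S \<oplus>\<^sub>T S' = S \<oplus>\<^bsub>PK Quot I\<^esub> S'" "k \<odot>\<^sub>T S = (\<Union>p\<in>S. pr (k \<odot>\<^sub>PK p))"
 by (simp_all add: trunc_poly_def ring.defs module.defs FactRing_def)

lemma pr_closed: "p : carrier PK ==> pr p : carrier T"
 and pr_mult: "p : carrier PK ==> p' : carrier PK ==> pr p \<otimes>\<^sub>T pr p' = pr (p \<otimes>\<^sub>PK p')"
 and pr_add: "p : carrier PK ==> p' : carrier PK ==> pr p \<oplus>\<^sub>T pr p' = pr (p \<oplus>\<^sub>PK p')"
 using ring_hom_closed[OF ideal.rcos_ring_hom[OF ideal_I]] ring_hom_mult[OF ideal.rcos_ring_hom[OF ideal_I]] ring_hom_add[OF ideal.rcos_ring_hom[OF ideal_I]]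
 by (simp_all add: T_simps)

lemma T_E: assumes "s : carrier T" obtains p where "p : carrier PK" "s = pr p"
 using assms by (auto simp: T_simps(1) FactRing_def A_RCOSETS_def RCOSETS_def a_r_coset_def)

lemma pr_eq: "p : carrier PK ==> p' : carrier PK ==> pr p = pr p' \<longleftrightarrow> p \<ominus>\<^sub>PK p' : I"
 using UP.P.quotient_eq_iff_same_a_r_cos[OF ideal_I] by blast

lemma pr_smult: assumes k: "k : carrier K" and p: "p : carrier PK" shows "k \<odot>\<^sub>T pr p = pr (k \<odot>\<^sub>PK p)"
proof -
 have "pr (k \<odot>\<^sub>PK p') = pr (k \<odot>\<^sub>PK p)" if pp: "p' : pr p" for p'
 proof -
 obtain i where i: "i : I" "p' = i \<oplus>\<^sub>PK p" using pp by (auto simp: a_r_coset_def r_coset_def)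
 have ic: "i : carrier PK" using ideal.Icarr[OF ideal_I i(1)] .
 have "k \<odot>\<^sub>PK p' = k \<odot>\<^sub>PK i \<oplus>\<^sub>PK k \<odot>\<^sub>PK p" using i(2) ic k p by (simp add: UP.UP_smult_r_distr)
 then have "k \<odot>\<^sub>PK p' \<ominus>\<^sub>PK k \<odot>\<^sub>PK p = k \<odot>\<^sub>PK i"
  using ic k p by (simp add: UP.P.minus_eq UP.P.a_assoc UP.P.r_neg)
 also have "k \<odot>\<^sub>PK i = monom PK k 0 \<otimes>\<^sub>PK i" using UP.monom_mult_is_smult[OF k ic] ..
 also have "... : I" using i(1) k by (simp add: ideal.I_l_closed[OF ideal_I])
 finally show ?thesis using ic k p i(2) by (simp add: pr_eq)
 qed
 moreover have "p : pr p"
 using abelian_subgroup.a_rcos_self[OF abelian_subgroupI3[OF ideal.axioms(1)[OF ideal_I] UP.P.is_abelian_group] p] .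
 ultimately show ?thesis unfolding T_simps by blast
qed

lemma T_vs: "vectorspace K T"
proof -
 interpret Qr: ring "PK Quot I" by (rule ideal.quotient_is_ring[OF ideal_I])
 have z: "\<zero>\<^sub>T = \<zero>\<^bsub>PK Quot I\<^esub>" by (simp add: T_simps FactRing_def)
 have ag: "abelian_group T"
 by (rule abelian_groupI) (auto simp: T_simps(1,5) z Qr.a_ac intro: Qr.l_neg)
 have "module K T"
 proof (rule moduleI[OF K.is_cring ag])
 show "a \<odot>\<^sub>T x : carrier T" if "a : carrier K" "x : carrier T" for a x
  using that by (auto elim!: T_E simp: pr_smult intro!: pr_closed)
 show "(a \<oplus>\<^sub>K b) \<odot>\<^sub>T x = a \<odot>\<^sub>T x \<oplus>\<^sub>T b \<odot>\<^sub>T x" if "a : carrier K" "b : carrier K" "x : carrier T" for a b x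
  using that by (auto elim!: T_E simp: pr_smult pr_add UP.UP_smult_l_distr)
 show "a \<odot>\<^sub>T (x \<oplus>\<^sub>T z) = a \<odot>\<^sub>T x \<oplus>\<^sub>T a \<odot>\<^sub>T z" if "a : carrier K" "x : carrier T" "z : carrier T" for a x z
  using that by (auto elim!: T_E simp: pr_smult pr_add UP.UP_smult_r_distr)
 show "(a \<otimes>\<^sub>K b) \<odot>\<^sub>T x = a \<odot>\<^sub>T (b \<odot>\<^sub>T x)" if "a : carrier K" "b : carrier K" "x : carrier T" for a b x
  using that by (auto elim!: T_E simp: pr_smult UP.UP_smult_assoc1)
 show "\<one>\<^sub>K \<odot>\<^sub>T x = x" if "x : carrier T" for x
  using that by (auto elim!: T_E simp: pr_smult)
 qed
 then show ?thesis by (simp add: vectorspace_def field)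
qed

lemma PK_vs: "vectorspace K PK"
 using UP.module_axioms by (simp add: vectorspace_def field)

lemma pr_lin: "(%p. pr p) : lin_maps K PK T"
 by (rule lin_mapsI) (simp_all add: pr_closed pr_add pr_smult)

sublocale TV: vectorspace K T by (rule T_vs)

lemma T_alg: "k_algebra K T"
proof (rule k_algebraI[OF T_vs])
 show "x \<otimes>\<^sub>T z : carrier T" if "x : carrier T" "z : carrier T" for x z
 using that by (auto elim!: T_E simp: pr_mult intro!: pr_closed)
 show "bilinear_map K T T T (monoid.mult T)"
 proof (rule bilinI)
 have sr: "p \<otimes>\<^sub>PK (k \<odot>\<^sub>PK p') = k \<odot>\<^sub>PK (p \<otimes>\<^sub>PK p')"
  if "p : carrier PK" "p' : carrier PK" "k : carrier K" for p p' k
  using UP.UP_smult_assoc2[OF that(3,2,1)] that by (simp add: UP.P.m_comm)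
 fix x assume "x : carrier T"
 then obtain p where p: "p : carrier PK" "x = pr p" by (rule T_E)
 show "(%z. x \<otimes>\<^sub>T z) : lin_maps K T T"
  by (rule lin_mapsI) (auto elim!: T_E simp: p pr_mult pr_add pr_smult pr_closed UP.P.r_distr sr)
 show "(%z. z \<otimes>\<^sub>T x) : lin_maps K T T"
  by (rule lin_mapsI) (auto elim!: T_E simp: p pr_mult pr_add pr_smult pr_closed UP.P.l_distr UP.UP_smult_assoc2)
 qed
 show "\<one>\<^sub>T : carrier T" by (simp add: T_simps(3) pr_closed)
 fix x assume x: "x : carrier T"
 show "\<one>\<^sub>T \<otimes>\<^sub>T x = x" "x \<otimes>\<^sub>T \<one>\<^sub>T = x"
 using x by (auto elim!: T_E simp: pr_mult T_simps(3))
 show "x \<otimes>\<^sub>T y \<otimes>\<^sub>T z = x \<otimes>\<^sub>T (y \<otimes>\<^sub>T z)" if "y : carrier T" "z : carrier T" for y z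
 using x that by (auto elim!: T_E simp: pr_mult UP.P.m_assoc)
qed

lemma tm_closed: "tm n : carrier T" by (simp add: pr_closed)

lemma tm_mult: "tm m \<otimes>\<^sub>T tm n = tm (m + n)"
 using UP.monom_mult[of "\<one>\<^sub>K" "\<one>\<^sub>K" m n] by (simp add: pr_mult)

lemma tm_0: "tm 0 = \<one>\<^sub>T" by (simp add: T_simps(3))

lemma tm_big: assumes n: "N <= n" shows "tm n = \<zero>\<^sub>T"
proof -
 have "monom PK \<one>\<^sub>K n = monom PK \<one>\<^sub>K (n - N) \<otimes>\<^sub>PK monom PK \<one>\<^sub>K N"
 using UP.monom_mult[of "\<one>\<^sub>K" "\<one>\<^sub>K" "n - N" N] n by simp
 then have "monom PK \<one>\<^sub>K n : I" unfolding I_mem by auto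
 then show ?thesis unfolding T_simps(4) by (rule UP.P.a_rcos_zero[OF ideal_I])
qed

lemma coeff_I:
 assumes "i : I" "n < N"
 shows "coeff PK i n = \<zero>\<^sub>K"
proof -
 obtain r where r: "r : carrier PK" "i = r \<otimes>\<^sub>PK monom PK \<one>\<^sub>K N" using assms(1) unfolding I_mem by blast
 have "coeff PK i n = finsum K (%i. coeff PK r i \<otimes>\<^sub>K coeff PK (monom PK \<one>\<^sub>K N) (n - i)) {..n}"
 unfolding r(2) by (rule UP.coeff_mult[OF r(1) monN])
 also have "... = finsum K (%i. \<zero>\<^sub>K) {..n}"
 by (rule K.finsum_cong'[OF refl]) (use assms(2) r(1) in \<open>auto simp: UP.coeff_closed\<close>)
 finally show ?thesis by simp
qed

text \<open>The choice of a representative does not matter for \<open>n < N\<close>, since multiples of \<open>X\<^sup>N\<close> have no coefficients there.\<close>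

definition cf where "cf n s = coeff PK (SOME p. p : carrier PK & s = pr p) n"

lemma cf_pr: assumes n: "n < N" and p: "p : carrier PK" shows "cf n (pr p) = coeff PK p n"
proof -
 define p' where "p' = (SOME p'. p' : carrier PK & pr p = pr p')"
 have p': "p' : carrier PK" "pr p = pr p'"
 using someI[of "%p'. p' : carrier PK & pr p = pr p'" p] p unfolding p'_def by auto
 have "p' \<ominus>\<^sub>PK p : I" using pr_eq[OF p'(1) p] p'(2) by simp
 from coeff_I[OF this n] have "coeff PK p' n \<ominus>\<^sub>K coeff PK p n = \<zero>\<^sub>K"
 using UP.coeff_minus[OF p'(1) p] by simp
 then have "coeff PK p' n = coeff PK p n" using UP.coeff_closed[OF p'(1)] UP.coeff_closed[OF p] by simp
 then show ?thesis by (simp add: cf_def p'_def)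
qed

lemma cf_lin: assumes n: "n < N" shows "cf n : lin_maps K T (base_module K)"
 by (rule lin_mapsI) (auto elim!: T_E simp: cf_pr[OF n] pr_add pr_smult UP.coeff_closed)

lemma cf_tm: "n < N ==> cf n (tm m) = (if m = n then \<one>\<^sub>K else \<zero>\<^sub>K)"
 by (simp add: cf_pr)

lemma tm_inj: "inj_on tm {..<N}"
proof (rule inj_onI)
 fix m n assume mn: "m : {..<N}" "n : {..<N}" "tm m = tm n"
 show "m = n" using cf_tm[of n m] cf_tm[of n n] mn K.one_not_zero by (auto split: if_splits)
qed

lemma tm_basis: "vectorspace.basis K T (tm ` {..<N})"
proof (rule dual_imp_basis[OF T_vs])
 show "tm ` {..<N} \<subseteq> carrier T" using tm_closed by auto
 show "EX l. dual_to K T (tm ` {..<N}) b l" if b: "b : tm ` {..<N}" for b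
 proof -
 obtain n where n: "n < N" "b = tm n" using b by auto
 show ?thesis unfolding dual_to_def using cf_lin[OF n(1)] cf_tm[OF n(1)] n by (intro exI[of _ "cf n"]) auto
 qed
 fix W assume W: "submodule K W T" and B: "tm ` {..<N} \<subseteq> W"
 interpret W: submodule K W T by (rule W)
 have tW: "tm n : W" for n
 proof (cases "n < N")
 case False
 then have "tm n = \<zero>\<^sub>T" by (simp add: tm_big)
 then show ?thesis using W.zero_closed by simp
 qed (use B in auto)
 show "carrier T \<subseteq> W"
 proof
 fix s assume "s : carrier T"
 then obtain p where p: "p : carrier PK" "s = pr p" by (rule T_E)
 have mc: "monom PK (coeff PK p i) i : carrier PK" for i using p by (simp add: UP.coeff_closed)
 have "pr (finsum PK (%i. monom PK (coeff PK p i) i) {..deg K p}) = finsum T (%i. pr (monom PK (coeff PK p i) i)) {..deg K p}"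
  by (rule lin_finsumD[OF pr_lin PK_vs T_vs finite_atMost mc])
 also have "... : W"
 proof (rule submodule_finsum[OF T_vs W finite_atMost])
  fix i
  have "pr (monom PK (coeff PK p i) i) = coeff PK p i \<odot>\<^sub>T tm i"
  using UP.monom_mult_smult[of "coeff PK p i" "\<one>\<^sub>K" i] p by (simp add: pr_smult UP.coeff_closed)
  then show "pr (monom PK (coeff PK p i) i) : W" using tW p by (simp add: UP.coeff_closed)
 qed
 finally show "s : W" using UP.up_repr[OF p(1)] p(2) by simp
 qed
qed

lemma trunc_var_pow: "trunc_var K N [^]\<^sub>T (n::nat) = tm n"
proof -
 interpret TR: ring T by (rule alg_ring[OF T_alg])
 have v: "trunc_var K N = tm 1" unfolding trunc_var_def ..
 show ?thesis
 proof (induction n)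
 case (Suc n)
 show ?case unfolding TR.nat_pow_Suc Suc.IH unfolding v tm_mult by (simp only: Suc_eq_plus1)
 qed (simp only: TR.nat_pow_0 tm_0)
qed

end

section \<open>The pre-bialgebra of coinvariants\<close>

lemma lift_zero:
 assumes "vectorspace K V" "vectorspace K W" "vectorspace K M" "t : carrier (tensor K V W)"
 shows "tensor_lift K V W M (%_ _. \<zero>\<^sub>M) t = \<zero>\<^sub>M"
 by (rule lift_unique[where L="%_. \<zero>\<^sub>M", OF assms(1-3) _ lin_zero[OF assms(3)] refl assms(4)])
 (rule bilinI; rule lin_zero[OF assms(3)])

text \<open>The definite description of the element of \<open>V \<otimes> W\<close> that becomes \<open>u\<close> in a larger tensor product: uniqueness follows from retractions of the two inclusions.\<close>

lemma the_tensor_preimage: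
 assumes V: "vectorspace K V" "vectorspace K W" "vectorspace K V'" "vectorspace K W'"
 and i: "i : lin_maps K V V'" and j: "j : lin_maps K W W'" and r: "r : lin_maps K V' V" and s: "s : lin_maps K W' W"
 and ri: "!!v. v : carrier V ==> r (i v) = v" and sj: "!!w. w : carrier W ==> s (j w) = w"
 and t: "t : carrier (tensor K V W)" and u: "tensor_map K V W V' W' i j t = u"
 shows "(THE t. t : carrier (tensor K V W) & tensor_map K V W V' W' i j t = u) = t"
proof (rule the_equality)
 show "t : carrier (tensor K V W) & tensor_map K V W V' W' i j t = u" using t u by simp
 have inv: "tensor_map K V' W' V W r s (tensor_map K V W V' W' i j t') = t'" if "t' : carrier (tensor K V W)" for t'
 unfolding tensor_map_comp[OF V V(1,2) i j r s that] by (rule tensor_map_id[OF V(1,2) ri sj that])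
 fix t' assume t': "t' : carrier (tensor K V W) & tensor_map K V W V' W' i j t' = u"
 then show "t' = t" using inv[OF t] inv[of t'] u by metis
qed

context yd_setting
begin

lemma antipode_one: "S \<one>\<^sub>H = \<one>\<^sub>H"
proof -
 have b: "bilinear_map K H H H (%x y. S x \<otimes>\<^sub>H y)" by (assumption | rule lin)+
 show ?thesis
 using antipode_l[OF hS HR.one_closed] lin_mem[OF S_lin HR.one_closed]
 by (simp add: comult_one lift_pure[OF hV hV hV b] counit_one)
qed

text \<open>A bilinear map that kills \<open>y\<^sup>k x \<otimes> y\<^sup>j v\<close> for \<open>j > 0\<close> sees only the leading term \<open>k = n\<close> of \<open>\<Delta>(y\<^sup>n h)\<close>. Maps that apply \<open>p\<close> to the second factor are of this kind.\<close>

lemma lift_top: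
 assumes M: "vectorspace K M" and F: "bilinear_map K A A M F" and h: "h : carrier H"
 and z: "!!k j x v. 0 < j ==> k + j = n ==> x : carrier H ==> v : carrier H ==> F (mono k x) (mono j v) = \<zero>\<^sub>M"
 shows "liftA M F (comult A (mono n h)) = liftH M (%x v. F (mono n x) (\<sigma> v)) (comult H h)"
proof -
 interpret M: vectorspace K M by (rule M)
 have b: "bilinear_map K H H M (%x v. F (mono n x) (\<sigma> v))"
 by (assumption | rule bilin_comp1[OF F] bilin_comp2[OF F] lin)+
 have tc: "liftH M (%x v. F (mono n x) (\<sigma> v)) (comult H h) : carrier M"
 by (rule lift_closed[OF hV hV M b comultH[OF h]])
 have "finsum M (%k. gs n k \<odot>\<^sub>M liftH M (%x v. F (mono k (g [^]\<^sub>H (n - k) \<otimes>\<^sub>H x)) (mono (n - k) v)) (comult H h)) {..n} =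
 finsum M (%k. if n = k then liftH M (%x v. F (mono n x) (\<sigma> v)) (comult H h) else \<zero>\<^sub>M) {..n}"
 proof (rule M.finsum_cong'[OF refl])
 fix k assume k: "k : {..n}"
 show "gs n k \<odot>\<^sub>M liftH M (%x v. F (mono k (g [^]\<^sub>H (n - k) \<otimes>\<^sub>H x)) (mono (n - k) v)) (comult H h) =
  (if n = k then liftH M (%x v. F (mono n x) (\<sigma> v)) (comult H h) else \<zero>\<^sub>M)"
 proof (cases "k = n")
  case True
  have "liftH M (%x v. F (mono n (g [^]\<^sub>H (n - n) \<otimes>\<^sub>H x)) (mono (n - n) v)) (comult H h) = liftH M (%x v. F (mono n x) (\<sigma> v)) (comult H h)"
  by (rule lift_fcong) simp
  then show ?thesis using True tc by (simp add: q_closed)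
 next
  case False
  have "liftH M (%x v. F (mono k (g [^]\<^sub>H (n - k) \<otimes>\<^sub>H x)) (mono (n - k) v)) (comult H h) = liftH M (%_ _. \<zero>\<^sub>M) (comult H h)"
  by (rule lift_fcong, rule z) (use k False in \<open>auto simp: gpow_mem\<close>)
  then show ?thesis using False by (simp add: lift_zero[OF hV hV M comultH[OF h]] gs_mem)
 qed
 qed (use tc in auto)
 also have "... = liftH M (%x v. F (mono n x) (\<sigma> v)) (comult H h)"
 by (rule M.M.add.finprod_singleton) (use tc in auto)
 finally show ?thesis unfolding lift_comult_mono[OF M F h] .
qed

context
 fixes p :: "(nat => 'h) => 'h"
 assumes p_lin: "p : lin_maps K A H"
 and p_small: "!!n h. n < N ==> h : carrier H ==> p (mono n h) = (if n = 0 then h else \<zero>\<^sub>H)"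
begin

lemmas p_closed = lin_mem[OF p_lin]
lemmas pl = lin_comp[OF p_lin] p_closed

lemma p_sig: "h : carrier H ==> p (\<sigma> h) = h" using p_small[OF N_pos] by simp

lemma p_coalg: "p : coalgebra_maps K A H"
proof -
 have "comult H (p c) = tensor_map K A A H H p p (comult A c)" if c: "c : carrier A" for c
 proof (rule O.A_lin_eq[OF hHH _ _ _ c, where F="%c. comult H (p c)" and G="%c. tensor_map K A A H H p p (comult A c)"])
 show "(%c. comult H (p c)) : lin_maps K A HH" by (assumption | rule p_lin pl lin)+
 show "(%c. tensor_map K A A H H p p (comult A c)) : lin_maps K A HH" by (rule tensor_map_lin[OF vA vA hV hV p_lin p_lin comult_A_lin])
 fix n h assume n: "n < N" and h: "h : carrier H"
 let ?F = "%u v. pure_tensor K H H (p u) (p v)"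
 have b: "bilinear_map K A A HH ?F" by (rule bilin_pure_map[OF vA vA hV hV p_lin p_lin])
 have z: "?F (mono k x) (mono j v) = \<zero>\<^sub>HH" if "0 < j" "k + j = n" "x : carrier H" "v : carrier H" for k j x v
  using that n p_small[of j v] lin_zeroD[OF bilin_lin1[OF bilin_pure[OF hV hV] p_closed[OF mono_mem[OF that(3)]]] hV hHH] by simp
 have "tensor_map K A A H H p p (comult A (mono n h)) = liftH HH (%x v. ?F (mono n x) (\<sigma> v)) (comult H h)"
  unfolding tensor_map_def by (rule lift_top[OF hHH b h z])
 also have "... = comult H (p (mono n h))"
 proof (cases "n = 0")
  case True
  have "liftH HH (%x v. ?F (mono n x) (\<sigma> v)) (comult H h) = liftH HH (pure_tensor K H H) (comult H h)"
  by (rule lift_fcong) (simp add: True p_sig)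
  then show ?thesis using lift_pure_id[OF hV hV comultH[OF h]] by (simp add: True p_sig h)
 next
  case False
  have "liftH HH (%x v. ?F (mono n x) (\<sigma> v)) (comult H h) = liftH HH (%_ _. \<zero>\<^sub>HH) (comult H h)"
  by (rule lift_fcong) (simp add: False n p_small p_sig lin_zeroD[OF bilin_lin2[OF bilin_pure[OF hV hV]] hV hHH])
  then show ?thesis using False n h by (simp add: lift_zero[OF hV hV hHH comultH] p_small lin_zeroD[OF comult_lin[OF hC] hV hHH])
 qed
 finally show "comult H (p (mono n h)) = tensor_map K A A H H p p (comult A (mono n h))" ..
 qed
 moreover have "counit H (p c) = counit A c" if c: "c : carrier A" for c
 by (rule O.A_lin_eq[OF baseV lin_comp[OF counit_lin[OF hC] p_lin] alg_map_lin[OF counit_A_alg] _ c])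
  (simp add: p_small counit_mono lin_zeroD[OF counit_lin[OF hC] hV baseV, simplified])
 ultimately show ?thesis unfolding coalgebra_maps_def using p_lin by auto
qed

lemma p_bilinear: "retraction_bilinear H A p \<sigma>"
 unfolding retraction_bilinear_def
proof (intro conjI ballI)
 show "p (\<sigma> h) = h" if "h : carrier H" for h using that by (rule p_sig)
 fix h a assume h: "h : carrier H" and a: "a : carrier A"
 note sc = mono_mem[OF h, of 0]
 show "p (\<sigma> h \<otimes>\<^sub>A a) = h \<otimes>\<^sub>H p a"
 by (rule O.A_lin_eq[OF hV lin_comp[OF p_lin lin_mult_r[OF aA lin_id sc]] lin_mult_r[OF hA p_lin h] _ a])
  (auto simp: O.mult_mono p_small phin_mem h)
 show "p (a \<otimes>\<^sub>A \<sigma> h) = p a \<otimes>\<^sub>H h"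
 by (rule O.A_lin_eq[OF hV lin_comp[OF p_lin lin_mult_l[OF aA lin_id sc]] lin_mult_l[OF hA p_lin h] _ a])
  (auto simp: O.mult_mono p_small h)
qed

abbreviation tt where "tt == tau K H A p \<sigma>"
abbreviation RR where "RR == assoc_prebialgebra K H A p \<sigma>"

definition eR where "eR n = (if n < N then mono n \<one>\<^sub>H else \<zero>\<^sub>A)"

lemma eR_mem: "eR n : carrier A" by (simp add: eR_def mono_mem vs_zero_closed[OF vA])

lemma tt_bilin: "bilinear_map K A A A (%x v. x \<otimes>\<^sub>A \<sigma> (S (p v)))"
 by (assumption | rule p_lin pl lin)+

lemma tt_lin: "tt : lin_maps K A A"
 unfolding tau_def[abs_def] sweedler_def by (rule lift_lin[OF vA vA vA tt_bilin comult_A_lin])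

lemmas tt_mem = lin_mem[OF tt_lin]

lemma tt_mono: assumes h: "h : carrier H" shows "tt (mono n h) = counit H h \<odot>\<^sub>A eR n"
proof -
 have small: "tt (mono n h) = counit H h \<odot>\<^sub>A mono n \<one>\<^sub>H" if n: "n < N" and h: "h : carrier H" for n h
 proof -
 have z: "mono k x \<otimes>\<^sub>A \<sigma> (S (p (mono j v))) = \<zero>\<^sub>A" if "0 < j" "k + j = n" "x : carrier H" "v : carrier H" for k j x v
  using that n mono_mem[OF that(3)] AR.r_null
  by (simp add: p_small lin_zeroD[OF S_lin hV hV] lin_zeroD[OF O.mono_lin hV vA])
 have b: "bilinear_map K H H H (%x v. x \<otimes>\<^sub>H S v)" by (assumption | rule lin)+
 have "tt (mono n h) = liftH A (%x v. mono n x \<otimes>\<^sub>A \<sigma> (S (p (\<sigma> v)))) (comult H h)"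
  unfolding tau_def sweedler_def by (rule lift_top[OF vA tt_bilin h z])
 also have "... = liftH A (%x v. mono n (x \<otimes>\<^sub>H S v)) (comult H h)"
  by (rule lift_fcong) (simp add: p_sig mono_mult lin_mem[OF S_lin])
 also have "... = mono n (liftH H (%x v. x \<otimes>\<^sub>H S v) (comult H h))"
  by (rule liftH_out[OF hV b vA O.mono_lin h, symmetric])
 also have "... = counit H h \<odot>\<^sub>A mono n \<one>\<^sub>H"
  by (simp add: antipode_r[OF hS h] lin_smultD[OF O.mono_lin] counitH h)
 finally show ?thesis .
 qed
 show ?thesis
 proof (cases "n < N")
 case True then show ?thesis using small h by (simp add: eR_def)
 next
 case False
 have c: "zz [^]\<^sub>H (n div N) \<otimes>\<^sub>H h : carrier H" using h by simp
 have m: "n mod N < N" using N_pos by simp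
 show ?thesis unfolding O.mono_split[OF h, of n] small[OF m c] using counit_mono_eps[OF h, of n] False mono_mem[OF HR.one_closed]
  by (simp add: eR_def counitH h)
 qed
qed

lemma tt_one: "tt (mono n \<one>\<^sub>H) = eR n" by (simp add: tt_mono counit_one eR_mem)

lemma tt_eR: "tt (eR n) = eR n"
 by (cases "n < N") (simp_all add: eR_def tt_one lin_zeroD[OF tt_lin vA vA])

lemma tt_idem: "a : carrier A ==> tt (tt a) = tt a"
 by (rule O.A_lin_eq[OF vA lin_comp[OF tt_lin tt_lin] tt_lin]) (simp_all add: tt_mono lin_smultD[OF tt_lin] counitH eR_mem tt_eR)

lemma R_carrier: "carrier RR = {a : carrier A. tt a = a}"
proof -
 let ?AH = "tensor K A H" let ?p = "pure_tensor K A H"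
 note vAH = vs_tensor[OF vA hV]
 let ?F = "%x v. ?p x (p v)" let ?rr = "%a. liftA ?AH ?F (comult A a)"
 have bF: "bilinear_map K A A ?AH ?F" by (assumption | rule p_lin pl lin)+
 have rl: "?rr : lin_maps K A ?AH" by (rule lift_lin[OF vA vA vAH bF comult_A_lin])
 have bL: "bilinear_map K A H A (%x h. x \<otimes>\<^sub>A \<sigma> (S h))" by (assumption | rule lin)+
 define L where "L = tensor_lift K A H A (%x h. x \<otimes>\<^sub>A \<sigma> (S h))"
 have L: "L : lin_maps K ?AH A" and Lp: "!!x h. x : carrier A ==> h : carrier H ==> L (?p x h) = x \<otimes>\<^sub>A \<sigma> (S h)"
 unfolding L_def using lift_spec[OF vA hV vA bL] by blast+
 have s1: "\<sigma> \<one>\<^sub>H = \<one>\<^sub>A" by (rule alg_map_one[OF sig_alg])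
 have 1: "tt a = a" if a: "a : carrier A" and eq: "?rr a = ?p a \<one>\<^sub>H" for a
 proof -
 have "L (?rr a) = liftA A (%x v. L (?F x v)) (comult A a)"
  by (rule lin_lift_comp[OF vA vA vAH bF vA L comult_A_closed[OF a]])
 also have "... = tt a" unfolding tau_def sweedler_def by (rule lift_fcong) (simp add: Lp p_closed)
 finally have "tt a = L (?p a \<one>\<^sub>H)" unfolding eq by simp
 also have "... = a" using a AR.r_one by (simp only: Lp[OF a HR.one_closed] antipode_one s1)
 finally show ?thesis .
 qed
 have 2: "?rr (tt a) = ?p (tt a) \<one>\<^sub>H" if a: "a : carrier A" for a
 proof (rule O.A_lin_eq[OF vAH lin_comp[OF rl tt_lin] lin_pure_l[OF vA hV tt_lin HR.one_closed] _ a])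
 fix n h assume n: "n < N" and h: "h : carrier H"
 have z: "?F (mono k x) (mono j v) = \<zero>\<^sub>?AH" if "0 < j" "k + j = n" "x : carrier H" "v : carrier H" for k j x v
  using that n lin_zeroD[OF bilin_lin1[OF bilin_pure[OF vA hV] mono_mem[OF that(3)]] hV vAH] by (simp add: p_small)
 have b: "bilinear_map K H H ?AH (%x v. ?F (mono n x) (\<sigma> v))" by (assumption | rule p_lin pl lin)+
 have "?rr (mono n \<one>\<^sub>H) = liftH ?AH (%x v. ?F (mono n x) (\<sigma> v)) (comult H \<one>\<^sub>H)"
  by (rule lift_top[OF vAH bF HR.one_closed z])
 also have "... = ?F (mono n \<one>\<^sub>H) (\<sigma> \<one>\<^sub>H)"
  unfolding comult_one by (rule lift_pure[OF hV hV vAH b HR.one_closed HR.one_closed])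
 finally have "?rr (eR n) = ?p (eR n) \<one>\<^sub>H" using n p_sig[OF HR.one_closed] by (simp only: eR_def if_True)
 then show "?rr (tt (mono n h)) = ?p (tt (mono n h)) \<one>\<^sub>H"
  unfolding tt_mono[OF h] lin_smultD[OF rl counitH[OF h] eR_mem]
  lin_smultD[OF bilin_lin2[OF bilin_pure[OF vA hV] HR.one_closed] counitH[OF h] eR_mem] by simp
 qed
 have iff: "?rr a = ?p a \<one>\<^sub>H \<longleftrightarrow> tt a = a" if a: "a : carrier A" for a
 proof
 assume "tt a = a"
 then show "?rr a = ?p a \<one>\<^sub>H" using 2[OF a] by simp
 qed (rule 1[OF a])
 have "carrier RR = {a : carrier A. ?rr a = ?p a \<one>\<^sub>H}"
 by (simp add: assoc_prebialgebra_def coinvariants_def sweedler_def Let_def)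
 also have "... = {a : carrier A. tt a = a}" by (intro Collect_cong conj_cong refl) (rule iff)
 finally show ?thesis .
qed

lemma R_simps:
 "r \<otimes>\<^sub>RR s = tt (r \<otimes>\<^sub>A s)" "\<one>\<^sub>RR = \<one>\<^sub>A" "\<zero>\<^sub>RR = \<zero>\<^sub>A" "r \<oplus>\<^sub>RR s = r \<oplus>\<^sub>A s" "k \<odot>\<^sub>RR r = k \<odot>\<^sub>A r"
 "counit RR = counit A" "act RR h r = liftH A (%h1 h2. \<sigma> h1 \<otimes>\<^sub>A r \<otimes>\<^sub>A \<sigma> (S h2)) (comult H h)"
 by (simp_all add: assoc_prebialgebra_def Let_def sweedler_def)

lemma CI_simps: "carrier (coinvariants K H A p) = carrier RR" "ring.add (coinvariants K H A p) = ring.add RR"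
 "smult (coinvariants K H A p) = smult RR"
 by (simp_all add: assoc_prebialgebra_def Let_def coinvariants_def module.defs)

lemma R_in_A: "r : carrier RR ==> r : carrier A" and tt_R: "r : carrier RR ==> tt r = r" and tt_in_R: "a : carrier A ==> tt a : carrier RR"
 and eR_R: "eR n : carrier RR"
 by (auto simp: R_carrier tt_idem tt_mem tt_eR eR_mem)

lemma vR: "vectorspace K RR"
proof -
 note t = lin_addD[OF tt_lin] lin_smultD[OF tt_lin] lin_zeroD[OF tt_lin vA vA] lin_negD[OF tt_lin vA vA]
 have ag: "abelian_group RR"
 proof (rule abelian_groupI)
 fix x assume x: "x : carrier RR"
 then have "\<ominus>\<^sub>A x : carrier RR" "\<ominus>\<^sub>A x \<oplus>\<^sub>A x = \<zero>\<^sub>A"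
  using AR.a_inv_closed AR.l_neg by (auto simp: R_carrier t)
 then show "EX y:carrier RR. y \<oplus>\<^sub>RR x = \<zero>\<^sub>RR" by (auto simp: R_simps)
 qed (auto simp: R_carrier R_simps t AR.a_assoc AR.a_comm AR.a_lcomm)
 have "module K RR"
 by (rule moduleI[OF K.is_cring ag])
  (auto simp: R_carrier R_simps t AV.smult_l_distr AV.smult_r_distr AV.smult_assoc1)
 then show ?thesis by (simp add: vectorspace_def field)
qed

lemma incl_lin: "(%x. x) : lin_maps K RR A"
 by (rule lin_mapsI) (auto simp: R_simps R_in_A)

lemma tt_lin_R: "tt : lin_maps K A RR"
 by (rule lin_mapsI) (auto simp: R_simps tt_in_R lin_addD[OF tt_lin] lin_smultD[OF tt_lin])

lemma R_lin_eq:
 assumes M: "vectorspace K M" and F: "F : lin_maps K RR M" and G: "G : lin_maps K RR M"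
 and eq: "!!n. n < N ==> F (eR n) = G (eR n)" and r: "r : carrier RR"
 shows "F r = G r"
proof -
 have "F (tt r) = G (tt r)"
 proof (rule O.A_lin_eq[OF M lin_comp[OF F tt_lin_R] lin_comp[OF G tt_lin_R] _ R_in_A[OF r]])
 fix n h assume n: "n < N" and h: "h : carrier H"
 show "F (tt (mono n h)) = G (tt (mono n h))"
  unfolding tt_mono[OF h] R_simps(5)[symmetric] lin_smultD[OF F counitH[OF h] eR_R] lin_smultD[OF G counitH[OF h] eR_R] eq[OF n] ..
 qed
 then show ?thesis using tt_R[OF r] by simp
qed

lemma R_lin_sub: "F : lin_maps K A M ==> F : lin_maps K RR M"
 by (rule lin_comp[OF _ incl_lin])

text \<open>On the comultiplication of a coinvariant, the projection \<open>\<tau>\<close> acts trivially on the second factor.\<close>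

lemma lift_comult_R:
 assumes M: "vectorspace K M" and F: "bilinear_map K A A M F" and r: "r : carrier RR"
 shows "liftA M (%x v. F x (tt v)) (comult A r) = liftA M F (comult A r)"
proof -
 interpret M: vectorspace K M by (rule M)
 have b: "bilinear_map K A A M (%x v. F x (tt v))"
 by (assumption | rule bilin_comp1[OF F] bilin_comp2[OF F] tt_lin tt_mem lin)+
 show ?thesis
 proof (rule R_lin_eq[OF M R_lin_sub[OF lift_lin[OF vA vA M b comult_A_lin]] R_lin_sub[OF lift_lin[OF vA vA M F comult_A_lin]] _ r])
 fix n assume n: "n < N"
 have e: "eR n = mono n \<one>\<^sub>H" using n by (simp add: eR_def)
 show "liftA M (%x v. F x (tt v)) (comult A (eR n)) = liftA M F (comult A (eR n))"
  unfolding e lift_comult_mono_one[OF M b] lift_comult_mono_one[OF M F]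
  by (rule M.finsum_cong'[OF refl])
  (use n in \<open>auto simp: tt_one eR_def bilin_closed[OF F] mono_mem gpow_mem gs_mem\<close>)
 qed
qed

lemma comult_R: assumes r: "r : carrier RR" shows "comult RR r = tensor_map K A A RR RR tt tt (comult A r)"
proof -
 note c = tensor_cong[OF CI_simps CI_simps, of K] tensor_lift_cong_space[OF CI_simps CI_simps, of _ _ K]
 have b: "bilinear_map K A A AA (%x v. ptA (tt x) v)" by (assumption | rule tt_lin tt_mem lin)+
 have "tensor_map K RR RR A A (%x. x) (%x. x) (tensor_map K A A RR RR tt tt (comult A r)) = liftA AA (%x v. ptA (tt x) (tt v)) (comult A r)"
 unfolding tensor_map_comp[OF vA vA vR vR vA vA tt_lin_R tt_lin_R incl_lin incl_lin comult_A_closed[OF R_in_A[OF r]]]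
 by (simp add: tensor_map_def)
 also have "... = liftA AA (%x v. ptA (tt x) v) (comult A r)" by (rule lift_comult_R[OF vAA b r])
 finally have u: "tensor_map K RR RR A A (%x. x) (%x. x) (tensor_map K A A RR RR tt tt (comult A r)) = liftA AA (%x v. ptA (tt x) v) (comult A r)" .
 have "comult RR r = (THE t. t : carrier (tensor K RR RR) & tensor_map K RR RR A A (%x. x) (%x. x) t = liftA AA (%x v. ptA (tt x) v) (comult A r))"
 by (subst assoc_prebialgebra_def) (simp add: Let_def sweedler_def tensor_map_def c(1) tensor_lift_cong_space[OF CI_simps CI_simps refl refl refl])
 also have "... = tensor_map K A A RR RR tt tt (comult A r)"
 by (rule the_tensor_preimage[OF vR vR vA vA incl_lin incl_lin tt_lin_R tt_lin_R tt_R tt_R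
  tensor_map_closed[OF vA vA vR vR tt_lin_R tt_lin_R comult_A_closed[OF R_in_A[OF r]]] u])
 finally show ?thesis .
qed

lemma coact_R: assumes r: "r : carrier RR" shows "coact RR r = tensor_map K A A H RR p tt (comult A r)"
proof -
 let ?HA = "tensor K H A" let ?pH = "pure_tensor K H A"
 have b: "bilinear_map K A A ?HA (%x v. ?pH (p x) v)" by (assumption | rule p_lin pl lin)+
 have "tensor_map K H RR H A (%x. x) (%x. x) (tensor_map K A A H RR p tt (comult A r)) = liftA ?HA (%x v. ?pH (p x) (tt v)) (comult A r)"
 unfolding tensor_map_comp[OF vA vA hV vR hV vA p_lin tt_lin_R lin_id incl_lin comult_A_closed[OF R_in_A[OF r]]]
 by (simp add: tensor_map_def)
 also have "... = liftA ?HA (%x v. ?pH (p x) v) (comult A r)" by (rule lift_comult_R[OF vs_tensor[OF hV vA] b r])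
 finally have u: "tensor_map K H RR H A (%x. x) (%x. x) (tensor_map K A A H RR p tt (comult A r)) = liftA ?HA (%x v. ?pH (p x) v) (comult A r)" .
 have "coact RR r = (THE t. t : carrier (tensor K H RR) & tensor_map K H RR H A (%x. x) (%x. x) t = liftA ?HA (%x v. ?pH (p x) v) (comult A r))"
 by (subst assoc_prebialgebra_def) (simp add: Let_def sweedler_def tensor_map_def tensor_cong[OF refl refl refl CI_simps] tensor_lift_cong_space[OF refl refl refl CI_simps refl refl refl])
 also have "... = tensor_map K A A H RR p tt (comult A r)"
 by (rule the_tensor_preimage[OF hV vR hV vA lin_id incl_lin lin_id tt_lin_R refl tt_R
  tensor_map_closed[OF vA vA hV vR p_lin tt_lin_R comult_A_closed[OF R_in_A[OF r]]] u])
 finally show ?thesis .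
qed

lemma eR_mult: "eR a \<otimes>\<^sub>RR eR b = eR (a + b)"
proof (cases "a < N & b < N")
 case True
 have "mono a \<one>\<^sub>H \<otimes>\<^sub>A mono b \<one>\<^sub>H = mono (a + b) \<one>\<^sub>H" by (simp add: O.mult_mono alg_map_one[OF phi_funpow_alg])
 then show ?thesis using True tt_one[of "a + b"] by (simp add: R_simps eR_def)
next
 case False
 then have "eR a \<otimes>\<^sub>A eR b = \<zero>\<^sub>A" using AR.l_null[OF eR_mem[of b]] AR.r_null[OF eR_mem[of a]]
 by (auto simp: eR_def[of a] eR_def[of b])
 moreover have "eR (a + b) = \<zero>\<^sub>A" using False by (auto simp: eR_def)
 ultimately show ?thesis using lin_zeroD[OF tt_lin vA vA] by (simp only: R_simps)
qed

lemma act_R_eR: assumes h: "h : carrier H" shows "act RR h (eR n) = cp n h \<odot>\<^sub>A eR n"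
proof (cases "n < N")
 case True
 have b: "bilinear_map K H H H (%x v. (\<phi> ^^ n) x \<otimes>\<^sub>H S v)" by (assumption | rule lin)+
 have "act RR h (eR n) = liftH A (%x v. mono n ((\<phi> ^^ n) x \<otimes>\<^sub>H S v)) (comult H h)"
 unfolding R_simps(7) by (rule lift_fcong) (simp add: True eR_def O.mult_mono lin_mem[OF S_lin] phin_mem)
 also have "... = mono n (cp n h \<odot>\<^sub>H \<one>\<^sub>H)"
 unfolding phin_antipode[OF h, symmetric] by (rule liftH_out[OF hV b vA O.mono_lin h, symmetric])
 finally show ?thesis using True by (simp add: eR_def lin_smultD[OF O.mono_lin] cp_mem h)
next
 case False
 have "act RR h (eR n) = liftH A (%_ _. \<zero>\<^sub>A) (comult H h)"
 unfolding R_simps(7) by (rule lift_fcong)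
  (use False AR.l_null AR.r_null mono_mem in \<open>simp add: eR_def lin_mem[OF S_lin]\<close>)
 then show ?thesis using False by (simp add: lift_zero[OF hV hV vA comultH[OF h]] eR_def cp_mem h)
qed

lemma act_R_A: "h : carrier H ==> (%r. act RR h r) : lin_maps K A A"
 "r : carrier A ==> (%h. act RR h r) : lin_maps K H A"
 unfolding R_simps(7) by (assumption | rule lin)+

lemma act_R_closed: assumes h: "h : carrier H" and r: "r : carrier RR" shows "act RR h r : carrier RR"
proof -
 have "tt (act RR h r) = act RR h r"
 by (rule R_lin_eq[OF vA R_lin_sub[OF lin_comp[OF tt_lin act_R_A(1)[OF h]]] R_lin_sub[OF act_R_A(1)[OF h]] _ r])
  (simp add: act_R_eR h lin_smultD[OF tt_lin] cp_mem eR_mem tt_eR)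
 then show ?thesis using lin_mem[OF act_R_A(1)[OF h] R_in_A[OF r]] by (simp add: R_carrier)
qed

lemma R_alg: "k_algebra K RR"
proof (rule k_algebraI[OF vR])
 show mc: "r \<otimes>\<^sub>RR s : carrier RR" if "r : carrier RR" "s : carrier RR" for r s
 unfolding R_simps(1) by (rule tt_in_R[OF AR.m_closed[OF R_in_A[OF that(1)] R_in_A[OF that(2)]]])
 have ml: "(%s. r \<otimes>\<^sub>RR s) : lin_maps K RR RR" if "r : carrier RR" for r
 unfolding R_simps(1) by (rule R_lin_sub[OF lin_comp[OF tt_lin_R lin_mult_r[OF aA lin_id R_in_A[OF that]]]])
 have mr: "(%s. s \<otimes>\<^sub>RR r) : lin_maps K RR RR" if "r : carrier RR" for r
 unfolding R_simps(1) by (rule R_lin_sub[OF lin_comp[OF tt_lin_R lin_mult_l[OF aA lin_id R_in_A[OF that]]]])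
 show "bilinear_map K RR RR RR (monoid.mult RR)" by (rule bilinI) (rule ml mr; assumption)+
 have e0: "\<one>\<^sub>RR = eR 0" using N_pos by (simp add: R_simps eR_def O.A_simps(3))
 show "\<one>\<^sub>RR : carrier RR" unfolding e0 by (rule eR_R)
 fix x assume x: "x : carrier RR"
 show "\<one>\<^sub>RR \<otimes>\<^sub>RR x = x" unfolding e0 by (rule R_lin_eq[OF vR ml[OF eR_R] lin_id _ x]) (simp add: eR_mult)
 show "x \<otimes>\<^sub>RR \<one>\<^sub>RR = x" unfolding e0 by (rule R_lin_eq[OF vR mr[OF eR_R] lin_id _ x]) (simp add: eR_mult)
 fix z w assume z: "z : carrier RR" and w: "w : carrier RR"
 have 1: "eR a \<otimes>\<^sub>RR eR b \<otimes>\<^sub>RR w = eR a \<otimes>\<^sub>RR (eR b \<otimes>\<^sub>RR w)" for a b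
 by (rule R_lin_eq[OF vR ml[OF mc[OF eR_R eR_R]] lin_comp[OF ml[OF eR_R] ml[OF eR_R]] _ w]) (simp add: eR_mult add.assoc)
 have 2: "eR a \<otimes>\<^sub>RR z \<otimes>\<^sub>RR w = eR a \<otimes>\<^sub>RR (z \<otimes>\<^sub>RR w)" for a
 by (rule R_lin_eq[OF vR lin_comp[OF mr[OF w] ml[OF eR_R]] lin_comp[OF ml[OF eR_R] mr[OF w]] 1 z])
 show "x \<otimes>\<^sub>RR z \<otimes>\<^sub>RR w = x \<otimes>\<^sub>RR (z \<otimes>\<^sub>RR w)"
 by (rule R_lin_eq[OF vR lin_comp[OF mr[OF w] mr[OF z]] mr[OF mc[OF z w]] 2 x])
qed

lemma eR_coord: "n < N ==> counit H (eR m n) = (if m = n then \<one>\<^sub>K else \<zero>\<^sub>K)"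
 using lin_zeroD[OF counit_lin[OF hC] hV baseV] by (auto simp: eR_def O.mono_small counit_one O.A_simps(4))

lemma eR_inj: "inj_on eR {..<N}"
proof (rule inj_onI)
 fix m n assume mn: "m : {..<N}" "n : {..<N}" "eR m = eR n"
 show "m = n" using eR_coord[of n m] eR_coord[of n n] mn K.one_not_zero by (auto split: if_splits)
qed

lemma eR_basis: "vectorspace.basis K RR (eR ` {..<N})"
proof (rule dual_imp_basis[OF vR])
 show "eR ` {..<N} \<subseteq> carrier RR" using eR_R by auto
 show "EX l. dual_to K RR (eR ` {..<N}) b l" if b: "b : eR ` {..<N}" for b
 proof -
 obtain n where n: "n < N" "b = eR n" using b by auto
 have "(%r. counit H (r n)) : lin_maps K RR KB"
  by (rule R_lin_sub[OF lin_comp[OF counit_lin[OF hC] O.comp_lin]])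
 then show ?thesis unfolding dual_to_def using eR_coord[OF n(1)] n by (intro exI[of _ "%r. counit H (r n)"]) auto
 qed
 fix W assume W: "submodule K W RR" and B: "eR ` {..<N} \<subseteq> W"
 interpret W: submodule K W RR by (rule W)
 show "carrier RR \<subseteq> W"
 proof
 fix r assume r: "r : carrier RR"
 note rA = R_in_A[OF r]
 have "r = tt (finsum A (%i. mono i (r i)) {..<N})" using O.A_decomp[OF rA] tt_R[OF r] by simp
 also have "... = finsum RR (%i. tt (mono i (r i))) {..<N}"
  by (rule lin_finsumD[OF tt_lin_R vA vR finite_lessThan mono_mem[OF O.comp_closed[OF rA]]])
 also have "... : W"
 proof (rule submodule_finsum[OF vR W finite_lessThan])
  fix i assume "i : {..<N}"
  then have "eR i : W" using B by auto
  then show "tt (mono i (r i)) : W"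
  unfolding tt_mono[OF O.comp_closed[OF rA]] R_simps(5)[symmetric] by (rule W.smult_closed[OF counitH[OF O.comp_closed[OF rA]]])
 qed
 finally show "r : W" .
 qed
qed

theorem line_structure_R: "line_structure K H g \<chi> q lam N RR eR"
proof (rule line_structure.intro[OF yd_setting_axioms], rule line_structure_axioms.intro)
 let ?pR = "pure_tensor K RR RR" let ?RRt = "tensor K RR RR"
 note vRR = vs_tensor[OF vR vR] and vHR = vs_tensor[OF hV vR]
 interpret RRV: vectorspace K ?RRt by (rule vRR)
 interpret HRV: vectorspace K "tensor K H RR" by (rule vHR)
 show "k_algebra K RR" by (rule R_alg)
 show "eR n : carrier RR" for n by (rule eR_R)
 show "eR 0 = \<one>\<^sub>RR" using N_pos by (simp add: R_simps eR_def O.A_simps(3))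
 show "eR n = \<zero>\<^sub>RR" if "N <= n" for n using that by (simp add: R_simps eR_def)
 show "eR m \<otimes>\<^sub>RR eR n = eR (m + n)" for m n by (rule eR_mult)
 show "vectorspace.basis K RR (eR ` {..<N})" by (rule eR_basis)
 show "inj_on eR {..<N}" by (rule eR_inj)
 show "act RR h : lin_maps K RR RR" if h: "h : carrier H" for h
 by (rule lin_mapsI) (simp_all add: act_R_closed[OF h] R_simps(4,5) R_in_A lin_addD[OF act_R_A(1)[OF h]] lin_smultD[OF act_R_A(1)[OF h]])
 show "(%h. act RR h r) : lin_maps K H RR" if r: "r : carrier RR" for r
 by (rule lin_mapsI) (simp_all add: act_R_closed[OF _ r] R_simps(4,5) lin_addD[OF act_R_A(2)[OF R_in_A[OF r]]] lin_smultD[OF act_R_A(2)[OF R_in_A[OF r]]])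
 show "act RR h (eR n) = cp n h \<odot>\<^sub>RR eR n" if "h : carrier H" for h n using act_R_eR[OF that] by (simp add: R_simps(5))
 show "coact RR : lin_maps K RR (tensor K H RR)"
 by (rule lin_cong[OF R_lin_sub[OF tensor_map_lin[OF vA vA hV vR p_lin tt_lin_R comult_A_lin]] vR]) (rule coact_R)
 show "comult RR : lin_maps K RR ?RRt"
 by (rule lin_cong[OF R_lin_sub[OF tensor_map_lin[OF vA vA vR vR tt_lin_R tt_lin_R comult_A_lin]] vR]) (rule comult_R)
 show "counit RR : lin_maps K RR KB" unfolding R_simps(6) by (rule R_lin_sub[OF alg_map_lin[OF counit_A_alg]])
 fix n assume n: "n < N"
 have e: "eR n = mono n \<one>\<^sub>H" using n by (simp add: eR_def)
 show "counit RR (eR n) = (if n = 0 then \<one>\<^sub>K else \<zero>\<^sub>K)" by (simp add: e R_simps counit_mono counit_one)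
 have tg: "tt (mono k (g [^]\<^sub>H (j::nat))) = eR k" for k j by (simp add: tt_mono gpow_mem gpow_counit eR_mem)
 show "comult RR (eR n) = finsum ?RRt (%k. gs n k \<odot>\<^sub>?RRt ?pR (eR k) (eR (n - k))) {..n}"
 unfolding comult_R[OF eR_R] unfolding tensor_map_def e lift_comult_mono_one[OF vRR bilin_pure_map[OF vA vA vR vR tt_lin_R tt_lin_R]] tg tt_one ..
 have pc: "pure_tensor K H RR (g [^]\<^sub>H n) (eR n) : carrier (tensor K H RR)" by (rule pure_mem[OF hV vR gpow_mem eR_R])
 have "coact RR (eR n) = finsum (tensor K H RR) (%k. gs n k \<odot>\<^bsub>tensor K H RR\<^esub> pure_tensor K H RR (p (mono k (g [^]\<^sub>H (n - k)))) (eR (n - k))) {..n}"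
 unfolding coact_R[OF eR_R] unfolding tensor_map_def e lift_comult_mono_one[OF vHR bilin_pure_map[OF vA vA hV vR p_lin tt_lin_R]] tt_one ..
 also have "... = finsum (tensor K H RR) (%k. if 0 = k then pure_tensor K H RR (g [^]\<^sub>H n) (eR n) else \<zero>\<^bsub>tensor K H RR\<^esub>) {..n}"
 by (rule HRV.finsum_cong'[OF refl])
  (use n pc in \<open>auto simp: p_small gpow_mem q_closed gs_mem lin_zeroD[OF bilin_lin2[OF bilin_pure[OF hV vR] eR_R] hV vHR]\<close>)
 also have "... = pure_tensor K H RR (g [^]\<^sub>H n) (eR n)"
 by (rule HRV.M.add.finprod_singleton) (use pc in auto)
 finally show "coact RR (eR n) = pure_tensor K H RR (g [^]\<^sub>H n) (eR n)" .
qed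

lemma y_pow_R: "y [^]\<^sub>RR (n::nat) = eR n"
proof (induction n)
 interpret Rr: ring RR by (rule alg_ring[OF R_alg])
 case 0 show ?case using N_pos by (simp add: R_simps eR_def O.A_simps(3))
next
 interpret Rr: ring RR by (rule alg_ring[OF R_alg])
 case (Suc n)
 have "tt (eR n \<otimes>\<^sub>A y) = eR (Suc n)"
 proof (cases "n < N")
 case True
 have "mono n \<one>\<^sub>H \<otimes>\<^sub>A y = mono (Suc n) \<one>\<^sub>H" by (simp add: O.y_def O.mult_mono alg_map_one[OF phi_alg])
 then show ?thesis using True tt_one[of "Suc n"] by (simp add: eR_def[of n])
 next
 case False
 then show ?thesis using AR.l_null[OF O.y_mem] lin_zeroD[OF tt_lin vA vA] by (simp add: eR_def)
 qed
 then show ?case unfolding Rr.nat_pow_Suc Suc.IH R_simps(1) .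
qed

lemma y_pow_eR: "n < N ==> y [^]\<^sub>A n = eR n"
 by (simp add: O.y_pow eR_def)

lemma dim_R: "vectorspace.dim K RR = N"
proof -
 interpret RV: vectorspace K RR by (rule vR)
 show ?thesis using RV.dim_basis[OF _ eR_basis] card_image[OF eR_inj] by simp
qed

abbreviation xi where "xi == cocycle K H A p"
abbreviation pR where "pR == pure_tensor K RR RR"

lemma xi_eq: "xi = tensor_lift K RR RR H (%r s. p (r \<otimes>\<^sub>A s))"
 unfolding cocycle_def tensor_lift_cong_space[OF CI_simps CI_simps refl refl refl] ..

lemma xi_bilin: "bilinear_map K RR RR H (%r s. p (r \<otimes>\<^sub>A s))"
 by (rule bilinI) (rule R_lin_sub[OF lin_comp[OF p_lin lin_mult_r[OF aA lin_id R_in_A]]]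
  R_lin_sub[OF lin_comp[OF p_lin lin_mult_l[OF aA lin_id R_in_A]]]; assumption)+

lemma xi_lin: "xi : lin_maps K (tensor K RR RR) H"
 and xi_pure: "r : carrier RR ==> s : carrier RR ==> xi (pR r s) = p (r \<otimes>\<^sub>A s)"
 unfolding xi_eq by (rule lift_spec(1)[OF vR vR hV xi_bilin]) (rule lift_spec(2)[OF vR vR hV xi_bilin])

lemma mono_one_mult: "mono a \<one>\<^sub>H \<otimes>\<^sub>A mono b \<one>\<^sub>H = mono (a + b) \<one>\<^sub>H"
 by (simp add: O.mult_mono alg_map_one[OF phi_funpow_alg])

lemma xi_eR:
 assumes a: "a < N" and b: "b < N"
 shows "xi (pR (eR a) (eR b)) = (if a + b = 0 then \<one>\<^sub>H else if a + b = N then zz else \<zero>\<^sub>H)"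
proof -
 have "xi (pR (eR a) (eR b)) = p (mono (a + b) \<one>\<^sub>H)"
 unfolding xi_pure[OF eR_R eR_R] by (simp add: eR_def a b mono_one_mult)
 also have "... = (if a + b = 0 then \<one>\<^sub>H else if a + b = N then zz else \<zero>\<^sub>H)"
 proof (cases "a + b < N")
 case True then show ?thesis by (simp add: p_small)
 next
 case False
 then have n: "a + b = (a + b - N) + 1 * N" and m: "a + b - N < N" using a b by auto
 have "mono (a + b) \<one>\<^sub>H = mono (a + b - N) zz"
  using O.mono_red[OF HR.one_closed, of "a + b - N" 1] zz_closed n by simp
 moreover have "\<not> (a = 0 & b = 0)" using False N_pos by auto
 ultimately show ?thesis using False m zz_closed by (auto simp: p_small)
 qed
 finally show ?thesis .
qed

section \<open>The bosonization\<close>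

abbreviation RH where "RH == tensor K RR H"
abbreviation pRH where "pRH == pure_tensor K RR H"
abbreviation om where "om == tensor_lift K RR H A (%r h. r \<otimes>\<^sub>A \<sigma> h)"
abbreviation SM where "SM == smash K H RR xi"
abbreviation tw where "tw == twisted_mult K H RR xi"

lemma vRH: "vectorspace K RH" by (rule vs_tensor[OF vR hV])

lemma om_bilin: "bilinear_map K RR H A (%r h. r \<otimes>\<^sub>A \<sigma> h)"
 by (rule bilinI) (rule lin_mult_r[OF aA sig_lin R_in_A] R_lin_sub[OF lin_mult_l[OF aA lin_id mono_mem]]; assumption)+

lemma om_lin: "om : lin_maps K RH A"
 and om_pure: "r : carrier RR ==> h : carrier H ==> om (pRH r h) = r \<otimes>\<^sub>A \<sigma> h"
 by (rule lift_spec(1)[OF vR hV vA om_bilin]) (rule lift_spec(2)[OF vR hV vA om_bilin])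

lemma om_eR: "n < N ==> h : carrier H ==> om (pRH (eR n) h) = mono n h"
 by (simp only: om_pure eR_R) (simp add: eR_def mono_mult)

lemma RH_lin_eq:
 assumes M: "vectorspace K M" and F: "F : lin_maps K RH M" and G: "G : lin_maps K RH M"
 and eq: "!!n h. n < N ==> h : carrier H ==> F (pRH (eR n) h) = G (pRH (eR n) h)" and t: "t : carrier RH"
 shows "F t = G t"
proof (rule tensor_lin_eq[OF vR hV F G _ t])
 fix r h assume r: "r : carrier RR" and h: "h : carrier H"
 note l = lin_pure_l[OF vR hV lin_id h]
 show "F (pRH r h) = G (pRH r h)"
 by (rule R_lin_eq[OF M lin_comp[OF F l] lin_comp[OF G l] eq[OF _ h] r])
qed

text \<open>Both sides are free over \<open>H\<close> on the powers of \<open>y\<close>.\<close>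

lemma om_bij: "bij_betw om (carrier RH) (carrier A)"
proof -
 have l: "(%h. pRH (eR n) h) : lin_maps K H RH" for n by (rule lin_pure_r[OF vR hV lin_id eR_R])
 define u where "u = O.dlift RH (%n h. pRH (eR n) h)"
 have ul: "u : lin_maps K A RH" unfolding u_def by (rule O.dlift_lin[OF vRH l])
 have um: "u (mono n h) = pRH (eR n) h" if "n < N" "h : carrier H" for n h
 unfolding u_def by (rule O.dlift_mono[OF vRH l that])
 have 1: "u (om t) = t" if "t : carrier RH" for t
 by (rule RH_lin_eq[OF vRH lin_comp[OF ul om_lin] lin_id _ that]) (simp add: om_eR um)
 have 2: "om (u a) = a" if "a : carrier A" for a
 by (rule O.A_lin_eq[OF vA lin_comp[OF om_lin ul] lin_id _ that]) (simp add: om_eR um)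
 show ?thesis
 by (rule bij_betw_byWitness[where f'=u]) (use 1 2 lin_mem[OF om_lin] lin_mem[OF ul] in auto)
qed

lemma om_bij_SM: "bij_betw om (carrier SM) (carrier A)"
proof -
 have "carrier SM = carrier RH" by (simp_all add: smash_def Let_def)
 then show ?thesis using om_bij by simp
qed

text \<open>\<open>\<Sum> \<tau>(c\<^sub>1) \<sigma>(\<pi>(c\<^sub>2)) = c\<close>: this inverts \<open>\<omega>\<close>.\<close>

lemma om_decompose:
 assumes c: "c : carrier A"
 shows "om (tensor_map K A A RR H tt p (comult A c)) = c"
proof -
 let ?F = "%x v. tt x \<otimes>\<^sub>A \<sigma> (p v)"
 have bF: "bilinear_map K A A A ?F" by (assumption | rule tt_lin tt_mem lin_comp[OF tt_lin] pl p_lin lin)+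
 have "om (tensor_map K A A RR H tt p (comult A c)) = liftA A ?F (comult A c)"
 by (rule lift_tensor_map[OF vA vA vR hV tt_lin_R p_lin vA om_bilin comult_A_closed[OF c]])
 also have "... = c"
 proof (rule O.A_lin_eq[OF vA lift_lin[OF vA vA vA bF comult_A_lin] lin_id _ c])
 fix n h assume n: "n < N" and h: "h : carrier H"
 have z: "?F (mono k x) (mono j v) = \<zero>\<^sub>A" if "0 < j" "k + j = n" "x : carrier H" "v : carrier H" for k j x v
  using that n AR.r_null[OF tt_mem[OF mono_mem[OF that(3)]]] by (simp add: p_small lin_zeroD[OF O.mono_lin hV vA])
 have b: "bilinear_map K H H H (%x v. counit H x \<odot>\<^sub>H v)" by (assumption | rule lin)+
 have "liftA A ?F (comult A (mono n h)) = liftH A (%x v. ?F (mono n x) (\<sigma> v)) (comult H h)"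
  by (rule lift_top[OF vA bF h z])
 also have "... = liftH A (%x v. mono n (counit H x \<odot>\<^sub>H v)) (comult H h)"
  by (rule lift_fcong) (simp add: p_sig tt_mono eR_def n mono_mem counitH alg_smult_l[OF aA] mono_mult lin_smultD[OF O.mono_lin])
 also have "... = mono n (liftH H (%x v. counit H x \<odot>\<^sub>H v) (comult H h))"
  by (rule liftH_out[OF hV b vA O.mono_lin h, symmetric])
 also have "... = mono n h" using counit_l[OF hC hV lin_id h] by simp
 finally show "liftA A ?F (comult A (mono n h)) = mono n h" .
 qed
 finally show ?thesis .
qed

lemma tw_lin: "s : carrier RR ==> (%r. tw r s) : lin_maps K RR RH" "r : carrier RR ==> (%s. tw r s) : lin_maps K RR RH"
proof -
 interpret L: line_structure K H g \<chi> q lam N RR eR by (fact line_structure_R)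
 show "s : carrier RR ==> (%r. tw r s) : lin_maps K RR RH" "r : carrier RR ==> (%s. tw r s) : lin_maps K RR RH"
 unfolding twisted_mult_def
 by (rule tensor_map_lin[OF L.vQQ L.vQQ vR hV L.mm_lin xi_lin L.braided_lin(1)], assumption)
  (rule tensor_map_lin[OF L.vQQ L.vQQ vR hV L.mm_lin xi_lin L.braided_lin(2)], assumption)
qed

text \<open>By multiplicativity of \<open>\<Delta>\<close>, the pair \<open>(m \<otimes> \<xi>) \<delta>\<^bsub>R \<otimes> R\<^esub>\<close> is \<open>(\<tau> \<otimes> \<pi>) \<Delta>\<close> of the product in \<open>A\<close>.\<close>

lemma om_tw:
 assumes a: "a < N" and b: "b < N"
 shows "om (tw (eR a) (eR b)) = mono a \<one>\<^sub>H \<otimes>\<^sub>A mono b \<one>\<^sub>H"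
proof -
 interpret L: line_structure K H g \<chi> q lam N RR eR by (fact line_structure_R)
 interpret RHV: vectorspace K RH by (rule vRH)
 note mc = mono_mem[OF HR.one_closed]
 let ?F = "%x v. pRH (tt x) (p v)"
 have b0: "bilinear_map K A A RH ?F" by (rule bilin_pure_map[OF vA vA vR hV tt_lin_R p_lin])
 note bc = bilin_comp1[OF b0] bilin_comp2[OF b0]
 have b1: "bilinear_map K A A RH (%x v. liftA RH (%x' v'. ?F (x \<otimes>\<^sub>A x') (v \<otimes>\<^sub>A v')) (comult A (mono b \<one>\<^sub>H)))"
 by (assumption | rule mc bc vRH lin)+
 have b2: "bilinear_map K A A RH (%x' v'. ?F (x \<otimes>\<^sub>A x') (v \<otimes>\<^sub>A v'))" if "x : carrier A" "v : carrier A" for x v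
 by (assumption | rule that bc lin)+
 have b4: "bilinear_map K L.QQ L.QQ RH (%s t. pRH (L.mm s) (xi t))"
 by (rule bilin_pure_map[OF L.vQQ L.vQQ vR hV L.mm_lin xi_lin])
 have "tt (mono k (g [^]\<^sub>H (i::nat)) \<otimes>\<^sub>A mono l (g [^]\<^sub>H (j::nat))) = q [^]\<^sub>K (l * i) \<odot>\<^sub>A eR (k + l)" for k l i j
 by (simp add: O.mult_mono gpow_mem phin_mem tt_mono counit_mult counit_phin cp_gpow gpow_counit q_closed)
 moreover have "L.mm (pR (eR k) (act RR (g [^]\<^sub>H (i::nat)) (eR l))) = q [^]\<^sub>K (l * i) \<odot>\<^sub>A eR (k + l)" for k l i
 by (simp add: L.act_gpow_e L.mm_pure eR_R q_closed L.QV.smult_closed alg_smult_r[OF R_alg] eR_mult) (simp add: R_simps)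
 moreover have "p (mono (a - k) \<one>\<^sub>H \<otimes>\<^sub>A mono (b - l) \<one>\<^sub>H) = xi (pR (eR (a - k)) (eR (b - l)))" for k l
 unfolding xi_pure[OF eR_R eR_R] using a b by (simp add: eR_def less_imp_diff_less)
 ultimately have t: "?F (mono k (g [^]\<^sub>H (a - k)) \<otimes>\<^sub>A mono l (g [^]\<^sub>H (b - l))) (mono (a - k) \<one>\<^sub>H \<otimes>\<^sub>A mono (b - l) \<one>\<^sub>H) =
 pRH (L.mm (pR (eR k) (act RR (g [^]\<^sub>H (a - k)) (eR l)))) (xi (pR (eR (a - k)) (eR (b - l))))" for k l
 by (simp only:)
 have "tensor_map K A A RR H tt p (comult A (mono a \<one>\<^sub>H \<otimes>\<^sub>A mono b \<one>\<^sub>H)) =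
 liftA RH (%x v. liftA RH (%x' v'. ?F (x \<otimes>\<^sub>A x') (v \<otimes>\<^sub>A v')) (comult A (mono b \<one>\<^sub>H))) (comult A (mono a \<one>\<^sub>H))"
 unfolding tensor_map_def by (rule lift_comult_mult[OF bialg_A vRH b0 mc mc])
 also have "... = tw (eR a) (eR b)"
 unfolding twisted_mult_def tensor_map_def L.lift_braided_e[OF vRH b4] lift_comult_mono_one[OF vRH b1]
  lift_comult_mono_one[OF vRH b2[OF mono_mem[OF gpow_mem] mc]] t ..
 finally show ?thesis using om_decompose[OF alg_mult_mem[OF aA mc[of a] mc[of b]]] by simp
qed

theorem smash_hopf: "hopf_algebra K SM" and om_hopf: "om : hopf_maps K SM A"
proof -
 interpret L: line_structure K H g \<chi> q lam N RR eR by (fact line_structure_R)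
 let ?T4 = "tensor K RH RH" let ?p4 = "pure_tensor K RH RH"
 note v4 = vs_tensor[OF vRH vRH]
 interpret V4: vectorspace K ?T4 by (rule v4)
 have s: "carrier SM = carrier RH" "\<zero>\<^sub>SM = \<zero>\<^sub>RH" "ring.add SM = ring.add RH" "smult SM = smult RH"
 by (simp_all add: smash_def Let_def)
 have vS: "vectorspace K SM" by (rule vs_cong[OF vRH s])
 have lS: "lin_maps K SM M = lin_maps K RH M" for M by (rule lin_maps_cong) (simp_all add: s)
 have tlS: "tensor_lift K SM SM AA = tensor_lift K RH RH AA" by (rule tensor_lift_cong_space) (simp_all add: s)
 have tS: "tensor K SM SM = ?T4" "tensor_map K SM SM A A = tensor_map K RH RH A A"
 using tensor_cong[OF s(1,3,4) s(1,3,4), of K] by (simp_all add: tensor_map_def fun_eq_iff tlS)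
 have twc: "tw r s : carrier RH" if "r : carrier RR" "s : carrier RR" for r s by (rule lin_mem[OF tw_lin(1)[OF that(2)] that(1)])
 have twl: "(%x. tw (f x) s) : lin_maps K U RH" if "f : lin_maps K U RR" "s : carrier RR" for f s U
 by (rule lin_comp[OF tw_lin(1)[OF that(2)] that(1)])
 have twr: "(%x. tw s (f x)) : lin_maps K U RH" if "f : lin_maps K U RR" "s : carrier RR" for f s U
 by (rule lin_comp[OF tw_lin(2)[OF that(2)] that(1)])
 note rr = vR vRH v4 twc twl twr L.act_comp L.act_comp' L.act_closed lin_comp[OF L.coact_lin] lin_mem[OF L.coact_lin]
 lin_comp[OF L.comult_lin] lin_mem[OF L.comult_lin] L.coact_lin L.comult_lin eR_R
 let ?G = "%h2 k m0 m1. pRH m0 (m1 \<otimes>\<^sub>H h2 \<otimes>\<^sub>H k)"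
 let ?W = "%r h s k. liftH RH (%h1 h2. tensor_lift K RR H RH (?G h2 k) (tw r (act RR h1 s))) (comult H h)"
 have bG: "bilinear_map K RR H RH (?G h2 k)" if "h2 : carrier H" "k : carrier H" for h2 k
 by (assumption | rule that rr lin)+
 have bW0: "bilinear_map K H H RH (%h1 h2. tensor_lift K RR H RH (?G h2 k) (tw r (act RR h1 s)))"
 if "r : carrier RR" "s : carrier RR" "k : carrier H" for r s k by (assumption | rule that rr lin)+
 have bW: "bilinear_map K RR H RH (%s k. ?W r h s k)" if "r : carrier RR" "h : carrier H" for r h
 by (assumption | rule that rr lin)+
 have bM: "bilinear_map K RR H RH (%r h. tensor_lift K RR H RH (%s k. ?W r h s k) u)" if "u : carrier RH" for u
 by (assumption | rule that rr lin)+
 have mult: "t \<otimes>\<^sub>SM u = tensor_lift K RR H RH (%r h. tensor_lift K RR H RH (%s k. ?W r h s k) u) t" for t u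
 by (simp add: smash_def Let_def sweedler_def)
 have mc: "t \<otimes>\<^sub>SM u : carrier SM" if "t : carrier SM" "u : carrier SM" for t u
 unfolding mult s using that by (intro lift_closed[OF vR hV vRH bM]) (simp_all add: s)
 have m2: "om (?W (eR a) h (eR b) k) = mono a h \<otimes>\<^sub>A mono b k"
 if a: "a < N" and b: "b < N" and h: "h : carrier H" and k: "k : carrier H" for a b h k
 proof -
 let ?y = "mono a \<one>\<^sub>H \<otimes>\<^sub>A mono b \<one>\<^sub>H"
 have yc: "?y : carrier A" by (simp add: mono_mem)
 have Ll: "(%v. ?y \<otimes>\<^sub>A \<sigma> (v \<otimes>\<^sub>H k)) : lin_maps K H A" by (assumption | rule yc k lin)+
 have bh: "bilinear_map K H H H (%x v. cp b x \<odot>\<^sub>H v)" by (assumption | rule lin)+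
 have i: "om (tensor_lift K RR H RH (?G v k) t) = om t \<otimes>\<^sub>A \<sigma> (v \<otimes>\<^sub>H k)" if v: "v : carrier H" and t: "t : carrier RH" for v t
 proof -
  have sc: "\<sigma> (v \<otimes>\<^sub>H k) : carrier A" using v k by (simp add: mono_mem)
  have "om (tensor_lift K RR H RH (?G v k) t) = tensor_lift K RR H A (%m0 m1. om (?G v k m0 m1)) t"
  by (rule lin_lift_comp[OF vR hV vRH bG[OF v k] vA om_lin t])
  also have "... = tensor_lift K RR H A (%m0 m1. (m0 \<otimes>\<^sub>A \<sigma> m1) \<otimes>\<^sub>A \<sigma> (v \<otimes>\<^sub>H k)) t"
  by (rule lift_fcong) (use v k in \<open>simp add: om_pure HR.m_assoc alg_assoc[OF aA] R_in_A mono_mem sig_mult\<close>)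
  also have "... = om t \<otimes>\<^sub>A \<sigma> (v \<otimes>\<^sub>H k)"
  by (rule lin_lift_comp[OF vR hV vA om_bilin vA lin_mult_l[OF aA lin_id sc] t, symmetric])
  finally show ?thesis .
 qed
 have "om (?W (eR a) h (eR b) k) = liftH A (%x v. om (tensor_lift K RR H RH (?G v k) (tw (eR a) (act RR x (eR b))))) (comult H h)"
  by (rule liftH_out[OF vRH bW0[OF eR_R eR_R k] vA om_lin h])
 also have "... = liftH A (%x v. ?y \<otimes>\<^sub>A \<sigma> ((cp b x \<odot>\<^sub>H v) \<otimes>\<^sub>H k)) (comult H h)"
 proof (rule lift_fcong)
  fix x v assume x: "x : carrier H" and v: "v : carrier H"
  note cx = cp_mem[OF x, of b]
  have "om (tw (eR a) (act RR x (eR b))) = cp b x \<odot>\<^sub>A ?y"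
  unfolding L.act_e'[OF x] lin_smultD[OF tw_lin(2)[OF eR_R] cx eR_R] lin_smultD[OF om_lin cx twc[OF eR_R eR_R]] om_tw[OF a b] ..
  then have "om (tensor_lift K RR H RH (?G v k) (tw (eR a) (act RR x (eR b)))) = (cp b x \<odot>\<^sub>A ?y) \<otimes>\<^sub>A \<sigma> (v \<otimes>\<^sub>H k)"
  using i[OF v twc[OF eR_R[of a] L.act_closed[OF x eR_R[of b]]]] by (simp only:)
  also have "... = cp b x \<odot>\<^sub>A (?y \<otimes>\<^sub>A \<sigma> (v \<otimes>\<^sub>H k))"
  by (rule alg_smult_l[OF aA cx yc mono_mem[OF HR.m_closed[OF v k]]])
  also have "... = ?y \<otimes>\<^sub>A \<sigma> ((cp b x \<odot>\<^sub>H v) \<otimes>\<^sub>H k)" by (rule lin_smultD[OF Ll cx v, symmetric])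
  finally show "om (tensor_lift K RR H RH (?G v k) (tw (eR a) (act RR x (eR b)))) = ?y \<otimes>\<^sub>A \<sigma> ((cp b x \<odot>\<^sub>H v) \<otimes>\<^sub>H k)" .
 qed
 also have "... = ?y \<otimes>\<^sub>A \<sigma> ((\<phi> ^^ b) h \<otimes>\<^sub>H k)"
  unfolding phin_eq[OF h] by (rule liftH_out[OF hV bh vA Ll h, symmetric])
 also have "... = mono a h \<otimes>\<^sub>A mono b k"
  unfolding mono_one_mult using h k by (simp add: O.mult_mono phin_mem)
 finally show ?thesis .
 qed
 have m1: "om (tensor_lift K RR H RH (%s k. ?W (eR a) h s k) u) = mono a h \<otimes>\<^sub>A om u"
 if a: "a < N" and h: "h : carrier H" and u: "u : carrier RH" for a h u
 proof (rule RH_lin_eq[OF vA lin_comp[OF om_lin lift_spec(1)[OF vR hV vRH bW[OF eR_R h]]] lin_mult_r[OF aA om_lin mono_mem[OF h]] _ u])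
 fix b k assume b: "b < N" and k: "k : carrier H"
 show "om (tensor_lift K RR H RH (%s k. ?W (eR a) h s k) (pRH (eR b) k)) = mono a h \<otimes>\<^sub>A om (pRH (eR b) k)"
  unfolding lift_pure[OF vR hV vRH bW[OF eR_R h] eR_R k] m2[OF a b h k] om_eR[OF b k] ..
 qed
 have m: "om (t \<otimes>\<^sub>SM u) = om t \<otimes>\<^sub>A om u" if "t : carrier SM" "u : carrier SM" for t u
 proof -
 have t: "t : carrier RH" and u: "u : carrier RH" using that by (simp_all add: s)
 show ?thesis unfolding mult
 proof (rule RH_lin_eq[OF vA lin_comp[OF om_lin lift_spec(1)[OF vR hV vRH bM[OF u]]] lin_mult_l[OF aA om_lin lin_mem[OF om_lin u]] _ t])
  fix a h assume a: "a < N" and h: "h : carrier H"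
  show "om (tensor_lift K RR H RH (%r h. tensor_lift K RR H RH (%s k. ?W r h s k) u) (pRH (eR a) h)) = om (pRH (eR a) h) \<otimes>\<^sub>A om u"
  unfolding lift_pure[OF vR hV vRH bM[OF u] eR_R h] m1[OF a h u] om_eR[OF a h] ..
 qed
 qed
 let ?D0 = "%h1 h2 r1 x r0. ?p4 (pRH r1 (x \<otimes>\<^sub>H h1)) (pRH r0 h2)"
 let ?D1 = "%h r1 r2. liftH ?T4 (%h1 h2. tensor_lift K H RR ?T4 (?D0 h1 h2 r1) (coact RR r2)) (comult H h)"
 have D0: "bilinear_map K H RR ?T4 (?D0 h1 h2 r1)" if "h1 : carrier H" "h2 : carrier H" "r1 : carrier RR" for h1 h2 r1
 by (assumption | rule that rr lin)+
 have D1: "bilinear_map K RR RR ?T4 (?D1 h)" if "h : carrier H" for h by (assumption | rule that rr lin)+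
 have D2: "bilinear_map K RR H ?T4 (%r h. tensor_lift K RR RR ?T4 (?D1 h) (comult RR r))" by (assumption | rule rr lin)+
 have dS: "comult SM = tensor_lift K RR H ?T4 (%r h. tensor_lift K RR RR ?T4 (?D1 h) (comult RR r))"
 by (simp add: smash_def Let_def sweedler_def)
 have dl: "comult SM : lin_maps K RH ?T4" unfolding dS by (rule lift_spec(1)[OF vR hV v4 D2])
 let ?P = "tensor_map K RH RH A A om om"
 have Pl: "?P : lin_maps K ?T4 AA" by (rule tensor_map_lin[OF vRH vRH vA vA om_lin om_lin lin_id])
 have d: "?P (comult SM t) = comult A (om t)" if t: "t : carrier RH" for t
 proof (rule RH_lin_eq[OF vAA lin_comp[OF Pl dl] lin_comp[OF comult_A_lin om_lin] _ t])
 fix n h assume n: "n < N" and h: "h : carrier H"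
 let ?e = "%k. liftH ?T4 (%h1 h2. ?p4 (pRH (eR k) (g [^]\<^sub>H (n - k) \<otimes>\<^sub>H h1)) (pRH (eR (n - k)) h2)) (comult H h)"
 have be: "bilinear_map K H H ?T4 (%h1 h2. ?p4 (pRH (eR k) (g [^]\<^sub>H (n - k) \<otimes>\<^sub>H h1)) (pRH (eR (n - k)) h2))" for k
  by (assumption | rule rr lin)+
 have ec: "?e k : carrier ?T4" for k by (rule lift_closed[OF hV hV v4 be comultH[OF h]])
 have e1: "?D1 h (eR k) (eR (n - k)) = ?e k" for k
  by (rule lift_fcong) (simp only: L.coact_e' lift_pure[OF hV vR v4 D0 gpow_mem eR_R] eR_R)
 have Pe: "?P (?e k) = liftH AA (%x v. ptA (mono k (g [^]\<^sub>H (n - k) \<otimes>\<^sub>H x)) (mono (n - k) v)) (comult H h)" if "k <= n" for k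
  unfolding liftH_out[OF v4 be vAA Pl h]
  by (rule lift_fcong) (use n that in \<open>simp add: tensor_map_pure[OF vRH vRH vA vA om_lin om_lin] pure_mem[OF vR hV] eR_R gpow_mem om_eR\<close>)
 have "comult SM (pRH (eR n) h) = finsum ?T4 (%k. gs n k \<odot>\<^sub>?T4 ?e k) {..n}"
  unfolding dS lift_pure[OF vR hV v4 D2 eR_R h] L.lift_comult_e[OF v4 D1[OF h]] e1 ..
 then have "?P (comult SM (pRH (eR n) h)) = finsum AA (%k. ?P (gs n k \<odot>\<^sub>?T4 ?e k)) {..n}"
  by (simp only:) (rule lin_finsumD[OF Pl v4 vAA finite_atMost V4.smult_closed[OF gs_mem ec]])
 also have "... = finsum AA (%k. gs n k \<odot>\<^sub>AA liftH AA (%x v. ptA (mono k (g [^]\<^sub>H (n - k) \<otimes>\<^sub>H x)) (mono (n - k) v)) (comult H h)) {..n}"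
 proof (rule TV.finsum_cong'[OF refl])
  have bm: "bilinear_map K H H AA (%x v. ptA (mono k (g [^]\<^sub>H (n - k) \<otimes>\<^sub>H x)) (mono (n - k) v))" for k by (assumption | rule lin)+
  show "(%k. gs n k \<odot>\<^sub>AA liftH AA (%x v. ptA (mono k (g [^]\<^sub>H (n - k) \<otimes>\<^sub>H x)) (mono (n - k) v)) (comult H h)) : {..n} \<rightarrow> carrier AA"
  using lift_closed[OF hV hV vAA bm comultH[OF h]] gs_mem by auto
  show "?P (gs n k \<odot>\<^sub>?T4 ?e k) = gs n k \<odot>\<^sub>AA liftH AA (%x v. ptA (mono k (g [^]\<^sub>H (n - k) \<otimes>\<^sub>H x)) (mono (n - k) v)) (comult H h)"
  if "k : {..n}" for k using that by (simp only: lin_smultD[OF Pl gs_mem ec] Pe atMost_iff)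
 qed
 also have "... = comult A (mono n h)"
  using lift_comult_mono[OF vAA bilin_pure[OF vA vA] h, of n] lift_pure_id[OF vA vA comult_A_closed[OF mono_mem[OF h]], of n] by simp
 finally show "?P (comult SM (pRH (eR n) h)) = comult A (om (pRH (eR n) h))" unfolding om_eR[OF n h] .
 qed
 have eB: "bilinear_map K RR H KB (%r h. counit RR r \<otimes>\<^sub>K counit H h)"
 proof (rule bilinI)
 show "(%h. counit RR r \<otimes>\<^sub>K counit H h) : lin_maps K H KB" if "r : carrier RR" for r
  by (rule kmult_r[OF counit_lin[OF hC] L.counit_Q_closed[OF that]])
 show "(%r. counit RR r \<otimes>\<^sub>K counit H h) : lin_maps K RR KB" if "h : carrier H" for h
  by (rule kmult_l[OF L.counit_lin counitH[OF that]])
 qed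
 have eS: "counit SM = tensor_lift K RR H KB (%r h. counit RR r \<otimes>\<^sub>K counit H h)"
 by (simp add: smash_def Let_def)
 have e: "counit SM t = counit A (om t)" if t: "t : carrier RH" for t
 proof (rule RH_lin_eq[OF baseV _ lin_comp[OF alg_map_lin[OF counit_A_alg] om_lin] _ t])
 show "counit SM : lin_maps K RH KB" unfolding eS by (rule lift_spec(1)[OF vR hV baseV eB])
 fix n h assume n: "n < N" and h: "h : carrier H"
 show "counit SM (pRH (eR n) h) = counit A (om (pRH (eR n) h))"
  unfolding eS lift_pure[OF vR hV baseV eB eR_R h] om_eR[OF n h] using h by (simp add: L.counit_e' counit_mono counitH)
 qed
 have o: "\<one>\<^sub>SM = pRH (eR 0) \<one>\<^sub>H" using L.e_0 by (simp add: smash_def Let_def)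
 have oc: "\<one>\<^sub>SM : carrier SM" unfolding o s by (rule pure_mem[OF vR hV eR_R HR.one_closed])
 have o1: "om \<one>\<^sub>SM = \<one>\<^sub>A" unfolding o om_eR[OF N_pos HR.one_closed] O.A_simps(3) ..
 note ht = hopf_transport[OF hopf_A vS _ _ mc m oc o1, unfolded lS s tS, OF om_lin om_bij]
 show "hopf_algebra K SM" by (rule ht(1)) (assumption | rule lin_mem[OF dl] d e)+
 show "om : hopf_maps K SM A" by (rule ht(2)) (assumption | rule lin_mem[OF dl] d e)+
qed

end

end

section \<open>Linear maps given on bases\<close>

lemma k_algebra_cong:
 assumes A: "k_algebra K A" and f: "carrier B = carrier A" "monoid.mult B = monoid.mult A" "\<one>\<^sub>B = \<one>\<^sub>A"
 "\<zero>\<^sub>B = \<zero>\<^sub>A" "ring.add B = ring.add A" "smult B = smult A"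
 shows "k_algebra K B"
proof -
 have v: "vectorspace K B" by (rule vs_cong[OF alg_vs[OF A] f(1,4,5,6)])
 have l: "lin_maps K B B = lin_maps K A A" by (rule lin_maps_cong) (simp_all add: f)
 have "bilinear_map K B B B (monoid.mult B)" using bilin_mult[OF A] by (simp add: bilinear_map_def f l)
 from k_algebraI[OF v _ this] show ?thesis
 using alg_assoc[OF A] alg_one_l[OF A] alg_one_r[OF A] alg_mult_mem[OF A] alg_one_mem[OF A] by (simp add: f)
qed

lemma basis_cong:
 assumes V: "vectorspace K V" and B: "vectorspace.basis K V B" and f: "carrier W = carrier V"
 "\<zero>\<^sub>W = \<zero>\<^sub>V" "ring.add W = ring.add V" "smult W = smult V"
 shows "vectorspace.basis K W B"
proof -
 interpret V: vectorspace K V by (rule V)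
 note W = vs_cong[OF V f]
 have Bc: "B \<subseteq> carrier V" using B by (simp add: V.basis_def)
 have l: "lin_maps K W (base_module K) = lin_maps K V (base_module K)" by (rule lin_maps_cong) (simp_all add: f)
 show ?thesis
 proof (rule dual_imp_basis[OF W])
 show "B \<subseteq> carrier W" using Bc f by simp
 show "EX l. dual_to K W B b l" if "b : B" for b using basis_dual_exists[OF V B that] by (simp add: dual_to_def l)
 fix S assume S: "submodule K S W" and BS: "B \<subseteq> S"
 interpret S: submodule K S W by (rule S)
 have Sadd: "v \<oplus>\<^sub>W w : S" if "v : S" "w : S" for v w using S.m_closed[OF that] by simp
 have "submodule K S V"
  by (rule submoduleI'[OF V]) (use S.subset S.zero_closed Sadd S.smult_closed f in auto)
 then show "carrier W \<subseteq> S" using submodule_span_induct[OF V Bc B _ _ BS] f by blast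
 qed
qed

lemma lin_bij_of_basis:
 assumes V: "vectorspace K V" and W: "vectorspace K W" and F: "F : lin_maps K V W"
 and B: "vectorspace.basis K V B" and inj: "inj_on F B" and FB: "vectorspace.basis K W (F ` B)"
 shows "bij_betw F (carrier V) (carrier W)"
proof -
 interpret V: vectorspace K V by (rule V)
 interpret W: vectorspace K W by (rule W)
 note KB = base_vs[OF vs_field[OF V]]
 have Bc: "B \<subseteq> carrier V" using B by (simp add: V.basis_def)
 have FBc: "F ` B \<subseteq> carrier W" using FB by (simp add: W.basis_def)
 have ker: "v = \<zero>\<^sub>V" if v: "v : carrier V" and Fv: "F v = \<zero>\<^sub>W" for v
 proof (rule basis_dual_zero[OF V B v])
 fix b l assume b: "b : B" and l: "dual_to K V B b l"
 obtain l' where l': "dual_to K W (F ` B) (F b) l'" using basis_dual_exists[OF W FB, of "F b"] b by auto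
 have ll: "l : lin_maps K V (base_module K)" "l' : lin_maps K W (base_module K)" using l l' by (simp_all add: dual_to_def)
 have "l v = l' (F v)"
 proof (rule basis_lin_eq[OF V KB B ll(1) lin_comp[OF ll(2) F] _ v])
  fix b' assume b': "b' : B"
  then have "F b' = F b \<longleftrightarrow> b' = b" using b inj by (auto simp: inj_on_def)
  then show "l b' = l' (F b')" using b b' l l' by (cases "b' = b") (auto simp: dual_to_def)
 qed
 then show "l v = \<zero>\<^sub>K" using lin_zeroD[OF ll(2) W KB] by (simp add: Fv)
 qed
 have "inj_on F (carrier V)"
 proof (rule inj_onI)
 fix v w assume vw: "v : carrier V" "w : carrier V" "F v = F w"
 then have "F (v \<ominus>\<^sub>V w) = \<zero>\<^sub>W" using lin_minusD[OF F V W vw(1,2)] lin_mem[OF F vw(2)] by (simp add: W.M.minus_eq W.M.r_neg)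
 then have z: "v \<ominus>\<^sub>V w = \<zero>\<^sub>V" using ker vw by simp
 have "v = (v \<ominus>\<^sub>V w) \<oplus>\<^sub>V w" using vw by (simp add: V.M.minus_eq V.M.a_assoc V.M.l_neg)
 then show "v = w" using z vw by simp
 qed
 moreover have "carrier W \<subseteq> F ` carrier V"
 proof
 fix w assume w: "w : carrier W"
 show "w : F ` carrier V"
 proof (rule submodule_span_induct[OF W FBc FB w], rule submoduleI'[OF W])
  show "F ` carrier V \<subseteq> carrier W" using lin_mem[OF F] by auto
  show "\<zero>\<^sub>W : F ` carrier V" using lin_zeroD[OF F V W] by (metis V.M.zero_closed imageI)
  show "x \<oplus>\<^sub>W z : F ` carrier V" if xz: "x : F ` carrier V" "z : F ` carrier V" for x z
  proof -
  obtain c d where cd: "c : carrier V" "d : carrier V" "x = F c" "z = F d" using xz by blast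
  then show ?thesis using lin_addD[OF F cd(1,2)] vs_add_closed[OF V cd(1,2)] by (metis imageI)
  qed
  show "k \<odot>\<^sub>W z : F ` carrier V" if kz: "k : carrier K" "z : F ` carrier V" for k z
  proof -
  obtain d where d: "d : carrier V" "z = F d" using kz by blast
  then show ?thesis using lin_smultD[OF F kz(1) d(1)] vs_smult_closed[OF V kz(1) d(1)] by (metis imageI)
  qed
  show "F ` B \<subseteq> F ` carrier V" using Bc by auto
 qed
 qed
 ultimately show ?thesis using lin_mem[OF F] by (auto simp: bij_betw_def)
qed

text \<open>Apply \<open>\<epsilon> \<otimes> 1\<close> to the comultiplication: \<open>b = \<epsilon>(b) 1 + b\<close>.\<close>

lemma counit_skew_primitive:
 assumes B: "bialgebra K B" and b: "b : carrier B" and G: "G : carrier B" and eG: "counit B G = \<one>\<^sub>K"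
 and d: "comult B b = pure_tensor K B B b \<one>\<^sub>B \<oplus>\<^bsub>tensor K B B\<^esub> pure_tensor K B B G b"
 shows "counit B b = \<zero>\<^sub>K"
proof -
 note C = bialg_coalg[OF B] and A = bialg_alg[OF B] and ea = bialg_counit[OF B]
 note V = alg_vs[OF A] and KB = base_vs[OF vs_field[OF alg_vs[OF A]]]
 interpret V: vectorspace K B by (rule V)
 note o = alg_one_mem[OF A] and cc = counit_mem[OF C b]
 have bl: "bilinear_map K B B B (%u v. counit B u \<odot>\<^sub>B v)"
 by (assumption | rule V counit_mem[OF C] counit_comp[OF C] lin)+
 let ?a = "counit B b \<odot>\<^sub>B \<one>\<^sub>B"
 have ac: "?a : carrier B" by (rule V.smult_closed[OF cc o])
 have eq: "b = ?a \<oplus>\<^sub>B b"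
 using counit_l[OF C V lin_id b]
 unfolding d lift_addD[OF V V V bl pure_mem[OF V V b o] pure_mem[OF V V G b]] lift_pure[OF V V V bl b o] lift_pure[OF V V V bl G b] eG
 by (simp add: b)
 have "?a = (?a \<oplus>\<^sub>B b) \<oplus>\<^sub>B \<ominus>\<^sub>B b" using ac b by (simp add: V.M.a_assoc V.M.r_neg)
 also have "... = \<zero>\<^sub>B" unfolding eq[symmetric] using b by (simp add: V.M.r_neg)
 finally have "counit B ?a = \<zero>\<^sub>K" using lin_zeroD[OF counit_lin[OF C] V KB] by simp
 then show ?thesis using cc alg_map_one[OF ea] o by (simp add: lin_smultD[OF counit_lin[OF C]])
qed

context yd_setting
begin

section \<open>Existence of the quantum line\<close>

sublocale TP: truncated_polynomials K N
 by (rule truncated_polynomials.intro) (rule field N_pos)+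

text \<open>The generator \<open>X\<close> of the quantum line satisfies the hypotheses on generators, and its powers are a basis of \<open>K[X] / (X\<^sup>N)\<close>.\<close>

lemma line_structure_quantum_line:
 fixes Q :: "('k, 'h, (nat => 'k) set) yd_bialg"
 assumes "is_quantum_line K H g \<chi> N Q"
 shows "line_structure K H g \<chi> q lam N Q (%n. trunc_var K N [^]\<^sub>Q n)"
proof -
 have t: "module.truncate Q = trunc_poly K N" and B: "braided_bialgebra K H Q"
 and a: "!!h. h : carrier H ==> act Q h (trunc_var K N) = \<chi> h \<odot>\<^sub>Q trunc_var K N"
 and c: "coact Q (trunc_var K N) = pure_tensor K H Q g (trunc_var K N)"
 and d: "comult Q (trunc_var K N) = pure_tensor K Q Q (trunc_var K N) \<one>\<^sub>Q \<oplus>\<^bsub>tensor K Q Q\<^esub> pure_tensor K Q Q \<one>\<^sub>Q (trunc_var K N)"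
 using assms unfolding is_quantum_line_def by simp_all
 have f: "carrier Q = carrier TP.T" "monoid.mult Q = monoid.mult TP.T" "\<one>\<^sub>Q = \<one>\<^bsub>TP.T\<^esub>" "\<zero>\<^sub>Q = \<zero>\<^bsub>TP.T\<^esub>"
 "ring.add Q = ring.add TP.T" "smult Q = smult TP.T"
 unfolding t[symmetric] by (simp_all add: module.defs)
 have pw: "trunc_var K N [^]\<^sub>Q (n::nat) = TP.tm n" for n
 unfolding TP.trunc_var_pow[symmetric] by (simp add: nat_pow_def f)
 have x: "trunc_var K N : carrier Q" using TP.tm_closed[of 1] by (simp add: trunc_var_def f)
 show ?thesis
 by (rule line_structure_of_generator[OF B x _ _ _ a c d])
  (use TP.tm_big[of N] TP.tm_inj basis_cong[OF TP.T_vs TP.tm_basis f(1,4,5,6)] in \<open>simp_all add: pw f\<close>)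
qed

text \<open>The structure maps are defined on the basis of powers of \<open>X\<close> by the formulas of a line structure.\<close>

lemma quantum_line_exists: "EX Q. is_quantum_line K H g \<chi> N Q"
proof -
 let ?T = "TP.T" let ?TT = "tensor K TP.T TP.T" let ?HT = "tensor K H TP.T"
 note vT = TP.T_vs and vTT = vs_tensor[OF TP.T_vs TP.T_vs] and vHT = vs_tensor[OF hV TP.T_vs]
 obtain l where l: "ALL n<N. l n : lin_maps K ?T KB" "ALL m<N. ALL n<N. l n (TP.tm m) = (if m = n then \<one>\<^sub>K else \<zero>\<^sub>K)"
 using coordinates_exist[OF vT TP.tm_basis TP.tm_inj] by blast
 have l1: "n < N ==> l n : lin_maps K ?T KB" and l2: "m < N ==> n < N ==> l n (TP.tm m) = (if m = n then \<one>\<^sub>K else \<zero>\<^sub>K)" for m n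
 using l by blast+
 define D where "D n = finsum ?TT (%k. gs n k \<odot>\<^sub>?TT pure_tensor K ?T ?T (TP.tm k) (TP.tm (n - k))) {..n}" for n
 define Q :: "('k, 'h, (nat => 'k) set) yd_bialg" where "Q =
  \<lparr>carrier = carrier ?T, monoid.mult = monoid.mult ?T, one = \<one>\<^sub>?T, ring.zero = \<zero>\<^sub>?T, ring.add = ring.add ?T, smult = smult ?T,
  comult = (%v. finsum ?TT (%n. l n v \<odot>\<^sub>?TT D n) {..<N}),
  counit = (%v. finsum KB (%n. l n v \<odot>\<^sub>KB (if n = 0 then \<one>\<^sub>K else \<zero>\<^sub>K)) {..<N}),
  act = (%h v. finsum ?T (%n. l n v \<odot>\<^sub>?T (cp n h \<odot>\<^sub>?T TP.tm n)) {..<N}),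
  coact = (%v. finsum ?HT (%n. l n v \<odot>\<^sub>?HT pure_tensor K H ?T (g [^]\<^sub>H n) (TP.tm n)) {..<N})\<rparr>"
 have f: "carrier Q = carrier ?T" "monoid.mult Q = monoid.mult ?T" "\<one>\<^sub>Q = \<one>\<^sub>?T" "\<zero>\<^sub>Q = \<zero>\<^sub>?T"
 "ring.add Q = ring.add ?T" "smult Q = smult ?T" by (simp_all add: Q_def)
 have t: "tensor K Q Q = ?TT" "pure_tensor K Q Q = pure_tensor K ?T ?T" "tensor K H Q = ?HT" "pure_tensor K H Q = pure_tensor K H ?T"
 using tensor_cong[OF f(1,5,6) f(1,5,6), of K] tensor_cong[OF refl refl refl f(1,5,6), of K H] by simp_all
 have lm: "lin_maps K ?T Q = lin_maps K ?T ?T" "lin_maps K H Q = lin_maps K H ?T" by (rule lin_maps_cong; simp add: f)+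
 have lm': "lin_maps K Q M = lin_maps K ?T M" for M by (rule lin_maps_cong) (simp_all add: f)
 note ce = coordinate_extension[where e=TP.tm and l=l, OF vT _ TP.tm_closed l1 l2]
 interpret TTV: vectorspace K ?TT by (rule vTT)
 have Dc: "D n : carrier ?TT" for n unfolding D_def by (rule TTV.finsum_closed) (simp add: gs_mem pure_mem[OF vT vT] TP.tm_closed)
 have kc: "cp n h \<odot>\<^sub>?T TP.tm n : carrier ?T" if "h : carrier H" for n h by (rule TP.TV.smult_closed[OF cp_mem[OF that] TP.tm_closed])
 have hc: "pure_tensor K H ?T (g [^]\<^sub>H n) (TP.tm n) : carrier ?HT" for n :: nat by (rule pure_mem[OF hV vT gpow_mem TP.tm_closed])
 have oc: "(if n = 0 then \<one>\<^sub>K else \<zero>\<^sub>K) : carrier KB" for n :: nat by simp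
 have L: "line_structure K H g \<chi> q lam N Q TP.tm"
 proof (rule line_structure.intro[OF yd_setting_axioms], rule line_structure_axioms.intro, unfold t lm' lm)
 show "k_algebra K Q" by (rule k_algebra_cong[OF TP.T_alg f])
 show "TP.tm n : carrier Q" for n unfolding f by (rule TP.tm_closed)
 show "TP.tm 0 = \<one>\<^sub>Q" unfolding f by (rule TP.tm_0)
 show "TP.tm n = \<zero>\<^sub>Q" if "N <= n" for n unfolding f by (rule TP.tm_big[OF that])
 show "TP.tm m \<otimes>\<^sub>Q TP.tm n = TP.tm (m + n)" for m n unfolding f by (rule TP.tm_mult)
 show "vectorspace.basis K Q (TP.tm ` {..<N})" by (rule basis_cong[OF vT TP.tm_basis f(1,4,5,6)])
 show "inj_on TP.tm {..<N}" by (rule TP.tm_inj)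
 show "act Q h : lin_maps K ?T ?T" if h: "h : carrier H" for h
  unfolding Q_def yd_bialg.simps by (rule ce(1)[OF vT]) (assumption | rule kc h)+
 show "(%h. act Q h v) : lin_maps K H ?T" if v: "v : carrier Q" for v
 proof -
  have lv: "n < N ==> l n v : carrier K" for n using lin_mem[OF l1] v by (simp add: f)
  show ?thesis unfolding Q_def yd_bialg.simps
  by (rule lin_finsum[OF vT finite_lessThan]) (auto intro!: lin_smult_const[OF vT] lin_smult_fun[OF vT] cp_lin TP.tm_closed lv)
 qed
 show "act Q h (TP.tm n) = cp n h \<odot>\<^sub>Q TP.tm n" if h: "h : carrier H" and n: "n < N" for h n
  unfolding f unfolding Q_def yd_bialg.simps by (rule ce(2)[OF vT]) (assumption | rule kc h n)+
 show "coact Q : lin_maps K ?T ?HT" unfolding Q_def yd_bialg.simps by (rule ce(1)[OF vHT]) (assumption | rule hc)+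
 show "coact Q (TP.tm n) = pure_tensor K H ?T (g [^]\<^sub>H n) (TP.tm n)" if n: "n < N" for n
  unfolding Q_def yd_bialg.simps by (rule ce(2)[OF vHT]) (assumption | rule hc n)+
 show "comult Q : lin_maps K ?T ?TT" unfolding Q_def bialg.simps by (rule ce(1)[OF vTT]) (assumption | rule Dc)+
 show "comult Q (TP.tm n) = finsum ?TT (%k. gs n k \<odot>\<^sub>?TT pure_tensor K ?T ?T (TP.tm k) (TP.tm (n - k))) {..n}" if n: "n < N" for n
  unfolding D_def[symmetric] unfolding Q_def bialg.simps by (rule ce(2)[OF vTT]) (assumption | rule Dc n)+
 show "counit Q : lin_maps K ?T KB" unfolding Q_def bialg.simps by (rule ce(1)[OF baseV]) (assumption | rule oc)+
 show "counit Q (TP.tm n) = (if n = 0 then \<one>\<^sub>K else \<zero>\<^sub>K)" if n: "n < N" for n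
  unfolding Q_def bialg.simps by (rule ce(2)[OF baseV]) (assumption | rule oc n)+
 qed
 interpret L: line_structure K H g \<chi> q lam N Q TP.tm by (fact L)
 have v: "trunc_var K N = TP.tm (Suc 0)" by (simp add: trunc_var_def)
 have T1: "pure_tensor K Q Q (TP.tm i) (TP.tm j) : carrier (tensor K Q Q)" for i j by (rule pure_mem[OF L.vQ L.vQ L.e_mem L.e_mem])
 have "comult Q (TP.tm (Suc 0)) = pure_tensor K Q Q (TP.tm (Suc 0)) (TP.tm 0) \<oplus>\<^bsub>tensor K Q Q\<^esub> pure_tensor K Q Q (TP.tm 0) (TP.tm (Suc 0))"
 unfolding L.comult_e' using T1[of "Suc 0" 0] T1[of 0 "Suc 0"] by (simp add: atMost_Suc q_closed)
 then have "is_quantum_line K H g \<chi> N Q"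
 unfolding is_quantum_line_def v
 using L.braided_bialgebra_Q L.act_e'[of _ "Suc 0"] L.coact_e'[of "Suc 0"] L.e_0
 by (simp add: cp_1 g_mem del: conv_pow.simps) (simp add: Q_def module.defs)
 then show ?thesis by blast
qed

lemma is_quantum_line_quantum_line: "is_quantum_line K H g \<chi> N (quantum_line K H g \<chi> N)"
 unfolding quantum_line_def using quantum_line_exists by (rule someI_ex)

section \<open>The universal property\<close>

lemma A_basis:
 assumes BH: "vectorspace.basis K H BH"
 shows "inj_on (%(i, h). mono i h) ({..<N} \<times> BH)" and "vectorspace.basis K A ((%(i, h). mono i h) ` ({..<N} \<times> BH))"
proof -
 have Bc: "BH \<subseteq> carrier H" using BH by (simp add: HV.basis_def)
 have nz: "h ~= \<zero>\<^sub>H" if h: "h : BH" for h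
 proof
 obtain l where l: "dual_to K H BH h l" using basis_dual_exists[OF hV BH h] by blast
 assume "h = \<zero>\<^sub>H"
 then show False using l lin_zeroD[of l K H KB] hV baseV K.one_not_zero by (simp add: dual_to_def)
 qed
 have eq: "i = j & h = k" if "i < N" "j < N" "h : BH" "k : BH" "mono i h = mono j k" for i j h k
 proof -
 have hk: "h : carrier H" "k : carrier H" using that Bc by auto
 have "h = (if i = j then k else \<zero>\<^sub>H)"
  using fun_cong[OF that(5), of i] unfolding O.mono_small[OF that(1) hk(1)] O.mono_small[OF that(2) hk(2)] by simp
 then show ?thesis using nz[OF that(3)] by (auto split: if_splits)
 qed
 show "inj_on (%(i, h). mono i h) ({..<N} \<times> BH)" using eq by (auto simp: inj_on_def)
 let ?B = "(%(i, h). mono i h) ` ({..<N} \<times> BH)"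
 show "vectorspace.basis K A ?B"
 proof (rule dual_imp_basis[OF vA])
 show "?B \<subseteq> carrier A" using Bc mono_mem by auto
 show "EX l. dual_to K A ?B b l" if b: "b : ?B" for b
 proof -
  obtain i h where ih: "i < N" "h : BH" "b = mono i h" using b by auto
  obtain l where l: "dual_to K H BH h l" using basis_dual_exists[OF hV BH ih(2)] by blast
  have ll: "l : lin_maps K H KB" using l by (simp add: dual_to_def)
  have "dual_to K A ?B b (%f. l (f i))"
  unfolding dual_to_def
  proof (intro conjI ballI impI)
  show "(%f. l (f i)) : lin_maps K A KB" by (rule lin_comp[OF ll O.comp_lin])
  show "l (b i) = \<one>\<^sub>K" using ih l Bc by (simp add: O.mono_small subset_iff dual_to_def)
  fix b' assume b': "b' : ?B" "b' ~= b"
  then obtain j k where jk: "j < N" "k : BH" "b' = mono j k" by auto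
  then show "l (b' i) = \<zero>\<^sub>K" using ih l Bc b' lin_zeroD[OF ll hV baseV]
   by (cases "j = i") (auto simp: O.mono_small subset_iff dual_to_def)
  qed
  then show ?thesis by blast
 qed
 fix W assume W: "submodule K W A" and BW: "?B \<subseteq> W"
 interpret W: submodule K W A by (rule W)
 have Wadd: "v \<oplus>\<^sub>A w : W" if "v : W" "w : W" for v w using W.m_closed[OF that] by simp
 have mW: "mono i v : W" if i: "i < N" and v: "v : carrier H" for i v
 proof -
  have "v : {v : carrier H. mono i v : W}"
  proof (rule submodule_span_induct[OF hV Bc BH v], rule submoduleI'[OF hV])
  show "BH \<subseteq> {v : carrier H. mono i v : W}" using BW Bc i by auto
  show "\<zero>\<^sub>H : {v : carrier H. mono i v : W}" using W.zero_closed lin_zeroD[OF O.mono_lin hV vA] by simp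
  show "v \<oplus>\<^sub>H w : {v : carrier H. mono i v : W}"
   if "v : {v : carrier H. mono i v : W}" "w : {v : carrier H. mono i v : W}" for v w
   using that Wadd lin_addD[OF O.mono_lin, of v w i] by simp
  show "c \<odot>\<^sub>H v : {v : carrier H. mono i v : W}"
   if "c : carrier K" "v : {v : carrier H. mono i v : W}" for c v
   using that W.smult_closed lin_smultD[OF O.mono_lin, of c v i] by simp
  qed auto
  then show ?thesis by simp
 qed
 show "carrier A \<subseteq> W"
 proof
  fix f assume fA: "f : carrier A"
  show "f : W" by (subst O.A_decomp[OF fA], rule submodule_finsum[OF vA W finite_lessThan]) (simp add: mW O.comp_closed[OF fA])
 qed
 qed
qed

lemma alg_map_zz:
 assumes B: "k_algebra K B" and f: "f : algebra_maps K H B"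
 shows "f zz = lam \<odot>\<^sub>B (\<one>\<^sub>B \<ominus>\<^sub>B f g [^]\<^sub>B N)"
 by (simp add: zz_def lin_smultD[OF alg_map_lin[OF f]] lin_minusD[OF alg_map_lin[OF f] hV alg_vs[OF B]] lam_closed gpow_mem
  alg_map_one[OF f] alg_map_pow[OF f hA B g_mem])

lemma is_O_A: "is_O K H g \<chi> N lam A \<sigma> y"
 unfolding is_O_def
proof (intro conjI allI impI ballI)
 show "hopf_algebra K A" "\<sigma> : hopf_maps K H A" "inj_on \<sigma> (carrier H)" "y : carrier A"
 by (rule hopf_A sig_hopf sig_inj O.y_mem)+
 show "y [^]\<^sub>A N = lam \<odot>\<^sub>A (\<one>\<^sub>A \<ominus>\<^sub>A \<sigma> g [^]\<^sub>A N)"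
 unfolding O.y_pow_N by (rule alg_map_zz[OF aA sig_alg])
 show "\<sigma> h \<otimes>\<^sub>A y [^]\<^sub>A a = y [^]\<^sub>A a \<otimes>\<^sub>A \<sigma> ((\<phi> ^^ a) h)" if "h : carrier H" for a :: nat and h
 by (rule O.sigma_y_pow[OF that])
 show "comult A y = ptA y \<one>\<^sub>A \<oplus>\<^sub>AA ptA (\<sigma> g) y" unfolding comult_y bO_def ..
 fix BH assume BH: "vectorspace.basis K H BH"
 have Bc: "BH \<subseteq> carrier H" using BH by (simp add: HV.basis_def)
 have m: "y [^]\<^sub>A i \<otimes>\<^sub>A \<sigma> h = mono i h" if "h : BH" for i :: nat and h by (rule O.y_pow_sigma) (use that Bc in auto)
 have "inj_on (%(i::nat, h). y [^]\<^sub>A i \<otimes>\<^sub>A \<sigma> h) ({..<N} \<times> BH) = inj_on (%(i, h). mono i h) ({..<N} \<times> BH)"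
 by (rule inj_on_cong) (auto simp: m)
 then show "inj_on (%(i::nat, h). y [^]\<^sub>A i \<otimes>\<^sub>A \<sigma> h) ({..<N} \<times> BH)" using A_basis(1)[OF BH] by simp
 have "{y [^]\<^sub>A (i::nat) \<otimes>\<^sub>A \<sigma> h |i h. i < N & h : BH} = (%(i, h). mono i h) ` ({..<N} \<times> BH)"
 proof (intro equalityI subsetI)
 fix u assume "u : {y [^]\<^sub>A (i::nat) \<otimes>\<^sub>A \<sigma> h |i h. i < N & h : BH}"
 then obtain i h where "i < N" "h : BH" "u = mono i h" using m by blast
 then show "u : (%(i, h). mono i h) ` ({..<N} \<times> BH)" by (intro image_eqI[where x="(i, h)"]) simp_all
 next
 fix u assume "u : (%(i, h). mono i h) ` ({..<N} \<times> BH)"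
 then obtain i h where w: "i < N" "h : BH" "u = mono i h" by auto
 then have "u = y [^]\<^sub>A i \<otimes>\<^sub>A \<sigma> h" using m by metis
 then show "u : {y [^]\<^sub>A (i::nat) \<otimes>\<^sub>A \<sigma> h |i h. i < N & h : BH}" using w(1,2) by blast
 qed
 then show "vectorspace.basis K A {y [^]\<^sub>A (i::nat) \<otimes>\<^sub>A \<sigma> h |i h. i < N & h : BH}" using A_basis(2)[OF BH] by simp
qed

text \<open>The extension as an algebra map exists by the relations. It is a coalgebra map because the two composites with \<open>\<Delta>\<close>, and those with \<open>\<epsilon>\<close>, are algebra maps that agree on \<open>H\<close> and at \<open>y\<close>.\<close>

lemma univ_bialg:
 assumes B: "bialgebra K B" and f: "f : bialgebra_maps K H B" and b: "b : carrier B"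
 and comm: "!!h. h : carrier H ==> f h \<otimes>\<^sub>B b = b \<otimes>\<^sub>B f (\<phi> h)"
 and bN: "b [^]\<^sub>B N = lam \<odot>\<^sub>B (\<one>\<^sub>B \<ominus>\<^sub>B f g [^]\<^sub>B N)"
 and d: "comult B b = pure_tensor K B B b \<one>\<^sub>B \<oplus>\<^bsub>tensor K B B\<^esub> pure_tensor K B B (f g) b"
 shows "EX F:bialgebra_maps K A B. (ALL h:carrier H. F (\<sigma> h) = f h) & F y = b"
proof -
 note aB = bialg_alg[OF B] and cB = bialg_coalg[OF B]
 note vB = alg_vs[OF aB]
 have fa: "f : algebra_maps K H B" and fc: "f : coalgebra_maps K H B" using f by (auto simp: bialgebra_maps_def)
 note fcl = lin_mem[OF alg_map_lin[OF fa]]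
 have bz: "b [^]\<^sub>B N = f zz" unfolding bN by (rule alg_map_zz[OF aB fa, symmetric])
 define F where "F = O.univ B f b"
 have Fa: "F : algebra_maps K A B" unfolding F_def by (rule O.univ_alg[OF aB fa b comm bz])
 have Fm: "F (mono n h) = b [^]\<^sub>B n \<otimes>\<^sub>B f h" if "h : carrier H" for n h unfolding F_def by (rule O.univ_mono[OF aB fa b bz that])
 interpret BR: ring B by (rule alg_ring[OF aB])
 have Fs: "F (\<sigma> h) = f h" if "h : carrier H" for h using Fm[OF that, of 0] fcl[OF that] by simp
 have Fy: "F y = b" unfolding O.y_def Fm[OF HR.one_closed] using b by (simp add: alg_map_one[OF fa])
 note Fl = alg_map_lin[OF Fa]
 let ?TB = "tensor_algebra K B B"
 interpret TB: two_algebras K B B using aB by (simp add: two_algebras_def)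
 have t1: "(%x. comult B (F x)) : algebra_maps K A ?TB" by (rule alg_map_comp[OF bialg_comult[OF B] Fa])
 have t2: "(%x. tensor_map K A A B B F F (comult A x)) : algebra_maps K A ?TB"
 by (rule alg_map_comp[OF tensor_map_algebra_map[OF aA aA aB aB Fa Fa] comult_A_alg])
 note tp = tensor_map_pure[OF vA vA vB vB Fl Fl]
 have ty: "comult B (F y) = tensor_map K A A B B F F (comult A y)"
 proof -
 have "tensor_map K A A B B F F (comult A y) = tensor_map K A A B B F F (ptA y \<one>\<^sub>A) \<oplus>\<^bsub>tensor K B B\<^esub> tensor_map K A A B B F F (ptA (\<sigma> g) y)"
  unfolding comult_y bO_def
  by (rule lin_addD[OF tensor_map_lin[OF vA vA vB vB Fl Fl lin_id]]) (rule pt_mem O.y_mem AR.one_closed mono_mem g_mem)+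
 then show ?thesis
  unfolding tp[OF O.y_mem AR.one_closed] tp[OF mono_mem[OF g_mem] O.y_mem] Fy Fs[OF g_mem] alg_map_one[OF Fa] d by simp
 qed
 have ts: "comult B (F (\<sigma> h)) = tensor_map K A A B B F F (comult A (\<sigma> h))" if h: "h : carrier H" for h
 unfolding comult_sig[OF h] fO_def tensor_map_comp[OF hV hV vA vA vB vB sig_lin sig_lin Fl Fl comultH[OF h]] Fs[OF h] coalg_map_comult[OF fc h]
 by (rule tensor_map_cong) (simp_all add: Fs)
 have D: "comult B (F x) = tensor_map K A A B B F F (comult A x)" if "x : carrier A" for x
 by (rule O.alg_map_eq[OF TB.tensor_k_algebra t1 t2 ty ts that])
 have eg: "counit B (f g) = \<one>\<^sub>K" using coalg_map_counit[OF fc g_mem] g_counit by simp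
 have eb: "counit B b = \<zero>\<^sub>K" by (rule counit_skew_primitive[OF B b fcl[OF g_mem] eg d])
 have E: "counit B (F x) = counit A x" if "x : carrier A" for x
 proof (rule O.alg_map_eq[OF base_algebra[OF field] alg_map_comp[OF bialg_counit[OF B] Fa] counit_A_alg _ _ that])
 show "counit B (F y) = counit A y" unfolding Fy eb unfolding O.y_def by (simp add: counit_mono)
 show "counit B (F (\<sigma> h)) = counit A (\<sigma> h)" if "h : carrier H" for h
  using that by (simp add: Fs coalg_map_counit[OF fc] counit_mono)
 qed
 have "F : bialgebra_maps K A B" unfolding bialgebra_maps_def coalgebra_maps_def using Fa Fl D E by auto
 then show ?thesis using Fs Fy by blast
qed

text \<open>The map given by the universal property of the model sends \<open>y\<^sup>i \<sigma>(h)\<close> to \<open>y'\<^sup>i \<sigma>'(h)\<close>, hence a basis to a basis.\<close>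

lemma is_O_iso:
 assumes O': "is_O K H g \<chi> N lam A' \<sigma>' y'"
 shows "EX F:bialgebra_maps K A A'. bij_betw F (carrier A) (carrier A') & (ALL h:carrier H. F (\<sigma> h) = \<sigma>' h) & F y = y'"
proof -
 have hopf': "hopf_algebra K A'" and s': "\<sigma>' : bialgebra_maps K H A'" and yc: "y' : carrier A'"
 and bas: "!!BH. vectorspace.basis K H BH ==> inj_on (%(i, h). y' [^]\<^sub>A' (i::nat) \<otimes>\<^sub>A' \<sigma>' h) ({..<N} \<times> BH) &
  vectorspace.basis K A' {y' [^]\<^sub>A' i \<otimes>\<^sub>A' \<sigma>' h | i h. i < N & h : BH}"
 and yN: "y' [^]\<^sub>A' N = lam \<odot>\<^sub>A' (\<one>\<^sub>A' \<ominus>\<^sub>A' \<sigma>' g [^]\<^sub>A' N)"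
 and com: "!!(a::nat) h. h : carrier H ==> \<sigma>' h \<otimes>\<^sub>A' y' [^]\<^sub>A' a = y' [^]\<^sub>A' a \<otimes>\<^sub>A' \<sigma>' ((\<phi> ^^ a) h)"
 and cy: "comult A' y' = pure_tensor K A' A' y' \<one>\<^sub>A' \<oplus>\<^bsub>tensor K A' A'\<^esub> pure_tensor K A' A' (\<sigma>' g) y'"
 using O' unfolding is_O_def hopf_maps_def by simp_all
 note bA' = hopf_bialg[OF hopf']
 note aA' = bialg_alg[OF bA']
 interpret R': ring A' by (rule alg_ring[OF aA'])
 have c1: "\<sigma>' h \<otimes>\<^sub>A' y' = y' \<otimes>\<^sub>A' \<sigma>' (\<phi> h)" if "h : carrier H" for h using com[OF that, of "Suc 0"] yc by simp
 obtain F where F: "F : bialgebra_maps K A A'" "ALL h:carrier H. F (\<sigma> h) = \<sigma>' h" "F y = y'"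
 using univ_bialg[OF bA' s' yc c1 yN cy] by blast
 have Fa: "F : algebra_maps K A A'" using F(1) by (auto simp: bialgebra_maps_def)
 obtain BH where BH: "vectorspace.basis K H BH" using basis_exists[OF hV] by blast
 have Bc: "BH \<subseteq> carrier H" using BH by (simp add: HV.basis_def)
 have Fm: "F (mono i h) = y' [^]\<^sub>A' i \<otimes>\<^sub>A' \<sigma>' h" if "h : BH" for i h
 using O.alg_map_mono[OF aA' Fa, of h i] F(2,3) that Bc by (simp add: subset_iff)
 let ?m = "%(i, h). mono i h" and ?m' = "%(i::nat, h). y' [^]\<^sub>A' i \<otimes>\<^sub>A' \<sigma>' h"
 have i: "inj_on F (?m ` ({..<N} \<times> BH))"
 proof (rule inj_onI)
 fix u v assume u: "u : ?m ` ({..<N} \<times> BH)" and v: "v : ?m ` ({..<N} \<times> BH)" and e: "F u = F v"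
 obtain i h j k where w: "i < N" "h : BH" "u = mono i h" "j < N" "k : BH" "v = mono j k" using u v by auto
 have "?m' (i, h) = ?m' (j, k)" using e w by (simp add: Fm)
 then have "(i, h) = (j, k)" using inj_onD[OF conjunct1[OF bas[OF BH]], of "(i, h)" "(j, k)"] w by blast
 then show "u = v" using w by simp
 qed
 have im: "F ` (?m ` ({..<N} \<times> BH)) = {y' [^]\<^sub>A' i \<otimes>\<^sub>A' \<sigma>' h | i h. i < N & h : BH}"
 proof (intro equalityI subsetI)
 fix u assume "u : F ` (?m ` ({..<N} \<times> BH))"
 then obtain i h where "i < N" "h : BH" "u = F (mono i h)" by auto
 then show "u : {y' [^]\<^sub>A' i \<otimes>\<^sub>A' \<sigma>' h | i h. i < N & h : BH}" using Fm by blast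
 next
 fix u assume "u : {y' [^]\<^sub>A' i \<otimes>\<^sub>A' \<sigma>' h | i h. i < N & h : BH}"
 then obtain i h where w: "i < N" "h : BH" "u = y' [^]\<^sub>A' i \<otimes>\<^sub>A' \<sigma>' h" by blast
 have "mono i h : ?m ` ({..<N} \<times> BH)" using w by (intro image_eqI[where x="(i, h)"]) simp_all
 then show "u : F ` (?m ` ({..<N} \<times> BH))" unfolding w(3) Fm[OF w(2), of i, symmetric] by (rule imageI)
 qed
 have "bij_betw F (carrier A) (carrier A')"
 by (rule lin_bij_of_basis[OF vA alg_vs[OF aA'] alg_map_lin[OF Fa] A_basis(2)[OF BH] i]) (simp only: im bas[OF BH])
 then show ?thesis using F by blast
qed

lemma is_O_universal:
 assumes O': "is_O K H g \<chi> N lam A' \<sigma>' y'" and B: "bialgebra K B" and f: "f : bialgebra_maps K H B" and b: "b : carrier B"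
 and comm: "ALL h:carrier H. f h \<otimes>\<^sub>B b = b \<otimes>\<^sub>B f (\<phi> h)"
 and bN: "b [^]\<^sub>B N = lam \<odot>\<^sub>B (\<one>\<^sub>B \<ominus>\<^sub>B f g [^]\<^sub>B N)"
 and d: "comult B b = pure_tensor K B B b \<one>\<^sub>B \<oplus>\<^bsub>tensor K B B\<^esub> pure_tensor K B B (f g) b"
 shows "\<exists>!F. F : extensional (carrier A') & F : bialgebra_maps K A' B & (ALL h:carrier H. F (\<sigma>' h) = f h) & F y' = b"
proof -
 have bA': "bialgebra K A'" and yc: "y' : carrier A'" and s': "\<sigma>' : bialgebra_maps K H A'"
 using O' unfolding is_O_def hopf_maps_def by (simp_all add: hopf_bialg)
 have sa: "\<sigma>' : algebra_maps K H A'" using s' by (simp add: bialgebra_maps_def)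
 have sc: "\<sigma>' h : carrier A'" if "h : carrier H" for h
 by (rule lin_mem[OF alg_map_lin[OF sa] that])
 obtain I where I: "I : bialgebra_maps K A A'" "bij_betw I (carrier A) (carrier A')" "!!h. h : carrier H ==> I (\<sigma> h) = \<sigma>' h" "I y = y'"
 using is_O_iso[OF O'] by blast
 obtain F where F: "F : bialgebra_maps K A B" "!!h. h : carrier H ==> F (\<sigma> h) = f h" "F y = b"
 using univ_bialg[OF B f b bspec[OF comm] bN d] by blast
 let ?J = "inv_into (carrier A) I"
 have J: "?J : bialgebra_maps K A' A" by (rule bialg_map_inverse[OF bialg_A bA' I(1,2)])
 have JI: "?J (I a) = a" if "a : carrier A" for a using bij_betw_inv_into_left[OF I(2) that] .
 define G where "G = restrict (%x. F (?J x)) (carrier A')"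
 have G: "G : bialgebra_maps K A' B"
 by (rule bialg_map_cong[OF bA' bialg_map_comp[OF bA' bialg_A B J F(1)]]) (simp add: G_def)
 have Gs: "G (\<sigma>' h) = f h" if "h : carrier H" for h
 using JI[OF mono_mem[OF that, of 0]] sc[OF that] by (simp add: G_def I(3)[OF that] F(2)[OF that])
 have Gy: "G y' = b" using JI[OF O.y_mem] yc by (simp add: G_def I(4) F(3))
 show ?thesis
 proof (rule ex1I[of _ G])
 show "G : extensional (carrier A') & G : bialgebra_maps K A' B & (ALL h:carrier H. G (\<sigma>' h) = f h) & G y' = b"
  using G Gs Gy by (simp add: G_def)
 fix F' assume F': "F' : extensional (carrier A') & F' : bialgebra_maps K A' B & (ALL h:carrier H. F' (\<sigma>' h) = f h) & F' y' = b"
 have Fa: "F' : algebra_maps K A' B" and Ga: "G : algebra_maps K A' B" and Ia: "I : algebra_maps K A A'"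
  using F' G I(1) by (simp_all add: bialgebra_maps_def)
 note a1 = alg_map_comp[OF Fa Ia] and a2 = alg_map_comp[OF Ga Ia]
 have e: "F' (I x) = G (I x)" if "x : carrier A" for x
  by (rule O.alg_map_eq[OF bialg_alg[OF B] a1 a2 _ _ that]) (use F' Gs Gy in \<open>simp_all add: I(3,4)\<close>)
 show "F' = G"
 proof (rule extensionalityI[of _ "carrier A'"])
  show "F' : extensional (carrier A')" using F' by simp
  show "G : extensional (carrier A')" by (simp add: G_def)
  fix x assume "x : carrier A'"
  then obtain a where "a : carrier A" "x = I a" using I(2) by (auto simp: bij_betw_def)
  then show "F' x = G x" using e by simp
 qed
 qed
qed

lemma p_values:
 assumes BH: "vectorspace.basis K H BH" and p: "p : lin_maps K A H"
 and pv: "ALL n<N. ALL h:BH. p (y [^]\<^sub>A n \<otimes>\<^sub>A \<sigma> h) = (if n = 0 then h else \<zero>\<^sub>H)"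
 and n: "n < N" and h: "h : carrier H"
 shows "p (mono n h) = (if n = 0 then h else \<zero>\<^sub>H)"
proof -
 have Bc: "BH \<subseteq> carrier H" using BH by (simp add: HV.basis_def)
 have l: "(%h. if n = 0 then h else \<zero>\<^sub>H) : lin_maps K H H" by (cases "n = 0") (simp_all add: lin_id lin_zero[OF hV])
 show ?thesis
 proof (rule basis_lin_eq[OF hV hV BH lin_comp[OF p O.mono_lin] l _ h])
 fix b assume b: "b : BH"
 then have bc: "b : carrier H" using Bc by blast
 have "p (y [^]\<^sub>A n \<otimes>\<^sub>A \<sigma> b) = (if n = 0 then b else \<zero>\<^sub>H)" using pv n b by blast
 then show "p (mono n b) = (if n = 0 then b else \<zero>\<^sub>H)" unfolding O.y_pow_sigma[OF bc] .
 qed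
qed

text \<open>The coefficient of \<open>y\<^sup>0\<close>.\<close>

lemma retraction_exists:
 assumes BH: "vectorspace.basis K H BH"
 shows "EX p. p : lin_maps K A H & (ALL n<N. ALL h:BH. p (y [^]\<^sub>A n \<otimes>\<^sub>A \<sigma> h) = (if n = 0 then h else \<zero>\<^sub>H))"
proof (rule exI[of _ "%f. f 0"], intro conjI allI impI ballI)
 show "(%f. f 0) : lin_maps K A H" by (rule O.comp_lin)
 fix n h assume n: "n < N" and h: "h : BH"
 have hc: "h : carrier H" using BH h by (auto simp: HV.basis_def)
 show "(y [^]\<^sub>A n \<otimes>\<^sub>A \<sigma> h) 0 = (if n = 0 then h else \<zero>\<^sub>H)"
 unfolding O.y_pow_sigma[OF hc] O.mono_small[OF n hc] by auto
qed

theorem splitting_properties: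
 assumes BH: "vectorspace.basis K H BH" and p: "p : lin_maps K A H"
 and pv: "ALL n<N. ALL h:BH. p (y [^]\<^sub>A n \<otimes>\<^sub>A \<sigma> h) = (if n = 0 then h else \<zero>\<^sub>H)"
 shows "let R = assoc_prebialgebra K H A p \<sigma>; \<xi> = cocycle K H A p;
     Q = quantum_line K H g \<chi> N;
     \<omega> = tensor_lift K R H A (%r h. r \<otimes>\<^sub>A \<sigma> h) in
    p : coalgebra_maps K A H & retraction_bilinear H A p \<sigma> &
    braided_bialgebra K H R &
    is_quantum_line K H g \<chi> N Q &
    (EX \<psi>:braided_bialgebra_isos K H Q R.
     ALL n<N. \<psi> (trunc_var K N [^]\<^sub>Q n) = y [^]\<^sub>A n) &
    inj_on (%n::nat. y [^]\<^sub>R n) {..<N} &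
    vectorspace.basis K R {y [^]\<^sub>R n | n. n < N} &
    vectorspace.dim K R = N &
    y [^]\<^sub>R N = \<zero>\<^sub>R &
    (ALL n<N. y [^]\<^sub>R n = y [^]\<^sub>A n) &
    (ALL a<N. ALL b<N. \<xi> (pure_tensor K R R (y [^]\<^sub>A a) (y [^]\<^sub>A b)) =
     (if a + b = 0 then \<one>\<^sub>H
     else if a + b = N then lam \<odot>\<^sub>H (\<one>\<^sub>H \<ominus>\<^sub>H g [^]\<^sub>H N)
     else \<zero>\<^sub>H)) &
    hopf_algebra K (smash K H R \<xi>) &
    \<omega> : hopf_maps K (smash K H R \<xi>) A &
    bij_betw \<omega> (carrier (smash K H R \<xi>)) (carrier A)"
 unfolding Let_def
proof (intro conjI)
 let ?R = "assoc_prebialgebra K H A p \<sigma>"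
 note ps = p_values[OF BH p pv]
 have R: "line_structure K H g \<chi> q lam N ?R eR" by (rule line_structure_R[OF p ps])
 have pR: "y [^]\<^sub>?R (n::nat) = eR n" for n by (rule y_pow_R[OF p ps])
 have fR: "(%n::nat. y [^]\<^sub>?R n) = eR" by (rule ext) (rule pR)
 have pA: "n < N ==> y [^]\<^sub>A n = eR n" for n by (rule y_pow_eR[OF p ps])
 have xR: "a < N ==> b < N ==> cocycle K H A p (pure_tensor K ?R ?R (eR a) (eR b)) = (if a + b = 0 then \<one>\<^sub>H else if a + b = N then zz else \<zero>\<^sub>H)" for a b
 by (rule xi_eR[OF p ps])
 have st: "{y [^]\<^sub>?R n | n. n < N} = eR ` {..<N}" by (auto simp: pR)
 show "p : coalgebra_maps K A H" by (rule p_coalg[OF p ps])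
 show "retraction_bilinear H A p \<sigma>" by (rule p_bilinear[OF p ps])
 show "braided_bialgebra K H ?R" by (rule line_structure.braided_bialgebra_Q[OF R])
 show "is_quantum_line K H g \<chi> N (quantum_line K H g \<chi> N)" by (rule is_quantum_line_quantum_line)
 obtain \<psi> where w: "\<psi> : braided_bialgebra_isos K H (quantum_line K H g \<chi> N) ?R"
  "ALL n<N. \<psi> (trunc_var K N [^]\<^bsub>quantum_line K H g \<chi> N\<^esub> n) = eR n"
 by (rule bexE[OF line_structure_iso[OF line_structure_quantum_line[OF is_quantum_line_quantum_line] R]])
 then show "EX \<psi>:braided_bialgebra_isos K H (quantum_line K H g \<chi> N) ?R. ALL n<N. \<psi> (trunc_var K N [^]\<^bsub>quantum_line K H g \<chi> N\<^esub> n) = y [^]\<^sub>A n"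
 by (intro bexI[of _ \<psi>]) (simp add: pA)
 show "inj_on (%n::nat. y [^]\<^sub>?R n) {..<N}" unfolding fR by (rule eR_inj[OF p ps])
 show "vectorspace.basis K ?R {y [^]\<^sub>?R n | n. n < N}" unfolding st by (rule eR_basis[OF p ps])
 show "vectorspace.dim K ?R = N" by (rule dim_R[OF p ps])
 show "y [^]\<^sub>?R N = \<zero>\<^sub>?R" unfolding pR by (rule line_structure.e_big[OF R]) simp
 show "ALL n<N. y [^]\<^sub>?R n = y [^]\<^sub>A n" by (simp add: pR pA)
 show "ALL a<N. ALL b<N. cocycle K H A p (pure_tensor K ?R ?R (y [^]\<^sub>A a) (y [^]\<^sub>A b)) =
  (if a + b = 0 then \<one>\<^sub>H else if a + b = N then lam \<odot>\<^sub>H (\<one>\<^sub>H \<ominus>\<^sub>H g [^]\<^sub>H N) else \<zero>\<^sub>H)"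
 unfolding zz_def[symmetric] by (intro allI impI) (simp only: pA xR)
 show "hopf_algebra K (smash K H ?R (cocycle K H A p))" by (rule smash_hopf[OF p ps])
 show "tensor_lift K ?R H A (%r h. r \<otimes>\<^sub>A \<sigma> h) : hopf_maps K (smash K H ?R (cocycle K H A p)) A" by (rule om_hopf[OF p ps])
 show "bij_betw (tensor_lift K ?R H A (%r h. r \<otimes>\<^sub>A \<sigma> h)) (carrier (smash K H ?R (cocycle K H A p))) (carrier A)"
 by (rule om_bij_SM[OF p ps])
qed

end

section \<open>The theorem\<close>

theorem theorem4p2:
  fixes K :: "('k, 'c) ring_scheme" and H :: "('k, 'h, 'm) bialg_scheme"
    and g :: 'h and \<chi> :: "'h \<Rightarrow> 'k" and q lam :: 'k and N :: nat
  assumes "field K" and "\<forall>n::nat. 0 < n \<longrightarrow> [n] \<cdot>\<^bsub>K\<^esub> \<one>\<^bsub>K\<^esub> \<noteq> \<zero>\<^bsub>K\<^esub>"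
    and "primitive_root K N q"
    and "compatible_datum K H g \<chi> q N lam"
  shows
    "phi K H \<chi> \<in> algebra_maps K H H \<and> bij_betw (phi K H \<chi>) (carrier H) (carrier H) \<and>
     (\<exists>(A :: ('k, nat \<Rightarrow> 'h) bialg) \<sigma> y.
        is_O K H g \<chi> N lam A \<sigma> y \<and>
        (\<forall>BH. vectorspace.basis K H BH \<longrightarrow>
          (\<exists>p. p \<in> lin_maps K A H \<and>
             (\<forall>n<N. \<forall>h\<in>BH. p (y [^]\<^bsub>A\<^esub> n \<otimes>\<^bsub>A\<^esub> \<sigma> h) = (if n = 0 then h else \<zero>\<^bsub>H\<^esub>))) \<and>
          (\<forall>p. p \<in> lin_maps K A H \<and>
             (\<forall>n<N. \<forall>h\<in>BH. p (y [^]\<^bsub>A\<^esub> n \<otimes>\<^bsub>A\<^esub> \<sigma> h) = (if n = 0 then h else \<zero>\<^bsub>H\<^esub>)) \<longrightarrow>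
             (let R = assoc_prebialgebra K H A p \<sigma>; \<xi> = cocycle K H A p;
                  Q = quantum_line K H g \<chi> N;
                  \<omega> = tensor_lift K R H A (\<lambda>r h. r \<otimes>\<^bsub>A\<^esub> \<sigma> h) in
              p \<in> coalgebra_maps K A H \<and> retraction_bilinear H A p \<sigma> \<and>
              braided_bialgebra K H R \<and>
              is_quantum_line K H g \<chi> N Q \<and>
              (\<exists>\<psi> \<in> braided_bialgebra_isos K H Q R.
                 \<forall>n<N. \<psi> (trunc_var K N [^]\<^bsub>Q\<^esub> n) = y [^]\<^bsub>A\<^esub> n) \<and>
              inj_on (\<lambda>n::nat. y [^]\<^bsub>R\<^esub> n) {..<N} \<and>
              vectorspace.basis K R {y [^]\<^bsub>R\<^esub> n | n. n < N} \<and>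
              vectorspace.dim K R = N \<and>
              y [^]\<^bsub>R\<^esub> N = \<zero>\<^bsub>R\<^esub> \<and>
              (\<forall>n<N. y [^]\<^bsub>R\<^esub> n = y [^]\<^bsub>A\<^esub> n) \<and>
              (\<forall>a<N. \<forall>b<N. \<xi> (pure_tensor K R R (y [^]\<^bsub>A\<^esub> a) (y [^]\<^bsub>A\<^esub> b)) =
                 (if a + b = 0 then \<one>\<^bsub>H\<^esub>
                  else if a + b = N then lam \<odot>\<^bsub>H\<^esub> (\<one>\<^bsub>H\<^esub> \<ominus>\<^bsub>H\<^esub> g [^]\<^bsub>H\<^esub> N)
                  else \<zero>\<^bsub>H\<^esub>)) \<and>
              hopf_algebra K (smash K H R \<xi>) \<and>
              \<omega> \<in> hopf_maps K (smash K H R \<xi>) A \<and>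
              bij_betw \<omega> (carrier (smash K H R \<xi>)) (carrier A))))) \<and>
     (\<forall>(A :: ('k, nat \<Rightarrow> 'h) bialg) \<sigma> y. is_O K H g \<chi> N lam A \<sigma> y \<longrightarrow>
        (\<forall>(B :: ('k, 'b) bialg) f b.
           bialgebra K B \<and> f \<in> bialgebra_maps K H B \<and> b \<in> carrier B \<and>
           (\<forall>h\<in>carrier H. f h \<otimes>\<^bsub>B\<^esub> b = b \<otimes>\<^bsub>B\<^esub> f (phi K H \<chi> h)) \<and>
           b [^]\<^bsub>B\<^esub> N = lam \<odot>\<^bsub>B\<^esub> (\<one>\<^bsub>B\<^esub> \<ominus>\<^bsub>B\<^esub> f g [^]\<^bsub>B\<^esub> N) \<and>
           comult B b =
             pure_tensor K B B b \<one>\<^bsub>B\<^esub> \<oplus>\<^bsub>tensor K B B\<^esub> pure_tensor K B B (f g) b \<longrightarrow>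
           (\<exists>!F. F \<in> extensional (carrier A) \<and> F \<in> bialgebra_maps K A B \<and>
              (\<forall>h\<in>carrier H. F (\<sigma> h) = f h) \<and> F y = b)))"
proof -
  interpret yd_setting K H g \<chi> q lam N by (rule yd_setting.intro) (fact assms)+
  show ?thesis
    apply (intro conjI)
       apply (rule phi_alg)
      apply (rule phi_bij)
     apply (rule exI[of _ O.A], rule exI[of _ "ext_mono H zz N 0"], rule exI[of _ O.y], rule conjI[OF is_O_A])
     apply (intro allI impI, rule conjI)
      apply (erule retraction_exists)
     apply (intro allI impI, elim conjE, rule splitting_properties; assumption)
    apply (intro allI impI, elim conjE, rule is_O_universal; assumption)
    done
qed

end
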